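(* Let $\omega$ be a polynomial differential $1$-form on $\mathbb C^n$. If $\omega$ is Liouvillian integrable and has no invariant algebraic hypersurface, then there exist a polynomial map $P:\mathbb C^n\to\mathbb C^2$ and polynomials $a,b\in\mathbb C[x]$ such that $$\omega=P^*\bigl(dy+(a(x)+b(x)y)\,dx\bigr),$$ where $(x,y)$ are the coordinates of $\mathbb C^2$.
   Context: A polynomial $1$-form $\omega$ on $\mathbb C^n$ is Liouvillian integrable if $\omega\wedge d\omega=0$ and the codimension one foliation it defines admits a non-constant Liouvillian first integral, i.e. there is a Liouvillian extension $K$ of the differential field $\mathbb C(x_1,\dots,x_n)$ (with derivations $\partial_{x_1},\dots,\partial_{x_n}$) and an element $F\in K$ with $dF\ne0$ and $dF\wedge\omega=0$. A Liouvillian extension is a differential field extension obtained by a finite tower in which each step is either algebraic, or adjoins an element $t$ all of whose derivatives $\partial_{x_j}t$ lie in the previous field (an integral of a closed $1$-form), or adjoins an element $t\neq 0$ with all $\partial_{x_j}t/t$ in the previous field (an exponential). An algebraic hypersurface $\{f=0\}$, with $f$ a reduced non-constant polynomial, is invariant by $\omega$ if $f$ divides $\omega\wedge df$. *)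

theory Defs
  imports
    Complex_Main
    "HOL-Library.Poly_Mapping"
    "HOL-Library.Numeral_Type"
    "HOL-Computational_Algebra.Polynomial"
    "HOL-Computational_Algebra.Fraction_Field"
    "HOL-Computational_Algebra.Squarefree"
begin

section \<open>Polynomials and rational functions on complex affine space\<close>

text \<open>
  The variables are indexed by a finite type; affine \<open>n\<close>-space corresponds to an index type with
  \<open>n\<close> elements. Wherever the fraction field is needed the index type is also linearly ordered, as
  the variables \<open>x_1, ..., x_n\<close> are: the library derives that polynomials form an integral domain
  from a linear order on the variables. The order plays no other role.
\<close>

type_synonym 'n mpoly = "('n \<Rightarrow>\<^sub>0 nat) \<Rightarrow>\<^sub>0 complex"

type_synonym 'n ratfun = "'n mpoly fract"

definition Const :: "complex \<Rightarrow> 'n mpoly" where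
  "Const c = Poly_Mapping.single 0 c"

definition Var :: "'n \<Rightarrow> 'n mpoly" where
  "Var i = Poly_Mapping.single (Poly_Mapping.single i 1) 1"

definition mpoly_subst :: "('m::finite \<Rightarrow> 'n mpoly) \<Rightarrow> 'm mpoly \<Rightarrow> 'n mpoly" where
  "mpoly_subst P f =
     (\<Sum>m\<in>Poly_Mapping.keys f.
        Const (Poly_Mapping.lookup f m) * (\<Prod>j\<in>UNIV. P j ^ Poly_Mapping.lookup m j))"

definition mpoly_partial :: "'n \<Rightarrow> 'n mpoly \<Rightarrow> 'n mpoly" where
  "mpoly_partial i f =
     (\<Sum>m\<in>Poly_Mapping.keys f.
        Poly_Mapping.single (m - Poly_Mapping.single i 1)
          (of_nat (Poly_Mapping.lookup m i) * Poly_Mapping.lookup f m))"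

lemma mpoly_partial_superset:
  assumes "finite S" "Poly_Mapping.keys f \<subseteq> S"
  shows "mpoly_partial i f =
     (\<Sum>m\<in>S. Poly_Mapping.single (m - Poly_Mapping.single i 1)
          (of_nat (Poly_Mapping.lookup m i) * Poly_Mapping.lookup f m))"
  unfolding mpoly_partial_def
  by (rule sum.mono_neutral_left) (use assms in \<open>auto simp: in_keys_iff\<close>)

lemma mpoly_partial_zero [simp]: "mpoly_partial i 0 = 0"
  by (simp add: mpoly_partial_def)

lemma mpoly_partial_add: "mpoly_partial i (f + g) = mpoly_partial i f + mpoly_partial i g"
proof -
  let ?S = "Poly_Mapping.keys f \<union> Poly_Mapping.keys g"
  have "mpoly_partial i h = (\<Sum>m\<in>?S. Poly_Mapping.single (m - Poly_Mapping.single i 1)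
          (of_nat (Poly_Mapping.lookup m i) * Poly_Mapping.lookup h m))"
    if "Poly_Mapping.keys h \<subseteq> ?S" for h
    using that by (intro mpoly_partial_superset) auto
  moreover have "Poly_Mapping.keys (f + g) \<subseteq> ?S"
    by (rule Poly_Mapping.keys_add)
  ultimately show ?thesis
    by (simp add: lookup_add distrib_left single_add sum.distrib)
qed

lemma mpoly_partial_single:
  "mpoly_partial i (Poly_Mapping.single m c) =
     Poly_Mapping.single (m - Poly_Mapping.single i 1) (of_nat (Poly_Mapping.lookup m i) * c)"
  by (cases "c = 0") (simp_all add: mpoly_partial_def)

lemma mpoly_partial_mult_single_single:
  fixes m m' :: "'n \<Rightarrow>\<^sub>0 nat"
  shows "mpoly_partial i (Poly_Mapping.single m c * Poly_Mapping.single m' c') =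
     mpoly_partial i (Poly_Mapping.single m c) * Poly_Mapping.single m' c' +
     Poly_Mapping.single m c * mpoly_partial i (Poly_Mapping.single m' c')"
proof -
  let ?e = "Poly_Mapping.single i (1::nat)"
  have shift: "a - ?e + b = a + b - ?e" if "Poly_Mapping.lookup a i \<noteq> 0" for a b :: "'n \<Rightarrow>\<^sub>0 nat"
    using that
    by (intro poly_mapping_eqI) (auto simp: lookup_add lookup_minus lookup_single when_def)
  have 1: "Poly_Mapping.single (m - ?e + m') (of_nat (Poly_Mapping.lookup m i) * c * c') =
        Poly_Mapping.single (m + m' - ?e) (of_nat (Poly_Mapping.lookup m i) * c * c')"
    using shift[of m m'] by (cases "Poly_Mapping.lookup m i = 0") auto
  have 2: "Poly_Mapping.single (m + (m' - ?e)) (c * (of_nat (Poly_Mapping.lookup m' i) * c')) =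
        Poly_Mapping.single (m + m' - ?e) (c * (of_nat (Poly_Mapping.lookup m' i) * c'))"
    using shift[of m' m] by (cases "Poly_Mapping.lookup m' i = 0") (auto simp: add.commute)
  show ?thesis
    by (simp add: mpoly_partial_single mult_single lookup_add 1[simplified] 2[simplified]
        flip: single_add) (simp add: algebra_simps)
qed

lemma mpoly_induct [case_names zero single add]:
  fixes f :: "'a \<Rightarrow>\<^sub>0 'b::comm_monoid_add"
  assumes "P 0" "\<And>m c. P (Poly_Mapping.single m c)" "\<And>f g. P f \<Longrightarrow> P g \<Longrightarrow> P (f + g)"
  shows "P f"
proof (induction f rule: update_induct)
  case (update f a b)
  have "Poly_Mapping.update a b f = f + Poly_Mapping.single a b"
    using update(1)
    by (intro poly_mapping_eqI)
      (auto simp: lookup_update lookup_add lookup_single when_def in_keys_iff)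
  then show ?case using assms update by metis
qed (fact assms(1))

lemma mpoly_partial_mult:
  "mpoly_partial i (f * g) = mpoly_partial i f * g + f * mpoly_partial i g"
proof (induction f rule: mpoly_induct)
  case (single m c)
  show ?case
  proof (induction g rule: mpoly_induct)
    case (single m' c')
    show ?case by (rule mpoly_partial_mult_single_single)
  qed (simp_all add: mpoly_partial_add algebra_simps)
qed (simp_all add: mpoly_partial_add algebra_simps)

lemma quotient_rule_well_defined:
  fixes f g f' g' :: "'a::comm_ring_1"
  assumes eq: "f * g' = f' * g" and d: "df * g' + f * dg' = df' * g + f' * dg"
  shows "(df * g - f * dg) * (g' * g') = (df' * g' - f' * dg') * (g * g)"
proof -
  have "(df * g - f * dg) * (g' * g') - (df' * g' - f' * dg') * (g * g)
      = g * g' * ((df * g' + f * dg') - (df' * g + f' * dg))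
        - (g' * dg + g * dg') * (f * g' - f' * g)"
    by (simp add: algebra_simps)
  then show ?thesis
    using d eq by simp
qed

lift_definition ratfun_partial :: "'n::linorder \<Rightarrow> 'n ratfun \<Rightarrow> 'n ratfun"
  is "\<lambda>i (f, g). (mpoly_partial i f * g - f * mpoly_partial i g, g * g)"
proof (clarsimp)
  fix i :: 'n and f g f' g' :: "'n mpoly"
  assume eq: "f * g' = f' * g"
  then have "mpoly_partial i f * g' + f * mpoly_partial i g' =
      mpoly_partial i f' * g + f' * mpoly_partial i g"
    by (metis mpoly_partial_mult)
  with eq show "(mpoly_partial i f * g - f * mpoly_partial i g) * (g' * g') =
      (mpoly_partial i f' * g' - f' * mpoly_partial i g') * (g * g)"
    by (rule quotient_rule_well_defined)
qed

lemma ratfun_partial_Fract: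
  "g \<noteq> 0 \<Longrightarrow> ratfun_partial i (Fract f g) =
     Fract (mpoly_partial i f * g - f * mpoly_partial i g) (g * g)"
  by (simp add: Fract.abs_eq ratfun_partial.abs_eq)


section \<open>Differential forms\<close>

text \<open>
  A \<open>p\<close>-form over a ring with derivations \<open>D i\<close> is represented by its coefficients: a 1-form
  \<open>\<omega> = (\<Sum>i. \<omega> i dx_i)\<close> by \<open>\<omega>\<close> itself, and 2- and 3-forms by the alternating arrays of the
  coefficients of \<open>dx_i \<and> dx_j\<close> and \<open>dx_i \<and> dx_j \<and> dx_k\<close>.
\<close>

definition d0 :: "('n \<Rightarrow> 'a \<Rightarrow> 'a) \<Rightarrow> 'a \<Rightarrow> 'n \<Rightarrow> 'a" where
  "d0 D f = (\<lambda>i. D i f)"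

definition d1 :: "('n \<Rightarrow> 'a \<Rightarrow> 'a::comm_ring_1) \<Rightarrow> ('n \<Rightarrow> 'a) \<Rightarrow> 'n \<Rightarrow> 'n \<Rightarrow> 'a" where
  "d1 D \<omega> = (\<lambda>i j. D i (\<omega> j) - D j (\<omega> i))"

definition wedge11 :: "('n \<Rightarrow> 'a::comm_ring_1) \<Rightarrow> ('n \<Rightarrow> 'a) \<Rightarrow> 'n \<Rightarrow> 'n \<Rightarrow> 'a" where
  "wedge11 \<alpha> \<beta> = (\<lambda>i j. \<alpha> i * \<beta> j - \<alpha> j * \<beta> i)"

definition wedge12 ::
  "('n \<Rightarrow> 'a::comm_ring_1) \<Rightarrow> ('n \<Rightarrow> 'n \<Rightarrow> 'a) \<Rightarrow> 'n \<Rightarrow> 'n \<Rightarrow> 'n \<Rightarrow> 'a" where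
  "wedge12 \<alpha> \<beta> = (\<lambda>i j k. \<alpha> i * \<beta> j k - \<alpha> j * \<beta> i k + \<alpha> k * \<beta> i j)"

text \<open>Pull-back of a 1-form on \<open>m\<close>-space under the polynomial map with components \<open>P j\<close>.\<close>

definition pullback ::
  "('m::finite \<Rightarrow> 'n mpoly) \<Rightarrow> ('m \<Rightarrow> 'm mpoly) \<Rightarrow> 'n \<Rightarrow> 'n mpoly" where
  "pullback P \<eta> = (\<lambda>i. \<Sum>j\<in>UNIV. mpoly_subst P (\<eta> j) * d0 mpoly_partial (P j) i)"

definition invariant_hypersurface :: "'n mpoly \<Rightarrow> ('n \<Rightarrow> 'n mpoly) \<Rightarrow> bool" where
  "invariant_hypersurface f \<omega> \<longleftrightarrow>
     squarefree f \<and> f \<notin> range Const \<and>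
     (\<forall>i j. f dvd wedge11 \<omega> (d0 mpoly_partial f) i j)"


section \<open>Liouvillian extensions\<close>

definition derivation :: "('a::comm_ring_1 \<Rightarrow> 'a) \<Rightarrow> bool" where
  "derivation d \<longleftrightarrow> (\<forall>a b. d (a + b) = d a + d b) \<and> (\<forall>a b. d (a * b) = d a * b + a * d b)"

definition differential_field :: "('n \<Rightarrow> 'k::field \<Rightarrow> 'k) \<Rightarrow> bool" where
  "differential_field D \<longleftrightarrow>
     (\<forall>i. derivation (D i)) \<and> (\<forall>i j a. D i (D j a) = D j (D i a))"

definition ratfun_embedding ::
  "('n::linorder \<Rightarrow> 'k::field \<Rightarrow> 'k) \<Rightarrow> ('n ratfun \<Rightarrow> 'k) \<Rightarrow> bool" where
  "ratfun_embedding D \<iota> \<longleftrightarrow>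
     \<iota> 1 = 1 \<and> (\<forall>a b. \<iota> (a + b) = \<iota> a + \<iota> b) \<and> (\<forall>a b. \<iota> (a * b) = \<iota> a * \<iota> b) \<and>
     (\<forall>i a. \<iota> (ratfun_partial i a) = D i (\<iota> a))"

definition subfield :: "'k::field set \<Rightarrow> bool" where
  "subfield L \<longleftrightarrow>
     1 \<in> L \<and> (\<forall>a\<in>L. \<forall>b\<in>L. a - b \<in> L \<and> a * b \<in> L) \<and> (\<forall>a\<in>L. inverse a \<in> L)"

definition differential_subfield :: "('n \<Rightarrow> 'k::field \<Rightarrow> 'k) \<Rightarrow> 'k set \<Rightarrow> bool" where
  "differential_subfield D L \<longleftrightarrow> subfield L \<and> (\<forall>i. \<forall>a\<in>L. D i a \<in> L)"

definition adjoin :: "'k::field set \<Rightarrow> 'k \<Rightarrow> 'k set" where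
  "adjoin L t = \<Inter>{M. subfield M \<and> insert t L \<subseteq> M}"

definition algebraic_over :: "'k::field set \<Rightarrow> 'k \<Rightarrow> bool" where
  "algebraic_over L t \<longleftrightarrow> (\<exists>p. p \<noteq> 0 \<and> (\<forall>i. poly.coeff p i \<in> L) \<and> poly p t = 0)"

inductive liouvillian_tower :: "('n \<Rightarrow> 'k::field \<Rightarrow> 'k) \<Rightarrow> 'k set \<Rightarrow> 'k set \<Rightarrow> bool"
  for D :: "'n \<Rightarrow> 'k \<Rightarrow> 'k" and K\<^sub>0 :: "'k set"
where
  base: "liouvillian_tower D K\<^sub>0 K\<^sub>0"
| algebraic: "liouvillian_tower D K\<^sub>0 L \<Longrightarrow> differential_subfield D M \<Longrightarrow> L \<subseteq> M \<Longrightarrow>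
    (\<forall>t\<in>M. algebraic_over L t) \<Longrightarrow> liouvillian_tower D K\<^sub>0 M"
| integral: "liouvillian_tower D K\<^sub>0 L \<Longrightarrow> (\<forall>i. D i t \<in> L) \<Longrightarrow>
    liouvillian_tower D K\<^sub>0 (adjoin L t)"
| exponential: "liouvillian_tower D K\<^sub>0 L \<Longrightarrow> t \<noteq> 0 \<Longrightarrow> (\<forall>i. D i t / t \<in> L) \<Longrightarrow>
    liouvillian_tower D K\<^sub>0 (adjoin L t)"

definition liouvillian_extension ::
  "('n::linorder \<Rightarrow> 'k::field \<Rightarrow> 'k) \<Rightarrow> ('n ratfun \<Rightarrow> 'k) \<Rightarrow> bool" where
  "liouvillian_extension D \<iota> \<longleftrightarrow>
     differential_field D \<and> ratfun_embedding D \<iota> \<and> liouvillian_tower D (range \<iota>) UNIV"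

text \<open>
  HOL cannot quantify existentially over the field type of the extension, so the type carrying
  it is a parameter. As a hypothesis of a theorem, with that type a free type variable, this says
  exactly that some Liouvillian extension contains a non-constant first integral.
\<close>

definition liouvillian_integrable ::
  "'k::field itself \<Rightarrow> ('n::linorder \<Rightarrow> 'n mpoly) \<Rightarrow> bool" where
  "liouvillian_integrable T \<omega> \<longleftrightarrow>
     (\<forall>i j k. wedge12 \<omega> (d1 mpoly_partial \<omega>) i j k = 0) \<and>
     (\<exists>(D :: 'n \<Rightarrow> 'k \<Rightarrow> 'k) \<iota> F. liouvillian_extension D \<iota> \<and>
        (\<exists>i. d0 D F i \<noteq> 0) \<and>
        (\<forall>i j. wedge11 (d0 D F) (\<lambda>l. \<iota> (Fract (\<omega> l) 1)) i j = 0))"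


section \<open>The model form on the plane\<close>

text \<open>
  The coordinates \<open>(x, y)\<close> of the plane are \<open>Var 1\<close> and \<open>Var 2\<close>, indexed by the two-element
  type \<open>2\<close>, as for vectors in the library; the form is \<open>dy + (a(x) + b(x) y) dx\<close>.
\<close>

definition affine_form :: "complex poly \<Rightarrow> complex poly \<Rightarrow> 2 \<Rightarrow> 2 mpoly" where
  "affine_form a b = (\<lambda>i. if i = 1
     then poly (map_poly Const a) (Var 1) + poly (map_poly Const b) (Var 1) * Var 2
     else 1)"

end

theory Submission
  imports
    Defs
    "HOL-Computational_Algebra.Field_as_Ring"
    "HOL-Computational_Algebra.Polynomial_Factorial"
    "HOL-Computational_Algebra.Fundamental_Theorem_Algebra"
    "HOL-Complex_Analysis.Complex_Analysis"
    "HOL-Real_Asymp.Real_Asymp"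
begin

text \<open>
  Liouvillian integrability is pushed down the tower (by traces and leading coefficients) to a
  rational closed form \<open>\<eta>\<close> with \<open>d\<omega> = \<eta> \<and> \<omega>\<close>. Its poles would be invariant hypersurfaces, so
  \<open>\<eta> = dh\<close> with \<open>h\<close> a polynomial and \<open>exp (- h) \<omega>\<close> is closed.

  On a plane with coordinates \<open>(z, t)\<close>, let \<open>p\<close> be the restriction of \<open>h\<close>, monic in \<open>t\<close>, and let
  \<open>exp (- p) (r dt + u dz)\<close> be the closed restriction, with \<open>r\<close> of low degree in \<open>t\<close>. Its
  primitive \<open>G\<close> has limits along the directions in which \<open>exp (- p)\<close> decays, and differs from one of
  them by at most a polynomial times \<open>exp (- p)\<close>. Write \<open>p = B(P)\<close> with \<open>P\<close> a polynomial first integral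
  of \<open>dp\<close> of minimal degree. On a fibre \<open>P = \<beta>\<close> the function \<open>G * \<partial>P/\<partial>t\<close> is polynomial, of degree bounded
  independently of \<open>\<beta>\<close>, and satisfies a linear equation up to an error \<open>exp (- B(\<beta>))\<close>; as the solutions of
  the homogeneous equation are the multiples of \<open>\<partial>P/\<partial>t\<close> by functions of \<open>P\<close>, \<open>G\<close> is nearly constant on the
  fibre when \<open>B(\<beta>)\<close> is large. So \<open>G\<close> has at most \<open>degree B\<close> distinct limits; these are matched
  by primitives of \<open>exp (- B(P)) P^k dP\<close>, and a primitive with a single limit is trivial. Hence
  \<open>r = a(P) \<partial>P/\<partial>t\<close>. One general plane suffices to conclude the same on the whole space, where \<open>P\<close> is
  an approximate root of \<open>h\<close>.
\<close>

section \<open>Descent along Liouvillian towers\<close>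

text \<open>The equation for \<open>r\<close> and \<open>u\<close> gives no direct hold on
  \<open>r\<close>: the information lies in the constants that \<open>G\<close> approaches at
  infinity, and these have to be compared along fibres that may be singular. This shapes two
  choices. The values of \<open>G\<close> on \<open>P = \<beta>\<close> are interpolated only after
  multiplication by \<open>pderiv P\<close>, which removes the denominators at multiple points. And
  one degree bound for all \<beta> is essential: only then is the equation on the fibre a fixed
  finite linear system over the polynomials in \<beta>, solvable up to a rational factor that cannot
  compensate the decay of exp (- B(\<beta>)). Minimality of \<open>P\<close> acts as irreducibility:
  P(0, T) - P(z, t) is prime, so a rational first integral is determined along the fibres by its
  values on z = 0. The low degree of \<open>r\<close> makes a single limit mean zero, because q' -
  p' q has degree at least degree p - 1 for nonzero q. On the whole space the degree of
  \<open>P\<close> on a general plane is not known beforehand, but it divides the degree of the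
  restricted \<open>h\<close>, so finitely many approximate roots cover all cases.\<close>

lemma derivationD:
  assumes "derivation d"
  shows "d (a + b) = d a + d b" "d (a * b) = d a * b + a * d b"
    "d 0 = 0" "d 1 = 0" "d (- a) = - d a" "d (a - b) = d a - d b" "d (of_nat n) = 0"
    "d (sum f A) = (\<Sum>x\<in>A. d (f x))"
proof -
  have add: "\<And>a b. d (a + b) = d a + d b" and mult: "\<And>a b. d (a * b) = d a * b + a * d b"
    using assms by (auto simp: derivation_def)
  show "d (a + b) = d a + d b" "d (a * b) = d a * b + a * d b" by fact+
  show d0: "d 0 = 0" using add[of 0 0] by simp
  show d1: "d 1 = 0" using mult[of 1 1] by simp
  show neg: "d (- a) = - d a" for a using add[of a "- a"] d0 by (simp add: eq_neg_iff_add_eq_0 add.commute)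
  show "d (a - b) = d a - d b" using add[of a "- b"] neg by simp
  show "d (of_nat n) = 0" by (induction n) (simp_all add: add d0 d1)
  show "d (sum f A) = (\<Sum>x\<in>A. d (f x))"
    by (induction A rule: infinite_finite_induct) (simp_all add: add d0)
qed

lemma derivation_divide:
  fixes a b :: "'k::field"
  assumes "derivation d" "b \<noteq> 0"
  shows "d (a / b) = (d a * b - a * d b) / (b * b)"
proof -
  have "d a = d (a / b * b)" using assms by simp
  also have "\<dots> = d (a / b) * b + a / b * d b" by (rule derivationD(2)[OF assms(1)])
  finally show ?thesis using assms(2) by (simp add: field_simps)
qed

lemma derivation_power:
  assumes "derivation d"
  shows "d (a ^ Suc n) = of_nat (Suc n) * a ^ n * d a"
  by (induction n) (simp_all add: derivationD[OF assms] algebra_simps)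

lemma derivation_poly:
  assumes "derivation d"
  shows "d (poly p a) = poly (map_poly d p) a + poly (pderiv p) a * d a"
proof (induction p)
  case (pCons c p)
  have "map_poly d (pCons c p) = pCons (d c) (map_poly d p)"
    by (simp add: map_poly_pCons derivationD[OF assms])
  then show ?case
    using pCons by (simp add: derivationD[OF assms] pderiv_pCons algebra_simps)
qed (simp add: derivationD[OF assms])

section \<open>Polynomials over subrings and simple field extensions\<close>

definition subring_set :: "'a::comm_ring_1 set \<Rightarrow> bool" where
  "subring_set A \<longleftrightarrow> 1 \<in> A \<and> (\<forall>a\<in>A. \<forall>b\<in>A. a - b \<in> A \<and> a * b \<in> A)"

lemma subring_setD:
  assumes "subring_set A"
  shows "1 \<in> A" "0 \<in> A" "a \<in> A \<Longrightarrow> - a \<in> A" "a \<in> A \<Longrightarrow> b \<in> A \<Longrightarrow> a + b \<in> A"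
    "a \<in> A \<Longrightarrow> b \<in> A \<Longrightarrow> a - b \<in> A" "a \<in> A \<Longrightarrow> b \<in> A \<Longrightarrow> a * b \<in> A" "of_nat n \<in> A"
    "(\<And>x. x \<in> S \<Longrightarrow> f x \<in> A) \<Longrightarrow> sum f S \<in> A" "a \<in> A \<Longrightarrow> a ^ n \<in> A"
proof -
  show 1: "1 \<in> A" and diff: "a \<in> A \<Longrightarrow> b \<in> A \<Longrightarrow> a - b \<in> A" and "a \<in> A \<Longrightarrow> b \<in> A \<Longrightarrow> a * b \<in> A" for a b
    using assms by (auto simp: subring_set_def)
  show 0: "0 \<in> A" using diff[OF 1 1] by simp
  show neg: "a \<in> A \<Longrightarrow> - a \<in> A" for a using diff[OF 0] by fastforce
  show add: "a \<in> A \<Longrightarrow> b \<in> A \<Longrightarrow> a + b \<in> A" for a b using diff[of a "- b"] neg by fastforce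
  show "of_nat n \<in> A" by (induction n) (use 0 1 add in auto)
  show "(\<And>x. x \<in> S \<Longrightarrow> f x \<in> A) \<Longrightarrow> sum f S \<in> A"
    by (induction S rule: infinite_finite_induct) (use 0 add in auto)
  show "a \<in> A \<Longrightarrow> a ^ n \<in> A" by (induction n) (use assms 1 in \<open>auto simp: subring_set_def\<close>)
qed

lemma subfield_subring: "subfield L \<Longrightarrow> subring_set L"
  by (simp add: subfield_def subring_set_def)

lemma subfield_divide: "subfield L \<Longrightarrow> a \<in> L \<Longrightarrow> b \<in> L \<Longrightarrow> a / b \<in> L"
  by (auto simp: subfield_def divide_inverse)

definition poly_over :: "'a::comm_ring_1 set \<Rightarrow> 'a poly \<Rightarrow> bool" where
  "poly_over A p \<longleftrightarrow> (\<forall>i. coeff p i \<in> A)"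

lemma poly_overI: "(\<And>i. coeff p i \<in> A) \<Longrightarrow> poly_over A p"
  and poly_overD: "poly_over A p \<Longrightarrow> coeff p i \<in> A"
  by (auto simp: poly_over_def)

lemma poly_over_closed:
  assumes "subring_set A"
  shows "poly_over A 0" "poly_over A 1"
    "poly_over A p \<Longrightarrow> poly_over A q \<Longrightarrow> poly_over A (p + q)"
    "poly_over A p \<Longrightarrow> poly_over A q \<Longrightarrow> poly_over A (p - q)"
    "poly_over A p \<Longrightarrow> poly_over A q \<Longrightarrow> poly_over A (p * q)"
    "c \<in> A \<Longrightarrow> poly_over A p \<Longrightarrow> poly_over A (smult c p)"
    "c \<in> A \<Longrightarrow> poly_over A (monom c n)"
    "c \<in> A \<Longrightarrow> poly_over A p \<Longrightarrow> poly_over A (pCons c p)"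
    "poly_over A p \<Longrightarrow> poly_over A (pderiv p)"
    "(\<And>a. a \<in> A \<Longrightarrow> f a \<in> A) \<Longrightarrow> f 0 = 0 \<Longrightarrow> poly_over A p \<Longrightarrow> poly_over A (map_poly f p)"
    "poly_over A p \<Longrightarrow> a \<in> A \<Longrightarrow> poly p a \<in> A"
  by (auto simp: poly_over_def coeff_mult coeff_pderiv coeff_map_poly coeff_pCons poly_altdef split: nat.split
      simp flip: of_nat_Suc
      intro!: subring_setD[OF assms])

text \<open>Division with remainder needs no division in the coefficients once the dividend is
  multiplied by a power of the leading coefficient of the divisor.\<close>

lemma pseudo_division_over:
  fixes f g :: "'a::idom poly"
  assumes A: "subring_set A" and f: "poly_over A f" and g: "poly_over A g" "g \<noteq> 0"
  obtains k q r where "poly_over A q" "poly_over A r" "smult (lead_coeff g ^ k) f = q * g + r"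
    "r = 0 \<or> degree r < degree g"
proof -
  have "\<exists>k q r. poly_over A q \<and> poly_over A r \<and> smult (lead_coeff g ^ k) f = q * g + r \<and>
      (r = 0 \<or> degree r < degree g)"
    using f
  proof (induction "degree f" arbitrary: f rule: less_induct)
    case less
    note cl = poly_over_closed[OF A] and lg = poly_overD[OF g(1), of "degree g"]
    show ?case
    proof (cases "f = 0 \<or> degree f < degree g")
      case True
      then show ?thesis using less.prems cl
        by (intro exI[of _ 0] exI[of _ "0::'a poly"] exI[of _ f]) auto
    next
      case False
      define m where "m = monom (lead_coeff f) (degree f - degree g)"
      define f1 where "f1 = smult (lead_coeff g) f - m * g"
      have m: "poly_over A m" unfolding m_def by (intro cl poly_overD less)
      have f1: "poly_over A f1" unfolding f1_def by (intro cl m g less lg)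
      have "degree (m * g) \<le> degree f"
        using False degree_mult_le[of m g] degree_monom_le[of "lead_coeff f" "degree f - degree g"]
        unfolding m_def by linarith
      then have "degree f1 \<le> degree f" unfolding f1_def
        by (intro degree_diff_le) (auto intro: order_trans[OF degree_smult_le])
      moreover have "coeff f1 (degree f) = 0"
        using False by (simp add: f1_def m_def coeff_monom_mult)
      ultimately have "f1 = 0 \<or> degree f1 < degree f"
        using eq_zero_or_degree_less by blast
      moreover have ?thesis if "f1 = 0"
      proof -
        have "smult (lead_coeff g ^ 1) f = m * g + 0" using that by (simp add: f1_def)
        then show ?thesis using m cl by blast
      qed
      moreover have ?thesis if lt: "degree f1 < degree f"
      proof -
        obtain k q r where *: "poly_over A q" "poly_over A r"
          "smult (lead_coeff g ^ k) f1 = q * g + r" "r = 0 \<or> degree r < degree g"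
          using less.hyps[OF lt f1] by blast
        have "smult (lead_coeff g ^ Suc k) f = (q + smult (lead_coeff g ^ k) m) * g + r"
        proof -
          have "smult (lead_coeff g ^ Suc k) f = smult (lead_coeff g ^ k) (f1 + m * g)"
            by (simp add: f1_def mult.commute)
          also have "\<dots> = q * g + r + smult (lead_coeff g ^ k) (m * g)"
            by (simp only: smult_add_right *(3))
          finally show ?thesis by (simp add: algebra_simps)
        qed
        moreover have "poly_over A (q + smult (lead_coeff g ^ k) m)"
          by (intro cl * m subring_setD(9)[OF A] lg)
        ultimately show ?thesis using * by blast
      qed
      ultimately show ?thesis by blast
    qed
  qed
  then show ?thesis using that by blast
qed

lemma adjoin_subfield: "subfield (adjoin L t)"
  by (auto simp: adjoin_def subfield_def)

lemma adjoin_mem: "t \<in> adjoin L t" "a \<in> L \<Longrightarrow> a \<in> adjoin L t"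
  by (auto simp: adjoin_def)

text \<open>The fractions on the right form a subfield containing \<open>L\<close> and
  \<open>t\<close>, and \<open>adjoin\<close> is the smallest one. The denominator is required to be
  nonzero at \<open>t\<close>, which for algebraic \<open>t\<close> is more than being a nonzero
  polynomial.\<close>

lemma adjoin_fraction:
  assumes "subfield L" "a \<in> adjoin L t"
  obtains p q where "poly_over L p" "poly_over L q" "poly q t \<noteq> 0" "a = poly p t / poly q t"
proof -
  note R = subfield_subring[OF assms(1)]
  note cl = poly_over_closed[OF R]
  let ?M = "{a. \<exists>p q. poly_over L p \<and> poly_over L q \<and> poly q t \<noteq> 0 \<and> a = poly p t / poly q t}"
  have "subfield ?M"
    unfolding subfield_def
  proof (intro conjI ballI)
    show "1 \<in> ?M" using cl(2) by (auto intro!: exI[of _ 1])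
    fix a assume "a \<in> ?M"
    then obtain p q where a: "poly_over L p" "poly_over L q" "poly q t \<noteq> 0" "a = poly p t / poly q t" by auto
    show "inverse a \<in> ?M"
    proof (cases "poly p t = 0")
      case True
      then have "inverse a = poly 0 t / poly 1 t" using a by simp
      then show ?thesis using cl(1,2) by (metis (mono_tags, lifting) mem_Collect_eq poly_1 zero_neq_one)
    next
      case False
      then show ?thesis using a by (intro CollectI exI[of _ q] exI[of _ p]) simp
    qed
    fix b assume "b \<in> ?M"
    then obtain p' q' where b: "poly_over L p'" "poly_over L q'" "poly q' t \<noteq> 0" "b = poly p' t / poly q' t" by auto
    have "a - b = poly (p * q' - p' * q) t / poly (q * q') t" using a b by (simp add: diff_frac_eq)
    moreover have "poly_over L (p * q' - p' * q)" "poly_over L (q * q')" using a b by (intro cl; simp)+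
    moreover have "poly (q * q') t \<noteq> 0" using a b by simp
    ultimately show "a - b \<in> ?M" by blast
    have "a * b = poly (p * p') t / poly (q * q') t" "poly (q * q') t \<noteq> 0" using a b by simp_all
    moreover have "poly_over L (p * p')" "poly_over L (q * q')" using a b by (intro cl; simp)+
    ultimately show "a * b \<in> ?M" by blast
  qed
  moreover have "insert t L \<subseteq> ?M"
  proof
    fix x assume "x \<in> insert t L"
    then show "x \<in> ?M"
    proof
      assume "x = t"
      then have "x = poly [:0,1:] t / poly 1 t" "poly 1 t \<noteq> 0" by auto
      moreover have "poly_over L [:0,1:]" by (intro cl subring_setD[OF R])
      ultimately show ?thesis using cl(2) by blast
    next
      assume "x \<in> L"
      then have "poly_over L [:x:]" by (intro cl subring_setD[OF R])
      moreover have "x = poly [:x:] t / poly 1 t" "poly 1 t \<noteq> 0" by auto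
      ultimately show ?thesis using cl(2) by blast
    qed
  qed
  ultimately have "adjoin L t \<subseteq> ?M" unfolding adjoin_def by (intro Inter_lower) blast
  then show ?thesis using assms(2) that by blast
qed

text \<open>When \<open>t\<close> is algebraic, a denominator of least degree is constant: dividing the minimal
  polynomial by it would produce a smaller one.\<close>

lemma adjoin_algebraic_poly:
  fixes L :: "'k::field set"
  assumes L: "subfield L" and m: "poly_over L m" "m \<noteq> 0" "poly m t = 0"
    and min: "\<And>p. poly_over L p \<Longrightarrow> p \<noteq> 0 \<Longrightarrow> poly p t = 0 \<Longrightarrow> degree m \<le> degree p"
    and a: "a \<in> adjoin L t"
  obtains p where "poly_over L p" "a = poly p t" "p = 0 \<or> degree p < degree m"
proof -
  note R = subfield_subring[OF L]
  note cl = poly_over_closed[OF R]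
  have red: "\<exists>r. poly_over L r \<and> poly r t = poly p t \<and> (r = 0 \<or> degree r < degree m)"
    if p: "poly_over L p" for p
  proof -
    obtain k q r where *: "poly_over L q" "poly_over L r" "smult (lead_coeff m ^ k) p = q * m + r"
      "r = 0 \<or> degree r < degree m"
      using pseudo_division_over[OF R p m(1,2)] by metis
    let ?c = "lead_coeff m ^ k"
    have c: "?c \<noteq> 0" "?c \<in> L" using m poly_overD[OF m(1)] subring_setD(9)[OF R] by auto
    have "poly r t = ?c * poly p t" using arg_cong[OF *(3), of "\<lambda>f. poly f t"] m(3) by simp
    moreover have "poly_over L (smult (1 / ?c) r)"
      by (rule cl(6)) (use * c L in \<open>auto intro!: subfield_divide subring_setD[OF R]\<close>)
    ultimately show ?thesis using *(4) c by (intro exI[of _ "smult (1 / ?c) r"]) auto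
  qed
  let ?P = "\<lambda>q. poly_over L q \<and> poly q t \<noteq> 0 \<and> (q = 0 \<or> degree q < degree m) \<and> (\<exists>p. poly_over L p \<and> poly q t * a = poly p t)"
  have "\<exists>q. ?P q"
  proof -
    obtain p q where *: "poly_over L p" "poly_over L q" "poly q t \<noteq> 0" "a = poly p t / poly q t"
      using adjoin_fraction[OF L a] by blast
    then obtain r where "poly_over L r" "poly r t = poly q t" "r = 0 \<or> degree r < degree m" using red by blast
    then show ?thesis using * by (intro exI[of _ r]) auto
  qed
  then obtain q where q: "?P q" and qmin: "\<And>q'. ?P q' \<Longrightarrow> degree q \<le> degree q'"
    using ex_has_least_nat[of ?P _ degree] by blast
  then obtain p where p: "poly_over L p" "poly q t * a = poly p t" by blast
  have q0: "q \<noteq> 0" using q by auto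
  have "degree q = 0"
  proof (rule ccontr)
    assume dq: "degree q \<noteq> 0"
    obtain k s r where *: "poly_over L s" "poly_over L r" "smult (lead_coeff q ^ k) m = s * q + r"
      "r = 0 \<or> degree r < degree q"
      using pseudo_division_over[OF R m(1) _ q0] q by metis
    have c: "lead_coeff q ^ k \<noteq> 0" using q0 by simp
    have ev: "0 = poly s t * poly q t + poly r t" using arg_cong[OF *(3), of "\<lambda>f. poly f t"] m(3) by simp
    \<comment> \<open>If \<open>q\<close> divided a multiple of \<open>m\<close>, the cofactor would
      vanish at \<open>t\<close> and have smaller degree than \<open>m\<close>.\<close>
    have "r \<noteq> 0"
    proof
      assume r: "r = 0"
      then have "poly s t = 0" using ev q by auto
      moreover have "s \<noteq> 0" using r *(3) c m(2) by auto
      moreover have "degree m = degree s + degree q"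
        using arg_cong[OF *(3), of degree] r c q0 \<open>s \<noteq> 0\<close> by (simp add: degree_mult_eq)
      ultimately show False using min[OF *(1)] dq by auto
    qed
    then have rd: "degree r < degree q" using * by auto
    have "poly r t \<noteq> 0" using min[OF *(2) \<open>r \<noteq> 0\<close>] rd q by auto
    moreover have "poly r t * a = poly (- s * p) t"
      using ev p(2) by (metis (no_types, opaque_lifting) add_eq_0_iff mult.assoc mult_minus_left poly_minus poly_mult)
    moreover have "poly_over L (- s * p)" using cl(5)[OF cl(4)[OF cl(1) *(1)] p(1)] by simp
    ultimately have "?P r" using * rd q by auto
    then show False using qmin[of r] rd by simp
  qed
  then obtain c where c: "q = [:c:]" by (metis degree_eq_zeroE)
  then have "c \<noteq> 0" "c \<in> L" using q poly_overD[of L q 0] by auto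
  then have "a = poly (smult (1 / c) p) t" "poly_over L (smult (1 / c) p)"
    using p c cl(6)[of "1 / c" p] subfield_divide[OF L] subring_setD(1)[OF R] by (auto simp: field_simps)
  then show ?thesis using red that by metis
qed

text \<open>With \<eta> = dh this says that \<open>exp (- h) \<omega>\<close> is closed. The
  logarithmic differential \<eta> of the integrating factor is recorded instead of the factor, which
  may lie outside \<open>L\<close>.\<close>

definition closed_multiplier :: "('n \<Rightarrow> 'k::field \<Rightarrow> 'k) \<Rightarrow> ('n \<Rightarrow> 'k) \<Rightarrow> 'k set \<Rightarrow> bool" where
  "closed_multiplier D \<omega> L \<longleftrightarrow> (\<exists>\<eta>. (\<forall>i. \<eta> i \<in> L) \<and> (\<forall>i j. D i (\<eta> j) = D j (\<eta> i)) \<and>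
     (\<forall>i j. d1 D \<omega> i j = wedge11 \<eta> \<omega> i j))"

locale integrable_form =
  fixes D :: "'n \<Rightarrow> 'k::field \<Rightarrow> 'k" and \<omega> :: "'n \<Rightarrow> 'k" and i0 :: 'n
  assumes diff_field: "differential_field D"
    and char0: "\<And>n. of_nat (Suc n) \<noteq> (0::'k)"
    and integrable: "\<And>i j k. wedge12 \<omega> (d1 D \<omega>) i j k = 0"
    and nonzero: "\<omega> i0 \<noteq> 0"
begin

lemma der: "derivation (D i)" and comm: "D i (D j a) = D j (D i a)"
  using diff_field by (auto simp: differential_field_def)

lemmas derD = derivationD[OF der] derivation_divide[OF der]

definition \<alpha> where "\<alpha> = d1 D \<omega>"
text \<open>The solution of d\<omega> = \<eta> \<and> \<omega> whose component \<open>i0\<close> is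
  zero, obtained by dividing the integrability condition by \<open>\<omega> i0\<close>. It need not
  be closed; \<kappa> is minus its differential.\<close>

definition \<eta>0 where "\<eta>0 i = - \<alpha> i0 i / \<omega> i0"
definition \<kappa> where "\<kappa> i j = D j (\<eta>0 i) - D i (\<eta>0 j)"

text \<open>The coefficient of da \<and> \<omega>, that is, the derivative along a vector field
  tangent to the foliation. Being a derivation, it can be applied to polynomial relations.\<close>

definition X where "X i j a = \<omega> j * D i a - \<omega> i * D j a"

lemma X_derivation: "derivation (X i j)"
  by (simp add: derivation_def X_def derD algebra_simps)

lemma \<alpha>_eq: "\<alpha> i j = \<eta>0 i * \<omega> j - \<eta>0 j * \<omega> i"
  using integrable[of i0 i j] nonzero by (simp add: wedge12_def \<eta>0_def \<alpha>_def field_simps)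

text \<open>The solutions \<open>\<eta>\<close> of \<open>d\<omega> = \<eta> \<and> \<omega>\<close> are \<open>\<eta>0 + \<lambda> \<omega>\<close>; closedness of \<open>\<eta>\<close> is the linear
  equation \<open>d(\<lambda>\<omega>) = - d\<eta>0\<close> for the function \<open>\<lambda>\<close>.\<close>

lemma closed_multiplier_iff:
  assumes L: "differential_subfield D L" and \<omega>: "\<And>i. \<omega> i \<in> L"
  shows "closed_multiplier D \<omega> L \<longleftrightarrow> (\<exists>l\<in>L. \<forall>i j. X i j l + \<alpha> i j * l = \<kappa> i j)"
proof
  have SL: "subfield L" and DL: "\<And>i a. a \<in> L \<Longrightarrow> D i a \<in> L"
    using L by (auto simp: differential_subfield_def)
  note R = subring_setD[OF subfield_subring[OF SL]] subfield_divide[OF SL]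
  have \<eta>0: "\<eta>0 i \<in> L" for i
    unfolding \<eta>0_def \<alpha>_def d1_def by (intro R DL \<omega>)
  have eqs: "X i j l + \<alpha> i j * l = \<kappa> i j \<longleftrightarrow> D i (\<eta>0 j + l * \<omega> j) = D j (\<eta>0 i + l * \<omega> i)" for i j l
    by (simp add: derD X_def \<alpha>_def d1_def \<kappa>_def algebra_simps eq_diff_eq diff_eq_eq)
  show "\<exists>l\<in>L. \<forall>i j. X i j l + \<alpha> i j * l = \<kappa> i j" if cm: "closed_multiplier D \<omega> L"
  proof -
    obtain \<eta> where "(\<forall>i. \<eta> i \<in> L) \<and> (\<forall>i j. D i (\<eta> j) = D j (\<eta> i)) \<and> (\<forall>i j. \<alpha> i j = \<eta> i * \<omega> j - \<eta> j * \<omega> i)"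
      using cm unfolding closed_multiplier_def \<alpha>_def wedge11_def by blast
    then have \<eta>: "\<And>i. \<eta> i \<in> L" "\<And>i j. D i (\<eta> j) = D j (\<eta> i)" "\<And>i j. \<alpha> i j = \<eta> i * \<omega> j - \<eta> j * \<omega> i"
      by simp_all
    define l where "l = (\<eta> i0 - \<eta>0 i0) / \<omega> i0"
    have "\<eta> i = \<eta>0 i + l * \<omega> i" for i
      using \<alpha>_eq[of i0 i] \<eta>(3)[of i0 i] nonzero by (simp add: l_def field_simps)
    then have "\<forall>i j. X i j l + \<alpha> i j * l = \<kappa> i j" using \<eta>(2) by (simp add: eqs)
    moreover have "l \<in> L" unfolding l_def by (intro R \<eta> \<eta>0 \<omega>)
    ultimately show ?thesis by blast
  qed
  show "closed_multiplier D \<omega> L" if ex: "\<exists>l\<in>L. \<forall>i j. X i j l + \<alpha> i j * l = \<kappa> i j"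
  proof -
    obtain l where l: "l \<in> L" "\<And>i j. X i j l + \<alpha> i j * l = \<kappa> i j" using ex by blast
    show ?thesis unfolding closed_multiplier_def
    proof (intro exI[of _ "\<lambda>i. \<eta>0 i + l * \<omega> i"] conjI allI)
      show "\<eta>0 i + l * \<omega> i \<in> L" for i by (intro R \<eta>0 l \<omega>)
      show "D i (\<eta>0 j + l * \<omega> j) = D j (\<eta>0 i + l * \<omega> i)" for i j using l(2) eqs by blast
      show "d1 D \<omega> i j = wedge11 (\<lambda>i. \<eta>0 i + l * \<omega> i) \<omega> i j" for i j
        using \<alpha>_eq[of i j] by (simp add: \<alpha>_def wedge11_def algebra_simps)
    qed
  qed
qed

lemma differential_subfieldD:
  assumes "differential_subfield D L"
  shows "subfield L" "a \<in> L \<Longrightarrow> D i a \<in> L"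
  using assms by (auto simp: differential_subfield_def)

context
  fixes L :: "'k set"
  assumes L: "differential_subfield D L" and \<omega>L: "\<And>i. \<omega> i \<in> L"
begin

lemmas SL = differential_subfieldD(1)[OF L] and DL = differential_subfieldD(2)[OF L]
lemmas R = subring_setD[OF subfield_subring[OF SL]] subfield_divide[OF SL]
lemmas cl = poly_over_closed[OF subfield_subring[OF SL]]

lemma XL: "a \<in> L \<Longrightarrow> X i j a \<in> L" unfolding X_def by (intro R DL \<omega>L)
lemma \<alpha>L: "\<alpha> i j \<in> L" unfolding \<alpha>_def d1_def by (intro R DL \<omega>L)
lemma \<kappa>L: "\<kappa> i j \<in> L" unfolding \<kappa>_def \<eta>0_def by (intro R DL \<omega>L \<alpha>L)

lemma minimal_polynomial:
  assumes "algebraic_over L t"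
  obtains m where "poly_over L m" "lead_coeff m = 1" "poly m t = 0" "degree m \<noteq> 0"
    "\<And>p. poly_over L p \<Longrightarrow> p \<noteq> 0 \<Longrightarrow> poly p t = 0 \<Longrightarrow> degree m \<le> degree p"
proof -
  let ?P = "\<lambda>p. poly_over L p \<and> p \<noteq> 0 \<and> poly p t = 0"
  have "\<exists>p. ?P p" using assms by (auto simp: algebraic_over_def poly_over_def)
  then obtain p where p: "?P p" and min: "\<And>q. ?P q \<Longrightarrow> degree p \<le> degree q"
    using ex_has_least_nat[of ?P _ degree] by blast
  let ?m = "smult (1 / lead_coeff p) p"
  have "poly_over L ?m" by (intro cl R poly_overD) (use p in auto)
  moreover have "degree p \<noteq> 0" using p by (metis degree_0_id poly_pCons poly_0 mult_zero_right add.right_neutral pCons_0_0)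
  ultimately show ?thesis using p min by (intro that[of ?m]) auto
qed

text \<open>If \<open>l\<close> solves the linear equation then so does its trace, divided by the degree. The trace
  is read off the minimal polynomial, and differentiating the polynomial relation shows that it
  solves the equation.\<close>

lemma descend_algebraic:
  assumes "algebraic_over L l" and eq: "\<And>i j. X i j l + \<alpha> i j * l = \<kappa> i j"
  shows "closed_multiplier D \<omega> L"
proof -
  obtain m where m: "poly_over L m" "lead_coeff m = 1" "poly m l = 0" "degree m \<noteq> 0"
    and min: "\<And>p. poly_over L p \<Longrightarrow> p \<noteq> 0 \<Longrightarrow> poly p l = 0 \<Longrightarrow> degree m \<le> degree p"
    using minimal_polynomial[OF assms(1)] by blast
  then obtain d where d: "degree m = Suc d" by (cases "degree m") auto
  define a where "a = coeff m d"
  define n where "n = (of_nat (Suc d) :: 'k)"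
  have n0: "n \<noteq> 0" using char0 by (simp only: n_def not_False_eq_True)
  have aL: "a \<in> L" unfolding a_def using m(1) by (rule poly_overD)
  have "X i j (- a / n) + \<alpha> i j * (- a / n) = \<kappa> i j" for i j
  proof -
    note XD = derivationD[OF X_derivation, of i j]
    \<comment> \<open>Applying \<open>X i j\<close> to m(l) = 0 and replacing \<open>X i j l\<close>
      by \<open>\<kappa> i j - \<alpha> i j * l\<close> gives a relation for \<open>l\<close>. The
      multiple \<open>n * \<alpha> i j\<close> of \<open>m\<close> is added to cancel the
      coefficient of degree \<open>Suc d\<close>, so that minimality of \<open>m\<close> makes
      \<open>q\<close> zero. Its coefficient of degree \<open>d\<close> is the equation for the
      trace.\<close>
    define q where "q = map_poly (X i j) m + pderiv m * [:\<kappa> i j, - \<alpha> i j:] + smult (n * \<alpha> i j) m"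
    have cm: "coeff m (Suc d) = 1" "\<And>k. k > Suc d \<Longrightarrow> coeff m k = 0" using m(2) d coeff_eq_0[of m] by auto
    have cq: "coeff q k = X i j (coeff m k) + \<kappa> i j * (of_nat (Suc k) * coeff m (Suc k))
        - \<alpha> i j * (of_nat k * coeff m k) + n * \<alpha> i j * coeff m k" for k
      by (cases k) (simp_all add: q_def coeff_map_poly XD coeff_pderiv algebra_simps)
    have "poly q l = 0"
    proof -
      have "poly (map_poly (X i j) m) l + poly (pderiv m) l * (\<kappa> i j - \<alpha> i j * l) = 0"
        using derivation_poly[OF X_derivation, of i j m l] m(3) XD(3) eq[of i j]
        by (metis add_diff_cancel_right')
      then show ?thesis using m(3) by (simp add: q_def algebra_simps)
    qed
    moreover have "poly_over L q"
      unfolding q_def n_def by (intro cl m XL R \<kappa>L \<alpha>L XD)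
    moreover have "degree q < degree m"
    proof -
      have "coeff q k = 0" if "k \<ge> Suc d" for k
        using that cm XD(3,4) by (cases "k = Suc d") (auto simp: cq n_def)
      then show ?thesis using d by (metis degree_0 leading_coeff_0_iff not_less_eq_eq zero_less_Suc linorder_not_le)
    qed
    ultimately have "q = 0" using min by fastforce
    then have "X i j a + \<kappa> i j * n - \<alpha> i j * (of_nat d * a) + n * \<alpha> i j * a = 0"
      using cq[of d] cm by (simp add: a_def n_def)
    then have *: "X i j a + \<kappa> i j * n + \<alpha> i j * a = 0" by (simp add: n_def algebra_simps)
    have "X i j (- a / n) = - X i j a / n"
      using n0 derivation_divide[OF X_derivation, of n i j "- a"] XD(5,7) by (simp add: n_def del: of_nat_Suc)
    then show ?thesis using * n0 by (simp add: field_simps eq_neg_iff_add_eq_0) (metis add_left_cancel)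
  qed
  moreover have "- a / n \<in> L" unfolding n_def by (intro R aL)
  ultimately show ?thesis using closed_multiplier_iff[OF L \<omega>L] by blast
qed

text \<open>The leading coefficients of a solution \<open>p(t) / q(t)\<close>, with \<open>dt = \<beta> t + c\<close>, either solve the
  linear equation themselves or give an integrating factor \<open>l t\<^sup>N\<close> (an integrating factor \<open>l\<close>
  when \<open>\<beta> = 0\<close>).\<close>

lemma descend_leading:
  fixes \<delta> :: "'n \<Rightarrow> 'k poly \<Rightarrow> 'k poly" and \<beta> :: "'n \<Rightarrow> 'k"
  assumes \<beta>: "\<And>i. \<beta> i \<in> L" "\<And>i j. D i (\<beta> j) = D j (\<beta> i)"
    and \<delta>_degree: "\<And>i p. degree (\<delta> i p) \<le> degree p"
    and \<delta>_lead: "\<And>i p. coeff (\<delta> i p) (degree p) = D i (lead_coeff p) + of_nat (degree p) * \<beta> i * lead_coeff p"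
    and pq: "poly_over L p" "poly_over L q" "q \<noteq> 0"
    and eq: "\<And>i j. smult (\<omega> j) (\<delta> i p * q - p * \<delta> i q) - smult (\<omega> i) (\<delta> j p * q - p * \<delta> j q)
        + smult (\<alpha> i j) (p * q) = smult (\<kappa> i j) (q * q)"
  shows "closed_multiplier D \<omega> L"
proof (cases "p \<noteq> 0 \<and> degree q \<le> degree p")
  \<comment> \<open>With \<open>p = 0\<close> or \<open>degree p < degree q\<close> the left side
    has no term of degree \<open>degree q + degree q\<close>. Hence \<kappa> = 0, so \<eta>0 is
    closed already and zero is a solution.\<close>
  case False
  have "\<kappa> i j = 0" for i j
  proof -
    have "coeff (\<delta> i p * q - p * \<delta> i q) (degree q + degree q) = 0"
      "coeff (\<delta> j p * q - p * \<delta> j q) (degree q + degree q) = 0"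
      "coeff (p * q) (degree q + degree q) = 0"
      if "p \<noteq> 0" "degree p < degree q"
    proof -
      have *: "degree (\<delta> i p * q) < degree q + degree q" "degree (p * \<delta> i q) < degree q + degree q"
         "degree (p * q) < degree q + degree q" for i
        using degree_mult_le[of "\<delta> i p" q] degree_mult_le[of p "\<delta> i q"] degree_mult_le[of p q]
          \<delta>_degree[of i p] \<delta>_degree[of i q] that by linarith+
      show "coeff (\<delta> i p * q - p * \<delta> i q) (degree q + degree q) = 0"
        "coeff (\<delta> j p * q - p * \<delta> j q) (degree q + degree q) = 0"
        "coeff (p * q) (degree q + degree q) = 0"
        by (simp_all add: coeff_eq_0 *)
    qed
    moreover have "\<delta> i 0 = 0" for i
      using \<delta>_degree[of i 0] \<delta>_lead[of i 0] by (simp add: derD leading_coeff_0_iff[symmetric] del: leading_coeff_0_iff)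
    ultimately have "coeff (smult (\<kappa> i j) (q * q)) (degree q + degree q) = 0"
      using False unfolding eq[symmetric] by (cases "p = 0") auto
    then show ?thesis using pq(3) by (simp add: coeff_mult_degree_sum)
  qed
  then show ?thesis unfolding closed_multiplier_iff[OF L \<omega>L]
    by (intro bexI[of _ 0]) (simp_all add: derivationD[OF X_derivation] R)
next
  case True
  define N where "N = degree p - degree q"
  have N: "degree p = N + degree q" using True by (simp add: N_def)
  define l where "l = lead_coeff p / lead_coeff q"
  have p0: "lead_coeff p \<noteq> 0" and q0: "lead_coeff q \<noteq> 0" using True pq by auto
  have lL: "l \<in> L" unfolding l_def by (intro R poly_overD pq)
  have l0: "l \<noteq> 0" using p0 q0 by (simp add: l_def)
  have co: "coeff (f * g) (degree p + degree q) = coeff f (degree p) * coeff g (degree q)"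
    if "degree f \<le> degree p" "degree g \<le> degree q" for f g :: "'k poly"
  proof -
    have "coeff (f * g) (degree p + degree q) = (\<Sum>i\<le>degree p + degree q. coeff f i * coeff g (degree p + degree q - i))"
      by (simp add: coeff_mult)
    also have "\<dots> = (\<Sum>i\<in>{degree p}. coeff f i * coeff g (degree p + degree q - i))"
    proof (rule sum.mono_neutral_right)
      show "\<forall>i\<in>{..degree p + degree q} - {degree p}. coeff f i * coeff g (degree p + degree q - i) = 0"
      proof
        fix i assume "i \<in> {..degree p + degree q} - {degree p}"
        then have "i > degree f \<or> degree p + degree q - i > degree g" using that by (cases "i < degree p") auto
        then show "coeff f i * coeff g (degree p + degree q - i) = 0" by (auto simp: coeff_eq_0)
      qed
    qed auto
    finally show ?thesis by simp
  qed
  have Dl: "D i l * (lead_coeff q * lead_coeff q) = D i (lead_coeff p) * lead_coeff q - lead_coeff p * D i (lead_coeff q)" for i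
    using q0 by (simp add: l_def derD)
  have lq: "lead_coeff p = l * lead_coeff q" using q0 by (simp add: l_def)
  \<comment> \<open>Comparison of the coefficients of degree \<open>degree p + degree q\<close>. The
    right side reaches this degree only when N = 0.\<close>
  have lead: "X i j l + of_nat N * (\<omega> j * \<beta> i - \<omega> i * \<beta> j) * l + \<alpha> i j * l = (if N = 0 then \<kappa> i j else 0)" for i j
  proof -
    have dd: "coeff (\<delta> i p * q - p * \<delta> i q) (degree p + degree q) =
        (D i l + of_nat N * \<beta> i * l) * (lead_coeff q * lead_coeff q)" for i
    proof -
      have "coeff (\<delta> i p * q - p * \<delta> i q) (degree p + degree q) =
        (D i (lead_coeff p) + of_nat (degree p) * \<beta> i * lead_coeff p) * lead_coeff q
        - lead_coeff p * (D i (lead_coeff q) + of_nat (degree q) * \<beta> i * lead_coeff q)"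
        by (simp only: coeff_diff co \<delta>_lead \<delta>_degree order_refl)
      also have "\<dots> = D i l * (lead_coeff q * lead_coeff q)
         + (of_nat (degree p) - of_nat (degree q)) * \<beta> i * (lead_coeff p * lead_coeff q)"
        unfolding Dl by (simp only: algebra_simps)
      also have "of_nat (degree p) - of_nat (degree q) = (of_nat N :: 'k)"
        unfolding N_def using True by (simp add: of_nat_diff)
      finally show ?thesis by (simp only: lq algebra_simps)
    qed
    have "coeff (smult (\<kappa> i j) (q * q)) (degree p + degree q) =
       (if N = 0 then \<kappa> i j * (lead_coeff q * lead_coeff q) else 0)"
      using N degree_mult_le[of q q] by (cases "N = 0") (auto simp: coeff_mult_degree_sum coeff_eq_0)
    moreover have "coeff (smult (\<kappa> i j) (q * q)) (degree p + degree q) =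
        \<omega> j * coeff (\<delta> i p * q - p * \<delta> i q) (degree p + degree q)
        - \<omega> i * coeff (\<delta> j p * q - p * \<delta> j q) (degree p + degree q) + \<alpha> i j * coeff (p * q) (degree p + degree q)"
    proof -
      define F where "F i = \<delta> i p * q - p * \<delta> i q" for i
      have "smult (\<omega> j) (F i) - smult (\<omega> i) (F j) + smult (\<alpha> i j) (p * q) = smult (\<kappa> i j) (q * q)"
        unfolding F_def by (rule eq)
      from arg_cong[OF this, of "\<lambda>f. coeff f (degree p + degree q)"] show ?thesis
        by (simp add: F_def[symmetric])
    qed
    moreover have "coeff (p * q) (degree p + degree q) = l * lead_coeff q * lead_coeff q"
      by (simp only: co order_refl lq)
    ultimately have "\<omega> j * ((D i l + of_nat N * \<beta> i * l) * (lead_coeff q * lead_coeff q))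
       - \<omega> i * ((D j l + of_nat N * \<beta> j * l) * (lead_coeff q * lead_coeff q))
       + \<alpha> i j * (l * lead_coeff q * lead_coeff q) = (if N = 0 then \<kappa> i j * (lead_coeff q * lead_coeff q) else 0)"
      by (simp only: dd)
    then have "(X i j l + of_nat N * (\<omega> j * \<beta> i - \<omega> i * \<beta> j) * l + \<alpha> i j * l) * (lead_coeff q * lead_coeff q)
       = (if N = 0 then \<kappa> i j else 0) * (lead_coeff q * lead_coeff q)"
      by (auto simp: X_def algebra_simps)
    then show ?thesis using q0 by simp
  qed
  show ?thesis
  proof (cases "N = 0")
    case True
    then show ?thesis using lead lL closed_multiplier_iff[OF L \<omega>L] by auto
  next
    case False
    show ?thesis unfolding closed_multiplier_def
    proof (intro exI[of _ "\<lambda>i. - D i l / l - of_nat N * \<beta> i"] conjI allI)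
      show "- D i l / l - of_nat N * \<beta> i \<in> L" for i
        by (intro R lL DL \<beta>)
      show "D i (- D j l / l - of_nat N * \<beta> j) = D j (- D i l / l - of_nat N * \<beta> i)" for i j
        using l0 \<beta>(2)[of i j] comm[of i j l] by (simp add: derD algebra_simps)
      show "d1 D \<omega> i j = wedge11 (\<lambda>i. - D i l / l - of_nat N * \<beta> i) \<omega> i j" for i j
      proof -
        have "l * \<alpha> i j = - X i j l - of_nat N * (\<omega> j * \<beta> i - \<omega> i * \<beta> j) * l"
          using lead[of i j] False by (simp add: algebra_simps eq_neg_iff_add_eq_0)
        then have "\<alpha> i j = (- X i j l - of_nat N * (\<omega> j * \<beta> i - \<omega> i * \<beta> j) * l) / l"
          using l0 by (metis nonzero_mult_div_cancel_left)
        then show ?thesis using l0 by (simp add: \<alpha>_def[symmetric] wedge11_def X_def diff_divide_distrib left_diff_distrib right_diff_distrib mult.commute mult.left_commute)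
      qed
    qed
  qed
qed

text \<open>An integral or exponential step may adjoin an element that is already algebraic. For
  transcendental \<open>t\<close> the relation \<open>\<Xi>\<close> between p(t) and q(t) is an
  identity of polynomials. For algebraic \<open>t\<close> the solution is p(t) with \<open>p\<close>
  of degree below the minimal polynomial. As \<open>\<delta>\<close> does not raise degrees,
  \<open>\<Xi>\<close> with q = 1 is still of smaller degree, and again an identity.\<close>

lemma descend_transcendental_or_algebraic:
  fixes \<delta> :: "'n \<Rightarrow> 'k poly \<Rightarrow> 'k poly" and \<beta> :: "'n \<Rightarrow> 'k"
  assumes \<beta>: "\<And>i. \<beta> i \<in> L" "\<And>i j. D i (\<beta> j) = D j (\<beta> i)"
    and \<delta>_degree: "\<And>i p. degree (\<delta> i p) \<le> degree p"
    and \<delta>_lead: "\<And>i p. coeff (\<delta> i p) (degree p) = D i (lead_coeff p) + of_nat (degree p) * \<beta> i * lead_coeff p"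
    and \<delta>_over: "\<And>i p. poly_over L p \<Longrightarrow> poly_over L (\<delta> i p)"
    and \<delta>_poly: "\<And>i p. poly (\<delta> i p) t = D i (poly p t)"
    and l: "l \<in> adjoin L t" "\<And>i j. X i j l + \<alpha> i j * l = \<kappa> i j"
  shows "closed_multiplier D \<omega> L"
proof -
  define \<Xi> where "\<Xi> i j p q = smult (\<omega> j) (\<delta> i p * q - p * \<delta> i q) - smult (\<omega> i) (\<delta> j p * q - p * \<delta> j q)
        + smult (\<alpha> i j) (p * q) - smult (\<kappa> i j) (q * q)" for i j p q
  have \<Xi>_over: "poly_over L (\<Xi> i j p q)" if "poly_over L p" "poly_over L q" for i j p q
    unfolding \<Xi>_def by (intro cl \<delta>_over that \<omega>L \<alpha>L \<kappa>L)
  have \<Xi>_poly: "poly (\<Xi> i j p q) t = 0" if "l = poly p t / poly q t" "poly q t \<noteq> 0" for i j p q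
  proof -
    have DQ: "D i (poly p t) * poly q t - poly p t * D i (poly q t) = D i l * (poly q t * poly q t)" for i
      unfolding that(1) using that(2) by (simp add: derD)
    have lQ: "poly p t * poly q t = l * (poly q t * poly q t)" using that by simp
    have "poly (\<Xi> i j p q) t = \<omega> j * (D i (poly p t) * poly q t - poly p t * D i (poly q t))
      - \<omega> i * (D j (poly p t) * poly q t - poly p t * D j (poly q t))
      + \<alpha> i j * (poly p t * poly q t) - \<kappa> i j * (poly q t * poly q t)"
      by (simp add: \<Xi>_def \<delta>_poly)
    also have "\<dots> = (X i j l + \<alpha> i j * l - \<kappa> i j) * (poly q t * poly q t)"
      by (simp only: DQ lQ X_def) (simp add: algebra_simps)
    finally show ?thesis by (simp add: l)
  qed
  have conclude: ?thesis if "poly_over L p" "poly_over L q" "q \<noteq> 0" "\<And>i j. \<Xi> i j p q = 0" for p q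
    using descend_leading[OF \<beta> \<delta>_degree \<delta>_lead that(1-3)] that(4) unfolding \<Xi>_def by simp
  show ?thesis
  proof (cases "algebraic_over L t")
    case False
    obtain p q where "poly_over L p" "poly_over L q" "poly q t \<noteq> 0" "l = poly p t / poly q t"
      using adjoin_fraction[OF SL l(1)] by blast
    moreover from this have "\<Xi> i j p q = 0" for i j
      using False \<Xi>_over[of p q i j] \<Xi>_poly[of p q i j] by (auto simp: algebraic_over_def poly_over_def)
    moreover have "q \<noteq> 0" using \<open>poly q t \<noteq> 0\<close> by auto
    ultimately show ?thesis using conclude[of p q] by blast
  next
    case True
    obtain m where m: "poly_over L m" "lead_coeff m = 1" "poly m t = 0" "degree m \<noteq> 0"
      and min: "\<And>p. poly_over L p \<Longrightarrow> p \<noteq> 0 \<Longrightarrow> poly p t = 0 \<Longrightarrow> degree m \<le> degree p"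
      using minimal_polynomial[OF True] by blast
    have m0: "m \<noteq> 0" using m(2) by auto
    obtain p where p: "poly_over L p" "l = poly p t" "p = 0 \<or> degree p < degree m"
      using adjoin_algebraic_poly[OF SL m(1) m0 m(3) min l(1)] by blast
    have \<delta>1: "\<delta> i 1 = 0" for i
      using \<delta>_degree[of i 1] \<delta>_lead[of i 1] derD(4)[of i]
      by (metis add.right_neutral degree_1 lead_coeff_1 leading_coeff_0_iff le_zero_eq mult_zero_left of_nat_0 mult_1_right)
    have "\<Xi> i j p 1 = 0" for i j
    proof -
      have "degree (\<Xi> i j p 1) \<le> degree p"
        unfolding \<Xi>_def using \<delta>_degree[of i p] \<delta>_degree[of j p] \<delta>1
        by (intro degree_diff_le degree_add_le order_trans[OF degree_smult_le]) auto
      then show ?thesis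
        using min[OF \<Xi>_over[OF p(1) cl(2), of i j]] \<Xi>_poly[of p 1 i j] p m(4) by fastforce
    qed
    then show ?thesis using conclude[OF p(1) cl(2)] by simp
  qed
qed

end

text \<open>Adjoining \<open>t\<close> with \<open>D i t = \<beta> i * t + c i\<close> covers both integrals and exponentials.\<close>

lemma adjoin_differential:
  assumes L: "differential_subfield D L" and t: "\<And>i. D i t \<in> adjoin L t"
  shows "differential_subfield D (adjoin L t)"
  unfolding differential_subfield_def
proof (intro conjI allI ballI adjoin_subfield)
  fix i a assume "a \<in> adjoin L t"
  note SL = differential_subfieldD(1)[OF L] and DL = differential_subfieldD(2)[OF L]
  then obtain p q where *: "poly_over L p" "poly_over L q" "poly q t \<noteq> 0" "a = poly p t / poly q t"
    using adjoin_fraction[OF SL \<open>a \<in> adjoin L t\<close>] by blast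
  note R' = subring_setD[OF subfield_subring[OF adjoin_subfield]] subfield_divide[OF adjoin_subfield]
  note cl = poly_over_closed[OF subfield_subring[OF SL]]
  have P: "poly p t \<in> adjoin L t" if "poly_over L p" for p
  proof -
    have "poly_over (adjoin L t) p" using that adjoin_mem(2) by (auto simp: poly_over_def)
    then show ?thesis using poly_over_closed(11)[OF subfield_subring[OF adjoin_subfield]] adjoin_mem(1) by metis
  qed
  have DP: "D i (poly p t) \<in> adjoin L t" if "poly_over L p" for p
    unfolding derivation_poly[OF der] by (intro R' P t cl that derD) (auto intro: DL)
  show "D i a \<in> adjoin L t" unfolding *(4)
    using * by (subst derD) (auto intro!: R' P DP)
qed

text \<open>The derivation is modelled on polynomials by \<open>\<delta>\<close>, which acts on the
  coefficients and sends the indeterminate to an affine polynomial in it; hence degrees do not grow.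
  Integrals are the case \<beta> = 0 and exponentials the case c = 0.\<close>

lemma descend_adjoin:
  assumes L: "differential_subfield D L" and \<omega>L: "\<And>i. \<omega> i \<in> L"
    and t: "\<And>i. D i t = \<beta> i * t + c i" "\<And>i. \<beta> i \<in> L" "\<And>i. c i \<in> L" "\<And>i j. D i (\<beta> j) = D j (\<beta> i)"
    and M: "closed_multiplier D \<omega> (adjoin L t)"
  shows "closed_multiplier D \<omega> L"
proof -
  note SL = differential_subfieldD(1)[OF L] and DL = differential_subfieldD(2)[OF L]
  note R = subring_setD[OF subfield_subring[OF SL]] and cl = poly_over_closed[OF subfield_subring[OF SL]]
  note R' = subring_setD[OF subfield_subring[OF adjoin_subfield]]
  have tA: "D i t \<in> adjoin L t" for i
    unfolding t(1) by (intro R' adjoin_mem t)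
  obtain l where l: "l \<in> adjoin L t" "\<And>i j. X i j l + \<alpha> i j * l = \<kappa> i j"
    using M closed_multiplier_iff[OF adjoin_differential[OF L tA]] \<omega>L adjoin_mem(2) by metis
  define \<delta> where "\<delta> i p = map_poly (D i) p + pderiv p * [:c i, \<beta> i:]" for i p
  have c\<delta>: "coeff (\<delta> i p) k = D i (coeff p k) + of_nat k * \<beta> i * coeff p k + c i * of_nat (Suc k) * coeff p (Suc k)" for i p k
    by (cases k) (simp_all add: \<delta>_def coeff_map_poly derD coeff_pderiv algebra_simps)
  have deg: "degree (\<delta> i p) \<le> degree p" for i p
    by (rule degree_le) (auto simp: c\<delta> coeff_eq_0 derD)
  show ?thesis
  proof (rule descend_transcendental_or_algebraic[OF L \<omega>L t(2) t(4) deg _ _ _ l])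
    show "coeff (\<delta> i p) (degree p) = D i (lead_coeff p) + of_nat (degree p) * \<beta> i * lead_coeff p" for i p
      by (simp add: c\<delta> coeff_eq_0)
    show "poly_over L (\<delta> i p)" if "poly_over L p" for i p
      unfolding \<delta>_def by (intro cl that t R derD) (auto intro: DL)
    show "poly (\<delta> i p) t = D i (poly p t)" for i p
      unfolding derivation_poly[OF der] by (simp add: \<delta>_def t(1) algebra_simps)
  qed
qed

text \<open>Stability under the derivations and inclusion of the base field are carried along
  because each descent step needs a lower field that is differential and contains \<omega>.\<close>

lemma descend_tower:
  assumes "liouvillian_tower D K0 L" and K0: "differential_subfield D K0" "\<And>i. \<omega> i \<in> K0"
  shows "differential_subfield D L \<and> K0 \<subseteq> L \<and> (closed_multiplier D \<omega> L \<longrightarrow> closed_multiplier D \<omega> K0)"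
  using assms(1)
proof induction
  case base
  then show ?case using K0 by simp
next
  case (algebraic L M)
  then have L: "differential_subfield D L" "\<And>i. \<omega> i \<in> L" using K0 by auto
  have "closed_multiplier D \<omega> L" if M: "closed_multiplier D \<omega> M"
  proof -
    obtain l where "l \<in> M" "\<And>i j. X i j l + \<alpha> i j * l = \<kappa> i j"
      using M closed_multiplier_iff[OF algebraic.hyps(2)] L(2) algebraic.hyps(3) by blast
    then show ?thesis using descend_algebraic[OF L] algebraic.hyps(4) by blast
  qed
  then show ?case using algebraic by auto
next
  case (integral L t)
  then have L: "differential_subfield D L" "\<And>i. \<omega> i \<in> L" using K0 by auto
  note R = subring_setD[OF subfield_subring[OF differential_subfieldD(1)[OF L(1)]]]
  have "differential_subfield D (adjoin L t)"
    using adjoin_differential[OF L(1)] integral.hyps(2) adjoin_mem(2) by metis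
  moreover have "closed_multiplier D \<omega> (adjoin L t) \<longrightarrow> closed_multiplier D \<omega> L"
    using descend_adjoin[OF L, of t "\<lambda>i. 0" "\<lambda>i. D i t"] integral.hyps(2) R(2) derD(3) by simp
  ultimately show ?case using integral adjoin_mem(2) by blast
next
  case (exponential L t)
  then have L: "differential_subfield D L" "\<And>i. \<omega> i \<in> L" using K0 by auto
  note R = subring_setD[OF subfield_subring[OF differential_subfieldD(1)[OF L(1)]]] and R' = subring_setD[OF subfield_subring[OF adjoin_subfield]]
  have D: "D i t = D i t / t * t + 0" for i using exponential.hyps(2) by simp
  have "D i t \<in> adjoin L t" for i
    using R'(6)[OF adjoin_mem(2)[of "D i t / t" L t] adjoin_mem(1)[of t L]] exponential.hyps(2,3) by simp
  then have "differential_subfield D (adjoin L t)"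
    by (rule adjoin_differential[OF L(1)])
  moreover have "D i (D j t / t) = D j (D i t / t)" for i j
    using exponential.hyps(2) comm[of i j t] by (simp add: derD algebra_simps)
  then have "closed_multiplier D \<omega> (adjoin L t) \<longrightarrow> closed_multiplier D \<omega> L"
    using descend_adjoin[OF L, of t "\<lambda>i. D i t / t" "\<lambda>i. 0"] D exponential.hyps(3) R(2) by blast
  ultimately show ?case using exponential adjoin_mem(2) by blast
qed

text \<open>Proportionality writes dG as \<phi> \<omega>. Since ddG = 0, \<phi> is an integrating
  factor, and minus its logarithmic differential is the multiplier.\<close>

lemma closed_multiplier_of_first_integral:
  assumes "F i \<noteq> 0" and dF: "\<And>i. F i = D i G" and F: "\<And>i j. wedge11 F \<omega> i j = 0"
  shows "closed_multiplier D \<omega> UNIV"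
proof -
  define \<phi> where "\<phi> = F i0 / \<omega> i0"
  have F\<phi>: "F i = \<phi> * \<omega> i" for i
    using F[of i i0] nonzero by (simp add: wedge11_def \<phi>_def field_simps)
  have \<phi>0: "\<phi> \<noteq> 0" using assms(1) F\<phi> by auto
  have *: "D i \<phi> * \<omega> j + \<phi> * D i (\<omega> j) = D j \<phi> * \<omega> i + \<phi> * D j (\<omega> i)" for i j
    using comm[of i j G] unfolding dF[symmetric] F\<phi> derD(2) by (simp only: mult.commute)
  show ?thesis unfolding closed_multiplier_def
  proof (intro exI[of _ "\<lambda>i. - D i \<phi> / \<phi>"] conjI allI)
    show "D i (- D j \<phi> / \<phi>) = D j (- D i \<phi> / \<phi>)" for i j
      using \<phi>0 comm[of i j \<phi>] by (simp add: derD(5,9) mult.commute)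
    show "d1 D \<omega> i j = wedge11 (\<lambda>i. - D i \<phi> / \<phi>) \<omega> i j" for i j
    proof -
      have "\<phi> * d1 D \<omega> i j = D j \<phi> * \<omega> i - D i \<phi> * \<omega> j"
        using *[of i j] by (simp add: d1_def right_diff_distrib) (metis add_diff_cancel_left' add_diff_eq diff_add_eq_diff_diff_swap diff_diff_eq2)
      then show ?thesis using \<phi>0 by (simp add: wedge11_def field_simps)
    qed
  qed simp
qed

end

section \<open>The closed multiplier over the rational functions\<close>

lemma mpoly_partial_Const: "mpoly_partial i (Const c) = 0"
  by (simp add: Const_def mpoly_partial_single)

lemma mpoly_partial_derivation: "derivation (mpoly_partial i)"
  by (simp add: derivation_def mpoly_partial_add mpoly_partial_mult)

lemma mpoly_partial_commute: "mpoly_partial i (mpoly_partial j f) = mpoly_partial j (mpoly_partial i f)"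
proof (induction f rule: mpoly_induct)
  case (single m c)
  have "m - Poly_Mapping.single j 1 - Poly_Mapping.single i 1 = m - Poly_Mapping.single i 1 - Poly_Mapping.single j (1::nat)"
    by (intro poly_mapping_eqI) (simp add: lookup_minus)
  then show ?case
    by (cases "i = j") (simp_all add: mpoly_partial_single lookup_minus lookup_single mult.left_commute)
qed (simp_all add: mpoly_partial_add)

lemma ratfun_exhaust:
  fixes a :: "'n::linorder ratfun"
  obtains f g where "a = Fract f g" "g \<noteq> 0"
  by (cases a) auto

lemma ratfun_partial_of_mpoly: "ratfun_partial i (Fract f 1) = Fract (mpoly_partial i f) 1"
  using mpoly_partial_Const[of i 1] by (simp add: ratfun_partial_Fract Const_def single_one)

theorem rational_closed_multiplier:
  fixes \<omega> :: "'n::{finite,linorder} \<Rightarrow> 'n mpoly"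
  assumes "liouvillian_integrable TYPE('k::field) \<omega>" and nz: "\<omega> i0 \<noteq> 0"
  obtains \<eta> :: "'n \<Rightarrow> 'n ratfun" where
    "\<And>i j. ratfun_partial i (\<eta> j) = ratfun_partial j (\<eta> i)"
    "\<And>i j. Fract (d1 mpoly_partial \<omega> i j) 1 = wedge11 \<eta> (\<lambda>l. Fract (\<omega> l) 1) i j"
proof -
  obtain D :: "'n \<Rightarrow> 'k \<Rightarrow> 'k" and \<iota> F where
    w: "\<And>i j k. wedge12 \<omega> (d1 mpoly_partial \<omega>) i j k = 0" and ext: "liouvillian_extension D \<iota>" and
    F: "\<exists>i. d0 D F i \<noteq> 0" "\<And>i j. wedge11 (d0 D F) (\<lambda>l. \<iota> (Fract (\<omega> l) 1)) i j = 0"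
    using assms(1) unfolding liouvillian_integrable_def by blast
  have emb: "\<iota> 1 = 1" "\<And>a b. \<iota> (a + b) = \<iota> a + \<iota> b" "\<And>a b. \<iota> (a * b) = \<iota> a * \<iota> b"
    "\<And>i a. \<iota> (ratfun_partial i a) = D i (\<iota> a)" and DF: "differential_field D"
    and tower: "liouvillian_tower D (range \<iota>) UNIV"
    using ext by (auto simp: liouvillian_extension_def ratfun_embedding_def)
  have \<iota>0: "\<iota> 0 = 0" using emb(2)[of 0 0] by (metis add.right_neutral add_left_cancel)
  have \<iota>m: "\<iota> (- a) = - \<iota> a" for a using emb(2)[of a "- a"] \<iota>0 by (simp add: eq_neg_iff_add_eq_0 add.commute)
  have \<iota>d: "\<iota> (a - b) = \<iota> a - \<iota> b" for a b using emb(2)[of a "- b"] \<iota>m by simp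
  have \<iota>inv: "\<iota> (inverse a) = inverse (\<iota> a)" for a
  proof (cases "a = 0")
    case False
    then have "\<iota> a * \<iota> (inverse a) = 1" using emb(1,3)[symmetric] by simp
    then show ?thesis by (metis inverse_unique)
  qed (simp add: \<iota>0)
  have \<iota>_inj: "a = b" if "\<iota> a = \<iota> b" for a b
  proof (rule ccontr)
    assume "a \<noteq> b"
    then have "\<iota> ((a - b) * inverse (a - b)) = 1" using emb(1) by simp
    moreover have "\<iota> ((a - b) * inverse (a - b)) = 0" using that by (simp add: emb(3) \<iota>d)
    ultimately show False by simp
  qed
  have of_nat: "\<iota> (of_nat n) = of_nat n" for n
    by (induction n) (simp_all add: \<iota>0 emb)
  define \<omega>' where "\<omega>' l = \<iota> (Fract (\<omega> l) 1)" for l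
  have D\<omega>: "d1 D \<omega>' i j = \<iota> (Fract (d1 mpoly_partial \<omega> i j) 1)" for i j
    by (simp add: d1_def \<omega>'_def emb(4)[symmetric] ratfun_partial_of_mpoly \<iota>d[symmetric])
  have K0: "differential_subfield D (range \<iota>)"
    unfolding differential_subfield_def subfield_def
  proof (intro conjI allI ballI)
    show "1 \<in> range \<iota>" using emb(1) by (metis rangeI)
    fix a assume "a \<in> range \<iota>"
    then obtain a' where a': "a = \<iota> a'" by (rule imageE)
    show "inverse a \<in> range \<iota>" unfolding a' \<iota>inv[symmetric] by (rule rangeI)
    show "D i a \<in> range \<iota>" for i unfolding a' emb(4)[symmetric] by (rule rangeI)
    fix b assume "b \<in> range \<iota>"
    then obtain b' where b': "b = \<iota> b'" by (rule imageE)
    show "a - b \<in> range \<iota>" unfolding a' b' \<iota>d[symmetric] by (rule rangeI)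
    show "a * b \<in> range \<iota>" unfolding a' b' emb(3)[symmetric] by (rule rangeI)
  qed
  interpret integrable_form D \<omega>' i0
  proof
    show "differential_field D" by fact
    \<comment> \<open>\<open>\<iota>\<close> is injective, so characteristic zero passes from the
      rational functions to the field of the extension.\<close>
    show "of_nat (Suc n) \<noteq> (0::'k)" for n
    proof
      assume "of_nat (Suc n) = (0::'k)"
      then have "of_nat (Suc n) = (0::'n ratfun)" using \<iota>_inj \<iota>0 of_nat by metis
      then have "of_nat (Suc n) = (0::'n mpoly)"
        by (simp add: of_nat_fract Zero_fract_def eq_fract del: of_nat_Suc)
      then show False by (simp only: of_nat_eq_0_iff)
    qed
    show "wedge12 \<omega>' (d1 D \<omega>') i j k = 0" for i j k
    proof -
      have "wedge12 \<omega>' (d1 D \<omega>') i j k = \<iota> (Fract (wedge12 \<omega> (d1 mpoly_partial \<omega>) i j k) 1)"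
        by (simp add: wedge12_def D\<omega> \<omega>'_def emb(2,3)[symmetric] \<iota>d[symmetric])
      then show ?thesis using w \<iota>0 by (simp add: fract_collapse)
    qed
    show "\<omega>' i0 \<noteq> 0"
      using \<iota>_inj[of "Fract (\<omega> i0) 1" 0] nz \<iota>0 by (auto simp: \<omega>'_def eq_fract Zero_fract_def)
  qed
  have "closed_multiplier D \<omega>' UNIV"
    using closed_multiplier_of_first_integral[of "d0 D F"] F by (auto simp: d0_def \<omega>'_def[abs_def])
  then have "closed_multiplier D \<omega>' (range \<iota>)"
    using descend_tower[OF tower K0] by (auto simp: \<omega>'_def)
  then obtain \<eta>' where "(\<forall>i. \<eta>' i \<in> range \<iota>) \<and> (\<forall>i j. D i (\<eta>' j) = D j (\<eta>' i)) \<and>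
     (\<forall>i j. d1 D \<omega>' i j = wedge11 \<eta>' \<omega>' i j)"
    unfolding closed_multiplier_def by (elim exE)
  then have \<eta>': "\<And>i. \<eta>' i \<in> range \<iota>" "\<And>i j. D i (\<eta>' j) = D j (\<eta>' i)"
     "\<And>i j. d1 D \<omega>' i j = wedge11 \<eta>' \<omega>' i j" by simp_all
  define \<eta> where "\<eta> i = (SOME a. \<iota> a = \<eta>' i)" for i
  have \<eta>: "\<iota> (\<eta> i) = \<eta>' i" for i
    unfolding \<eta>_def using \<eta>'(1)[of i] by (metis (mono_tags, lifting) imageE someI_ex)
  show ?thesis
  proof
    show "ratfun_partial i (\<eta> j) = ratfun_partial j (\<eta> i)" for i j
      by (rule \<iota>_inj) (simp add: emb(4) \<eta> \<eta>'(2))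
    show "Fract (d1 mpoly_partial \<omega> i j) 1 = wedge11 \<eta> (\<lambda>l. Fract (\<omega> l) 1) i j" for i j
      by (rule \<iota>_inj) (simp add: wedge11_def \<iota>d emb(3) \<eta> D\<omega>[symmetric] \<eta>'(3) \<omega>'_def[symmetric])
  qed
qed

section \<open>Unique factorisation of polynomials\<close>

definition is_ring_hom :: "('a::comm_ring_1 \<Rightarrow> 'b::comm_ring_1) \<Rightarrow> bool" where
  "is_ring_hom H \<longleftrightarrow> H 1 = 1 \<and> (\<forall>a b. H (a + b) = H a + H b) \<and> (\<forall>a b. H (a * b) = H a * H b)"

lemma is_ring_homD:
  assumes "is_ring_hom H"
  shows "H 1 = 1" "H 0 = 0" "H (a + b) = H a + H b" "H (a * b) = H a * H b" "H (- a) = - H a"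
    "H (a - b) = H a - H b" "H (a ^ n) = H a ^ n" "H (sum f S) = (\<Sum>x\<in>S. H (f x))"
    "H (prod f S) = (\<Prod>x\<in>S. H (f x))" "H (of_nat n) = of_nat n"
proof -
  show 1: "H 1 = 1" and add: "H (a + b) = H a + H b" and mult: "H (a * b) = H a * H b" for a b
    using assms by (auto simp: is_ring_hom_def)
  show 0: "H 0 = 0" using add[of 0 0] by (metis add.right_neutral add_left_cancel)
  show neg: "H (- a) = - H a" for a using add[of a "- a"] 0 by (simp add: eq_neg_iff_add_eq_0 add.commute)
  show "H (a - b) = H a - H b" using add[of a "- b"] neg by simp
  show "H (a ^ n) = H a ^ n" by (induction n) (simp_all add: 1 mult)
  show "H (sum f S) = (\<Sum>x\<in>S. H (f x))" by (induction S rule: infinite_finite_induct) (simp_all add: 0 add)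
  show "H (prod f S) = (\<Prod>x\<in>S. H (f x))" by (induction S rule: infinite_finite_induct) (simp_all add: 1 mult)
  show "H (of_nat n) = of_nat n" by (induction n) (simp_all add: 0 1 add)
qed

lemma is_ring_hom_comp: "is_ring_hom F \<Longrightarrow> is_ring_hom G \<Longrightarrow> is_ring_hom (\<lambda>x. F (G x))"
  by (simp add: is_ring_hom_def)

lemma is_ring_hom_id: "is_ring_hom (\<lambda>x. x)"
  by (simp add: is_ring_hom_def)

lemma is_ring_hom_poly: "is_ring_hom (\<lambda>p. poly p a)"
  by (simp add: is_ring_hom_def)

lemma is_ring_hom_pCons: "is_ring_hom (\<lambda>c. [:c:])"
  by (simp add: is_ring_hom_def one_pCons)

lemma is_ring_hom_Const: "is_ring_hom Const"
  by (simp add: is_ring_hom_def Const_def single_add mult_single single_one)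

lemma lookup_sum_mpoly: "Poly_Mapping.lookup (sum f S) m = (\<Sum>x\<in>S. Poly_Mapping.lookup (f x) m)"
  by (induction S rule: infinite_finite_induct) (simp_all add: lookup_add)

text \<open>The universal property of polynomial rings: \<open>c\<close> acts on the constants,
  \<open>a\<close> on the variables. Isolating a variable, evaluation, and restriction to lines and
  planes are all instances, compared with each other through
  \<open>ring_hom_mpoly_eqI\<close>.\<close>

definition insertion :: "(complex \<Rightarrow> 'a::comm_ring_1) \<Rightarrow> ('n::finite \<Rightarrow> 'a) \<Rightarrow> 'n mpoly \<Rightarrow> 'a" where
  "insertion c a f = (\<Sum>m\<in>Poly_Mapping.keys f. c (Poly_Mapping.lookup f m) * (\<Prod>i\<in>UNIV. a i ^ Poly_Mapping.lookup m i))"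

lemma insertion_superset:
  assumes "is_ring_hom c" "finite S" "Poly_Mapping.keys f \<subseteq> S"
  shows "insertion c a f = (\<Sum>m\<in>S. c (Poly_Mapping.lookup f m) * (\<Prod>i\<in>UNIV. a i ^ Poly_Mapping.lookup m i))"
  unfolding insertion_def
  by (rule sum.mono_neutral_left) (use assms in \<open>auto simp: in_keys_iff is_ring_homD\<close>)

lemma insertion_add:
  assumes "is_ring_hom c"
  shows "insertion c a (f + g) = insertion c a f + insertion c a g"
  using insertion_superset[OF assms, of "Poly_Mapping.keys f \<union> Poly_Mapping.keys g"] Poly_Mapping.keys_add[of f g]
  by (simp add: lookup_add is_ring_homD[OF assms] distrib_right sum.distrib)

lemma insertion_single:
  assumes "is_ring_hom c"
  shows "insertion c a (Poly_Mapping.single m x) = c x * (\<Prod>i\<in>UNIV. a i ^ Poly_Mapping.lookup m i)"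
  using insertion_superset[OF assms, of "{m}" "Poly_Mapping.single m x" a] by simp

lemma insertion_ring_hom:
  assumes c: "is_ring_hom c"
  shows "is_ring_hom (insertion c a)"
proof -
  note c' = is_ring_homD[OF c]
  have "insertion c a (f * g) = insertion c a f * insertion c a g" for f g
  proof (induction f rule: mpoly_induct)
    case zero then show ?case by (simp add: insertion_def)
  next
    case (single m x)
    show ?case
    proof (induction g rule: mpoly_induct)
      case zero then show ?case by (simp add: insertion_def)
    next
      case (single m' x')
      show ?case by (simp add: mult_single insertion_single[OF c] c' lookup_add power_add prod.distrib algebra_simps)
    next
      case (add f g) then show ?case by (simp add: insertion_add[OF c] distrib_left)
    qed
  next
    case (add f g) then show ?case by (simp add: insertion_add[OF c] distrib_right)
  qed
  moreover have "insertion c a 1 = 1"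
    using insertion_single[OF c, of a 0 1] by (simp add: c' single_one)
  ultimately show ?thesis by (simp add: is_ring_hom_def insertion_add[OF c])
qed

lemma insertion_Const: "is_ring_hom c \<Longrightarrow> insertion c a (Const x) = c x"
  by (simp add: Const_def insertion_single)

lemma prod_power_single: "(\<Prod>i\<in>UNIV. (a (i::'n::finite) :: 'a::comm_ring_1) ^ Poly_Mapping.lookup (Poly_Mapping.single j n) i) = a j ^ n"
proof -
  have "(\<Prod>i\<in>UNIV. a i ^ Poly_Mapping.lookup (Poly_Mapping.single j n) i) = (\<Prod>i\<in>UNIV. if i = j then a i ^ n else 1)"
    by (rule prod.cong) (auto simp: lookup_single when_def)
  then show ?thesis by (simp add: prod.delta)
qed

lemma insertion_Var: "is_ring_hom c \<Longrightarrow> insertion c a (Var j) = a j"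
  by (simp add: Var_def insertion_single is_ring_homD prod_power_single)

lemma mpoly_single_eq:
  "Poly_Mapping.single m x = Const x * (\<Prod>i\<in>UNIV. Var (i::'n::finite) ^ Poly_Mapping.lookup m i)"
proof -
  have pw: "Var i ^ n = Poly_Mapping.single (Poly_Mapping.single i n) (1::complex)" for i :: 'n and n
    by (induction n) (simp_all add: Var_def single_one mult_single single_add[symmetric])
  have "(\<Prod>i\<in>S. Poly_Mapping.single (Poly_Mapping.single i (Poly_Mapping.lookup m i)) (1::complex)) =
     Poly_Mapping.single (\<Sum>i\<in>S. Poly_Mapping.single i (Poly_Mapping.lookup m i)) 1" for S :: "'n set"
    by (induction S rule: infinite_finite_induct) (simp_all add: single_one mult_single)
  moreover have "(\<Sum>i\<in>UNIV. Poly_Mapping.single i (Poly_Mapping.lookup m i)) = m"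
    by (intro poly_mapping_eqI) (simp add: lookup_sum_mpoly lookup_single when_def)
  ultimately show ?thesis by (simp add: pw Const_def mult_single)
qed

lemma ring_hom_mpoly_eqI:
  fixes F G :: "'n::finite mpoly \<Rightarrow> 'a::comm_ring_1"
  assumes F: "is_ring_hom F" and G: "is_ring_hom G"
    and "\<And>x. F (Const x) = G (Const x)" "\<And>i. F (Var i) = G (Var i)"
  shows "F f = G f"
proof (induction f rule: mpoly_induct)
  case (single m x)
  show ?case unfolding mpoly_single_eq by (simp add: is_ring_homD[OF F] is_ring_homD[OF G] assms)
qed (simp_all add: is_ring_homD[OF F] is_ring_homD[OF G])

section \<open>Isolating one variable\<close>

definition mpoly_vars :: "'n set \<Rightarrow> 'n mpoly set" where
  "mpoly_vars W = {f. \<forall>m\<in>Poly_Mapping.keys f. Poly_Mapping.keys m \<subseteq> W}"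

lemma mpoly_vars_subring: "subring_set (mpoly_vars W)"
  unfolding subring_set_def
proof (intro conjI ballI)
  show "1 \<in> mpoly_vars W" by (simp add: mpoly_vars_def)
  fix a b :: "'a mpoly" assume ab: "a \<in> mpoly_vars W" "b \<in> mpoly_vars W"
  show "a - b \<in> mpoly_vars W"
    using ab Poly_Mapping.keys_diff[of a b] by (auto simp: mpoly_vars_def)
  show "a * b \<in> mpoly_vars W"
    unfolding mpoly_vars_def
  proof (clarify)
    fix m x assume "m \<in> Poly_Mapping.keys (a * b)" "x \<in> Poly_Mapping.keys m"
    then obtain k l where "m = k + l" "k \<in> Poly_Mapping.keys a" "l \<in> Poly_Mapping.keys b"
      using Poly_Mapping.keys_mult[of a b] by blast
    then show "x \<in> W" using ab \<open>x \<in> Poly_Mapping.keys m\<close> Poly_Mapping.keys_add[of k l]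
      unfolding mpoly_vars_def by blast
  qed
qed

lemma Const_mpoly_vars: "Const c \<in> mpoly_vars W"
  by (auto simp: mpoly_vars_def Const_def)

lemma mpoly_vars_mono: "V \<subseteq> W \<Longrightarrow> mpoly_vars V \<subseteq> mpoly_vars W"
  by (auto simp: mpoly_vars_def)

lemma mpoly_vars_empty: "mpoly_vars {} = range Const"
proof (intro equalityI subsetI)
  fix f :: "'a mpoly" assume "f \<in> mpoly_vars {}"
  then have "Poly_Mapping.keys f \<subseteq> {0}" by (auto simp: mpoly_vars_def)
  then have "f = Const (Poly_Mapping.lookup f 0)"
    by (intro poly_mapping_eqI) (auto simp: Const_def lookup_single when_def in_keys_iff)
  then show "f \<in> range Const" by blast
qed (auto simp: Const_mpoly_vars)

text \<open>The coefficients stay in the ring of all polynomials, so one type serves every stage of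
  an induction on the variables; membership in \<open>mpoly_vars W\<close> records which variables
  occur.\<close>

definition as_poly :: "'n::finite \<Rightarrow> 'n mpoly \<Rightarrow> 'n mpoly poly" where
  "as_poly x = insertion (\<lambda>c. [:Const c:]) (\<lambda>i. if i = x then [:0, 1:] else [:Var i:])"

lemma hom_CC: "is_ring_hom (\<lambda>c. [:Const c:])"
  using is_ring_hom_comp[OF is_ring_hom_pCons is_ring_hom_Const] .

lemma as_poly_hom: "is_ring_hom (as_poly x)"
  unfolding as_poly_def by (rule insertion_ring_hom[OF hom_CC])

lemmas as_poly = is_ring_homD[OF as_poly_hom]

lemma as_poly_Var: "as_poly x (Var i) = (if i = x then [:0, 1:] else [:Var i:])"
  and as_poly_Const: "as_poly x (Const c) = [:Const c:]"
  by (simp_all add: as_poly_def insertion_Var[OF hom_CC] insertion_Const[OF hom_CC])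

lemma poly_as_poly: "poly (as_poly x f) (Var x) = f"
  by (rule ring_hom_mpoly_eqI[OF is_ring_hom_comp[OF is_ring_hom_poly as_poly_hom] is_ring_hom_id])
    (simp_all add: as_poly_Var as_poly_Const)

lemma as_poly_single: "as_poly x (Poly_Mapping.single m c) =
    monom (Poly_Mapping.single (m - Poly_Mapping.single x (Poly_Mapping.lookup m x)) c) (Poly_Mapping.lookup m x)"
proof -
  let ?m = "m - Poly_Mapping.single x (Poly_Mapping.lookup m x)"
  have hom: "is_ring_hom (\<lambda>f. as_poly x f)" by (rule as_poly_hom)
  have "Poly_Mapping.single m c = Poly_Mapping.single ?m c * Var x ^ Poly_Mapping.lookup m x"
  proof -
    have "Var x ^ n = Poly_Mapping.single (Poly_Mapping.single x n) (1::complex)" for n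
      by (induction n) (simp_all add: Var_def single_one mult_single single_add[symmetric])
    moreover have "m = ?m + Poly_Mapping.single x (Poly_Mapping.lookup m x)"
      by (intro poly_mapping_eqI) (simp add: lookup_add lookup_minus lookup_single when_def)
    ultimately show ?thesis by (simp add: mult_single)
  qed
  moreover have "as_poly x (Poly_Mapping.single ?m c) = [:Poly_Mapping.single ?m c:]"
  proof -
    have "(if i = x then [:0, 1:] else [:Var i:]) ^ Poly_Mapping.lookup ?m i = [:Var i ^ Poly_Mapping.lookup ?m i:]" for i
      by (auto simp: lookup_minus one_pCons is_ring_homD(7)[OF is_ring_hom_pCons])
    then show ?thesis
      by (subst (1 2) mpoly_single_eq)
        (simp add: as_poly as_poly_Var as_poly_Const is_ring_homD(9)[OF is_ring_hom_pCons, symmetric])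
  qed
  ultimately show ?thesis
    by (simp add: as_poly as_poly_Var monom_altdef)
qed

lemma as_poly_const:
  assumes "f \<in> mpoly_vars W" "x \<notin> W"
  shows "as_poly x f = [:f:]"
proof -
  have f: "f = (\<Sum>m\<in>Poly_Mapping.keys f. Poly_Mapping.single m (Poly_Mapping.lookup f m))"
    by (intro poly_mapping_eqI) (auto simp: lookup_sum_mpoly lookup_single when_def in_keys_iff)
  have "as_poly x (Poly_Mapping.single m (Poly_Mapping.lookup f m)) = [:Poly_Mapping.single m (Poly_Mapping.lookup f m):]"
    if "m \<in> Poly_Mapping.keys f" for m
  proof -
    have "x \<notin> Poly_Mapping.keys m" using assms that by (auto simp: mpoly_vars_def)
    then have "Poly_Mapping.lookup m x = 0" by (simp add: in_keys_iff)
    then show ?thesis by (simp add: as_poly_single monom_0)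
  qed
  then have "as_poly x f = (\<Sum>m\<in>Poly_Mapping.keys f. [:Poly_Mapping.single m (Poly_Mapping.lookup f m):])"
    by (subst f) (simp only: as_poly(8) cong: sum.cong)
  also have "\<dots> = [:f:]"
    by (subst (3) f) (simp only: is_ring_homD(8)[OF is_ring_hom_pCons])
  finally show ?thesis .
qed

lemma as_poly_poly_Var:
  assumes "poly_over (mpoly_vars W) F" "x \<notin> W"
  shows "as_poly x (poly F (Var x)) = F"
proof -
  have "as_poly x (poly F (Var x)) = (\<Sum>i\<le>degree F. [:coeff F i:] * [:0, 1:] ^ i)"
    by (simp add: poly_altdef as_poly as_poly_Var as_poly_const[OF poly_overD[OF assms(1)] assms(2)])
  also have "\<dots> = F"
    by (simp add: monom_altdef[symmetric] poly_as_sum_of_monoms)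
  finally show ?thesis .
qed

lemma as_poly_over:
  assumes "f \<in> mpoly_vars (insert x W)"
  shows "poly_over (mpoly_vars W) (as_poly x f)"
proof (rule poly_overI)
  fix k
  note R = subring_setD[OF mpoly_vars_subring]
  have f: "f = (\<Sum>m\<in>Poly_Mapping.keys f. Poly_Mapping.single m (Poly_Mapping.lookup f m))"
    by (intro poly_mapping_eqI) (auto simp: lookup_sum_mpoly lookup_single when_def in_keys_iff)
  show "coeff (as_poly x f) k \<in> mpoly_vars W"
    unfolding arg_cong[OF f, of "as_poly x"] as_poly(8) coeff_sum
  proof (rule R(8))
    fix m assume m: "m \<in> Poly_Mapping.keys f"
    have "Poly_Mapping.keys (m - Poly_Mapping.single x (Poly_Mapping.lookup m x)) \<subseteq> W"
    proof
      fix y assume "y \<in> Poly_Mapping.keys (m - Poly_Mapping.single x (Poly_Mapping.lookup m x))"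
      then have "y \<noteq> x" "y \<in> Poly_Mapping.keys m"
        by (auto simp: in_keys_iff lookup_minus lookup_single when_def split: if_splits)
      then show "y \<in> W" using m assms by (auto simp: mpoly_vars_def)
    qed
    then show "coeff (as_poly x (Poly_Mapping.single m (Poly_Mapping.lookup f m))) k \<in> mpoly_vars W"
      using R(2) by (auto simp: as_poly_single) (auto simp: mpoly_vars_def split: if_splits)
  qed
qed

lemma as_poly_eq_0_iff: "as_poly x f = 0 \<longleftrightarrow> f = 0"
proof
  assume "as_poly x f = 0"
  then show "f = 0" using poly_as_poly[of x f] by simp
qed (simp add: as_poly(2))

lemma mpoly_vars_insertI:
  fixes x :: "'n::linorder"
  assumes "poly_over (mpoly_vars W) F"
  shows "poly F (Var x) \<in> mpoly_vars (insert x W)"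
proof -
  have "poly_over (mpoly_vars (insert x W)) F"
    using assms mpoly_vars_mono[of W "insert x W"] by (auto simp: poly_over_def)
  moreover have "Var x \<in> mpoly_vars (insert x W)" by (auto simp: mpoly_vars_def Var_def)
  ultimately show ?thesis
    by (rule poly_over_closed(11)[OF mpoly_vars_subring])
qed

lemma degree_as_poly_0:
  assumes "f \<in> mpoly_vars (insert x W)" "degree (as_poly x f) = 0"
  shows "f \<in> mpoly_vars W"
proof -
  obtain c where c: "as_poly x f = [:c:]" using assms(2) by (metis degree_eq_zeroE)
  then have "c = f" using poly_as_poly[of x f] by simp
  then show ?thesis using as_poly_over[OF assms(1)] c poly_overD[of _ _ 0] by force
qed

text \<open>A measure for inductions on factors: each summand is additive on products of nonzero
  polynomials, and size zero leaves only constants, so a proper factor is smaller.\<close>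

definition mpoly_size :: "'n::{finite,linorder} mpoly \<Rightarrow> nat" where
  "mpoly_size f = (\<Sum>x\<in>UNIV. degree (as_poly x f))"

lemma mpoly_size_mult: "f \<noteq> 0 \<Longrightarrow> g \<noteq> 0 \<Longrightarrow> mpoly_size (f * g) = mpoly_size f + mpoly_size g"
  by (simp add: mpoly_size_def as_poly degree_mult_eq as_poly_eq_0_iff sum.distrib)

lemma mpoly_vars_degree:
  fixes f :: "'n::{finite,linorder} mpoly"
  assumes "\<And>x. x \<notin> W \<Longrightarrow> degree (as_poly x f) = 0"
  shows "f \<in> mpoly_vars W"
proof -
  have "f \<in> mpoly_vars (W \<union> V)" for V
  proof -
    have "finite (- V)" by simp
    then have "f \<in> mpoly_vars (W \<union> - (- V))"
    proof (induction "- V" arbitrary: V rule: finite_induct)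
      case empty
      then show ?case by (auto simp: mpoly_vars_def)
    next
      case (insert x F)
      have "F = - (insert x V)" using insert by auto
      then have *: "f \<in> mpoly_vars (W \<union> insert x V)" using insert(3)[of "insert x V"] by simp
      show ?case
      proof (cases "x \<in> W")
        case True then show ?thesis using * by (simp add: insert_absorb)
      next
        case False
        then show ?thesis using degree_as_poly_0[of f x "W \<union> V"] * assms by simp
      qed
    qed
    then show ?thesis by simp
  qed
  from this[of "{}"] show ?thesis by simp
qed

lemma mpoly_size_0: "mpoly_size f = 0 \<Longrightarrow> f \<in> range Const"
  using mpoly_vars_degree[of "{}" f] by (simp add: mpoly_size_def mpoly_vars_empty)

lemma mpoly_unit_iff: "(f::'n::{finite,linorder} mpoly) dvd 1 \<longleftrightarrow> f \<in> range Const \<and> f \<noteq> 0"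
proof
  assume "f dvd 1"
  then obtain g where g: "1 = f * g" by (elim dvdE)
  then have nz: "f \<noteq> 0" "g \<noteq> 0" by auto
  have "mpoly_size (1::'n mpoly) = 0" by (simp add: mpoly_size_def as_poly)
  then have "mpoly_size f = 0" using mpoly_size_mult[OF nz] g by simp
  then show "f \<in> range Const \<and> f \<noteq> 0" using mpoly_size_0 nz by blast
next
  assume "f \<in> range Const \<and> f \<noteq> 0"
  then obtain c where c: "f = Const c" "f \<noteq> 0" by auto
  then have "c \<noteq> 0" using is_ring_homD(2)[OF is_ring_hom_Const] by auto
  then have "1 = f * Const (1 / c)" unfolding c
    by (simp flip: is_ring_homD(4)[OF is_ring_hom_Const] add: is_ring_homD(1)[OF is_ring_hom_Const])
  then show "f dvd 1" by (rule dvdI)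
qed

section \<open>Gauss's lemma and induction on the variables\<close>

lemma irreducible_nonzero_nonunit: "irreducible p \<Longrightarrow> p \<noteq> 0 \<and> \<not> p dvd 1"
  unfolding irreducible_def by (elim conjE) (intro conjI)

lemma irreducible_split: "irreducible (a * b) \<Longrightarrow> a dvd 1 \<or> b dvd 1"
  unfolding irreducible_def by (metis (no_types))

lemma mpoly_irreducible_factor:
  fixes f :: "'n::{finite,linorder} mpoly"
  assumes "f \<noteq> 0" "\<not> f dvd 1"
  obtains g where "irreducible g" "g dvd f"
proof -
  have "\<exists>g. irreducible g \<and> g dvd f" using assms
  proof (induction "mpoly_size f" arbitrary: f rule: less_induct)
    case less
    show ?case
    proof (cases "irreducible f")
      case False
      then obtain a b where ab: "f = a * b" "\<not> a dvd 1" "\<not> b dvd 1"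
        using less.prems by (auto simp: irreducible_def)
      then have nz: "a \<noteq> 0" "b \<noteq> 0" using less.prems by auto
      have "mpoly_size b \<noteq> 0" using ab(3) nz mpoly_size_0 mpoly_unit_iff by blast
      then have "mpoly_size a < mpoly_size f" using mpoly_size_mult[OF nz] ab by simp
      then show ?thesis using less.hyps[of a] nz ab by auto
    qed auto
  qed
  then show ?thesis using that by blast
qed

lemma mpoly_vars_factor:
  fixes f g :: "'n::{finite,linorder} mpoly"
  assumes "f * g \<in> mpoly_vars W" "f * g \<noteq> 0"
  shows "f \<in> mpoly_vars W"
proof (rule mpoly_vars_degree)
  fix x assume "x \<notin> W"
  then have "degree (as_poly x (f * g)) = 0" using as_poly_const[OF assms(1)] by simp
  then show "degree (as_poly x f) = 0" using assms(2)
    by (simp add: as_poly degree_mult_eq as_poly_eq_0_iff)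
qed

text \<open>Both the factors and the product are confined to the variables in \<open>W\<close>, so
  that the property can be proved by adding one variable at a time; for all variables it is ordinary
  primality.\<close>

definition primes_in :: "'n::{finite,linorder} set \<Rightarrow> bool" where
  "primes_in W \<longleftrightarrow> (\<forall>f\<in>mpoly_vars W. irreducible f \<longrightarrow>
     (\<forall>a\<in>mpoly_vars W. \<forall>b\<in>mpoly_vars W. f dvd a * b \<longrightarrow> f dvd a \<or> f dvd b))"

lemma dvd_as_poly:
  assumes "p \<in> mpoly_vars W" "x \<notin> W"
  shows "p dvd f \<longleftrightarrow> (\<forall>k. p dvd coeff (as_poly x f) k)"
proof
  assume "p dvd f"
  then obtain g where "f = p * g" by (elim dvdE)
  then have "as_poly x f = smult p (as_poly x g)" using as_poly_const[OF assms] by (simp add: as_poly)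
  then show "\<forall>k. p dvd coeff (as_poly x f) k" by simp
next
  assume "\<forall>k. p dvd coeff (as_poly x f) k"
  then have "p dvd poly (as_poly x f) (Var x)"
    unfolding poly_altdef by (intro dvd_sum dvd_mult2) auto
  then show "p dvd f" by (simp add: poly_as_poly)
qed

text \<open>Gauss's argument: if \<open>i\<close> and \<open>j\<close> are the first indices at
  which \<open>p\<close> fails to divide the coefficients of \<open>a\<close> and \<open>b\<close>,
  then modulo \<open>p\<close> the coefficient of degree \<open>i + j\<close> of the product is the
  product of these two.\<close>

lemma gauss_mpoly:
  fixes p :: "'n::{finite,linorder} mpoly"
  assumes P: "primes_in W" and p: "p \<in> mpoly_vars W" "irreducible p" and x: "x \<notin> W"
    and ab: "a \<in> mpoly_vars (insert x W)" "b \<in> mpoly_vars (insert x W)" "p dvd a * b"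
  shows "p dvd a \<or> p dvd b"
proof (rule ccontr)
  assume neg: "\<not> (p dvd a \<or> p dvd b)"
  define A B where "A = as_poly x a" and "B = as_poly x b"
  have "\<exists>k. \<not> p dvd coeff A k" "\<exists>k. \<not> p dvd coeff B k"
    using neg dvd_as_poly[OF p(1) x, of a] dvd_as_poly[OF p(1) x, of b] unfolding A_def B_def by blast+
  define i where "i = (LEAST k. \<not> p dvd coeff A k)"
  define j where "j = (LEAST k. \<not> p dvd coeff B k)"
  have i: "\<not> p dvd coeff A i" "\<And>k. k < i \<Longrightarrow> p dvd coeff A k"
    unfolding i_def using LeastI_ex[OF \<open>\<exists>k. \<not> p dvd coeff A k\<close>] not_less_Least by blast+
  have j: "\<not> p dvd coeff B j" "\<And>k. k < j \<Longrightarrow> p dvd coeff B k"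
    unfolding j_def using LeastI_ex[OF \<open>\<exists>k. \<not> p dvd coeff B k\<close>] not_less_Least by blast+
  have "p dvd coeff (A * B) (i + j)"
    using ab(3) dvd_as_poly[OF p(1) x, of "a * b"] by (simp add: as_poly A_def B_def)
  also have "coeff (A * B) (i + j) = coeff A i * coeff B j + (\<Sum>k\<in>{..i+j}-{i}. coeff A k * coeff B (i + j - k))"
    by (simp add: coeff_mult sum.remove[of _ i])
  finally have "p dvd coeff A i * coeff B j + (\<Sum>k\<in>{..i+j}-{i}. coeff A k * coeff B (i + j - k))" .
  moreover have "p dvd (\<Sum>k\<in>{..i+j}-{i}. coeff A k * coeff B (i + j - k))"
  proof (rule dvd_sum)
    fix k assume "k \<in> {..i + j} - {i}"
    then have "k < i \<or> i + j - k < j" by auto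
    then show "p dvd coeff A k * coeff B (i + j - k)" using i j by auto
  qed
  ultimately have "p dvd coeff A i * coeff B j" by (simp add: dvd_add_left_iff)
  then show False using P p i(1) j(1) poly_overD[OF as_poly_over[OF ab(1)]] poly_overD[OF as_poly_over[OF ab(2)]]
    unfolding primes_in_def A_def B_def by blast
qed

text \<open>The factor \<open>c\<close> is removed prime by prime: by Gauss's lemma each prime
  factor divides \<open>q\<close> or \<open>d\<close>. What is taken away from \<open>d\<close> is
  collected in \<open>e\<close> and still does not involve \<open>x\<close>.\<close>

lemma strip_content:
  fixes f :: "'n::{finite,linorder} mpoly"
  assumes P: "primes_in W" and x: "x \<notin> W"
    and "c \<in> mpoly_vars W" "c \<noteq> 0" "c * f = q * d" "q \<in> mpoly_vars (insert x W)" "d \<in> mpoly_vars (insert x W)"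
  shows "\<exists>q1 d1 e. f = q1 * d1 \<and> d = e * d1 \<and> e \<in> mpoly_vars W \<and> e \<noteq> 0"
  using assms(3-)
proof (induction "mpoly_size c" arbitrary: c q d rule: less_induct)
  case less
  show ?case
  proof (cases "c dvd 1")
    case True
    then obtain c' where "1 = c * c'" by (elim dvdE)
    then have "f = c' * (c * f)" by (metis mult.assoc mult.commute mult_1)
    then have "f = (c' * q) * d" using less.prems by (simp add: mult.assoc)
    then show ?thesis using subring_setD(1)[OF mpoly_vars_subring] by (metis mult_1 one_neq_zero)
  next
    case False
    obtain p where p: "irreducible p" "p dvd c" using mpoly_irreducible_factor[OF less.prems(2) False] .
    then obtain c' where c': "c = p * c'" by (elim dvdE)
    then have nz: "p \<noteq> 0" "c' \<noteq> 0" using less.prems by auto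
    have pW: "p \<in> mpoly_vars W" and cW: "c' \<in> mpoly_vars W"
      using mpoly_vars_factor[of p c' W] mpoly_vars_factor[of c' p W] less.prems c' by (simp_all add: mult.commute)
    have "mpoly_size p \<noteq> 0" using irreducible_nonzero_nonunit[OF p(1)] mpoly_size_0[of p] mpoly_unit_iff[of p] by blast
    then have lt: "mpoly_size c' < mpoly_size c" using mpoly_size_mult[OF nz] c' by simp
    have "p dvd q * d" using less.prems(3) c' by (metis dvd_triv_left mult.assoc)
    then have "p dvd q \<or> p dvd d" using gauss_mpoly[OF P pW p(1) x] less.prems by blast
    then show ?thesis
    proof
      assume "p dvd q"
      then obtain q' where q': "q = p * q'" by (elim dvdE)
      have "c' * f = q' * d" using less.prems(3) nz c' q' by (simp add: mult.assoc)
      moreover have "q' \<in> mpoly_vars (insert x W)"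
        using mpoly_vars_factor[of q' p "insert x W"] less.prems q'
        by (cases "q' = 0") (auto simp: mult.commute nz subring_setD(2)[OF mpoly_vars_subring])
      ultimately show ?thesis using less.hyps[OF lt cW nz(2)] less.prems by blast
    next
      assume "p dvd d"
      then obtain d' where d': "d = p * d'" by (elim dvdE)
      have "c' * f = q * d'" using less.prems(3) nz c' d' by (simp add: mult.assoc mult.left_commute)
      moreover have "d' \<in> mpoly_vars (insert x W)"
        using mpoly_vars_factor[of d' p "insert x W"] less.prems d'
        by (cases "d' = 0") (auto simp: mult.commute nz subring_setD(2)[OF mpoly_vars_subring])
      ultimately obtain q1 d1 e where "f = q1 * d1" "d' = e * d1" "e \<in> mpoly_vars W" "e \<noteq> 0"
        using less.hyps[OF lt cW nz(2)] less.prems by blast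
      then show ?thesis using d' pW nz subring_setD(6)[OF mpoly_vars_subring, of p W e]
        by (metis mult.assoc mult_eq_0_iff)
    qed
  qed
qed

text \<open>Euclid's argument over the fraction field of the smaller ring, written without
  fractions. An element \<open>d\<close> of least degree in \<open>x\<close> in the ideal of
  \<open>f\<close> and \<open>a\<close> divides both up to factors without \<open>x\<close>, which
  \<open>strip_content\<close> and the local fact \<open>strip\<close> remove. Irreducibility leaves
  two cases: \<open>d\<close> is \<open>f\<close> up to such a factor, or \<open>d\<close> does not
  involve \<open>x\<close>.\<close>

lemma primes_in_insert:
  fixes W :: "'n::{finite,linorder} set"
  assumes P: "primes_in W" and x: "x \<notin> W"
  shows "primes_in (insert x W)"
  unfolding primes_in_def
proof (intro ballI impI)
  fix f a b assume f: "f \<in> mpoly_vars (insert x W)" "irreducible f"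
    and a: "a \<in> mpoly_vars (insert x W)" and b: "b \<in> mpoly_vars (insert x W)" and dvd: "f dvd a * b"
  note R = subring_setD[OF mpoly_vars_subring]
  have f0: "f \<noteq> 0" "\<not> f dvd 1" using irreducible_nonzero_nonunit[OF f(2)] by simp_all
  show "f dvd a \<or> f dvd b"
  proof (cases "f \<in> mpoly_vars W")
    case True
    then show ?thesis using gauss_mpoly[OF P _ f(2) x a b dvd] by blast
  next
    case False
    have strip: "f dvd g" if c: "c \<in> mpoly_vars W" "c \<noteq> 0" "f dvd c * g" and g: "g \<in> mpoly_vars (insert x W)" for c g
    proof (cases "g = 0")
      case g0: False
      obtain k where k: "c * g = k * f" using c(3) by (metis dvdE mult.commute)
      have "k \<in> mpoly_vars (insert x W)"
      proof (rule mpoly_vars_factor)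
        show "k * f \<in> mpoly_vars (insert x W)"
          unfolding k[symmetric] by (intro R g) (use c mpoly_vars_mono[of W "insert x W"] in auto)
        show "k * f \<noteq> 0" using k g0 c by (metis mult_eq_0_iff)
      qed
      then obtain q1 d1 e where *: "g = q1 * d1" "f = e * d1" "e \<in> mpoly_vars W" "e \<noteq> 0"
        using strip_content[OF P x c(1,2) k _ f(1)] by blast
      then have "e dvd 1 \<or> d1 dvd 1" using f(2) * irreducible_split by blast
      then show ?thesis
      proof
        assume "e dvd 1"
        then have "f dvd d1" using *(2) by (simp add: mult_unit_dvd_iff')
        then show ?thesis using *(1) by simp
      next
        assume "d1 dvd 1"
        then have "d1 \<in> mpoly_vars W" using mpoly_unit_iff[of d1] Const_mpoly_vars by auto
        then have "f \<in> mpoly_vars W" using * R(6) by simp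
        then show ?thesis using False by simp
      qed
    qed simp
    show ?thesis
    proof (rule disjCI)
      assume nb: "\<not> f dvd b"
      let ?I = "{d. d \<noteq> 0 \<and> (\<exists>u v. u \<in> mpoly_vars (insert x W) \<and> v \<in> mpoly_vars (insert x W) \<and> d = u * f + v * a)}"
      have "f \<in> ?I"
        by (intro CollectI conjI f0(1), rule exI[of _ 1], rule exI[of _ 0]) (simp add: R)
      then obtain d where d: "d \<in> ?I" and min: "\<And>d'. d' \<in> ?I \<Longrightarrow> degree (as_poly x d) \<le> degree (as_poly x d')"
        using ex_has_least_nat[of "\<lambda>d. d \<in> ?I" f "\<lambda>d. degree (as_poly x d)"] by blast
      obtain u v where uv: "u \<in> mpoly_vars (insert x W)" "v \<in> mpoly_vars (insert x W)" "d = u * f + v * a"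
        and d0: "d \<noteq> 0" using d by auto
      have dW: "d \<in> mpoly_vars (insert x W)" unfolding uv(3) by (intro R uv f a)
      have divide: "\<exists>c q. c \<in> mpoly_vars W \<and> c \<noteq> 0 \<and> q \<in> mpoly_vars (insert x W) \<and> c * g = q * d"
        if g: "g \<in> mpoly_vars (insert x W)" "\<exists>u v. u \<in> mpoly_vars (insert x W) \<and> v \<in> mpoly_vars (insert x W) \<and> g = u * f + v * a" for g
      proof -
        obtain k q r where *: "poly_over (mpoly_vars W) q" "poly_over (mpoly_vars W) r"
          "smult (lead_coeff (as_poly x d) ^ k) (as_poly x g) = q * as_poly x d + r"
          "r = 0 \<or> degree r < degree (as_poly x d)"
          using pseudo_division_over[OF mpoly_vars_subring as_poly_over[OF g(1)] as_poly_over[OF dW]] d0 as_poly_eq_0_iff[of x d] by blast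
        let ?c = "lead_coeff (as_poly x d) ^ k"
        have c: "?c \<in> mpoly_vars W" by (intro R poly_overD[OF as_poly_over[OF dW]])
        have c0: "?c \<noteq> 0" using d0 as_poly_eq_0_iff by auto
        have cW: "?c \<in> mpoly_vars (insert x W)" using c mpoly_vars_mono[of W "insert x W"] by blast
        let ?q = "poly q (Var x)" and ?r = "poly r (Var x)"
        have q: "?q \<in> mpoly_vars (insert x W)" by (rule mpoly_vars_insertI[OF *(1)])
        have e: "?c * g = ?q * d + ?r" using arg_cong[OF *(3), of "\<lambda>p. poly p (Var x)"] by (simp add: poly_as_poly)
        have "?r = 0"
        proof (rule ccontr)
          assume r0: "?r \<noteq> 0"
          obtain u' v' where g': "u' \<in> mpoly_vars (insert x W)" "v' \<in> mpoly_vars (insert x W)" "g = u' * f + v' * a"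
            using g(2) by blast
          have "?r = ?c * g - ?q * d" using e by simp
          also have "\<dots> = (?c * u' - ?q * u) * f + (?c * v' - ?q * v) * a"
            unfolding g'(3) uv(3) by (simp add: algebra_simps)
          finally have r: "?r = (?c * u' - ?q * u) * f + (?c * v' - ?q * v) * a" .
          moreover have "?c * u' - ?q * u \<in> mpoly_vars (insert x W)" "?c * v' - ?q * v \<in> mpoly_vars (insert x W)"
            by (intro R cW q g' uv)+
          ultimately have "?r \<in> ?I" using r0 by blast
          then have "degree (as_poly x d) \<le> degree (as_poly x ?r)" by (rule min)
          then show False using *(4) r0 as_poly_poly_Var[OF *(2) x] by auto
        qed
        then show ?thesis using e c c0 q by auto
      qed
      obtain c q where cq: "c \<in> mpoly_vars W" "c \<noteq> 0" "q \<in> mpoly_vars (insert x W)" "c * f = q * d"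
      proof -
        have "\<exists>u v. u \<in> mpoly_vars (insert x W) \<and> v \<in> mpoly_vars (insert x W) \<and> f = u * f + v * a"
          by (rule exI[of _ 1], rule exI[of _ 0]) (simp add: R)
        then show thesis using divide[OF f(1)] that by blast
      qed
      obtain c' q' where cq': "c' \<in> mpoly_vars W" "c' \<noteq> 0" "q' \<in> mpoly_vars (insert x W)" "c' * a = q' * d"
      proof -
        have "\<exists>u v. u \<in> mpoly_vars (insert x W) \<and> v \<in> mpoly_vars (insert x W) \<and> a = u * f + v * a"
          by (rule exI[of _ 0], rule exI[of _ 1]) (simp add: R)
        then show thesis using divide[OF a] that by blast
      qed
      obtain q1 d1 e where *: "f = q1 * d1" "d = e * d1" "e \<in> mpoly_vars W" "e \<noteq> 0"
        using strip_content[OF P x cq(1,2,4,3) dW] by blast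
      then have "q1 dvd 1 \<or> d1 dvd 1" using f(2) * irreducible_split by blast
      then show "f dvd a"
      proof
        assume "q1 dvd 1"
        then have "f dvd d1" using * by (simp add: mult_unit_dvd_iff')
        then have "f dvd c' * a" unfolding cq'(4) *(2) by simp
        then show ?thesis using strip[OF cq'(1,2) _ a] by blast
      next
        \<comment> \<open>Now \<open>d\<close> is free of \<open>x\<close>, and multiplying d = u f
          + v a by \<open>b\<close> shows that \<open>f\<close> divides
          \<open>d * b\<close>.\<close>
        assume "d1 dvd 1"
        then have "d1 \<in> mpoly_vars W" using mpoly_unit_iff[of d1] Const_mpoly_vars by auto
        then have "d \<in> mpoly_vars W" using * R(6) by simp
        moreover have "d * b = f * (u * b) + v * (a * b)" unfolding uv(3) by (simp add: algebra_simps)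
        then have "f dvd d * b" using dvd by simp
        ultimately show ?thesis using strip[OF _ d0 _ b] nb by blast
      qed
    qed
  qed
qed

theorem mpoly_irreducible_prime:
  fixes f :: "'n::{finite,linorder} mpoly"
  assumes "irreducible f"
  shows "prime_elem f"
proof -
  have "primes_in W" if "finite W" for W :: "'n set"
    using that
  proof induction
    case empty
    show ?case unfolding primes_in_def
    proof (intro ballI impI)
      fix f a b :: "'n mpoly" assume "f \<in> mpoly_vars {}" "irreducible f"
      then show "f dvd a \<or> f dvd b"
        using irreducible_nonzero_nonunit[of f] mpoly_unit_iff[of f] mpoly_vars_empty by blast
    qed
  qed (rule primes_in_insert)
  then have "primes_in (UNIV :: 'n set)" by simp
  have all: "x \<in> mpoly_vars UNIV" for x :: "'n mpoly" by (simp add: mpoly_vars_def)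
  show ?thesis
  proof (rule prime_elemI)
    show "f \<noteq> 0" "\<not> f dvd 1" using irreducible_nonzero_nonunit[OF assms] by simp_all
    show "f dvd a \<or> f dvd b" if "f dvd a * b" for a b
      by (rule \<open>primes_in UNIV\<close>[unfolded primes_in_def, rule_format, OF all assms all all that])
  qed
qed

section \<open>Closed polynomial multipliers\<close>

lemma irreducible_squarefree:
  fixes f :: "'a::idom"
  assumes "irreducible f"
  shows "squarefree f"
  unfolding squarefree_def
proof (intro allI impI)
  fix x assume "x\<^sup>2 dvd f"
  then obtain k where "f = x\<^sup>2 * k" by (elim dvdE)
  then have "f = x * (x * k)" by (simp add: power2_eq_square mult.assoc)
  then have "x dvd 1 \<or> x * k dvd 1" using assms irreducible_split by metis
  then show "x dvd 1" using dvd_mult_left by blast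
qed

lemma mpoly_extract_power:
  fixes f g :: "'n::{finite,linorder} mpoly"
  assumes f: "irreducible f" "f dvd g" and g: "g \<noteq> 0"
  obtains k g' where "g = f ^ Suc k * g'" "\<not> f dvd g'"
proof -
  note f0 = irreducible_nonzero_nonunit[OF f(1)]
  have pos: "mpoly_size f \<noteq> 0" using f0 mpoly_size_0[of f] mpoly_unit_iff[of f] by blast
  have "\<exists>k g'. g = f ^ k * g' \<and> \<not> f dvd g'" using g
  proof (induction "mpoly_size g" arbitrary: g rule: less_induct)
    case less
    show ?case
    proof (cases "f dvd g")
      case False
      then show ?thesis by (intro exI[of _ 0] exI[of _ g]) simp
    next
      case True
      then obtain h where h: "g = f * h" by (elim dvdE)
      then have h0: "h \<noteq> 0" using less.prems by auto
      have "mpoly_size h < mpoly_size g" using mpoly_size_mult[of f h] f0 h0 h pos by simp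
      then obtain k g' where "h = f ^ k * g'" "\<not> f dvd g'" using less.hyps[OF _ h0] by blast
      then show ?thesis using h by (intro exI[of _ "Suc k"] exI[of _ g']) (simp add: mult.assoc)
    qed
  qed
  then obtain k g' where k: "g = f ^ k * g'" "\<not> f dvd g'" by blast
  then obtain k' where "k = Suc k'" using f(2) by (cases k) auto
  then show ?thesis using k that by blast
qed

lemma of_nat_mpoly_unit: "(of_nat (Suc n) :: 'n::{finite,linorder} mpoly) dvd 1"
proof -
  have "of_nat (Suc n) = (Const (of_nat (Suc n)) :: 'n mpoly)"
    by (rule is_ring_homD(10)[OF is_ring_hom_Const, symmetric])
  moreover have "(of_nat (Suc n) :: 'n mpoly) \<noteq> 0" by (simp only: of_nat_eq_0_iff)
  ultimately show ?thesis unfolding mpoly_unit_iff by blast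
qed

text \<open>The polar divisor of a closed rational form \<open>\<alpha> / g\<close> is invariant: along a prime
  component \<open>f\<close> of \<open>g\<close> both \<open>\<omega>\<close> and \<open>df\<close> are proportional to \<open>\<alpha>\<close>.\<close>

theorem polynomial_closed_multiplier:
  fixes \<omega> :: "'n::{finite,linorder} \<Rightarrow> 'n mpoly"
  assumes int: "liouvillian_integrable TYPE('k::field) \<omega>"
    and noinv: "\<not> (\<exists>f. invariant_hypersurface f \<omega>)" and nz: "\<omega> i0 \<noteq> 0"
  obtains \<eta> :: "'n \<Rightarrow> 'n mpoly" where
    "\<And>i j. mpoly_partial i (\<eta> j) = mpoly_partial j (\<eta> i)"
    "\<And>i j. d1 mpoly_partial \<omega> i j = wedge11 \<eta> \<omega> i j"
proof -
  obtain \<eta>r :: "'n \<Rightarrow> 'n ratfun" where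
    closed: "\<And>i j. ratfun_partial i (\<eta>r j) = ratfun_partial j (\<eta>r i)" and
    mult: "\<And>i j. Fract (d1 mpoly_partial \<omega> i j) 1 = wedge11 \<eta>r (\<lambda>l. Fract (\<omega> l) 1) i j"
    using rational_closed_multiplier[OF int nz] by blast
  \<comment> \<open>A common denominator of least size: a prime dividing it cannot divide all the
    numerators.\<close>
  let ?G = "\<lambda>g. g \<noteq> 0 \<and> (\<exists>\<alpha>. \<forall>i. \<eta>r i = Fract (\<alpha> i) g)"
  have "\<exists>g. ?G g"
  proof -
    have "\<exists>a b. b \<noteq> 0 \<and> \<eta>r i = Fract a b" for i using ratfun_exhaust[of "\<eta>r i"] by metis
    then obtain a b where ab: "\<And>i. b i \<noteq> 0" "\<And>i. \<eta>r i = Fract (a i) (b i)" by metis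
    have "\<eta>r i = Fract (a i * prod b (UNIV - {i})) (prod b UNIV)" for i
    proof -
      have "prod b UNIV = b i * prod b (UNIV - {i})" by (simp add: prod.remove)
      moreover have "prod b (UNIV - {i}) \<noteq> 0" using ab(1) by simp
      ultimately show ?thesis using ab by (simp add: eq_fract)
    qed
    moreover have "prod b UNIV \<noteq> 0" using ab(1) by simp
    ultimately show ?thesis
      by (intro exI[of _ "prod b UNIV"] conjI exI[of _ "\<lambda>i. a i * prod b (UNIV - {i})"] allI)
  qed
  then obtain g where g: "?G g" and gmin: "\<And>g'. ?G g' \<Longrightarrow> mpoly_size g \<le> mpoly_size g'"
    using ex_has_least_nat[of ?G _ mpoly_size] by blast
  then obtain \<alpha> where \<alpha>: "\<And>i. \<eta>r i = Fract (\<alpha> i) g" and g0: "g \<noteq> 0" by blast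
  have 1: "g * d1 mpoly_partial \<omega> i j = \<alpha> i * \<omega> j - \<alpha> j * \<omega> i" for i j
  proof -
    have "Fract (d1 mpoly_partial \<omega> i j) 1 = Fract (\<alpha> i * \<omega> j - \<alpha> j * \<omega> i) g"
      unfolding mult wedge11_def \<alpha> using g0 by (simp add: eq_fract algebra_simps)
    then show ?thesis using g0 by (simp add: eq_fract mult.commute)
  qed
  have 2: "g * (mpoly_partial i (\<alpha> j) - mpoly_partial j (\<alpha> i)) = mpoly_partial i g * \<alpha> j - mpoly_partial j g * \<alpha> i" for i j
  proof -
    have "(mpoly_partial i (\<alpha> j) * g - \<alpha> j * mpoly_partial i g) * (g * g)
       = (mpoly_partial j (\<alpha> i) * g - \<alpha> i * mpoly_partial j g) * (g * g)"
      using closed[of i j] g0 unfolding \<alpha> by (simp add: ratfun_partial_Fract eq_fract)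
    then have "mpoly_partial i (\<alpha> j) * g - \<alpha> j * mpoly_partial i g = mpoly_partial j (\<alpha> i) * g - \<alpha> i * mpoly_partial j g"
      using g0 by simp
    then show ?thesis by (simp add: algebra_simps)
  qed
  have "g dvd 1"
  proof (rule ccontr)
    assume "\<not> g dvd 1"
    then obtain f where f: "irreducible f" "f dvd g" using mpoly_irreducible_factor[OF g0] by blast
    note f0 = irreducible_nonzero_nonunit[OF f(1)]
    note prime = prime_elem_dvd_mult_iff[OF mpoly_irreducible_prime[OF f(1)]]
    have "\<exists>e. \<not> f dvd \<alpha> e"
    proof (rule ccontr)
      assume "\<not> (\<exists>e. \<not> f dvd \<alpha> e)"
      then have "\<forall>i. \<exists>b. \<alpha> i = f * b" by (auto elim!: dvdE)
      then obtain \<alpha>' where \<alpha>': "\<And>i. \<alpha> i = f * \<alpha>' i" by metis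
      obtain g' where g': "g = f * g'" using f(2) by (elim dvdE)
      then have "g' \<noteq> 0" using g0 by auto
      moreover have "\<eta>r i = Fract (\<alpha>' i) g'" for i
        unfolding \<alpha> \<alpha>' g' using f0 \<open>g' \<noteq> 0\<close> by (simp add: eq_fract)
      ultimately have "mpoly_size g \<le> mpoly_size g'" using gmin by blast
      moreover have "mpoly_size f \<noteq> 0" using f0 mpoly_size_0[of f] mpoly_unit_iff[of f] by blast
      ultimately show False using mpoly_size_mult[of f g'] f0 \<open>g' \<noteq> 0\<close> g' by simp
    qed
    then obtain e where e: "\<not> f dvd \<alpha> e" by blast
    have P: "f dvd \<alpha> i * \<omega> j - \<alpha> j * \<omega> i" for i j
      unfolding 1[symmetric] using f(2) by simp
    \<comment> \<open>The pole of highest order in d(\<alpha> / g) = 0: with g = f^(k+1) g', the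
      terms not divisible by \<open>f\<close> are (k+1) g' times df \<and> \<alpha>.\<close>
    have Q: "f dvd mpoly_partial i f * \<alpha> j - mpoly_partial j f * \<alpha> i" for i j
    proof -
      obtain k g' where g': "g = f ^ Suc k * g'" "\<not> f dvd g'" using mpoly_extract_power[OF f g0] .
      have Dg: "mpoly_partial i g = f ^ k * (of_nat (Suc k) * g' * mpoly_partial i f + f * mpoly_partial i g')" for i
        unfolding g'(1) derivationD(2)[OF mpoly_partial_derivation] derivation_power[OF mpoly_partial_derivation]
        by (simp add: algebra_simps del: of_nat_Suc)
      have "f ^ k * (f * g' * (mpoly_partial i (\<alpha> j) - mpoly_partial j (\<alpha> i))) =
         f ^ k * (of_nat (Suc k) * (g' * (mpoly_partial i f * \<alpha> j - mpoly_partial j f * \<alpha> i))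
           + f * (mpoly_partial i g' * \<alpha> j - mpoly_partial j g' * \<alpha> i))"
        using 2[of i j] unfolding Dg by (simp add: g'(1) algebra_simps del: of_nat_Suc)
      then have "f * g' * (mpoly_partial i (\<alpha> j) - mpoly_partial j (\<alpha> i)) =
         of_nat (Suc k) * (g' * (mpoly_partial i f * \<alpha> j - mpoly_partial j f * \<alpha> i))
           + f * (mpoly_partial i g' * \<alpha> j - mpoly_partial j g' * \<alpha> i)"
        using f0 by (simp only: mult_cancel_left power_eq_0_iff) simp
      then have "of_nat (Suc k) * (g' * (mpoly_partial i f * \<alpha> j - mpoly_partial j f * \<alpha> i)) =
          f * (g' * (mpoly_partial i (\<alpha> j) - mpoly_partial j (\<alpha> i)) - (mpoly_partial i g' * \<alpha> j - mpoly_partial j g' * \<alpha> i))"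
        by (simp add: algebra_simps del: of_nat_Suc)
      then have "f dvd of_nat (Suc k) * (g' * (mpoly_partial i f * \<alpha> j - mpoly_partial j f * \<alpha> i))" by (metis dvd_triv_left)
      moreover have "\<not> f dvd (of_nat (Suc k) :: 'n mpoly)" using f0 of_nat_mpoly_unit dvd_trans by blast
      ultimately show ?thesis using g'(2) by (simp only: prime) simp
    qed
    \<comment> \<open>Modulo \<open>f\<close> both \<omega> and df are proportional to \<alpha>.
      Normalising by \<open>\<alpha> e\<close>, which is not divisible by \<open>f\<close>, costs
      two factors \<open>\<alpha> e\<close>; primality of \<open>f\<close> removes them.\<close>
    have "f dvd \<omega> i * mpoly_partial j f - \<omega> j * mpoly_partial i f" for i j
    proof -
      define u where "u i = \<alpha> e * \<omega> i - \<alpha> i * \<omega> e" for i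
      define v where "v i = \<alpha> e * mpoly_partial i f - \<alpha> i * mpoly_partial e f" for i
      have "f dvd u i" "f dvd v i" for i
        using P[of e i] Q[of i e] by (simp_all add: u_def v_def mult.commute)
      then have "f dvd u i * (\<alpha> e * mpoly_partial j f) + \<alpha> i * \<omega> e * v j - u j * (\<alpha> e * mpoly_partial i f) - \<alpha> j * \<omega> e * v i"
        by (intro dvd_diff dvd_add dvd_mult dvd_mult2)
      also have "u i * (\<alpha> e * mpoly_partial j f) + \<alpha> i * \<omega> e * v j - u j * (\<alpha> e * mpoly_partial i f) - \<alpha> j * \<omega> e * v i
         = \<alpha> e * (\<alpha> e * (\<omega> i * mpoly_partial j f - \<omega> j * mpoly_partial i f))"
        by (simp add: u_def v_def algebra_simps)
      finally show ?thesis using e by (simp only: prime) simp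
    qed
    moreover have "f \<notin> range Const" using f0 mpoly_unit_iff[of f] by blast
    ultimately have "invariant_hypersurface f \<omega>"
      using irreducible_squarefree[OF f(1)] by (simp add: invariant_hypersurface_def wedge11_def d0_def)
    then show False using noinv by blast
  qed
  then obtain c where c: "1 = g * c" by (elim dvdE)
  define \<eta> where "\<eta> i = c * \<alpha> i" for i
  have \<eta>\<alpha>: "\<alpha> i = g * \<eta> i" for i using c by (simp add: \<eta>_def mult.assoc[symmetric])
  have "c \<noteq> 0" using c by auto
  have Dg: "mpoly_partial i g = 0" for i
  proof -
    have "g dvd 1" using c by (metis dvd_triv_left)
    then obtain b where "g = Const b" unfolding mpoly_unit_iff by blast
    then show ?thesis using mpoly_partial_Const by simp
  qed
  show ?thesis
  proof
    show "mpoly_partial i (\<eta> j) = mpoly_partial j (\<eta> i)" for i j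
    proof -
      have "g * (mpoly_partial i (\<eta> j) - mpoly_partial j (\<eta> i)) = 0"
        using 2[of i j] g0 unfolding \<eta>\<alpha> derivationD(2)[OF mpoly_partial_derivation] Dg
        by (simp add: algebra_simps)
      then show ?thesis using g0 by simp
    qed
    show "d1 mpoly_partial \<omega> i j = wedge11 \<eta> \<omega> i j" for i j
    proof -
      have "g * d1 mpoly_partial \<omega> i j = g * wedge11 \<eta> \<omega> i j"
        unfolding 1 wedge11_def \<eta>\<alpha> by (simp add: algebra_simps)
      then show ?thesis using g0 by simp
    qed
  qed
qed

section \<open>Exactness of closed polynomial forms\<close>

definition monomial_degree :: "('n::finite \<Rightarrow>\<^sub>0 nat) \<Rightarrow> nat" where
  "monomial_degree m = (\<Sum>i\<in>UNIV. Poly_Mapping.lookup m i)"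

definition euler :: "'n::finite mpoly \<Rightarrow> 'n mpoly" where
  "euler f = (\<Sum>i\<in>UNIV. Var i * mpoly_partial i f)"

lemma euler_add: "euler (f + g) = euler f + euler g"
  by (simp add: euler_def mpoly_partial_add distrib_left sum.distrib)

lemma euler_single: "euler (Poly_Mapping.single m c) = Poly_Mapping.single m (of_nat (monomial_degree m) * c)"
proof -
  have "Var i * mpoly_partial i (Poly_Mapping.single m c) = Poly_Mapping.single m (of_nat (Poly_Mapping.lookup m i) * c)" for i
  proof (cases "Poly_Mapping.lookup m i = 0")
    case False
    then have "Poly_Mapping.single i 1 + (m - Poly_Mapping.single i 1) = m"
      by (intro poly_mapping_eqI) (auto simp: lookup_add lookup_minus lookup_single when_def)
    then show ?thesis by (simp add: Var_def mpoly_partial_single mult_single)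
  qed (simp add: Var_def mpoly_partial_single)
  then have "euler (Poly_Mapping.single m c) = (\<Sum>i\<in>UNIV. Poly_Mapping.single m (of_nat (Poly_Mapping.lookup m i) * c))"
    by (simp add: euler_def)
  also have "\<dots> = Poly_Mapping.single m (of_nat (monomial_degree m) * c)"
    by (intro poly_mapping_eqI) (simp add: lookup_sum_mpoly lookup_single when_def monomial_degree_def sum_distrib_right)
  finally show ?thesis .
qed

lemma lookup_euler: "Poly_Mapping.lookup (euler f) m = of_nat (monomial_degree m) * Poly_Mapping.lookup f m"
proof (induction f rule: mpoly_induct)
  case zero then show ?case by (simp add: euler_def)
next
  case (single m' c) then show ?case by (simp add: euler_single lookup_single when_def)
next
  case (add f g) then show ?case by (simp add: euler_add lookup_add distrib_left)
qed

lemma lookup_Var_mult_0: "Poly_Mapping.lookup (Var i * f) 0 = 0"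
proof (induction f rule: mpoly_induct)
  case (single m c)
  have "Poly_Mapping.single i 1 + m \<noteq> (0 :: 'a \<Rightarrow>\<^sub>0 nat)"
    by (metis add_is_0 lookup_add lookup_single_eq lookup_zero one_neq_zero)
  then show ?case by (simp add: Var_def mult_single lookup_single when_def)
qed (simp_all add: distrib_left lookup_add)

lemma monomial_degree_0: "monomial_degree m = 0 \<longleftrightarrow> m = 0"
  by (auto simp: monomial_degree_def intro: poly_mapping_eqI)

text \<open>The Euler field \<open>E\<close> inverts \<open>d\<close>: a closed form \<open>\<eta>\<close> is the differential of the solution
  \<open>h\<close> of \<open>E h = \<eta>(E)\<close>.\<close>

lemma closed_form_exact:
  fixes \<eta> :: "'n::finite \<Rightarrow> 'n mpoly"
  assumes closed: "\<And>i j. mpoly_partial i (\<eta> j) = mpoly_partial j (\<eta> i)"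
  obtains h where "\<And>i. mpoly_partial i h = \<eta> i"
proof -
  define S where "S = (\<Sum>i\<in>UNIV. Var i * \<eta> i)"
  define h where "h = (\<Sum>m\<in>Poly_Mapping.keys S. Poly_Mapping.single m (Poly_Mapping.lookup S m / of_nat (monomial_degree m)))"
  have lh: "Poly_Mapping.lookup h m = Poly_Mapping.lookup S m / of_nat (monomial_degree m)" for m
    by (auto simp: h_def lookup_sum_mpoly lookup_single when_def in_keys_iff)
  have "Poly_Mapping.lookup S 0 = 0" by (simp add: S_def lookup_sum_mpoly lookup_Var_mult_0)
  then have Eh: "euler h = S"
    by (intro poly_mapping_eqI) (auto simp: lookup_euler lh monomial_degree_0)
  note D = derivationD[OF mpoly_partial_derivation]
  have DV: "mpoly_partial j (Var i) = (if i = j then 1 else (0::'n mpoly))" for i j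
    by (simp add: Var_def mpoly_partial_single lookup_single when_def)
  have DE: "mpoly_partial j (\<Sum>i\<in>UNIV. Var i * f i) = f j + (\<Sum>i\<in>UNIV. Var i * mpoly_partial j (f i))" for j and f :: "'n \<Rightarrow> 'n mpoly"
  proof -
    have "mpoly_partial j (Var i * f i) = (if i = j then f i else 0) + Var i * mpoly_partial j (f i)" for i
      by (simp add: D(2) DV)
    then show ?thesis by (simp add: D(8) sum.distrib)
  qed
  show ?thesis
  proof
    fix j
    \<comment> \<open>\<open>euler\<close> multiplies each monomial by its degree, so adding the
      identity gives an injective operator; \<open>f\<close> is shown to lie in its kernel.\<close>
    define f where "f = mpoly_partial j h - \<eta> j"
    have "mpoly_partial j h + euler (mpoly_partial j h) = mpoly_partial j (euler h)"
      by (simp add: euler_def DE mpoly_partial_commute)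
    also have "\<dots> = \<eta> j + euler (\<eta> j)"
      unfolding Eh S_def DE by (simp add: euler_def closed[of j])
    finally have "f + euler f = 0"
      by (simp add: f_def euler_def D(6) algebra_simps sum_subtractf)
    then have "Poly_Mapping.lookup f m + Poly_Mapping.lookup (euler f) m = 0" for m
      by (metis lookup_add lookup_zero)
    then have "(1 + of_nat (monomial_degree m)) * Poly_Mapping.lookup f m = 0" for m
      by (simp add: lookup_euler algebra_simps)
    moreover have "(1 + of_nat (monomial_degree m) :: complex) \<noteq> 0" for m
      by (metis of_nat_Suc of_nat_eq_0_iff nat.distinct(1))
    ultimately have "Poly_Mapping.lookup f m = 0" for m by (metis mult_eq_0_iff)
    then have "f = 0" by (intro poly_mapping_eqI) simp
    then show "mpoly_partial j h = \<eta> j" by (simp add: f_def)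
  qed
qed

section \<open>Polynomial first integrals on the plane\<close>

lemma smult_sum_right: "smult c (sum f A) = (\<Sum>x\<in>A. smult c (f x))"
  by (induction A rule: infinite_finite_induct) (simp_all add: smult_add_right)

lemma degree_map_poly_leI: "h 0 = 0 \<Longrightarrow> degree (map_poly h p) \<le> degree p"
  by (rule degree_le) (simp add: coeff_map_poly coeff_eq_0)

lemma poly_eq_sum_le: "degree r \<le> n \<Longrightarrow> poly r c = (\<Sum>k\<le>n. coeff r k * c ^ k)"
  for r :: "'a::comm_semiring_1 poly"
  unfolding poly_altdef by (rule sum.mono_neutral_left) (auto simp: coeff_eq_0)

lemma is_ring_hom_map_poly:
  fixes h :: "'a::idom \<Rightarrow> 'b::idom"
  assumes h: "is_ring_hom h"
  shows "is_ring_hom (map_poly h)"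
proof -
  note H = is_ring_homD[OF h]
  have "map_poly h (p + q) = map_poly h p + map_poly h q" for p q
    by (rule poly_eqI) (simp add: coeff_map_poly H)
  moreover have "map_poly h (p * q) = map_poly h p * map_poly h q" for p q
    by (rule poly_eqI) (simp add: coeff_map_poly coeff_mult H)
  moreover have "map_poly h 1 = 1" by (simp add: H)
  ultimately show ?thesis by (simp add: is_ring_hom_def)
qed

lemma map_poly_derivation:
  fixes d :: "'a::idom \<Rightarrow> 'a"
  assumes d: "derivation d"
  shows "derivation (map_poly d)"
proof -
  note D = derivationD[OF d]
  show ?thesis unfolding derivation_def
  proof (intro conjI allI)
    show "map_poly d (p + q) = map_poly d p + map_poly d q" for p q
      by (rule poly_eqI) (simp add: coeff_map_poly D)
    show "map_poly d (p * q) = map_poly d p * q + p * map_poly d q" for p q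
      by (rule poly_eqI) (simp add: coeff_map_poly coeff_mult D sum.distrib)
  qed
qed

lemma pderiv_derivation: "derivation (pderiv :: 'a::idom poly \<Rightarrow> 'a poly)"
  by (simp add: derivation_def pderiv_add pderiv_mult mult.commute)

lemma monic_division:
  fixes f g :: "'a::idom poly"
  assumes "lead_coeff g = 1"
  obtains q r where "f = q * g + r" "r = 0 \<or> degree r < degree g"
proof -
  have "subring_set (UNIV :: 'a set)" by (simp add: subring_set_def)
  moreover have "g \<noteq> 0" using assms by auto
  ultimately obtain k q r where "smult (lead_coeff g ^ k) f = q * g + r" "r = 0 \<or> degree r < degree g"
    using pseudo_division_over[of UNIV f g] by (auto simp: poly_over_def)
  then show ?thesis using assms that by simp
qed

lemma monic_dvd_small:
  fixes f g :: "'a::idom poly"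
  assumes "lead_coeff g = 1" "g dvd f" "degree f < degree g"
  shows "f = 0"
proof (rule ccontr)
  assume f: "f \<noteq> 0"
  obtain k where k: "f = g * k" using assms(2) by (elim dvdE)
  then have "degree f = degree g + degree k" using f by (simp add: degree_mult_eq)
  then show False using assms(3) by simp
qed

lemma adic_expansion:
  fixes f g :: "'a::idom poly"
  assumes g: "lead_coeff g = 1" "degree g > 0"
  obtains n \<mu> where "f = (\<Sum>k\<le>n. g ^ k * \<mu> k)" "\<And>k. degree (\<mu> k) < degree g"
proof -
  have "\<exists>n \<mu>. f = (\<Sum>k\<le>n. g ^ k * \<mu> k) \<and> (\<forall>k. degree (\<mu> k) < degree g)"
  proof (induction "degree f" arbitrary: f rule: less_induct)
    case less
    show ?case
    proof (cases "degree f < degree g")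
      case True
      then show ?thesis by (intro exI[of _ 0] exI[of _ "\<lambda>k. f"]) simp
    next
      case False
      obtain q r where qr: "f = q * g + r" "r = 0 \<or> degree r < degree g" using monic_division[OF g(1)] by blast
      have r: "degree r < degree g" using qr(2) g(2) by auto
      have "degree q < degree f"
      proof (cases "q = 0")
        case True then show ?thesis using False g(2) by simp
      next
        case q0: False
        have "g \<noteq> 0" using g by auto
        then have "degree (q * g) = degree q + degree g" using q0 by (simp add: degree_mult_eq)
        then have "degree f = degree q + degree g" unfolding qr(1) using r by (subst degree_add_eq_left) auto
        then show ?thesis using g by simp
      qed
      then obtain n \<mu> where "q = (\<Sum>k\<le>n. g ^ k * \<mu> k)" "\<forall>k. degree (\<mu> k) < degree g" using less by blast
      then have "f = (\<Sum>k\<le>Suc n. g ^ k * (case k of 0 \<Rightarrow> r | Suc k \<Rightarrow> \<mu> k))"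
        unfolding qr(1) sum.atMost_Suc_shift by (simp add: sum_distrib_left mult.commute mult.left_commute)
      moreover have "degree (case k of 0 \<Rightarrow> r | Suc k \<Rightarrow> \<mu> k) < degree g" for k
        using r \<open>\<forall>k. _\<close> by (auto split: nat.split)
      ultimately show ?thesis by blast
    qed
  qed
  then show ?thesis using that by blast
qed

lemma adic_unique:
  fixes g :: "'a::idom poly"
  assumes g: "lead_coeff g = 1" "degree g > 0" and "(\<Sum>k\<le>n. g ^ k * \<mu> k) = 0" "\<And>k. k \<le> n \<Longrightarrow> degree (\<mu> k) < degree g"
    and "k \<le> n"
  shows "\<mu> k = 0"
  using assms(3-)
proof (induction n arbitrary: \<mu> k)
  case 0
  then show ?case by simp
next
  case (Suc n)
  have e: "\<mu> 0 + g * (\<Sum>k\<le>n. g ^ k * \<mu> (Suc k)) = 0"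
    using Suc.prems(1) unfolding sum.atMost_Suc_shift by (simp add: sum_distrib_left mult.assoc)
  have "g dvd \<mu> 0" by (rule dvdI[of _ _ "- (\<Sum>k\<le>n. g ^ k * \<mu> (Suc k))"]) (use e in \<open>simp add: add_eq_0_iff\<close>)
  then have m0: "\<mu> 0 = 0" using monic_dvd_small[OF g(1)] Suc.prems(2)[of 0] by simp
  then have "(\<Sum>k\<le>n. g ^ k * \<mu> (Suc k)) = 0" using e g by auto
  then have "\<mu> (Suc k) = 0" if "k \<le> n" for k using Suc.IH[of "\<lambda>k. \<mu> (Suc k)"] Suc.prems(2) that by simp
  then show ?case using m0 Suc.prems(3) by (cases k) auto
qed

text \<open>The outer variable is t and the inner one z: \<open>pderiv\<close> differentiates by t,
  \<open>dz\<close> by z, and \<open>degree\<close> and \<open>lead_coeff\<close> refer to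
  t.\<close>

type_synonym bipoly = "complex poly poly"

definition cc :: "complex \<Rightarrow> bipoly" where "cc c = [:[:c:]:]"

definition dz :: "bipoly \<Rightarrow> bipoly" where "dz = map_poly pderiv"

definition at0 :: "bipoly \<Rightarrow> complex poly" where "at0 = map_poly (\<lambda>c. poly c 0)"

text \<open>The variable of the given polynomial becomes a third indeterminate T, independent of z
  and t. In particular \<open>lift (at0 f)\<close> is f(0, T).\<close>

definition lift :: "complex poly \<Rightarrow> bipoly poly" where "lift = map_poly cc"

lemma cc_hom: "is_ring_hom cc"
  unfolding cc_def using is_ring_hom_comp[OF is_ring_hom_pCons is_ring_hom_pCons] .

lemma dz_derivation: "derivation dz"
  unfolding dz_def by (rule map_poly_derivation[OF pderiv_derivation])

lemma at0_hom: "is_ring_hom at0"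
  unfolding at0_def by (rule is_ring_hom_map_poly[OF is_ring_hom_poly])

lemma lift_hom: "is_ring_hom lift"
  unfolding lift_def by (rule is_ring_hom_map_poly[OF cc_hom])

lemmas at0 = is_ring_homD[OF at0_hom] and lift = is_ring_homD[OF lift_hom] and cc = is_ring_homD[OF cc_hom]

lemma coeff_dz: "coeff (dz f) n = pderiv (coeff f n)"
  and coeff_at0: "coeff (at0 f) n = poly (coeff f n) 0"
  and coeff_lift: "coeff (lift q) n = cc (coeff q n)"
  by (simp_all add: dz_def at0_def lift_def coeff_map_poly cc)

lemma cc_eq_0: "cc c = 0 \<longleftrightarrow> c = 0" by (simp add: cc_def)

lemma degree_lift: "degree (lift q) = degree q"
  by (simp add: lift_def degree_map_poly cc_eq_0)

lemma degree_at0_monic: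
  assumes "lead_coeff f = 1"
  shows "degree (at0 f) = degree f" "lead_coeff (at0 f) = 1"
proof -
  have 1: "coeff (at0 f) (degree f) = 1" using assms by (simp add: coeff_at0)
  moreover have "degree (at0 f) \<le> degree f" unfolding at0_def by (rule degree_map_poly_leI) simp
  ultimately show "degree (at0 f) = degree f" by (metis le_antisym le_degree one_neq_zero)
  then show "lead_coeff (at0 f) = 1" using 1 by simp
qed

locale plane =
  fixes p :: bipoly
  assumes monic: "lead_coeff p = 1" and deg: "degree p > 0"
begin

text \<open>The coefficient of dp \<and> df, the Hamiltonian derivation of \<open>p\<close>; its
  kernel consists of the polynomial first integrals of dp.\<close>

definition X :: "bipoly \<Rightarrow> bipoly" where "X f = pderiv p * dz f - dz p * pderiv f"

lemma X_derivation: "derivation X"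
  by (simp add: derivation_def X_def derivationD[OF dz_derivation] pderiv_add pderiv_mult algebra_simps)

lemmas XD = derivationD[OF X_derivation]

lemma X_p: "X p = 0" by (simp add: X_def mult.commute)

lemma X_cc: "X (cc c) = 0"
  by (simp add: X_def cc_def dz_def map_poly_pCons pderiv_pCons)

lemma pderiv_p: "pderiv p \<noteq> 0" "degree (pderiv p) = degree p - 1"
  using deg by (auto simp: pderiv_eq_0_iff degree_pderiv)

lemma degree_dz_p: "dz p = 0 \<or> degree (dz p) < degree p"
proof -
  have "degree (dz p) \<le> degree p" unfolding dz_def by (rule degree_map_poly_leI) simp
  moreover have "coeff (dz p) (degree p) = 0" using monic by (simp add: coeff_dz)
  ultimately show ?thesis by (metis leading_coeff_0_iff le_neq_implies_less)
qed

text \<open>As \<open>p\<close> is monic in t, \<open>dz p\<close> has smaller degree than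
  \<open>p\<close>. A leading coefficient of \<open>f\<close> depending on z would make the degree
  of \<open>pderiv p * dz f\<close> too large for \<open>dz p * pderiv f\<close>.\<close>

lemma X_eq_0_lead:
  assumes "X f = 0"
  obtains c where "lead_coeff f = [:c:]"
proof -
  have "pderiv (lead_coeff f) = 0"
  proof (rule ccontr)
    assume nz: "pderiv (lead_coeff f) \<noteq> 0"
    then have c: "coeff (dz f) (degree f) \<noteq> 0" by (simp add: coeff_dz)
    have "degree (dz f) \<le> degree f" unfolding dz_def by (rule degree_map_poly_leI) simp
    then have d: "degree (dz f) = degree f" "dz f \<noteq> 0" using c by (auto intro: le_antisym le_degree)
    have e: "pderiv p * dz f = dz p * pderiv f" using assms by (simp add: X_def)
    have l: "degree (pderiv p * dz f) = degree p - 1 + degree f" using d pderiv_p by (simp add: degree_mult_eq)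
    have nz': "dz p \<noteq> 0" "pderiv f \<noteq> 0" using e d pderiv_p by auto
    then have "degree f > 0" by (auto simp: pderiv_eq_0_iff)
    moreover have "degree (dz p * pderiv f) = degree (dz p) + (degree f - 1)" using nz' by (simp add: degree_mult_eq degree_pderiv)
    ultimately show False using e l degree_dz_p nz' by simp
  qed
  then show ?thesis using that by (auto simp: pderiv_eq_0_iff elim: degree_eq_zeroE)
qed

lemma X_eq_0_const:
  assumes "X f = 0" "degree f = 0"
  obtains c where "f = cc c"
proof -
  obtain c where "lead_coeff f = [:c:]" using X_eq_0_lead[OF assms(1)] .
  moreover obtain b where "f = [:b:]" using assms(2) by (rule degree_eq_zeroE)
  ultimately show ?thesis using that by (simp add: cc_def)
qed

definition XT :: "bipoly poly \<Rightarrow> bipoly poly" where "XT = map_poly X"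

lemma XT_derivation: "derivation XT"
  unfolding XT_def by (rule map_poly_derivation[OF X_derivation])

lemmas XTD = derivationD[OF XT_derivation]

lemma coeff_XT: "coeff (XT F) k = X (coeff F k)"
  by (simp add: XT_def coeff_map_poly XD)

lemma XT_lift: "XT (lift q) = 0"
  by (rule poly_eqI) (simp add: coeff_XT coeff_lift X_cc)

lemma XT_const: "XT [:f:] = [:X f:]"
  by (simp add: XT_def map_poly_pCons XD)

lemma XT_smult: "XT (smult f F) = smult (X f) F + smult f (XT F)"
  by (rule poly_eqI) (simp add: coeff_XT XD)

definition evT :: "complex \<Rightarrow> bipoly poly \<Rightarrow> bipoly" where "evT c F = poly F (cc c)"

lemma evT_hom: "is_ring_hom (evT c)"
  unfolding evT_def by (rule is_ring_hom_poly)

lemma X_evT: "X (evT c F) = evT c (XT F)"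
  unfolding evT_def derivation_poly[OF X_derivation] X_cc XT_def by simp

lemma evT_lift: "evT c (lift q) = cc (poly q c)"
  by (simp add: evT_def poly_altdef degree_lift coeff_lift cc)

text \<open>The coefficient of a nonconstant monomial in z and t in F(c) is a polynomial in
  \<open>c\<close> with infinitely many zeros.\<close>

lemma coeffs_const_of_evT_const:
  assumes inf: "infinite {c. \<exists>b. evT c F = cc b}"
  obtains q where "F = lift q"
proof -
  have "coeff (coeff (coeff F k) i) j = 0" if ij: "i \<noteq> 0 \<or> j \<noteq> 0" for k i j
  proof -
    define r where "r = map_poly (\<lambda>f. coeff (coeff f i) j) F"
    have "poly r c = coeff (coeff (evT c F) i) j" for c
    proof -
      have "cc c ^ k = cc (c ^ k)" for k by (simp add: cc)
      moreover have "coeff (coeff (f * cc b) i) j = coeff (coeff f i) j * b" for f b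
        by (simp add: cc_def mult.commute[of f])
      moreover have "degree r \<le> degree F" unfolding r_def by (rule degree_map_poly_leI) simp
      then have "poly r c = (\<Sum>k\<le>degree F. coeff r k * c ^ k)" by (rule poly_eq_sum_le)
      ultimately show ?thesis
        by (simp add: evT_def poly_altdef[of F] coeff_sum r_def coeff_map_poly)
    qed
    moreover have "coeff (coeff (cc b) i) j = 0" for b
      using ij by (auto simp: cc_def coeff_pCons split: nat.split)
    ultimately have "{c. \<exists>b. evT c F = cc b} \<subseteq> {c. poly r c = 0}" by auto
    then have "r = 0" using inf finite_subset poly_roots_finite by blast
    then have "coeff r k = 0" by simp
    then show ?thesis by (simp add: r_def coeff_map_poly)
  qed
  then have "coeff F k = cc (coeff (coeff (coeff F k) 0) 0)" for k
    by (intro poly_eqI) (auto simp: cc_def coeff_pCons split: nat.split intro!: poly_eqI)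
  moreover have "finite {k. coeff (coeff (coeff F k) 0) 0 \<noteq> 0}"
    by (rule finite_subset[of _ "{..degree F}"]) (auto intro: le_degree)
  ultimately have "F = lift (map_poly (\<lambda>f. coeff (coeff f 0) 0) F)"
    by (intro poly_eqI) (simp add: coeff_lift coeff_map_poly)
  then show ?thesis by (rule that)
qed

end

section \<open>Irreducibility of the fibres of a minimal first integral\<close>

locale minimal_integral = plane +
  fixes P :: bipoly
  assumes P: "X P = 0" "lead_coeff P = 1" "degree P > 0"
    and minimal: "\<And>f. X f = 0 \<Longrightarrow> degree f > 0 \<Longrightarrow> degree P \<le> degree f"
begin

text \<open>P(0, T) - P(z, t), monic in T: its roots are the points of the line z = 0 on the level
  curve of \<open>P\<close> through (z, t). Congruence modulo \<open>a\<close> thus expresses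
  transport along level curves to z = 0.\<close>

definition a :: "bipoly poly" where "a = lift (at0 P) - [:P:]"

lemma a_degree: "degree a = degree P" "lead_coeff a = 1" "a \<noteq> 0"
proof -
  have d: "degree (lift (at0 P)) = degree P" by (simp add: degree_lift degree_at0_monic[OF P(2)])
  show *: "degree a = degree P" unfolding a_def
    by (subst diff_conv_add_uminus, subst degree_add_eq_left) (use d P(3) in auto)
  show "lead_coeff a = 1" unfolding * using P(2,3) degree_at0_monic[OF P(2)]
    by (simp add: a_def coeff_lift cc coeff_pCons split: nat.split)
  then show "a \<noteq> 0" by auto
qed

lemma XT_a: "XT a = 0"
  by (simp add: a_def XTD(6) XT_lift XT_const P)

lemma evT_a: "evT c a = cc (poly (at0 P) c) - P"
  using is_ring_homD(6)[OF evT_hom, of c "lift (at0 P)" "[:P:]"] by (simp add: a_def evT_lift) (simp add: evT_def)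

text \<open>A unit leading coefficient is a constant and is killed by \<open>X\<close>. So
  \<open>XT F\<close> has smaller degree in T than \<open>F\<close> and is a multiple of
  \<open>F\<close> only if it is zero.\<close>

lemma XT_monic_small:
  assumes "XT F = G * F" "lead_coeff F dvd 1"
  shows "XT F = 0"
proof (rule ccontr)
  assume nz: "XT F \<noteq> 0"
  then have F0: "F \<noteq> 0" "G \<noteq> 0" using assms(1) by auto
  obtain c where c: "lead_coeff F = cc c"
  proof -
    obtain b where b: "lead_coeff F = [:b:]" "b dvd 1" using assms(2) by (auto simp: is_unit_poly_iff)
    then obtain c where "b = [:c:]" by (auto simp: is_unit_poly_iff)
    then show ?thesis using that b by (simp add: cc_def)
  qed
  have "degree (XT F) = degree G + degree F" using F0 by (simp add: assms(1) degree_mult_eq)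
  moreover have "degree (XT F) \<le> degree F" unfolding XT_def by (rule degree_map_poly_leI) (simp add: XD)
  moreover have "coeff (XT F) (degree F) = 0" by (simp add: coeff_XT c X_cc)
  ultimately show False using nz leading_coeff_0_iff[of "XT F"] by simp
qed

text \<open>At a root of \<open>q\<close> the polynomial \<open>a\<close> becomes a constant minus
  \<open>P\<close>, which is nonzero since \<open>P\<close> has positive degree.\<close>

lemma not_dvd_const:
  assumes "lift q dvd a" shows "degree q = 0"
proof (rule ccontr)
  assume "degree q \<noteq> 0"
  then obtain c where c: "poly q c = 0"
    using Fundamental_Theorem_Algebra.fundamental_theorem_of_algebra[of q] by (auto simp: constant_degree)
  obtain k where "a = lift q * k" using assms by (elim dvdE)
  then have "evT c a = 0" by (simp add: is_ring_homD(4)[OF evT_hom] evT_lift c cc)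
  then have "P = cc (poly (at0 P) c)" by (simp add: evT_a)
  then have "degree P = 0" by (metis cc_def degree_pCons_0)
  then show False using P(3) by simp
qed

text \<open>Specialising the last variable, a factorisation of \<open>a\<close> gives factorisations of
  \<open>const - P\<close> into first integrals, one factor of which is constant by minimality.\<close>

lemma a_prime: "prime_elem a"
proof -
  have nu: "\<not> a dvd 1"
    using a_degree(1) P(3) by (auto simp: is_unit_poly_iff)
  obtain b where b: "b dvd a" "prime_elem b"
    using prime_divisor_exists[OF a_degree(3) nu] by (auto simp: prime_def)
  obtain d where d: "a = b * d" using b(1) by (elim dvdE)
  have nz: "b \<noteq> 0" "d \<noteq> 0" using d a_degree by auto
  have unit: "lead_coeff b dvd 1" "lead_coeff d dvd 1"
    using a_degree(2) unfolding d lead_coeff_mult by (metis dvd_triv_left, metis dvd_triv_right)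
  \<comment> \<open>Differentiating a = b^k c, with \<open>b\<close> not dividing \<open>c\<close>,
    in \<open>XT a = 0\<close> shows that \<open>b\<close> divides k c \<open>XT b\<close>; the
    positive integer k is a unit.\<close>
  have "b dvd XT b"
  proof -
    have "\<exists>k c. a = b ^ k * c \<and> \<not> b dvd c"
      using multiplicity_decompose'[of a b] a_degree(3) b(2) by (metis prime_elem_not_unit)
    then obtain k c where kc: "a = b ^ k * c" "\<not> b dvd c" by blast
    then obtain k' where k': "k = Suc k'" using b(1) by (cases k) auto
    have "b ^ k' * (of_nat (Suc k') * XT b * c + b * XT c) = 0"
      using XT_a unfolding kc(1) k' XTD(2) derivation_power[OF XT_derivation] by (simp add: algebra_simps)
    then have "of_nat (Suc k') * (XT b * c) = b * (- XT c)"
      using nz by (simp add: add_eq_0_iff mult.assoc del: of_nat_Suc)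
    then have "b dvd of_nat (Suc k') * (XT b * c)" by (metis dvd_triv_left)
    moreover have "(of_nat (Suc k') :: bipoly poly) dvd 1"
    proof -
      have "of_nat (Suc k') = lift [:of_nat (Suc k'):]"
        by (metis lift(10) of_nat_poly)
      moreover have "lift [:of_nat (Suc k'):] * lift [:1 / of_nat (Suc k'):] = 1"
        by (simp add: lift(1) lift(4)[symmetric] one_pCons[symmetric] del: of_nat_Suc)
      ultimately show ?thesis by (metis dvd_triv_left)
    qed
    then have "\<not> b dvd of_nat (Suc k')" using b(2) dvd_trans prime_elem_not_unit by blast
    ultimately show ?thesis using b(2) kc(2) by (simp add: prime_elem_dvd_mult_iff del: of_nat_Suc)
  qed
  then obtain G where "XT b = G * b" by (metis dvdE mult.commute)
  then have Xb: "XT b = 0" using XT_monic_small unit by blast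
  have Xd: "XT d = 0" using XT_a nz unfolding d XTD(2) Xb by simp
  have split: "(\<exists>c'. evT c b = cc c') \<or> (\<exists>c'. evT c d = cc c')" for c
  proof -
    have X: "X (evT c b) = 0" "X (evT c d) = 0" by (simp_all add: X_evT Xb Xd is_ring_homD(2)[OF evT_hom])
    have pr: "evT c b * evT c d = cc (poly (at0 P) c) - P"
      using evT_a[of c] unfolding d is_ring_homD(4)[OF evT_hom] .
    have dg: "degree (cc (poly (at0 P) c) - P) = degree P"
      by (subst diff_conv_add_uminus, subst degree_add_eq_right) (use P(3) in \<open>auto simp: cc_def\<close>)
    then have "evT c b * evT c d \<noteq> 0" unfolding pr using P(3) by auto
    then have "degree (evT c b) + degree (evT c d) = degree P"
      using dg pr by (metis degree_mult_eq mult_eq_0_iff)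
    then have "degree (evT c b) = 0 \<or> degree (evT c d) = 0"
      using minimal[OF X(1)] minimal[OF X(2)] P(3) by linarith
    then show ?thesis using X_eq_0_const X by metis
  qed
  have "infinite {c. \<exists>c'. evT c b = cc c'} \<or> infinite {c. \<exists>c'. evT c d = cc c'}"
  proof (rule ccontr)
    assume "\<not> ?thesis"
    then have "finite ({c. \<exists>c'. evT c b = cc c'} \<union> {c. \<exists>c'. evT c d = cc c'})" by simp
    moreover have "{c. \<exists>c'. evT c b = cc c'} \<union> {c. \<exists>c'. evT c d = cc c'} = UNIV" using split by blast
    ultimately show False by (simp add: infinite_UNIV_char_0)
  qed
  then have "\<exists>q. b = lift q \<or> d = lift q" using coeffs_const_of_evT_const by metis
  moreover have "b \<noteq> lift q" for q
  proof
    assume bq: "b = lift q"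
    then obtain c where "b = lift [:c:]" using not_dvd_const[of q] b(1) by (metis degree_eq_zeroE)
    then have "b = [:lead_coeff b:]" by (simp add: lift_def map_poly_pCons cc_eq_0)
    then have "b dvd 1" using unit(1) by (metis is_unit_const_poly_iff)
    then show False using b(2) by (simp add: prime_elem_def)
  qed
  ultimately obtain q where q: "d = lift q" by blast
  then obtain c where "d = lift [:c:]" using not_dvd_const[of q] d by (metis degree_eq_zeroE dvd_triv_right)
  then have "d = [:lead_coeff d:]" by (simp add: lift_def map_poly_pCons cc_eq_0)
  then have "d dvd 1" using unit(2) by (metis is_unit_const_poly_iff)
  then show ?thesis unfolding d using b(2) using prime_elem_mult_unit_left[of d b] \<open>d dvd 1\<close> by (simp add: mult.commute)
qed

text \<open>g(z, t) f(0, T) - f(z, t) g(0, T). It vanishes modulo \<open>a\<close> when f / g takes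
  the same value at (z, t) and at the transported point (0, T).\<close>

definition cross :: "bipoly \<Rightarrow> bipoly \<Rightarrow> bipoly poly" where
  "cross f g = smult g (lift (at0 f)) - smult f (lift (at0 g))"

text \<open>If \<open>a\<close> did not divide the cross difference, the two would generate a nonzero constant
  \<open>\<delta>\<close> (in the last variable). The ideal of such constants is stable under \<open>g X\<close>, and all of them
  vanish on the line \<open>z = 0\<close>, hence to infinite order.\<close>

lemma a_dvd_cross:
  assumes fg: "X f * g = f * X g" and g0: "at0 g \<noteq> 0"
  shows "a dvd cross f g"
proof (rule ccontr)
  assume ndvd: "\<not> a dvd cross f g"
  define B where "B = cross f g"
  define I where "I = {\<kappa>. \<exists>u v. \<kappa> = u * a + v * B}"
  have I_mult: "q * \<kappa> \<in> I" if "\<kappa> \<in> I" for q \<kappa>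
  proof -
    obtain u v where "\<kappa> = u * a + v * B" using \<open>\<kappa> \<in> I\<close> by (auto simp: I_def)
    then have "q * \<kappa> = (q * u) * a + (q * v) * B" by (simp add: algebra_simps)
    then show ?thesis unfolding I_def by blast
  qed
  have I_diff: "\<kappa> - \<kappa>' \<in> I" if "\<kappa> \<in> I" "\<kappa>' \<in> I" for \<kappa> \<kappa>'
  proof -
    obtain u v u' v' where "\<kappa> = u * a + v * B" "\<kappa>' = u' * a + v' * B"
      using \<open>\<kappa> \<in> I\<close> \<open>\<kappa>' \<in> I\<close> by (auto simp: I_def)
    then have "\<kappa> - \<kappa>' = (u - u') * a + (v - v') * B" by (simp add: algebra_simps)
    then show ?thesis unfolding I_def by blast
  qed
  have I_add: "\<kappa> + \<kappa>' \<in> I" if "\<kappa> \<in> I" "\<kappa>' \<in> I" for \<kappa> \<kappa>'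
    using I_diff[OF that(1) I_mult[OF that(2), of "-1"]] by simp
  have aI: "a \<in> I" unfolding I_def by (rule CollectI, rule exI[of _ 1], rule exI[of _ 0]) simp
  have BI: "B \<in> I" unfolding I_def by (rule CollectI, rule exI[of _ 0], rule exI[of _ 1]) simp
  obtain \<kappa> where \<kappa>: "\<kappa> \<in> I" "\<kappa> \<noteq> 0" and min: "\<And>\<kappa>'. \<kappa>' \<in> I \<Longrightarrow> \<kappa>' \<noteq> 0 \<Longrightarrow> degree \<kappa> \<le> degree \<kappa>'"
    using ex_has_least_nat[of "\<lambda>\<kappa>. \<kappa> \<in> I \<and> \<kappa> \<noteq> 0" a degree] aI a_degree(3) by blast
  have R: "subring_set (UNIV :: bipoly set)" by (simp add: subring_set_def)
  have divide: "\<exists>c q. c \<noteq> 0 \<and> smult c F = q * \<kappa>" if "F \<in> I" for F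
  proof -
    obtain k q r where *: "smult (lead_coeff \<kappa> ^ k) F = q * \<kappa> + r" "r = 0 \<or> degree r < degree \<kappa>"
      using pseudo_division_over[OF R _ _ \<kappa>(2), of F] by (auto simp: poly_over_def)
    have "r = [:lead_coeff \<kappa> ^ k:] * F - q * \<kappa>" using *(1) by simp
    then have "r \<in> I" using I_diff I_mult that \<kappa>(1) by metis
    then have "r = 0" using min[of r] *(2) by linarith
    then show ?thesis using * \<kappa>(2) by (intro exI[of _ "lead_coeff \<kappa> ^ k"] exI[of _ q]) auto
  qed
  note a_dvd_mult = prime_elem_dvd_mult_iff[OF a_prime]
  have not_a_const: "\<not> a dvd [:c:]" if "c \<noteq> 0" for c
  proof
    assume "a dvd [:c:]"
    then have "degree a \<le> degree [:c:]" by (rule dvd_imp_degree_le) (use that in simp)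
    then show False using a_degree(1) P(3) by simp
  qed
  \<comment> \<open>\<open>\<kappa>\<close> divides \<open>a\<close> and \<open>B\<close> up to
    factors free of T. The prime \<open>a\<close> divides either \<open>\<kappa>\<close>, and then
    also \<open>B\<close>, which is excluded, or the cofactor of \<open>\<kappa>\<close>, and then
    \<open>\<kappa>\<close> has degree zero.\<close>
  have "degree \<kappa> = 0"
  proof -
    obtain c q where cq: "c \<noteq> 0" "smult c a = q * \<kappa>" using divide[OF aI] by blast
    have "a dvd q * \<kappa>" unfolding cq(2)[symmetric] by (simp add: dvd_smult)
    then have "a dvd q \<or> a dvd \<kappa>" by (simp only: a_dvd_mult)
    then show ?thesis
    proof
      assume "a dvd \<kappa>"
      obtain c' q' where c': "c' \<noteq> 0" "smult c' B = q' * \<kappa>" using divide[OF BI] by blast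
      have "a dvd [:c':] * B" using \<open>a dvd \<kappa>\<close> c'(2) by simp
      then show ?thesis using not_a_const[OF c'(1)] ndvd by (simp only: a_dvd_mult B_def) simp
    next
      assume "a dvd q"
      then obtain q' where q': "q = a * q'" by (elim dvdE)
      have "a * [:c:] = a * (q' * \<kappa>)" using cq(2) q' by (simp add: mult.assoc)
      then have "[:c:] = q' * \<kappa>" using a_degree(3) by (simp only: mult_cancel_left) simp
      moreover have "q' \<noteq> 0" using calculation cq(1) by auto
      ultimately have "degree [:c:] = degree q' + degree \<kappa>" using \<kappa>(2) degree_mult_eq[of q' \<kappa>] by simp
      then show ?thesis by simp
    qed
  qed
  then obtain \<delta> where \<delta>: "\<kappa> = [:\<delta>:]" by (metis degree_eq_zeroE)
  \<comment> \<open>\<open>g\<close> times the derivation preserves the ideal: it kills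
    \<open>a\<close>, and it multiplies \<open>B\<close> by \<open>X g\<close> because f / g is a
    first integral.\<close>
  have stable: "[:g * X d:] \<in> I" if dI: "[:d:] \<in> I" for d
  proof -
    obtain u v where uv: "[:d:] = u * a + v * B" using dI by (auto simp: I_def)
    have XB: "smult g (XT B) = smult (X g) B"
    proof -
      have "XT B = smult (X g) (lift (at0 f)) - smult (X f) (lift (at0 g))"
        by (simp add: B_def cross_def XTD(6) XT_smult XT_lift)
      then have "smult g (XT B) = smult (X g) (smult g (lift (at0 f))) - smult (X f * g) (lift (at0 g))"
        by (simp add: smult_diff_right mult.commute)
      moreover have "X f * g = X g * f" using fg by (simp add: mult.commute)
      ultimately show ?thesis by (simp add: B_def cross_def smult_diff_right)
    qed
    have "[:g * X d:] = smult g (XT [:d:])" by (simp add: XT_const)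
    also have "\<dots> = smult g (XT u * a + XT v * B) + v * smult g (XT B)"
      unfolding uv XTD(1,2) XT_a by (simp add: smult_add_right)
    also have "\<dots> = smult g (XT u) * a + (smult g (XT v) + smult (X g) v) * B"
      unfolding XB by (simp add: smult_add_right algebra_simps)
    finally show ?thesis unfolding I_def by blast
  qed
  \<comment> \<open>Restriction to z = 0 and t = T. There a point is transported to itself, so both
    \<open>a\<close> and \<open>B\<close> vanish.\<close>
  define \<theta> where "\<theta> F = poly (map_poly at0 F) [:0, 1:]" for F
  have \<theta>: "is_ring_hom \<theta>"
    unfolding \<theta>_def[abs_def] by (rule is_ring_hom_comp[OF is_ring_hom_poly is_ring_hom_map_poly[OF at0_hom]])
  have \<theta>_lift: "\<theta> (lift q) = q" for q
  proof -
    have "map_poly at0 (lift q) = map_poly (\<lambda>c. [:c:]) q"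
      by (rule poly_eqI) (simp add: coeff_map_poly coeff_lift at0 cc_def at0_def map_poly_pCons)
    moreover have "poly (map_poly (\<lambda>c. [:c:]) q) [:0, 1:] = q"
      by (induction q) (simp_all add: map_poly_pCons)
    ultimately show ?thesis by (simp add: \<theta>_def)
  qed
  have \<theta>_const: "\<theta> [:f:] = at0 f" for f by (simp add: \<theta>_def map_poly_pCons at0)
  have \<theta>_smult: "\<theta> (smult f F) = at0 f * \<theta> F" for f F
    using is_ring_homD(4)[OF \<theta>, of "[:f:]" F] by (simp add: \<theta>_const)
  have "\<theta> a = 0" "\<theta> B = 0"
    by (simp_all add: a_def B_def cross_def is_ring_homD(6)[OF \<theta>] \<theta>_lift \<theta>_const \<theta>_smult mult.commute)
  then have vanish: "at0 d = 0" if "[:d:] \<in> I" for d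
    using that \<theta>_const[of d] by (auto simp: I_def is_ring_homD(3,4)[OF \<theta>])
  define Z where "Z = ([:[:0, 1:]:] :: bipoly)"
  have XZ: "X Z = pderiv p"
    by (simp add: Z_def X_def dz_def map_poly_pCons pderiv_pCons one_pCons[symmetric])
  have at0_Z: "at0 Z = 0" by (simp add: Z_def at0_def map_poly_pCons)
  have at0_p: "at0 (pderiv p) \<noteq> 0"
  proof -
    have "coeff (at0 (pderiv p)) (degree p - 1) = of_nat (degree p)"
      using deg monic by (simp add: coeff_at0 coeff_pderiv)
    then show ?thesis using deg by auto
  qed
  \<comment> \<open>Applying \<open>g\<close> times \<open>X\<close> to Z^(k+1) \<eta> lowers the
    power of \<open>Z\<close> by one, and the cofactor restricts to (k+1)
    \<open>g * pderiv p * \<eta>\<close> on z = 0, where neither \<open>g\<close> nor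
    \<open>pderiv p\<close> is identically zero.\<close>
  have order: "at0 \<eta> = 0" if "[:Z ^ k * \<eta>:] \<in> I" for k \<eta>
    using that
  proof (induction k arbitrary: \<eta>)
    case 0
    then show ?case using vanish by simp
  next
    case (Suc k)
    have "g * X (Z ^ Suc k * \<eta>) = Z ^ k * (of_nat (Suc k) * g * pderiv p * \<eta> + Z * g * X \<eta>)"
      unfolding XD(2) derivation_power[OF X_derivation] XZ by (simp add: algebra_simps del: of_nat_Suc)
    then have "at0 (of_nat (Suc k) * g * pderiv p * \<eta> + Z * g * X \<eta>) = 0"
      using Suc.IH stable[OF Suc.prems] by simp
    then have "of_nat (Suc k) * at0 g * at0 (pderiv p) * at0 \<eta> = 0"
      by (simp add: at0(3,4,10) at0_Z del: of_nat_Suc)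
    then show ?case using g0 at0_p by (simp del: of_nat_Suc)
  qed
  have "\<exists>k \<eta>. d = Z ^ k * \<eta> \<and> at0 \<eta> \<noteq> 0" if "d \<noteq> 0" for d
    using that
  proof (induction "degree (lead_coeff d)" arbitrary: d rule: less_induct)
    case less
    show ?case
    proof (cases "at0 d = 0")
      case False
      then show ?thesis by (intro exI[of _ 0] exI[of _ d]) simp
    next
      case True
      then have "\<forall>k. \<exists>b. coeff d k = [:0, 1:] * b"
        by (metis coeff_0 coeff_at0 dvdE poly_eq_0_iff_dvd minus_zero)
      then obtain b where b: "\<And>k. coeff d k = [:0, 1:] * b k" by metis
      define d' where "d' = map_poly (\<lambda>c. SOME b. c = [:0, 1:] * b) d"
      have d'b: "coeff d' k = b k" for k
      proof -
        have "(SOME c. [:0, 1:] * b k = [:0, 1:] * c) = b k" for k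
          by (rule some_equality) (auto simp: mult_cancel_left simp del: mult_pCons_left)
        moreover have "(SOME c. (0::complex poly) = [:0, 1:] * c) = 0"
          by (rule some_equality) (auto simp: mult_eq_0_iff simp del: mult_pCons_left)
        ultimately show ?thesis using b[of k] by (simp only: d'_def coeff_map_poly)
      qed
      then have d: "d = Z * d'"
      proof -
        have "coeff d k = coeff (smult [:0, 1:] d') k" for k by (simp only: coeff_smult b d'b)
        then have "d = smult [:0, 1:] d'" by (rule poly_eqI)
        then show ?thesis by (simp add: Z_def)
      qed
      then have d'0: "d' \<noteq> 0" using less.prems by auto
      have "lead_coeff d = [:0, 1:] * lead_coeff d'" unfolding d by (simp add: lead_coeff_mult Z_def del: mult_pCons_left)
      then have "degree (lead_coeff d) = Suc (degree (lead_coeff d'))" using d'0 by (simp add: degree_mult_eq del: mult_pCons_left)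
      then obtain k \<eta> where "d' = Z ^ k * \<eta>" "at0 \<eta> \<noteq> 0" using less.hyps[OF _ d'0] by auto
      then show ?thesis using d by (intro exI[of _ "Suc k"] exI[of _ \<eta>]) (simp add: mult.assoc)
    qed
  qed
  then show False using order \<kappa> \<delta> by (metis pCons_0_0)
qed

text \<open>P(0, T) is congruent to \<open>P\<close> modulo \<open>a\<close>: the powers of
  \<open>P\<close> in the adic expansion of f(0, T) may be taken at (z, t), while the digits remain
  polynomials in T.\<close>

lemma lift_adic:
  assumes "f = (\<Sum>k\<le>n. P ^ k * \<mu> k)"
  shows "a dvd lift (at0 f) - (\<Sum>k\<le>n. smult (P ^ k) (lift (at0 (\<mu> k))))"
proof -
  have "lift (at0 f) = (\<Sum>k\<le>n. lift (at0 P) ^ k * lift (at0 (\<mu> k)))"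
    by (simp add: assms at0 lift)
  then have "lift (at0 f) - (\<Sum>k\<le>n. smult (P ^ k) (lift (at0 (\<mu> k)))) =
      (\<Sum>k\<le>n. (lift (at0 P) ^ k - [:P:] ^ k) * lift (at0 (\<mu> k)))"
    by (simp add: sum_subtractf[symmetric] left_diff_distrib is_ring_homD(7)[OF is_ring_hom_pCons, symmetric])
  also have "a dvd \<dots>"
    unfolding a_def by (intro dvd_sum dvd_mult2) (simp add: power_diff_sumr2)
  finally show ?thesis .
qed

lemma small_sum:
  assumes "\<And>k. degree (\<mu> k) < degree P"
  shows "degree (\<Sum>k\<le>(n::nat). smult (h k) (lift (at0 (\<mu> k)))) < degree P"
proof -
  have "degree (smult (h k) (lift (at0 (\<mu> k)))) \<le> degree P - 1" for k
  proof -
    have "degree (at0 (\<mu> k)) \<le> degree (\<mu> k)" unfolding at0_def by (rule degree_map_poly_leI) simp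
    then show ?thesis using assms[of k] degree_smult_le[of "h k" "lift (at0 (\<mu> k))"] by (simp add: degree_lift)
  qed
  then have "degree (\<Sum>k\<le>n. smult (h k) (lift (at0 (\<mu> k)))) \<le> degree P - 1" by (intro degree_sum_le) auto
  then show ?thesis using P(3) by simp
qed

text \<open>Since \<open>p\<close> is a first integral, p(0, T) is congruent to \<open>p\<close>
  modulo \<open>a\<close>. Replacing p(0, T) by the sum of \<open>lift_adic\<close> leaves a
  difference of degree below that of \<open>a\<close>, hence zero. Its coefficient of degree zero in
  T expresses \<open>p\<close> by powers of \<open>P\<close>.\<close>

theorem decomposition:
  obtains q where "p = poly (map_poly cc q) P"
proof -
  obtain n \<mu> where \<mu>: "p = (\<Sum>k\<le>n. P ^ k * \<mu> k)" "\<And>k. degree (\<mu> k) < degree P"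
    using adic_expansion[OF P(2,3)] by blast
  have "a dvd cross p 1"
    by (rule a_dvd_cross) (simp_all add: X_p XD at0)
  then have "a dvd lift (at0 p) - [:p:]" by (simp add: cross_def at0 lift smult_1_left)
  then have "a dvd (\<Sum>k\<le>n. smult (P ^ k) (lift (at0 (\<mu> k)))) - [:p:]"
  proof -
    have "(\<Sum>k\<le>n. smult (P ^ k) (lift (at0 (\<mu> k)))) - [:p:] =
       (lift (at0 p) - [:p:]) - (lift (at0 p) - (\<Sum>k\<le>n. smult (P ^ k) (lift (at0 (\<mu> k)))))" by simp
    then show ?thesis by (simp only: dvd_diff[OF \<open>a dvd lift (at0 p) - [:p:]\<close> lift_adic[OF \<mu>(1)]])
  qed
  moreover have "degree ((\<Sum>k\<le>n. smult (P ^ k) (lift (at0 (\<mu> k)))) - [:p:]) < degree a"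
    unfolding a_degree by (rule degree_diff_less) (use small_sum \<mu> P(3) in auto)
  ultimately have "(\<Sum>k\<le>n. smult (P ^ k) (lift (at0 (\<mu> k)))) - [:p:] = 0"
    by (rule monic_dvd_small[OF a_degree(2)])
  then have "(\<Sum>k\<le>n. smult (P ^ k) (lift (at0 (\<mu> k)))) = [:p:]" by (simp only: right_minus_eq)
  then have "coeff (\<Sum>k\<le>n. smult (P ^ k) (lift (at0 (\<mu> k)))) 0 = p" by simp
  then have p: "p = (\<Sum>k\<le>n. P ^ k * cc (coeff (at0 (\<mu> k)) 0))" by (simp add: coeff_sum coeff_lift)
  define q where "q = (\<Sum>k\<le>n. monom (coeff (at0 (\<mu> k)) 0) k)"
  have H: "is_ring_hom (map_poly cc)" by (rule is_ring_hom_map_poly[OF cc_hom])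
  have "poly (map_poly cc q) P = (\<Sum>k\<le>n. poly (map_poly cc (monom (coeff (at0 (\<mu> k)) 0) k)) P)"
    by (simp add: q_def is_ring_homD(8)[OF H] poly_sum)
  also have "\<dots> = (\<Sum>k\<le>n. P ^ k * cc (coeff (at0 (\<mu> k)) 0))" by (simp add: map_poly_monom cc poly_monom mult.commute)
  also have "\<dots> = p" by (rule p[symmetric])
  finally show ?thesis using that by metis
qed

text \<open>The hypothesis makes the quotient of the sum by \<open>pderiv P\<close> a rational first
  integral, so \<open>a_dvd_cross\<close> and \<open>lift_adic\<close> give an identity of
  polynomials of degree below \<open>degree P\<close> in T. The coefficient of degree
  \<open>degree P - 1\<close>, where \<open>pderiv P\<close> has the entry \<open>degree P\<close>,
  rewrites the sum with digits that are constant multiples of \<open>pderiv P\<close>; uniqueness of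
  digits does the rest.\<close>

theorem rational_integral_trivial:
  assumes w: "X (\<Sum>k\<le>n. P ^ k * \<mu> k) * pderiv P = (\<Sum>k\<le>n. P ^ k * \<mu> k) * X (pderiv P)"
    and \<mu>: "\<And>k. degree (\<mu> k) < degree P" and k: "k \<le> n"
  shows "of_nat (degree P) * \<mu> k = cc (coeff (at0 (\<mu> k)) (degree P - 1)) * pderiv P"
proof -
  define e where "e = degree P"
  have e0: "e > 0" using P(3) by (simp add: e_def)
  have lead: "coeff (pderiv P) (e - 1) = of_nat e" using P(2,3) by (simp add: coeff_pderiv e_def)
  have dP: "degree (pderiv P) < degree P" using P(3) by (simp add: degree_pderiv)
  define w where "w = (\<Sum>k\<le>n. P ^ k * \<mu> k)"
  have dvd: "a dvd cross w (pderiv P)"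
  proof (rule a_dvd_cross)
    have "coeff (at0 (pderiv P)) (e - 1) = of_nat e" unfolding coeff_at0 lead by simp
    then show "at0 (pderiv P) \<noteq> 0" using e0 by auto
  qed (use assms(1) in \<open>simp add: w_def\<close>)
  define S where "S = (\<Sum>k\<le>n. smult (pderiv P * P ^ k) (lift (at0 (\<mu> k)))) - smult w (lift (at0 (pderiv P)))"
  have "S = cross w (pderiv P) - smult (pderiv P) (lift (at0 w) - (\<Sum>k\<le>n. smult (P ^ k) (lift (at0 (\<mu> k)))))"
    by (simp add: S_def cross_def smult_diff_right smult_sum_right)
  then have "a dvd S" using dvd lift_adic[OF w_def] by (simp add: dvd_smult)
  moreover have "degree S < degree a"
    unfolding a_degree S_def
  proof (rule degree_diff_less)
    show "degree (\<Sum>k\<le>n. smult (pderiv P * P ^ k) (lift (at0 (\<mu> k)))) < degree P" by (rule small_sum[OF \<mu>])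
    have "degree (at0 (pderiv P)) \<le> degree (pderiv P)" unfolding at0_def by (rule degree_map_poly_leI) simp
    then show "degree (smult w (lift (at0 (pderiv P)))) < degree P"
      using dP degree_smult_le[of w "lift (at0 (pderiv P))"] by (simp add: degree_lift)
  qed
  ultimately have "S = 0" using monic_dvd_small[OF a_degree(2)] by blast
  then have "coeff S (e - 1) = 0" by simp
  moreover have "cc (poly (coeff (pderiv P) (e - 1)) 0) = of_nat e" unfolding lead by (simp add: cc)
  ultimately have "(\<Sum>k\<le>n. pderiv P * P ^ k * cc (coeff (at0 (\<mu> k)) (e - 1))) = w * of_nat e"
    by (simp add: S_def coeff_sum coeff_lift coeff_at0)
  then have "(\<Sum>k\<le>n. P ^ k * (of_nat e * \<mu> k - cc (coeff (at0 (\<mu> k)) (e - 1)) * pderiv P)) = 0"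
    by (simp add: w_def sum_distrib_left sum_distrib_right sum_subtractf algebra_simps)
  moreover have "degree (of_nat e * \<mu> k - cc (coeff (at0 (\<mu> k)) (e - 1)) * pderiv P) < degree P" for k
  proof (rule degree_diff_less)
    have "(of_nat e :: bipoly) = cc (of_nat e)" by (simp add: cc)
    then show "degree (of_nat e * \<mu> k) < degree P" using \<mu>[of k] degree_smult_le[of "[:of_nat e:]" "\<mu> k"] by (simp add: cc_def)
    show "degree (cc (coeff (at0 (\<mu> k)) (e - 1)) * pderiv P) < degree P"
      using dP degree_smult_le[of "[:coeff (at0 (\<mu> k)) (e - 1):]" "pderiv P"] by (simp add: cc_def)
  qed
  ultimately have "of_nat e * \<mu> k - cc (coeff (at0 (\<mu> k)) (e - 1)) * pderiv P = 0"
    by (rule adic_unique[OF P(2,3) _ _ k])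
  then show ?thesis by (simp add: e_def)
qed

end

section \<open>Primitives twisted by an exponential\<close>

definition slice :: "complex \<Rightarrow> bipoly \<Rightarrow> complex poly" where
  "slice z = map_poly (\<lambda>c. poly c z)"

definition ev :: "bipoly \<Rightarrow> complex \<Rightarrow> complex \<Rightarrow> complex" where
  "ev f z t = poly (slice z f) t"

lemma slice_hom: "is_ring_hom (slice z)"
  unfolding slice_def by (rule is_ring_hom_map_poly[OF is_ring_hom_poly])

lemmas slice = is_ring_homD[OF slice_hom]

lemma ev_hom: "is_ring_hom (\<lambda>f. ev f z t)"
  unfolding ev_def by (rule is_ring_hom_comp[OF is_ring_hom_poly slice_hom])

lemmas ev = is_ring_homD[OF ev_hom]

lemma coeff_slice: "coeff (slice z f) n = poly (coeff f n) z"
  by (simp add: slice_def coeff_map_poly)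

lemma degree_slice_le: "degree (slice z f) \<le> degree f"
  unfolding slice_def by (rule degree_map_poly_leI) simp

lemma degree_slice_monic:
  assumes "lead_coeff f = 1"
  shows "degree (slice z f) = degree f" "lead_coeff (slice z f) = 1"
proof -
  have 1: "coeff (slice z f) (degree f) = 1" using assms by (simp add: coeff_slice)
  then show "degree (slice z f) = degree f" using degree_slice_le by (metis le_antisym le_degree one_neq_zero)
  then show "lead_coeff (slice z f) = 1" using 1 by simp
qed

lemma pderiv_slice: "pderiv (slice z f) = slice z (pderiv f)"
  by (rule poly_eqI) (simp add: coeff_pderiv coeff_slice)

lemma ev_cc: "ev (cc c) z t = c"
  by (simp add: ev_def slice_def cc_def map_poly_pCons)

lemma ev_const: "ev [:c:] z t = poly c z"
  by (simp add: ev_def slice_def map_poly_pCons)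

lemma ev_sum: "degree f \<le> n \<Longrightarrow> ev f z t = (\<Sum>k\<le>n. poly (coeff f k) z * t ^ k)"
  using poly_eq_sum_le[OF order_trans[OF degree_slice_le]] by (simp add: ev_def coeff_slice)

lemma ev_deriv_t: "((\<lambda>t. ev f z t) has_field_derivative ev (pderiv f) z t) (at t)"
  unfolding ev_def pderiv_slice[symmetric] by (rule poly_DERIV)

lemma degree_dz_le: "degree (dz f) \<le> degree f"
  unfolding dz_def by (rule degree_map_poly_leI) simp

lemma ev_deriv_z: "((\<lambda>z. ev f z t) has_field_derivative ev (dz f) z t) (at z)"
proof -
  have "(\<lambda>z. ev f z t) = (\<lambda>z. \<Sum>k\<le>degree f. poly (coeff f k) z * t ^ k)"
    by (rule ext) (rule ev_sum, simp)
  moreover have "ev (dz f) z t = (\<Sum>k\<le>degree f. poly (pderiv (coeff f k)) z * t ^ k)"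
    using ev_sum[OF degree_dz_le, of f z t] by (simp add: coeff_dz)
  ultimately show ?thesis
    by (auto intro!: derivative_eq_intros DERIV_sum poly_DERIV)
qed

lemma bipoly_eqI:
  assumes "\<And>z. slice z f = slice z g"
  shows "f = g"
proof (intro poly_eqI)
  fix n m
  have "poly (coeff f n) z = poly (coeff g n) z" for z
    using assms[of z] coeff_slice by metis
  then have "coeff f n = coeff g n" using poly_eq_poly_eq_iff by blast
  then show "coeff (coeff f n) m = coeff (coeff g n) m" by simp
qed

lemma ev_eqI: "(\<And>z t. ev f z t = ev g z t) \<Longrightarrow> f = g"
  by (rule bipoly_eqI) (auto simp: ev_def poly_eq_poly_eq_iff[symmetric])

text \<open>Polynomial bounds are given by a single constant, serving as factor and as exponent.\<close>

lemma poly_bound_mono: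
  assumes "(K::nat) \<le> L" "(M::real) \<ge> 1"
  shows "real K * M ^ K \<le> real L * M ^ L"
  using assms by (intro mult_mono power_increasing) auto

lemma ev_bound: "\<exists>K::nat. \<forall>z t. norm (ev f z t) \<le> K * (1 + norm z + norm t) ^ K"
proof -
  have c: "\<exists>K::nat. \<forall>z. norm (poly q z) \<le> K * (1 + norm z) ^ K" for q :: "complex poly"
  proof -
    define K where "K = degree q + nat \<lceil>\<Sum>i\<le>degree q. norm (coeff q i)\<rceil>"
    have "norm (poly q z) \<le> K * (1 + norm z) ^ K" for z
    proof -
      have "norm (poly q z) \<le> (\<Sum>i\<le>degree q. norm (coeff q i) * norm z ^ i)"
        unfolding poly_altdef by (rule order_trans[OF norm_sum]) (simp add: norm_mult norm_power)
      also have "\<dots> \<le> (\<Sum>i\<le>degree q. norm (coeff q i) * (1 + norm z) ^ K)"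
      proof (intro sum_mono mult_left_mono)
        fix i assume "i \<in> {..degree q}"
        have "norm z ^ i \<le> (1 + norm z) ^ i" by (intro power_mono) auto
        also have "\<dots> \<le> (1 + norm z) ^ K" using \<open>i \<in> _\<close> by (intro power_increasing) (auto simp: K_def)
        finally show "norm z ^ i \<le> (1 + norm z) ^ K" .
      qed auto
      also have "\<dots> = (\<Sum>i\<le>degree q. norm (coeff q i)) * (1 + norm z) ^ K" by (simp add: sum_distrib_right)
      also have "\<dots> \<le> K * (1 + norm z) ^ K"
        by (intro mult_right_mono) (auto simp: K_def intro: order_trans[OF real_nat_ceiling_ge])
      finally show ?thesis .
    qed
    then show ?thesis by blast
  qed
  have "\<forall>i. \<exists>K::nat. \<forall>z. norm (poly (coeff f i) z) \<le> K * (1 + norm z) ^ K" using c by blast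
  then obtain K :: "nat \<Rightarrow> nat" where K: "\<And>i z. norm (poly (coeff f i) z) \<le> K i * (1 + norm z) ^ K i"
    unfolding choice_iff by blast
  define L where "L = (\<Sum>i\<le>degree f. K i) + degree f"
  have "norm (ev f z t) \<le> L * (1 + norm z + norm t) ^ L" for z t
  proof -
    define M where "M = 1 + norm z + norm t"
    have M: "M \<ge> 1" "1 + norm z \<le> M" "norm t \<le> M" by (auto simp: M_def)
    have "norm (ev f z t) \<le> (\<Sum>i\<le>degree f. norm (poly (coeff f i) z) * norm t ^ i)"
      unfolding ev_sum[OF order_refl] by (rule order_trans[OF norm_sum]) (simp add: norm_mult norm_power)
    also have "\<dots> \<le> (\<Sum>i\<le>degree f. real (K i) * M ^ L)"
    proof (intro sum_mono)
      fix i assume i: "i \<in> {..degree f}"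
      have "K i \<le> (\<Sum>i\<le>degree f. K i)" using i by (intro member_le_sum) auto
      then have "K i + i \<le> L" using i by (simp add: L_def)
      have "norm (poly (coeff f i) z) * norm t ^ i \<le> (K i * (1 + norm z) ^ K i) * M ^ i"
        using K M by (intro mult_mono power_mono) auto
      also have "\<dots> \<le> (K i * M ^ K i) * M ^ i"
        using M by (intro mult_right_mono mult_left_mono power_mono) auto
      also have "\<dots> = K i * M ^ (K i + i)" by (simp add: power_add)
      also have "\<dots> \<le> K i * M ^ L" using M \<open>K i + i \<le> L\<close> by (intro mult_left_mono power_increasing) auto
      finally show "norm (poly (coeff f i) z) * norm t ^ i \<le> real (K i) * M ^ L" .
    qed
    also have "\<dots> = real (\<Sum>i\<le>degree f. K i) * M ^ L" by (simp add: sum_distrib_right)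
    also have "\<dots> \<le> L * M ^ L" using M by (intro mult_right_mono) (auto simp: L_def)
    finally show ?thesis by (simp add: M_def)
  qed
  then show ?thesis by blast
qed

section \<open>Distance to the nearest root\<close>

lemma monic_root_list:
  fixes f :: "complex poly"
  assumes "lead_coeff f = 1"
  obtains xs where "f = (\<Prod>x\<leftarrow>xs. [:- x, 1:])" "length xs = degree f"
proof -
  have "\<exists>xs. f = (\<Prod>x\<leftarrow>xs. [:- x, 1:]) \<and> length xs = degree f"
    using assms
  proof (induction "degree f" arbitrary: f)
    case 0
    then have "f = 1" by (metis degree_eq_zeroE lead_coeff_pCons(2) one_pCons pCons_0_0 coeff_pCons_0 zero_neq_one)
    then show ?case by (intro exI[of _ "[]"]) simp
  next
    case (Suc n)
    then obtain x where "poly f x = 0"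
      using Fundamental_Theorem_Algebra.fundamental_theorem_of_algebra[of f] by (auto simp: constant_degree)
    then obtain g where g: "f = [:- x, 1:] * g" by (auto simp: poly_eq_0_iff_dvd elim: dvdE)
    have "g \<noteq> 0" using g Suc.prems by auto
    then have "degree f = Suc (degree g)" unfolding g by (subst degree_mult_eq) auto
    moreover have "lead_coeff g = 1" using Suc.prems unfolding g lead_coeff_mult by simp
    ultimately obtain xs where "g = (\<Prod>x\<leftarrow>xs. [:- x, 1:])" "length xs = degree g"
      using Suc.hyps(1)[of g] Suc.hyps(2) by auto
    then show ?case using g \<open>degree f = Suc (degree g)\<close> by (intro exI[of _ "x # xs"]) simp
  qed
  then show ?thesis using that by blast
qed

lemma poly_root_list: "poly (\<Prod>x\<leftarrow>xs. [:- x, 1:]) t = (\<Prod>x\<leftarrow>xs. t - (x::complex))"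
  by (induction xs) (auto simp: algebra_simps)

lemma root_list_iff: "poly (\<Prod>x\<leftarrow>xs. [:- x, 1:]) t = 0 \<longleftrightarrow> (t::complex) \<in> set xs"
  by (induction xs) auto

text \<open>The product of the distances from \<open>t\<close> to the roots of f - v is |f(t) - v|,
  so the nearest root is no further away than their geometric mean.\<close>

lemma near_root:
  fixes f :: "complex poly"
  assumes f: "lead_coeff f = 1" "degree f > 0"
  obtains t' where "poly f t' = v" "norm (t - t') ^ degree f \<le> norm (poly f t - v)"
proof -
  define g where "g = f - [:v:]"
  have dg: "degree g = degree f" "lead_coeff g = 1"
  proof -
    show *: "degree g = degree f" unfolding g_def diff_conv_add_uminus
      by (rule degree_add_eq_left) (use f in simp)
    show "lead_coeff g = 1" unfolding * using f by (simp add: g_def coeff_pCons split: nat.split)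
  qed
  obtain xs where xs: "g = (\<Prod>x\<leftarrow>xs. [:- x, 1:])" "length xs = degree f"
    using monic_root_list[OF dg(2)] dg(1) by metis
  have ne: "set xs \<noteq> {}" using xs(2) f(2) by auto
  obtain x where x: "x \<in> set xs" "\<And>y. y \<in> set xs \<Longrightarrow> norm (t - x) \<le> norm (t - y)"
    using arg_min_if_finite[OF finite_set ne, of "\<lambda>x. norm (t - x)"] by (metis linorder_not_less)
  have aux: "norm (t - x) ^ length ys \<le> norm (\<Prod>x\<leftarrow>ys. t - x)" if "set ys \<subseteq> set xs" for ys
    using that x(2) by (induction ys) (auto simp: norm_mult intro!: mult_mono)
  then have "norm (t - x) ^ degree f \<le> norm (poly g t)"
    using aux[OF order_refl] by (simp only: xs poly_root_list)
  moreover have "poly g x = 0" using x(1) unfolding xs(1) root_list_iff .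
  ultimately show ?thesis using that[of x] by (simp add: g_def)
qed

section \<open>Primitives of polynomials and their limits\<close>

definition int_t :: "bipoly \<Rightarrow> bipoly" where
  "int_t f = (\<Sum>k\<le>degree f. monom (smult (1 / of_nat (Suc k)) (coeff f k)) (Suc k))"

lemma pderiv_int_t: "pderiv (int_t f) = f"
proof -
  have "pderiv (monom (smult (1 / of_nat (Suc k)) (coeff f k)) (Suc k)) = monom (coeff f k) k" for k
    by (simp add: pderiv_monom smult_monom mult_monom of_nat_poly del: of_nat_Suc)
  then show ?thesis
    by (simp add: int_t_def derivationD(8)[OF pderiv_derivation] poly_as_sum_of_monoms)
qed

lemma ev_int_t_0: "ev (int_t f) z 0 = 0"
  by (simp add: int_t_def ev(8)) (simp add: ev_def slice_def map_poly_monom poly_monom)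

definition int_z :: "complex poly \<Rightarrow> complex poly" where
  "int_z q = (\<Sum>k\<le>degree q. monom (coeff q k / of_nat (Suc k)) (Suc k))"

lemma pderiv_int_z: "pderiv (int_z q) = q"
proof -
  have "pderiv (monom (coeff q k / of_nat (Suc k)) (Suc k)) = monom (coeff q k) k" for k
    by (simp add: pderiv_monom del: of_nat_Suc)
  then show ?thesis
    by (simp add: int_z_def derivationD(8)[OF pderiv_derivation] poly_as_sum_of_monoms)
qed

lemma poly_int_z_0: "poly (int_z q) 0 = 0"
  by (simp add: int_z_def poly_sum poly_monom)

lemma dz_pderiv_commute: "dz (pderiv f) = pderiv (dz f)"
  by (intro poly_eqI) (simp add: coeff_dz coeff_pderiv pderiv_mult derivationD(7)[OF pderiv_derivation] del: of_nat_Suc)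

lemma dz_const: "dz [:c:] = [:pderiv c:]"
  by (simp add: dz_def map_poly_pCons)

lemma bipoly_eq_from_t_derivative:
  assumes "pderiv f = pderiv g" "\<And>z. ev f z 0 = ev g z 0"
  shows "f = g"
proof -
  have "pderiv (f - g) = 0" using assms(1) by (simp add: pderiv_diff)
  then obtain c where c: "f - g = [:c:]" by (auto simp: pderiv_eq_0_iff elim: degree_eq_zeroE)
  have "poly c z = 0" for z using ev(6)[of f g z 0] assms(2) unfolding c ev_const by simp
  then have "c = 0" using poly_all_0_iff_0 by blast
  then show ?thesis using c by simp
qed

lemma antiderivative_bound:
  fixes F f :: "complex \<Rightarrow> complex"
  assumes "\<And>t. norm t \<le> \<rho> \<Longrightarrow> (F has_field_derivative f t) (at t)" "F 0 = 0"
    and "\<And>t. norm t \<le> \<rho> \<Longrightarrow> norm (f t) \<le> B" "norm t \<le> \<rho>"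
  shows "norm (F t) \<le> B * \<rho>"
proof -
  have "norm (F t - F 0) \<le> B * norm (t - 0)"
  proof (rule field_differentiable_bound[of "cball 0 \<rho>"])
    show "(F has_field_derivative f x) (at x within cball 0 \<rho>)" if "x \<in> cball 0 \<rho>" for x
      using assms(1) that by (auto intro: has_field_derivative_at_within)
  qed (use assms in \<open>auto intro: order_trans[OF norm_ge_zero]\<close>)
  moreover have "B \<ge> 0" using assms(3)[OF assms(4)] norm_ge_zero order_trans by blast
  ultimately show ?thesis using assms(2,4) by (smt (verit) diff_zero mult_left_mono)
qed

lemma uniform_limit_derivative:
  fixes f :: "nat \<Rightarrow> complex \<Rightarrow> complex"
  assumes d: "\<And>n x. (f n has_field_derivative f' n x) (at x)"
    and u: "\<And>\<rho>. uniform_limit (cball 0 \<rho>) f g sequentially"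
    and l: "(\<lambda>n. f' n x) \<longlonglongrightarrow> g'"
  shows "(g has_field_derivative g') (at x)"
proof -
  have du: "\<exists>d. 0 < d \<and> cball y d \<subseteq> UNIV \<and> uniform_limit (cball y d) f g sequentially" for y :: complex
  proof (intro exI[of _ 1] conjI uniform_limit_on_subset[OF u[of "norm y + 1"]])
    show "cball y 1 \<subseteq> cball 0 (norm y + 1)"
    proof
      fix x assume "x \<in> cball y 1"
      then show "x \<in> cball 0 (norm y + 1)"
        using norm_triangle_sub[of x y] by (simp add: dist_norm norm_minus_commute)
    qed
  qed auto
  have "\<exists>h. \<forall>x\<in>UNIV. (g has_field_derivative h x) (at x) \<and> (\<lambda>n. f' n x) \<longlonglongrightarrow> h x"
    by (rule has_complex_derivative_uniform_sequence[OF open_UNIV]) (rule d, rule du)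
  then obtain h where h: "\<forall>x\<in>UNIV. (g has_field_derivative h x) (at x) \<and> (\<lambda>n. f' n x) \<longlonglongrightarrow> h x" ..
  then have "h x = g'" using LIMSEQ_unique[OF _ l] by blast
  then show ?thesis using h by auto
qed

text \<open>The assumption is the closedness of \<open>exp (- p) (r dt + u dz)\<close> with the
  exponential factor divided out.\<close>

locale twisted = plane +
  fixes r u :: bipoly
  assumes closed: "dz r - dz p * r = pderiv u - pderiv p * u"
begin

definition e :: "nat \<Rightarrow> bipoly" where "e k = cc (1 / fact k) * (- p) ^ k"

text \<open>One term of the exponential series, integrated along t = 0 in z and then in t. In this
  way \<open>G\<close> is a locally uniform limit of polynomials \<open>G_approx n\<close>, whose
  remainders modulo \<open>P - cc \<beta>\<close> are later used to interpolate \<open>G\<close> on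
  fibres.\<close>

definition G_term :: "nat \<Rightarrow> bipoly" where
  "G_term k = int_t (r * e k) + [:int_z (coeff (u * e k) 0):]"

definition G_approx :: "nat \<Rightarrow> bipoly" where "G_approx n = (\<Sum>k<n. G_term k)"

definition G :: "complex \<Rightarrow> complex \<Rightarrow> complex" where "G z t = suminf (\<lambda>k. ev (G_term k) z t)"

lemma ev_e: "ev (e k) z t = (- ev p z t) ^ k /\<^sub>R fact k"
  by (simp add: e_def ev ev_cc scaleR_conv_of_real divide_inverse)

lemma ev_e_sums: "(\<lambda>k. ev (e k) z t) sums exp (- ev p z t)"
  unfolding ev_e by (rule exp_converges)

lemma pderiv_e: "pderiv (e (Suc k)) = - pderiv p * e k" and dz_e: "dz (e (Suc k)) = - dz p * e k"
proof -
  have f: "cc (1 / fact (Suc k)) * of_nat (Suc k) = cc (1 / fact k)"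
    by (simp add: cc(10)[symmetric] cc(4)[symmetric] del: of_nat_Suc)
  have "d (e (Suc k)) = - d p * e k" if d: "derivation d" "\<And>c. d (cc c) = 0" for d
  proof -
    have "d (e (Suc k)) = (cc (1 / fact (Suc k)) * of_nat (Suc k)) * ((- p) ^ k * - d p)"
      unfolding e_def derivationD(2)[OF d(1)] derivation_power[OF d(1)] d(2) derivationD(5)[OF d(1)]
      by (simp add: mult.assoc del: of_nat_Suc)
    then show ?thesis unfolding f by (simp add: e_def mult_ac)
  qed
  from this[OF pderiv_derivation] this[OF dz_derivation]
  show "pderiv (e (Suc k)) = - pderiv p * e k" "dz (e (Suc k)) = - dz p * e k"
    by (simp_all add: cc_def dz_def map_poly_pCons)
qed

lemma e_0: "e 0 = 1" by (simp add: e_def cc)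

text \<open>For bounded z and t each term is dominated by a term of the exponential series of a
  bound for \<open>p\<close>. The second estimate controls the error that truncation causes in the
  derivative by z.\<close>

lemma G_term_bound:
  "\<exists>A M::real. \<forall>k z t. norm z \<le> \<rho> \<longrightarrow> norm t \<le> \<rho> \<longrightarrow>
    norm (ev (G_term k) z t) \<le> A * (M ^ k /\<^sub>R fact k) \<and>
    norm (ev (int_t (v * e k)) z t) \<le> A * (M ^ k /\<^sub>R fact k)"
proof -
  have b: "\<exists>B. \<forall>z t. norm z \<le> \<rho> \<longrightarrow> norm t \<le> \<rho> \<longrightarrow> norm (ev f z t) \<le> B" for f
  proof -
    obtain K :: nat where K: "\<And>z t. norm (ev f z t) \<le> K * (1 + norm z + norm t) ^ K" using ev_bound[of f] by blast
    have "norm (ev f z t) \<le> K * (1 + \<rho> + \<rho>) ^ K" if "norm z \<le> \<rho>" "norm t \<le> \<rho>" for z t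
    proof -
      have "1 + norm z + norm t \<le> 1 + \<rho> + \<rho>" using that by linarith
      then have "(1 + norm z + norm t) ^ K \<le> (1 + \<rho> + \<rho>) ^ K" by (rule power_mono) simp
      then show ?thesis using K[of z t] mult_left_mono[of "(1 + norm z + norm t) ^ K" "(1 + \<rho> + \<rho>) ^ K" "real K"] by linarith
    qed
    then show ?thesis by blast
  qed
  obtain M where M: "\<And>z t. norm z \<le> \<rho> \<Longrightarrow> norm t \<le> \<rho> \<Longrightarrow> norm (ev p z t) \<le> M" using b by metis
  obtain R where R: "\<And>z t. norm z \<le> \<rho> \<Longrightarrow> norm t \<le> \<rho> \<Longrightarrow> norm (ev r z t) \<le> R" using b by metis
  obtain U where U: "\<And>z t. norm z \<le> \<rho> \<Longrightarrow> norm t \<le> \<rho> \<Longrightarrow> norm (ev u z t) \<le> U" using b by metis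
  obtain V where V: "\<And>z t. norm z \<le> \<rho> \<Longrightarrow> norm t \<le> \<rho> \<Longrightarrow> norm (ev v z t) \<le> V" using b by metis
  define M' where "M' = max 0 M"
  have prod: "norm (ev (f * e k) z t) \<le> max 0 B * (M' ^ k /\<^sub>R fact k)"
    if "norm (ev f z t) \<le> B" "norm z \<le> \<rho>" "norm t \<le> \<rho>" for f B k z t
  proof -
    have "norm (ev p z t) ^ k \<le> M' ^ k" using M[OF that(2,3)] by (intro power_mono) (auto simp: M'_def)
    then have "norm (ev (e k) z t) \<le> M' ^ k /\<^sub>R fact k"
      unfolding ev_e by (simp add: norm_power divide_right_mono)
    then show ?thesis unfolding ev(4) norm_mult using that(1) by (intro mult_mono) auto
  qed
  have int: "norm (ev (int_t (f * e k)) z t) \<le> max 0 B * (M' ^ k /\<^sub>R fact k) * \<rho>"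
    if B: "\<And>z t. norm z \<le> \<rho> \<Longrightarrow> norm t \<le> \<rho> \<Longrightarrow> norm (ev f z t) \<le> B" and zt: "norm z \<le> \<rho>" "norm t \<le> \<rho>" for f B k z t
    by (rule antiderivative_bound[where F = "\<lambda>t. ev (int_t (f * e k)) z t"])
      (use ev_deriv_t[of "int_t (f * e k)"] pderiv_int_t ev_int_t_0 prod B zt in auto)
  have intz: "norm (poly (int_z (coeff (u * e k) 0)) z) \<le> max 0 U * (M' ^ k /\<^sub>R fact k) * \<rho>" if "norm z \<le> \<rho>" for k z
  proof (rule antiderivative_bound[where F = "\<lambda>z. poly (int_z (coeff (u * e k) 0)) z"])
    show "((\<lambda>z. poly (int_z (coeff (u * e k) 0)) z) has_field_derivative ev (u * e k) w 0) (at w)" for w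
      using poly_DERIV[of "int_z (coeff (u * e k) 0)" w] pderiv_int_z[of "coeff (u * e k) 0"]
      by (simp add: ev_def poly_0_coeff_0 coeff_slice)
    show "norm (ev (u * e k) w 0) \<le> max 0 U * (M' ^ k /\<^sub>R fact k)" if "norm w \<le> \<rho>" for w
      by (rule prod[OF U]) (use that order_trans[OF norm_ge_zero that] in auto)
  qed (use that in \<open>auto simp: poly_int_z_0\<close>)
  define A where "A = (max 0 R + max 0 U + max 0 V) * max 0 \<rho>"
  show ?thesis
  proof (rule exI[of _ A], rule exI[of _ M'], intro allI impI conjI)
    fix k and z t :: complex assume zt: "norm z \<le> \<rho>" "norm t \<le> \<rho>"
    then have \<rho>: "max 0 \<rho> = \<rho>" using norm_ge_zero[of z] by linarith
    have q: "(M' ^ k /\<^sub>R fact k) \<ge> 0" by (simp add: M'_def)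
    have \<rho>0: "\<rho> \<ge> 0" using \<rho> by simp
    show "norm (ev (G_term k) z t) \<le> A * (M' ^ k /\<^sub>R fact k)"
    proof -
      have "norm (ev (G_term k) z t) \<le> max 0 R * (M' ^ k /\<^sub>R fact k) * \<rho> + max 0 U * (M' ^ k /\<^sub>R fact k) * \<rho>"
        unfolding G_term_def ev(3) ev_const
        by (rule order_trans[OF norm_triangle_ineq]) (intro add_mono int[OF R zt] intz zt)
      also have "\<dots> \<le> (max 0 R + max 0 U + max 0 V) * (M' ^ k /\<^sub>R fact k) * \<rho>"
        unfolding distrib_right using q \<rho>0 by simp
      finally show ?thesis by (simp add: A_def \<rho> mult_ac)
    qed
    have "max 0 V * (M' ^ k /\<^sub>R fact k) * \<rho> \<le> (max 0 R + max 0 U + max 0 V) * (M' ^ k /\<^sub>R fact k) * \<rho>"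
      unfolding distrib_right using q \<rho>0 by simp
    then show "norm (ev (int_t (v * e k)) z t) \<le> A * (M' ^ k /\<^sub>R fact k)"
      using int[OF V zt, of k] by (simp add: A_def \<rho> mult_ac)
  qed
qed

lemma G_uniform: "uniform_limit (cball 0 \<rho> \<times> cball 0 \<rho>) (\<lambda>n (z, t). ev (G_approx n) z t) (\<lambda>(z, t). G z t) sequentially"
proof -
  obtain A M :: real where "\<forall>k z t. norm z \<le> \<rho> \<longrightarrow> norm t \<le> \<rho> \<longrightarrow>
    norm (ev (G_term k) z t) \<le> A * (M ^ k /\<^sub>R fact k) \<and>
    norm (ev (int_t (0 * e k)) z t) \<le> A * (M ^ k /\<^sub>R fact k)"
    using G_term_bound[where \<rho> = \<rho> and v = 0] by (elim exE)
  then have M: "norm (ev (G_term k) z t) \<le> A * (M ^ k /\<^sub>R fact k)" if "norm z \<le> \<rho>" "norm t \<le> \<rho>" for k z t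
    using that by simp
  have "summable (\<lambda>k. A * (M ^ k /\<^sub>R fact k))"
    by (intro summable_mult sums_summable[OF exp_converges])
  then have "uniform_limit (cball 0 \<rho> \<times> cball 0 \<rho>) (\<lambda>n x. \<Sum>k<n. (\<lambda>(z, t). ev (G_term k) z t) x)
     (\<lambda>x. suminf (\<lambda>k. (\<lambda>(z, t). ev (G_term k) z t) x)) sequentially"
    by (rule Weierstrass_m_test[rotated]) (use M in auto)
  then show ?thesis
    by (simp add: G_def G_approx_def ev split_def)
qed

lemma G_approx_t: "pderiv (G_approx n) = r * (\<Sum>k<n. e k)"
  by (simp add: G_approx_def G_term_def derivationD(8)[OF pderiv_derivation] pderiv_add pderiv_int_t sum_distrib_left)

text \<open>A truncated exponential series reproduces itself under differentiation except for its
  last term. Closedness of the form therefore holds for the truncation up to a multiple of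
  \<open>e n\<close>, whose primitive is the correction.\<close>

lemma dz_G_term_sum:
  "dz (G_approx (Suc n)) = u * (\<Sum>k<Suc n. e k) + int_t ((r * dz p - u * pderiv p) * e n)"
proof (rule bipoly_eq_from_t_derivative)
  define E where "E = (\<Sum>k<Suc n. e k)"
  have E: "E = (\<Sum>k<n. e k) + e n" by (simp add: E_def)
  have dE: "d E = - d p * (E - e n)" if "derivation d" "\<And>k. d (e (Suc k)) = - d p * e k" for d
  proof -
    have "E = 1 + (\<Sum>k<n. e (Suc k))" unfolding E_def sum.lessThan_Suc_shift by (simp add: e_0)
    then have "d E = d (1 + (\<Sum>k<n. e (Suc k)))" by (simp only:)
    also have "\<dots> = - d p * (\<Sum>k<n. e k)"
      by (simp only: derivationD[OF that(1)] that(2) sum_distrib_left add_0_left)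
    also have "(\<Sum>k<n. e k) = E - e n" by (simp add: E)
    finally show ?thesis .
  qed
  note pE = dE[OF pderiv_derivation pderiv_e] and zE = dE[OF dz_derivation dz_e]
  have "pderiv (dz (G_approx (Suc n))) = dz (r * E)"
    by (simp add: dz_pderiv_commute[symmetric] G_approx_t E_def)
  also have "\<dots> = (dz r - dz p * r) * E + r * dz p * e n"
    unfolding derivationD(2)[OF dz_derivation] zE by (simp add: algebra_simps)
  also have "\<dots> = pderiv u * E + u * pderiv E + (r * dz p - u * pderiv p) * e n"
    unfolding closed pE by (simp add: algebra_simps)
  finally show "pderiv (dz (G_approx (Suc n))) = pderiv (u * (\<Sum>k<Suc n. e k) + int_t ((r * dz p - u * pderiv p) * e n))"
    by (simp add: E_def[symmetric] pderiv_add pderiv_int_t derivationD(2)[OF pderiv_derivation] del: sum.lessThan_Suc)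
next
  fix z
  have "ev (dz (int_t f)) z 0 = 0" for f
  proof -
    have "((\<lambda>z. ev (int_t f) z 0) has_field_derivative ev (dz (int_t f)) z 0) (at z)" by (rule ev_deriv_z)
    then show ?thesis unfolding ev_int_t_0 using DERIV_const DERIV_unique by blast
  qed
  then have "ev (dz (G_term k)) z 0 = ev (u * e k) z 0" for k
    by (simp add: G_term_def derivationD(1)[OF dz_derivation] ev dz_const ev_const pderiv_int_z)
      (simp add: ev_def poly_0_coeff_0 coeff_slice coeff_mult)
  then have "ev (dz (G_approx (Suc n))) z 0 = (\<Sum>k<Suc n. ev (u * e k) z 0)"
    by (simp only: G_approx_def derivationD(8)[OF dz_derivation] ev(8))
  also have "\<dots> = ev (u * (\<Sum>k<Suc n. e k)) z 0" by (simp only: sum_distrib_left ev(8))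
  finally show "ev (dz (G_approx (Suc n))) z 0 = ev (u * (\<Sum>k<Suc n. e k) + int_t ((r * dz p - u * pderiv p) * e n)) z 0"
    by (simp only: ev(3) ev_int_t_0 add_0_right)
qed

lemma G_approx_t_limit: "(\<lambda>n. ev (pderiv (G_approx n)) z t) \<longlonglongrightarrow> ev r z t * exp (- ev p z t)"
  unfolding G_approx_t ev using ev_e_sums by (intro tendsto_mult tendsto_const) (simp add: sums_def)

lemma G_approx_z_limit: "(\<lambda>n. ev (dz (G_approx n)) z t) \<longlonglongrightarrow> ev u z t * exp (- ev p z t)"
proof -
  define \<rho> where "\<rho> = max (norm z) (norm t)"
  define w where "w = r * dz p - u * pderiv p"
  obtain A M :: real where "\<forall>k z t. norm z \<le> \<rho> \<longrightarrow> norm t \<le> \<rho> \<longrightarrow>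
    norm (ev (G_term k) z t) \<le> A * (M ^ k /\<^sub>R fact k) \<and>
    norm (ev (int_t (w * e k)) z t) \<le> A * (M ^ k /\<^sub>R fact k)"
    using G_term_bound[where \<rho> = \<rho> and v = w] by (elim exE)
  then have M: "norm (ev (int_t (w * e k)) z t) \<le> A * (M ^ k /\<^sub>R fact k)" for k
    by (simp add: \<rho>_def)
  have "(\<lambda>k. A * (M ^ k /\<^sub>R fact k)) \<longlonglongrightarrow> A * 0"
    by (intro tendsto_mult tendsto_const summable_LIMSEQ_zero sums_summable[OF exp_converges])
  then have l0: "(\<lambda>k. A * (M ^ k /\<^sub>R fact k)) \<longlonglongrightarrow> 0" by simp
  have 0: "(\<lambda>k. ev (int_t (w * e k)) z t) \<longlonglongrightarrow> 0"
    by (rule Lim_null_comparison[OF always_eventually l0]) (simp only: M simp_thms)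
  have "(\<lambda>n. ev u z t * (\<Sum>k<Suc n. ev (e k) z t) + ev (int_t (w * e n)) z t) \<longlonglongrightarrow> ev u z t * exp (- ev p z t) + 0"
    using ev_e_sums[of z t, unfolded sums_def] by (intro tendsto_add tendsto_mult tendsto_const 0 LIMSEQ_Suc)
  then have "(\<lambda>n. ev (dz (G_approx (Suc n))) z t) \<longlonglongrightarrow> ev u z t * exp (- ev p z t)"
    unfolding dz_G_term_sum w_def[symmetric] by (simp only: ev add_0_right)
  then show ?thesis by (rule LIMSEQ_imp_Suc)
qed

lemma G_uniform_t: "uniform_limit (cball 0 \<rho>) (\<lambda>n t. ev (G_approx n) z t) (G z) sequentially"
  and G_uniform_z: "uniform_limit (cball 0 \<rho>) (\<lambda>n z. ev (G_approx n) z t) (\<lambda>z. G z t) sequentially"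
proof -
  have *: "uniform_limit A (\<lambda>n x. ev (G_approx n) (h x) (k x)) (\<lambda>x. G (h x) (k x)) sequentially"
    if "\<And>x. x \<in> A \<Longrightarrow> norm (h x) \<le> \<sigma> \<and> norm (k x) \<le> \<sigma>" for A \<sigma> and h k :: "complex \<Rightarrow> complex"
    unfolding uniform_limit_iff
  proof (intro allI impI)
    fix \<epsilon> :: real assume "\<epsilon> > 0"
    from G_uniform[of \<sigma>, unfolded uniform_limit_iff, rule_format, OF this]
    show "\<forall>\<^sub>F n in sequentially. \<forall>x\<in>A. dist (ev (G_approx n) (h x) (k x)) (G (h x) (k x)) < \<epsilon>"
      by (rule eventually_mono) (use that in auto)
  qed
  show "uniform_limit (cball 0 \<rho>) (\<lambda>n t. ev (G_approx n) z t) (G z) sequentially"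
    using *[of "cball 0 \<rho>" "\<lambda>t. z" "max (norm z) \<rho>" "\<lambda>t. t"] by (simp add: le_max_iff_disj)
  show "uniform_limit (cball 0 \<rho>) (\<lambda>n z. ev (G_approx n) z t) (\<lambda>z. G z t) sequentially"
    using *[of "cball 0 \<rho>" "\<lambda>z. z" "max (norm t) \<rho>" "\<lambda>z. t"] by (simp add: le_max_iff_disj)
qed

lemma G_deriv_t: "((\<lambda>t. G z t) has_field_derivative ev r z t * exp (- ev p z t)) (at t)"
  by (rule uniform_limit_derivative[OF ev_deriv_t G_uniform_t G_approx_t_limit])

lemma G_deriv_z: "((\<lambda>z. G z t) has_field_derivative ev u z t * exp (- ev p z t)) (at z)"
  by (rule uniform_limit_derivative[OF ev_deriv_z G_uniform_z G_approx_z_limit])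

end

section \<open>Limits of the primitive\<close>

text \<open>Since \<delta> may depend on \<epsilon>, this is the limit for t tending to infinity
  with direction tending to \<xi>; no sector of fixed opening is required.\<close>

definition sector_limit :: "(complex \<Rightarrow> complex) \<Rightarrow> complex \<Rightarrow> complex \<Rightarrow> bool" where
  "sector_limit g \<xi> c \<longleftrightarrow> (\<forall>\<epsilon>>0. \<exists>\<delta>>0. \<exists>R. \<forall>t. norm t \<ge> R \<longrightarrow> norm (t - complex_of_real (norm t) * \<xi>) \<le> \<delta> * norm t \<longrightarrow> norm (g t - c) < \<epsilon>)"

lemma poly_bound_compose:
  fixes K K' :: nat
  shows "\<exists>L::nat. \<forall>(M::real) (x::real). M \<ge> 1 \<longrightarrow> 0 \<le> x \<longrightarrow> x \<le> K' * M ^ K' \<longrightarrow> real K * (M + x) ^ K \<le> real L * M ^ L"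
proof (rule exI[of _ "K * Suc K' ^ K + Suc K' * K"], intro allI impI)
  fix M x :: real assume M: "M \<ge> 1" and x: "0 \<le> x" "x \<le> K' * M ^ K'"
  have "M + x \<le> M ^ Suc K' + K' * M ^ Suc K'"
    using x M power_increasing[of 1 "Suc K'" M] power_increasing[of K' "Suc K'" M] mult_left_mono[of "M ^ K'" "M ^ Suc K'" "real K'"]
    by (intro add_mono) auto
  also have "\<dots> = real (Suc K') * M ^ Suc K'" by (simp add: algebra_simps)
  finally have "real K * (M + x) ^ K \<le> real K * (real (Suc K') * M ^ Suc K') ^ K"
    using M x by (intro mult_left_mono power_mono) auto
  also have "\<dots> = real (K * Suc K' ^ K) * M ^ (Suc K' * K)"
    by (simp only: power_mult_distrib power_mult of_nat_mult of_nat_power mult.assoc)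
  also have "\<dots> \<le> real (K * Suc K' ^ K + Suc K' * K) * M ^ (K * Suc K' ^ K + Suc K' * K)"
    using M by (intro mult_mono power_increasing) auto
  finally show "real K * (M + x) ^ K \<le> real (K * Suc K' ^ K + Suc K' * K) * M ^ (K * Suc K' ^ K + Suc K' * K)" .
qed

lemma ev_bound_degree:
  assumes "degree f \<le> n" "Z \<ge> 0"
  shows "\<exists>B\<ge>0. \<forall>z t. norm z \<le> Z \<longrightarrow> norm t \<ge> 1 \<longrightarrow> norm (ev f z t) \<le> B * norm t ^ n"
proof -
  have "\<exists>b. \<forall>z. norm z \<le> Z \<longrightarrow> norm (poly q z) \<le> b" for q :: "complex poly"
  proof -
    have "compact (poly q ` cball 0 Z)" by (intro compact_continuous_image continuous_intros compact_cball)
    then obtain b where "\<forall>y\<in>poly q ` cball 0 Z. norm y \<le> b" using compact_imp_bounded bounded_iff by blast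
    then show ?thesis by (intro exI[of _ b]) auto
  qed
  then have "\<forall>k. \<exists>b. \<forall>z. norm z \<le> Z \<longrightarrow> norm (poly (coeff f k) z) \<le> b" by blast
  then obtain b where b: "\<And>k z. norm z \<le> Z \<Longrightarrow> norm (poly (coeff f k) z) \<le> b k" unfolding choice_iff by blast
  have b0: "b k \<ge> 0" for k using b[of 0 k] assms(2) norm_ge_zero order_trans norm_zero by metis
  show ?thesis
  proof (intro exI[of _ "\<Sum>k\<le>n. b k"] conjI allI impI sum_nonneg b0)
    fix z t :: complex assume zt: "norm z \<le> Z" "norm t \<ge> 1"
    have "norm (ev f z t) \<le> (\<Sum>k\<le>n. norm (poly (coeff f k) z) * norm t ^ k)"
      unfolding ev_sum[OF assms(1)] by (rule order_trans[OF norm_sum]) (simp add: norm_mult norm_power)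
    also have "\<dots> \<le> (\<Sum>k\<le>n. b k * norm t ^ n)"
      using b[OF zt(1)] zt(2) b0 by (intro sum_mono mult_mono power_increasing) auto
    finally show "norm (ev f z t) \<le> (\<Sum>k\<le>n. b k) * norm t ^ n" by (simp add: sum_distrib_right)
  qed
qed

context plane
begin

definition low :: bipoly where "low = p - monom 1 (degree p)"

lemma low_degree: "degree low \<le> degree p - 1"
proof -
  have "coeff low k = 0" if "k > degree p - 1" for k
    using that monic deg coeff_eq_0[of p k] by (cases "k = degree p") (auto simp: low_def)
  then show ?thesis by (intro degree_le) auto
qed

lemma ev_monom: "ev (monom 1 n) z t = t ^ n"
  by (simp add: ev_def slice_def map_poly_monom poly_monom)

lemma ev_p_low: "ev p z t = t ^ degree p + ev low z t"
  by (simp add: low_def ev ev_monom)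

text \<open>For |t| > 1, dividing \<open>ev p z t - ev low z t\<close>, which is
  \<open>t ^ degree p\<close>, by \<open>t ^ (degree p - 1)\<close> bounds |t| by |p| and the
  coefficients of \<open>low\<close>.\<close>

lemma root_bound: "\<exists>K::nat. \<forall>z t. norm t \<le> K * (1 + norm z + norm (ev p z t)) ^ K"
proof -
  obtain n where n: "degree p = Suc n" using deg by (cases "degree p") auto
  have "\<exists>K::nat. \<forall>z. norm (poly (coeff low k) z) \<le> K * (1 + norm z) ^ K" for k
    using ev_bound[of "[:coeff low k:]"] unfolding ev_const by (metis add.right_neutral norm_zero)
  then have "\<forall>k. \<exists>K::nat. \<forall>z. norm (poly (coeff low k) z) \<le> K * (1 + norm z) ^ K" by blast
  then obtain K :: "nat \<Rightarrow> nat" where K: "\<And>k z. norm (poly (coeff low k) z) \<le> K k * (1 + norm z) ^ K k"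
    unfolding choice_iff by blast
  define L where "L = (\<Sum>k\<le>n. K k) + 1"
  show ?thesis
  proof (intro exI[of _ L] allI)
    fix z t
    define M where "M = 1 + norm z + norm (ev p z t)"
    have M: "M \<ge> 1" "1 + norm z \<le> M" "norm (ev p z t) \<le> M" by (auto simp: M_def)
    show "norm t \<le> L * M ^ L"
    proof (cases "norm t \<le> 1")
      case True
      have "1 \<le> real L" by (simp add: L_def del: of_nat_sum)
      moreover have "1 \<le> M ^ L" using M(1) by (rule one_le_power)
      ultimately have "1 * 1 \<le> real L * M ^ L" by (rule mult_mono) simp_all
      then show ?thesis using True by linarith
    next
      case False
      have Kk: "norm (poly (coeff low k) z) \<le> K k * M ^ L" if "k \<le> n" for k
      proof -
        have "K k \<le> (\<Sum>k\<le>n. K k)" using that by (intro member_le_sum) auto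
        then have KL: "K k \<le> L" by (simp add: L_def)
        have "(1 + norm z) ^ K k \<le> M ^ K k" using M by (intro power_mono) auto
        also have "\<dots> \<le> M ^ L" using M KL by (intro power_increasing) auto
        finally have "(1 + norm z) ^ K k \<le> M ^ L" .
        then show ?thesis using K[of k z] mult_left_mono[of "(1 + norm z) ^ K k" "M ^ L" "real (K k)"] by linarith
      qed
      have "norm t ^ Suc n = norm (ev p z t - ev low z t)" by (simp add: ev_p_low n norm_mult norm_power)
      also have "\<dots> \<le> norm (ev p z t) + norm (ev low z t)" by (rule norm_triangle_ineq4)
      also have "\<dots> \<le> norm (ev p z t) * norm t ^ n + (\<Sum>k\<le>n. norm (poly (coeff low k) z) * norm t ^ n)"
      proof (rule add_mono)
        show "norm (ev p z t) \<le> norm (ev p z t) * norm t ^ n" using False by (simp add: mult_le_cancel_left1)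
        have "norm (ev low z t) \<le> (\<Sum>k\<le>n. norm (poly (coeff low k) z) * norm t ^ k)"
          unfolding ev_sum[OF low_degree[unfolded n, simplified]]
          by (rule order_trans[OF norm_sum]) (simp add: norm_mult norm_power)
        also have "\<dots> \<le> (\<Sum>k\<le>n. norm (poly (coeff low k) z) * norm t ^ n)"
          using False by (intro sum_mono mult_left_mono power_increasing) auto
        finally show "norm (ev low z t) \<le> (\<Sum>k\<le>n. norm (poly (coeff low k) z) * norm t ^ n)" .
      qed
      also have "\<dots> = (norm (ev p z t) + (\<Sum>k\<le>n. norm (poly (coeff low k) z))) * norm t ^ n"
        by (simp add: sum_distrib_right distrib_right)
      finally have "norm t * norm t ^ n \<le> (norm (ev p z t) + (\<Sum>k\<le>n. norm (poly (coeff low k) z))) * norm t ^ n" by simp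
      moreover have "norm t > 0" using False by linarith
      then have "norm t ^ n > 0" by (rule zero_less_power)
      ultimately have "norm t \<le> norm (ev p z t) + (\<Sum>k\<le>n. norm (poly (coeff low k) z))" by simp
      also have "\<dots> \<le> M ^ L + (\<Sum>k\<le>n. K k * M ^ L)"
      proof (intro add_mono sum_mono)
        have "M ^ 1 \<le> M ^ L" using M by (intro power_increasing) (auto simp: L_def)
        then show "norm (ev p z t) \<le> M ^ L" using M(3) by simp
      qed (use Kk in auto)
      also have "\<dots> = L * M ^ L" by (simp add: L_def sum_distrib_right distrib_right)
      finally show ?thesis .
    qed
  qed
qed

text \<open>On the ray through a root of unity \<xi> the power \<open>t ^ degree p\<close> is
  positive. A thin cone changes it by at most a quarter, and far out the lower terms change it by
  another quarter, so the real part of \<open>p\<close> is at least half of \<open>Re s\<close>.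
  Half of the decay gained absorbs the factor \<open>f\<close>.\<close>

lemma cone_decay:
  assumes \<xi>: "\<xi> ^ degree p = 1" and Z: "Z \<ge> 0"
  shows "\<exists>\<delta>>0. \<exists>\<rho>\<ge>1. \<forall>z s. norm z \<le> Z \<longrightarrow> Re s \<ge> \<rho> \<longrightarrow> \<bar>Im s\<bar> \<le> \<delta> * Re s \<longrightarrow>
    norm (ev f z (\<xi> * s) * exp (- ev p z (\<xi> * s))) \<le> exp (- Re s / 4)"
proof -
  obtain n where n: "degree p = Suc n" using deg by (cases "degree p") auto
  have n\<xi>: "norm \<xi> = 1"
    using power_eq_1_iff[OF \<xi>] deg by auto
  have "((\<lambda>x. (1 + \<i> * complex_of_real x) ^ degree p) \<longlongrightarrow> (1 + \<i> * complex_of_real 0) ^ degree p) (at 0)"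
    by (intro tendsto_intros)
  from tendstoD[OF this, of "1/4"]
  obtain d where d: "d > 0" "\<And>x. x \<noteq> 0 \<Longrightarrow> \<bar>x\<bar> < d \<Longrightarrow> norm ((1 + \<i> * complex_of_real x) ^ degree p - 1) < 1/4"
    by (auto simp: eventually_at dist_norm)
  define \<delta> where "\<delta> = min (d / 2) 1"
  obtain B where B: "B \<ge> 0" "\<And>z t. norm z \<le> Z \<Longrightarrow> norm t \<ge> 1 \<Longrightarrow> norm (ev low z t) \<le> B * norm t ^ n"
    using ev_bound_degree[OF low_degree Z] n by auto
  obtain F where F: "F \<ge> 0" "\<And>z t. norm z \<le> Z \<Longrightarrow> norm t \<ge> 1 \<Longrightarrow> norm (ev f z t) \<le> F * norm t ^ degree f"
    using ev_bound_degree[OF order_refl Z, of f] by auto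
  have "((\<lambda>a. F * (2 * a) ^ degree f * exp (- a / 4)) \<longlongrightarrow> 0) at_top" by real_asymp
  then have "\<forall>\<^sub>F a in at_top. F * (2 * a) ^ degree f * exp (- a / 4) < 1"
    by (rule order_tendstoD) simp
  then obtain a0 where a0: "\<And>a. a \<ge> a0 \<Longrightarrow> F * (2 * a) ^ degree f * exp (- a / 4) < 1"
    unfolding eventually_at_top_linorder by auto
  define \<rho> where "\<rho> = max 1 (max a0 (4 * B * 2 ^ n))"
  show ?thesis
  proof (rule exI[of _ \<delta>], intro conjI, goal_cases)
    case 1 then show ?case using d by (simp add: \<delta>_def)
  next
    case 2
    show ?case
    proof (rule exI[of _ \<rho>], intro conjI allI impI, goal_cases)
      case 1 then show ?case by (simp add: \<rho>_def)
    next
      case (2 z s)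
      define a where "a = Re s"
      define x where "x = Im s / Re s"
      have a: "a \<ge> 1" "a \<ge> a0" "a \<ge> 4 * B * 2 ^ n" using 2 by (auto simp: a_def \<rho>_def)
      have x: "\<bar>x\<bar> \<le> \<delta>" using 2 a by (simp add: x_def a_def abs_mult field_simps)
      have s: "s = complex_of_real a * (1 + \<i> * complex_of_real x)"
        using a by (simp add: complex_eq_iff a_def x_def)
      have pow: "norm ((1 + \<i> * complex_of_real x) ^ degree p - 1) \<le> 1/4"
        using d(2)[of x] x d(1) by (cases "x = 0") (auto simp: \<delta>_def)
      have ns: "norm (\<xi> * s) \<le> 2 * a" "norm (\<xi> * s) \<ge> 1"
      proof -
        have "norm s \<le> \<bar>Re s\<bar> + \<bar>Im s\<bar>" by (rule cmod_le)
        moreover have "\<bar>Im s\<bar> \<le> a" using x a by (simp add: x_def a_def \<delta>_def field_simps)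
        ultimately show "norm (\<xi> * s) \<le> 2 * a" using a by (simp add: norm_mult n\<xi> a_def)
        have "norm s \<ge> a" unfolding a_def by (rule complex_Re_le_cmod)
        then show "norm (\<xi> * s) \<ge> 1" using a by (simp add: norm_mult n\<xi>)
      qed
      have t: "(\<xi> * s) ^ degree p = complex_of_real (a ^ degree p) * (1 + \<i> * complex_of_real x) ^ degree p"
        by (simp add: power_mult_distrib \<xi> s)
      have "norm ((\<xi> * s) ^ degree p - complex_of_real (a ^ degree p)) = a ^ degree p * norm ((1 + \<i> * complex_of_real x) ^ degree p - 1)"
        unfolding t using a by (metis (no_types, opaque_lifting) abs_of_nonneg mult.right_neutral norm_mult norm_of_real right_diff_distrib zero_le_power order_trans zero_le_one)
      also have "\<dots> \<le> a ^ degree p * (1/4)" using pow a by (intro mult_left_mono) auto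
      finally have 1: "norm ((\<xi> * s) ^ degree p - complex_of_real (a ^ degree p)) \<le> a ^ degree p / 4" by simp
      have "norm (ev low z (\<xi> * s)) \<le> B * norm (\<xi> * s) ^ n" using B(2) 2 ns by blast
      also have "\<dots> \<le> B * (2 * a) ^ n" using ns B(1) by (intro mult_left_mono power_mono) auto
      also have "\<dots> \<le> a ^ degree p / 4"
        using a(3) mult_right_mono[of "4 * B * 2 ^ n" a "a ^ n"] a(1) by (simp add: n power_mult_distrib)
      finally have lo: "norm (ev low z (\<xi> * s)) \<le> a ^ degree p / 4" .
      have "\<bar>Re ((\<xi> * s) ^ degree p - complex_of_real (a ^ degree p))\<bar> \<le> a ^ degree p / 4"
        "\<bar>Re (ev low z (\<xi> * s))\<bar> \<le> a ^ degree p / 4"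
        using order_trans[OF abs_Re_le_cmod 1] order_trans[OF abs_Re_le_cmod lo] by auto
      moreover have "Re ((\<xi> * s) ^ degree p - complex_of_real (a ^ degree p)) = Re ((\<xi> * s) ^ degree p) - a ^ degree p"
        by (simp only: minus_complex.sel Re_complex_of_real)
      moreover have "Re (ev p z (\<xi> * s)) = Re ((\<xi> * s) ^ degree p) + Re (ev low z (\<xi> * s))"
        by (simp only: ev_p_low plus_complex.sel)
      ultimately have "Re (ev p z (\<xi> * s)) \<ge> a ^ degree p / 2" by linarith
      moreover have "a ^ degree p \<ge> a" using a(1) power_increasing[of 1 "degree p" a] deg by simp
      ultimately have Re: "Re (ev p z (\<xi> * s)) \<ge> a / 2" by linarith
      have "norm (ev f z (\<xi> * s)) \<le> F * (2 * a) ^ degree f"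
        using F(2)[OF _ ns(2), of z] 2 mult_left_mono[OF power_mono[OF ns(1)] F(1)] by (meson norm_ge_zero order_trans)
      then have "norm (ev f z (\<xi> * s) * exp (- ev p z (\<xi> * s))) \<le> F * (2 * a) ^ degree f * exp (- a / 2)"
        unfolding norm_mult norm_exp_eq_Re using Re F(1) a by (intro mult_mono) auto
      also have "\<dots> = (F * (2 * a) ^ degree f * exp (- a / 4)) * exp (- a / 4)"
        by (simp add: exp_add[symmetric] mult.assoc)
      also have "\<dots> \<le> 1 * exp (- a / 4)" using a0[OF a(2)] by (intro mult_right_mono) auto
      finally show ?case by (simp add: a_def)
    qed
  qed
qed

end

lemma convex_cone_sector: "convex {s. Re s \<ge> a \<and> \<bar>Im s\<bar> \<le> \<delta> * Re s}"
proof -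
  have "{s. Re s \<ge> a \<and> \<bar>Im s\<bar> \<le> \<delta> * Re s} = {s. Re s \<ge> a} \<inter> {s. inner (Complex (-\<delta>) 1) s \<le> 0} \<inter> {s. inner (Complex (-\<delta>) (-1)) s \<le> 0}"
    by (auto simp: inner_complex_def)
  moreover have "convex {s::complex. Re s \<ge> a}" by (rule convex_halfspace_Re_ge)
  ultimately show ?thesis by (auto intro!: convex_Int convex_halfspace_le)
qed

context twisted
begin

text \<open>The t-derivative of \<open>G\<close> decays in a cone about the ray, so the values at
  the multiples of \<xi> converge and nearby points follow them. The z-derivative decays too,
  uniformly for bounded z, hence the limit does not depend on z.\<close>

lemma sector_limit_exists:
  assumes \<xi>: "\<xi> ^ degree p = 1"
  shows "\<exists>c. \<forall>z. sector_limit (G z) \<xi> c"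
proof -
  have n\<xi>: "norm \<xi> = 1"
    using power_eq_1_iff[OF \<xi>] deg by auto
  then have \<xi>0: "\<xi> \<noteq> 0" by auto
  have one: "\<exists>c. sector_limit (G z) \<xi> c \<and> ((\<lambda>n. G z (\<xi> * of_nat n)) \<longlonglongrightarrow> c)" for z
  proof -
    obtain \<delta> \<rho> where \<delta>: "\<delta> > 0" "\<rho> \<ge> 1" and decay: "\<And>s. Re s \<ge> \<rho> \<Longrightarrow> \<bar>Im s\<bar> \<le> \<delta> * Re s \<Longrightarrow>
        norm (ev r z (\<xi> * s) * exp (- ev p z (\<xi> * s))) \<le> exp (- Re s / 4)"
      using cone_decay[OF \<xi> norm_ge_zero[of z], of r] by (metis order_refl)
    define g where "g s = G z (\<xi> * s)" for s
    have dg: "(g has_field_derivative ev r z (\<xi> * s) * exp (- ev p z (\<xi> * s)) * \<xi>) (at s)" for s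
      unfolding g_def using DERIV_chain2[OF G_deriv_t, of "\<lambda>s. \<xi> * s" \<xi> s UNIV] by (auto intro!: derivative_eq_intros)
    have near: "norm (g s - g s') \<le> exp (- a / 4) * norm (s - s')"
      if "a \<ge> \<rho>" "Re s \<ge> a" "Re s' \<ge> a" "\<bar>Im s\<bar> \<le> \<delta> * Re s" "\<bar>Im s'\<bar> \<le> \<delta> * Re s'" for a s s'
    proof (rule field_differentiable_bound[OF convex_cone_sector[of a \<delta>]])
      fix y assume y: "y \<in> {s. a \<le> Re s \<and> \<bar>Im s\<bar> \<le> \<delta> * Re s}"
      then show "(g has_field_derivative ev r z (\<xi> * y) * exp (- ev p z (\<xi> * y)) * \<xi>) (at y within {s. a \<le> Re s \<and> \<bar>Im s\<bar> \<le> \<delta> * Re s})"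
        using dg has_field_derivative_at_within by blast
      have "norm (ev r z (\<xi> * y) * exp (- ev p z (\<xi> * y)) * \<xi>) \<le> exp (- Re y / 4)"
        using decay[of y] y that(1) by (simp add: norm_mult n\<xi>)
      also have "\<dots> \<le> exp (- a / 4)" using y by simp
      finally show "norm (ev r z (\<xi> * y) * exp (- ev p z (\<xi> * y)) * \<xi>) \<le> exp (- a / 4)" .
    qed (use that in auto)
    have step: "norm (g (of_nat (Suc n)) - g (of_nat n)) \<le> exp (- real n / 4)" if "real n \<ge> \<rho>" for n
      using near[of "real n" "of_nat (Suc n)" "of_nat n"] that \<delta> by (simp add: norm_minus_commute)
    have "summable (\<lambda>n. exp (- real n / 4))"
    proof -
      have "exp (- real n / 4) = exp (- 1 / 4) ^ n" for n by (simp add: exp_of_nat_mult[symmetric])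
      then show ?thesis by (simp add: summable_geometric)
    qed
    then have "summable (\<lambda>n. g (of_nat (Suc n)) - g (of_nat n))"
      by (rule summable_comparison_test'[where N = "nat \<lceil>\<rho>\<rceil>"]) (use step in \<open>simp add: nat_le_iff ceiling_le_iff\<close>)
    then have "convergent (\<lambda>n. g (of_nat n))"
    proof -
      assume "summable (\<lambda>n. g (of_nat (Suc n)) - g (of_nat n))"
      then have "convergent (\<lambda>n. \<Sum>k<n. g (of_nat (Suc k)) - g (of_nat k))" by (simp add: summable_iff_convergent)
      moreover have "(\<lambda>n. \<Sum>k<n. g (of_nat (Suc k)) - g (of_nat k)) = (\<lambda>n. g (of_nat n) - g (of_nat 0))"
        by (rule ext) (rule sum_lessThan_telescope)
      ultimately have "convergent (\<lambda>n. (g (of_nat n) - g (of_nat 0)) + g (of_nat 0))"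
        by (intro convergent_add convergent_const) simp
      then show ?thesis by simp
    qed
    then obtain c where c: "(\<lambda>n. g (of_nat n)) \<longlonglongrightarrow> c" by (auto simp: convergent_def)
    have "sector_limit (G z) \<xi> c"
      unfolding sector_limit_def
    proof (intro allI impI)
      fix \<epsilon> :: real assume \<epsilon>: "\<epsilon> > 0"
      \<comment> \<open>The comparison point is the integer below \<open>Re s\<close>, hence
        \<open>a - 1\<close>; it is at distance at most \<open>1 + \<delta> * a\<close>.\<close>
      have "((\<lambda>a. exp (- (a - 1) / 4) * (1 + \<delta> * a)) \<longlongrightarrow> 0) at_top" by real_asymp
      then have "\<forall>\<^sub>F a in at_top. exp (- (a - 1) / 4) * (1 + \<delta> * a) < \<epsilon> / 2"
        using \<epsilon> by (intro order_tendstoD) auto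
      then obtain a0 where a0: "\<And>a. a \<ge> a0 \<Longrightarrow> exp (- (a - 1) / 4) * (1 + \<delta> * a) < \<epsilon> / 2"
        unfolding eventually_at_top_linorder by auto
      obtain n0 where n0: "\<And>n. n \<ge> n0 \<Longrightarrow> norm (g (of_nat n) - c) < \<epsilon> / 2"
        using LIMSEQ_D[OF c, of "\<epsilon> / 2"] \<epsilon> by auto
      define \<delta>' where "\<delta>' = min (1/2) (\<delta> / 2)"
      define R where "R = 2 * (\<rho> + 1 + \<bar>a0\<bar> + real n0)"
      show "\<exists>\<delta>>0. \<exists>R. \<forall>t. R \<le> norm t \<longrightarrow> norm (t - norm t * \<xi>) \<le> \<delta> * norm t \<longrightarrow> norm (G z t - c) < \<epsilon>"
      proof (rule exI[of _ \<delta>'], rule conjI, use \<delta> in \<open>simp add: \<delta>'_def\<close>, rule exI[of _ R], intro allI impI)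
        fix t assume t: "R \<le> norm t" "norm (t - norm t * \<xi>) \<le> \<delta>' * norm t"
        define s where "s = t / \<xi>"
        have ts: "t = \<xi> * s" using \<xi>0 by (simp add: s_def)
        have "norm (t - norm t * \<xi>) = norm (\<xi> * (s - of_real (norm s)))"
          by (simp add: ts norm_mult n\<xi> algebra_simps)
        then have ds: "norm (s - of_real (norm s)) \<le> \<delta>' * norm s" using t(2) by (simp add: ts norm_mult n\<xi>)
        have "Re s \<ge> norm s - \<delta>' * norm s" "\<bar>Im s\<bar> \<le> \<delta>' * norm s"
          using order_trans[OF abs_Re_le_cmod ds] order_trans[OF abs_Im_le_cmod ds] by auto
        moreover have "\<delta>' * norm s \<le> (1 / 2) * norm s" by (intro mult_right_mono) (auto simp: \<delta>'_def)
        then have "\<delta>' * norm s \<le> norm s / 2" by simp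
        moreover have "\<delta>' * norm s \<le> (\<delta> / 2) * norm s" by (intro mult_right_mono) (auto simp: \<delta>'_def)
        ultimately have s: "Re s \<ge> norm s / 2" "\<bar>Im s\<bar> \<le> \<delta> * (norm s / 2)" by auto
        then have Im: "\<bar>Im s\<bar> \<le> \<delta> * Re s" using \<delta>(1) by (meson mult_left_mono order_trans less_imp_le)
        define a where "a = Re s"
        have "a \<ge> R / 2" using s(1) t(1) by (simp add: a_def ts norm_mult n\<xi>)
        then have a: "a \<ge> \<rho> + 1" "a \<ge> a0" "a - 1 \<ge> real n0" using \<delta>(2) by (auto simp: R_def)
        define n where "n = nat \<lfloor>a\<rfloor>"
        have n: "real n \<le> a" "real n \<ge> a - 1" unfolding n_def using a \<delta>(2) by linarith+
        have "norm (g s - g (of_nat n)) \<le> exp (- (a - 1) / 4) * norm (s - of_nat n)"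
          by (rule near) (use a n Im \<delta> in \<open>auto simp: a_def\<close>)
        also have "norm (s - of_nat n) \<le> 1 + \<delta> * a"
        proof -
          have "norm (s - of_nat n) \<le> \<bar>Re (s - of_nat n)\<bar> + \<bar>Im (s - of_nat n)\<bar>" by (rule cmod_le)
          then show ?thesis using n Im by (simp add: a_def)
        qed
        finally have "norm (g s - g (of_nat n)) < \<epsilon> / 2"
          using a0[OF a(2)] by (smt (verit) exp_gt_zero mult_left_mono)
        moreover have "norm (g (of_nat n) - c) < \<epsilon> / 2" using n0[of n] n a(3) by linarith
        ultimately have "norm (g s - c) < \<epsilon>" using norm_triangle_ineq[of "g s - g (of_nat n)" "g (of_nat n) - c"] by simp
        then show "norm (G z t - c) < \<epsilon>" by (simp add: g_def ts)
      qed
    qed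
    then show ?thesis using c by (auto simp: g_def)
  qed
  then have "\<forall>z. \<exists>c. sector_limit (G z) \<xi> c \<and> ((\<lambda>n. G z (\<xi> * of_nat n)) \<longlonglongrightarrow> c)" by blast
  then obtain c where c: "\<And>z. sector_limit (G z) \<xi> (c z)" "\<And>z. (\<lambda>n. G z (\<xi> * of_nat n)) \<longlonglongrightarrow> c z"
    unfolding choice_iff by blast
  have "c z = c 0" for z
  proof -
    obtain \<delta> \<rho> where \<delta>: "\<delta> > 0" "\<rho> \<ge> 1" and decay: "\<And>z' s. norm z' \<le> norm z \<Longrightarrow> Re s \<ge> \<rho> \<Longrightarrow> \<bar>Im s\<bar> \<le> \<delta> * Re s \<Longrightarrow>
        norm (ev u z' (\<xi> * s) * exp (- ev p z' (\<xi> * s))) \<le> exp (- Re s / 4)"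
      using cone_decay[OF \<xi> norm_ge_zero[of z], of u] by metis
    have "norm (G z (\<xi> * of_nat n) - G 0 (\<xi> * of_nat n)) \<le> exp (- real n / 4) * norm (z - 0)" if n: "real n \<ge> \<rho>" for n
    proof (rule field_differentiable_bound[of "cball 0 (norm z)"])
      fix y :: complex assume y: "y \<in> cball 0 (norm z)"
      show "((\<lambda>z. G z (\<xi> * of_nat n)) has_field_derivative ev u y (\<xi> * of_nat n) * exp (- ev p y (\<xi> * of_nat n))) (at y within cball 0 (norm z))"
        using G_deriv_z has_field_derivative_at_within by blast
      show "norm (ev u y (\<xi> * of_nat n) * exp (- ev p y (\<xi> * of_nat n))) \<le> exp (- real n / 4)"
        using decay[of y "of_nat n"] y n \<delta> by simp
    qed auto
    then have "\<forall>\<^sub>F n in sequentially. norm (G z (\<xi> * of_nat n) - G 0 (\<xi> * of_nat n)) \<le> exp (- real n / 4) * norm z"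
      by (intro eventually_sequentiallyI[of "nat \<lceil>\<rho>\<rceil>"]) (simp add: nat_le_iff ceiling_le_iff)
    moreover have "(\<lambda>n. exp (- real n / 4) * norm z) \<longlonglongrightarrow> 0" by real_asymp
    ultimately have "(\<lambda>n. G z (\<xi> * of_nat n) - G 0 (\<xi> * of_nat n)) \<longlonglongrightarrow> 0" by (rule Lim_null_comparison)
    moreover have "(\<lambda>n. G z (\<xi> * of_nat n) - G 0 (\<xi> * of_nat n)) \<longlonglongrightarrow> c z - c 0" by (intro tendsto_diff c)
    ultimately have "c z - c 0 = 0" by (rule LIMSEQ_unique[symmetric])
    then show ?thesis by simp
  qed
  then show ?thesis using c(1) by metis
qed

end

section \<open>Following the primitive along roots by unit steps\<close>

context plane
begin

lemma ev_near_root: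
  obtains t' where "ev p z t' = v" "norm (t - t') ^ degree p \<le> norm (ev p z t - v)"
  using near_root[of "slice z p"] degree_slice_monic[OF monic, of z] deg unfolding ev_def by metis

text \<open>A root of \<open>p = s\<close> moves to a root of \<open>p = s + 1\<close> through \<open>k\<close> small steps. The product of the
  distances to the roots of \<open>p = s + 1/k\<close> is \<open>1/k\<close>, so some root is at distance at most
  \<open>(1/k)\<close> to the power \<open>1 / degree p\<close>; no path in a fibre has to be lifted.\<close>

lemma unit_step:
  assumes dG: "\<And>z t. ((\<lambda>t. G z t) has_field_derivative ev r z t * exp (- ev p z t)) (at t)"
  shows "\<exists>K::nat. \<forall>z t. \<exists>t'. ev p z t' = ev p z t + 1 \<and>
    norm (G z t' - G z t) \<le> K * (1 + norm z + norm (ev p z t)) ^ K * exp (- Re (ev p z t))"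
proof -
  obtain K1 :: nat where K1: "\<And>z t. norm (ev (pderiv p) z t) \<le> K1 * (1 + norm z + norm t) ^ K1" using ev_bound by blast
  obtain K2 :: nat where K2: "\<And>z t. norm (ev r z t) \<le> K2 * (1 + norm z + norm t) ^ K2" using ev_bound by blast
  obtain K3 :: nat where K3: "\<And>z t. norm t \<le> K3 * (1 + norm z + norm (ev p z t)) ^ K3" using root_bound by blast
  define K where "K = K1 + K2 + 1"
  define K' where "K' = K3 * 2 ^ K3 + K3 + 1"
  define D where "D = degree p"
  obtain L1 :: nat where "\<forall>(M::real) (x::real). M \<ge> 1 \<longrightarrow> 0 \<le> x \<longrightarrow> x \<le> K' * M ^ K' \<longrightarrow> real K * (M + x) ^ K \<le> real L1 * M ^ L1"
    using poly_bound_compose[where K = K and K' = K'] by (elim exE)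
  then have L1: "real K * (M + x) ^ K \<le> real L1 * M ^ L1" if "M \<ge> 1" "0 \<le> x" "x \<le> K' * M ^ K'" for M x :: real
    using that by simp
  define L where "L = 3 * (L1 ^ D + 1) + L1 * D"
  have "\<exists>t'. ev p z t' = ev p z t + 1 \<and>
    norm (G z t' - G z t) \<le> L * (1 + norm z + norm (ev p z t)) ^ L * exp (- Re (ev p z t))" for z t
  proof -
    define s where "s = ev p z t"
    define M where "M = 1 + norm z + norm s"
    \<comment> \<open>During the passage |p| is at most |s| + 1, so by \<open>root_bound\<close> all
      intermediate roots stay within \<open>R\<close>; \<open>Q\<close> bounds
      \<open>pderiv p\<close> and \<open>r\<close> on the disc of radius
      \<open>R + 1\<close>.\<close>
    define R where "R = real K3 * (2 * M) ^ K3"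
    define Q where "Q = real K * (M + (R + 1)) ^ K"
    have M: "M \<ge> 1" by (simp add: M_def)
    have R0: "R \<ge> 0" using M by (simp add: R_def)
    have Q1: "Q \<ge> 1"
    proof -
      have "1 * 1 \<le> real K * (M + (R + 1)) ^ K" using M R0 by (intro mult_mono one_le_power) (auto simp: K_def)
      then show ?thesis by (simp add: Q_def)
    qed
    have QL: "Q \<le> L1 * M ^ L1"
      unfolding Q_def
    proof (rule L1[OF M])
      have K3': "K3 \<le> K'" by (simp add: K'_def)
      have "M ^ K3 \<le> M ^ K'" using M K3' by (intro power_increasing)
      then have "real K3 * (2 ^ K3 * M ^ K3) \<le> real K3 * (2 ^ K3 * M ^ K')" by (intro mult_left_mono) auto
      moreover have "1 \<le> M ^ K'" using M by (rule one_le_power)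
      ultimately have "R + 1 \<le> real (K3 * 2 ^ K3) * M ^ K' + 1 * M ^ K'"
        unfolding R_def power_mult_distrib by (simp add: mult.assoc)
      also have "\<dots> \<le> real K' * M ^ K'" using M by (simp add: K'_def distrib_right)
      finally show "R + 1 \<le> real K' * M ^ K'" .
    qed (use R0 in simp)
    \<comment> \<open>With \<open>k\<close> at least \<open>Q ^ D\<close> a single step has length
      at most 1 / Q. On a disc of this radius \<open>p\<close> changes by at most one, and
      \<open>G\<close> by at most exp (1 - Re s).\<close>
    define k where "k = nat \<lceil>Q ^ D\<rceil>"
    have k: "real k \<ge> Q ^ D" "real k \<le> Q ^ D + 1" "k \<ge> 1"
    proof -
      have "Q ^ D \<ge> 1" using Q1 by (rule one_le_power)
      then show "real k \<ge> Q ^ D" "real k \<le> Q ^ D + 1" "k \<ge> 1" unfolding k_def by linarith+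
    qed
    have bd: "norm (ev (pderiv p) z y) \<le> Q" "norm (ev r z y) \<le> Q" if "norm y \<le> R + 1" for y
    proof -
      have le: "1 + norm z + norm y \<le> M + (R + 1)" using that norm_ge_zero[of s] unfolding M_def by linarith
      have "real k' * (1 + norm z + norm y) ^ k' \<le> Q" if "k' \<le> K" for k'
        unfolding Q_def
        by (rule order_trans[OF mult_left_mono[OF power_mono[OF le]] poly_bound_mono[OF that]]) (use M R0 in auto)
      then show "norm (ev (pderiv p) z y) \<le> Q" "norm (ev r z y) \<le> Q"
        using K1[of z y] K2[of z y] by (auto simp: K_def intro: order_trans)
    qed
    have "\<exists>t'. ev p z t' = s + of_real (real j / real k) \<and> norm (G z t' - G z t) \<le> j * exp (1 - Re s)" if "j \<le> k" for j
      using that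
    proof (induction j)
      case 0
      then show ?case by (intro exI[of _ t]) (simp add: s_def)
    next
      case (Suc j)
      then obtain tj where tj: "ev p z tj = s + of_real (real j / real k)" "norm (G z tj - G z t) \<le> j * exp (1 - Re s)" by auto
      obtain t' where t': "ev p z t' = s + of_real (real (Suc j) / real k)"
        "norm (tj - t') ^ degree p \<le> norm (ev p z tj - (s + of_real (real (Suc j) / real k)))"
        by (rule ev_near_root)
      have eq: "ev p z tj - (s + of_real (real (Suc j) / real k)) = of_real (- (1 / real k))"
      proof -
        have "real (Suc j) / real k = real j / real k + 1 / real k" by (simp add: add_divide_distrib)
        then show ?thesis unfolding tj(1) by simp
      qed
      have "norm (tj - t') ^ D \<le> 1 / real k" using t'(2) unfolding eq norm_of_real D_def by simp
      also have "\<dots> \<le> 1 / Q ^ D" using k(1,3) Q1 by (intro divide_left_mono mult_pos_pos zero_less_power) auto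
      also have "\<dots> = (1 / Q) ^ D" by (simp add: power_divide)
      finally have "norm (tj - t') ^ D \<le> (1 / Q) ^ D" .
      moreover have "0 \<le> 1 / Q" "0 < D" using Q1 deg by (simp_all add: D_def)
      ultimately have dist: "norm (tj - t') \<le> 1 / Q" using power_mono_iff[of "norm (tj - t')" "1 / Q" D] by simp
      have ntj: "norm tj \<le> R"
      proof -
        have "norm (ev p z tj) \<le> norm s + norm (complex_of_real (real j / real k))" unfolding tj(1) by (rule norm_triangle_ineq)
        also have "norm (complex_of_real (real j / real k)) \<le> 1" unfolding norm_of_real using Suc.prems by (simp add: divide_le_eq)
        finally have "1 + norm z + norm (ev p z tj) \<le> 2 * M"
          using norm_ge_zero[of z] norm_ge_zero[of s] unfolding M_def distrib_left by linarith
        then show ?thesis unfolding R_def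
          by (intro order_trans[OF K3[of tj z]] mult_left_mono power_mono) auto
      qed
      have Q': "1 / Q \<le> 1" using Q1 by simp
      have ny: "norm y \<le> R + 1" if "y \<in> cball tj (1 / Q)" for y
        using that ntj Q' norm_triangle_sub[of y tj] by (simp add: dist_norm norm_minus_commute)
      have Re: "Re (ev p z y) \<ge> Re s - 1" if y: "y \<in> cball tj (1 / Q)" for y
      proof -
        have "norm (ev p z y - ev p z tj) \<le> Q * norm (y - tj)"
          by (rule field_differentiable_bound[of "cball tj (1 / Q)"])
            (use y Q1 bd(1) ny in \<open>auto intro: has_field_derivative_at_within[OF ev_deriv_t]\<close>)
        also have "\<dots> \<le> Q * (1 / Q)" using y Q1 by (intro mult_left_mono) (auto simp: dist_norm norm_minus_commute)
        finally have "norm (ev p z y - ev p z tj) \<le> 1" using Q1 by simp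
        then have "\<bar>Re (ev p z y - ev p z tj)\<bar> \<le> 1" using abs_Re_le_cmod order_trans by blast
        moreover have "Re (ev p z tj) \<ge> Re s" unfolding tj(1) plus_complex.sel Re_complex_of_real by simp
        ultimately show ?thesis by simp
      qed
      have "norm (G z t' - G z tj) \<le> (Q * exp (1 - Re s)) * norm (t' - tj)"
      proof (rule field_differentiable_bound[of "cball tj (1 / Q)"])
        fix y assume y: "y \<in> cball tj (1 / Q)"
        show "((\<lambda>t. G z t) has_field_derivative ev r z y * exp (- ev p z y)) (at y within cball tj (1 / Q))"
          using dG has_field_derivative_at_within by blast
        show "norm (ev r z y * exp (- ev p z y)) \<le> Q * exp (1 - Re s)"
          unfolding norm_mult norm_exp_eq_Re using bd(2)[OF ny[OF y]] Re[OF y] Q1 by (intro mult_mono) auto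
      qed (use dist Q1 in \<open>auto simp: dist_norm\<close>)
      also have "\<dots> \<le> (Q * exp (1 - Re s)) * (1 / Q)"
        using dist Q1 by (intro mult_left_mono) (auto simp: norm_minus_commute)
      also have "\<dots> = exp (1 - Re s)" using Q1 by simp
      finally have "norm (G z t' - G z t) \<le> exp (1 - Re s) + j * exp (1 - Re s)"
        using tj(2) norm_triangle_ineq[of "G z t' - G z tj" "G z tj - G z t"] by simp
      then show ?case using t'(1) by (intro exI[of _ t']) (simp add: algebra_simps)
    qed
    from this[of k] obtain t' where t': "ev p z t' = s + 1" "norm (G z t' - G z t) \<le> k * exp (1 - Re s)" using k(3) by auto
    have "real k * exp (1 - Re s) = (real k * exp 1) * exp (- Re s)" by (simp add: exp_diff exp_minus divide_inverse)
    also have "real k * exp 1 \<le> L * M ^ L"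
    proof -
      have "real k * exp 1 \<le> (Q ^ D + 1) * 3" using k exp_le by (intro mult_mono) auto
      also have "\<dots> \<le> ((L1 * M ^ L1) ^ D + 1) * 3" using QL Q1 by (intro mult_right_mono add_mono power_mono) auto
      also have "\<dots> = 3 * (real (L1 ^ D) * M ^ (L1 * D) + 1)" by (simp add: power_mult_distrib power_mult)
      also have "\<dots> \<le> 3 * (real (L1 ^ D) * M ^ (L1 * D) + M ^ (L1 * D))" using M by (simp add: one_le_power)
      also have "\<dots> = real (3 * (L1 ^ D + 1)) * M ^ (L1 * D)" by (simp add: algebra_simps)
      also have "\<dots> \<le> L * M ^ L" using M by (intro mult_mono power_increasing) (auto simp: L_def)
      finally show ?thesis .
    qed
    finally have "real k * exp (1 - Re s) \<le> L * M ^ L * exp (- Re s)" by simp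
    then show ?thesis using t' by (intro exI[of _ t']) (auto simp: M_def s_def)
  qed
  then show ?thesis by blast
qed

text \<open>Along the chain \<open>T n ^ degree p\<close> is asymptotic to s + n, so directions can
  accumulate only at roots of unity; compactness provides a subsequence with convergent
  direction.\<close>

lemma chain_limit:
  assumes lim: "\<And>\<xi>. \<xi> ^ degree p = 1 \<Longrightarrow> sector_limit g \<xi> (c \<xi>)"
    and T: "\<And>n. ev p z (T n) = s + of_nat n"
  obtains r \<xi> where "strict_mono (r :: nat \<Rightarrow> nat)" "\<xi> ^ degree p = 1" "(\<lambda>n. g (T (r n))) \<longlonglongrightarrow> c \<xi>"
proof -
  obtain m where m: "degree p = Suc m" using deg by (cases "degree p") auto
  have inf: "filterlim (\<lambda>n. norm (T n)) at_top sequentially"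
    unfolding filterlim_at_top
  proof
    fix B :: real
    obtain K :: nat where K: "\<And>z t. norm (ev p z t) \<le> K * (1 + norm z + norm t) ^ K" using ev_bound by blast
    define V where "V = K * (1 + norm z + \<bar>B\<bar>) ^ K + norm s"
    have big: "norm (T n) \<ge> B" if n: "real n > V" for n
    proof (rule ccontr)
      assume "\<not> B \<le> norm (T n)"
      then have "K * (1 + norm z + norm (T n)) ^ K \<le> K * (1 + norm z + \<bar>B\<bar>) ^ K"
        by (intro mult_left_mono power_mono) auto
      then have "norm (s + of_nat n) \<le> V - norm s" using K[of z "T n"] unfolding T V_def by linarith
      moreover have "real n \<le> norm (s + of_nat n) + norm s"
        using norm_triangle_ineq4[of "s + of_nat n" s] by simp
      ultimately show False using n by linarith
    qed
    show "eventually (\<lambda>n. B \<le> norm (T n)) sequentially"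
    proof (rule eventually_sequentiallyI[of "nat \<lceil>V\<rceil> + 1"])
      fix n assume "nat \<lceil>V\<rceil> + 1 \<le> n"
      then have "real n > V" by linarith
      then show "B \<le> norm (T n)" by (rule big)
    qed
  qed
  have nz: "\<forall>\<^sub>F n in sequentially. norm (T n) \<ge> 1" using inf unfolding filterlim_at_top by blast
  obtain B where B: "B \<ge> 0" "\<And>t. norm t \<ge> 1 \<Longrightarrow> norm (ev low z t) \<le> B * norm t ^ m"
    using ev_bound_degree[OF low_degree norm_ge_zero[of z]] m by auto
  define \<eta> where "\<eta> n = ev low z (T n) / T n ^ degree p" for n
  have "\<eta> \<longlonglongrightarrow> 0"
  proof (rule Lim_null_comparison)
    show "\<forall>\<^sub>F n in sequentially. norm (\<eta> n) \<le> B * inverse (norm (T n))"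
      using nz
    proof eventually_elim
      case (elim n)
      have "norm (\<eta> n) \<le> B * norm (T n) ^ m / norm (T n) ^ Suc m"
        unfolding \<eta>_def norm_divide norm_power m using B(2)[OF elim] by (intro divide_right_mono) auto
      also have "\<dots> = B * inverse (norm (T n))" using elim by (auto simp: field_simps)
      finally show ?case .
    qed
    show "(\<lambda>n. B * inverse (norm (T n))) \<longlonglongrightarrow> 0"
      using tendsto_mult[OF tendsto_const tendsto_inverse_0_at_top[OF inf], of B] by simp
  qed
  then have "(\<lambda>n. sgn (1 + \<eta> n)) \<longlonglongrightarrow> sgn (1 + 0)" by (intro tendsto_sgn tendsto_add tendsto_const) auto
  then have \<eta>: "(\<lambda>n. sgn (1 + \<eta> n)) \<longlonglongrightarrow> 1" by simp
  have "(\<lambda>n. s * of_real (inverse (real n)) + 1) \<longlonglongrightarrow> s * of_real 0 + 1"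
    by (intro tendsto_intros lim_inverse_n)
  then have "(\<lambda>n. sgn (s * of_real (inverse (real n)) + 1)) \<longlonglongrightarrow> sgn (s * of_real 0 + 1)"
    by (rule tendsto_sgn) simp
  then have "(\<lambda>n. sgn (s * of_real (inverse (real n)) + 1)) \<longlonglongrightarrow> 1" by simp
  moreover have "sgn (s * of_real (inverse (real n)) + 1) = sgn (s + of_nat n)" if "n \<ge> 1" for n
  proof -
    have "s * of_real (inverse (real n)) + 1 = of_real (inverse (real n)) * (s + of_nat n)" using that by (simp add: field_simps)
    then show ?thesis using that by (simp add: sgn_mult sgn_of_real del: of_real_inverse)
  qed
  then have "\<forall>\<^sub>F n in sequentially. sgn (s * of_real (inverse (real n)) + 1) = sgn (s + of_nat n)"
    by (intro eventually_sequentiallyI[of 1]) auto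
  ultimately have sn: "(\<lambda>n. sgn (s + of_nat n)) \<longlonglongrightarrow> 1" by (rule Lim_transform_eventually)
  have pw: "sgn (w ^ k) = sgn w ^ k" for w :: complex and k by (induction k) (simp_all add: sgn_mult)
  have eq: "sgn (s + of_nat n) / sgn (1 + \<eta> n) = sgn (T n) ^ degree p" if "norm (T n) \<ge> 1" "sgn (1 + \<eta> n) \<noteq> 0" for n
  proof -
    have "T n \<noteq> 0" using that(1) by auto
    then have "s + of_nat n = T n ^ degree p * (1 + \<eta> n)" unfolding T[symmetric] ev_p_low by (simp add: \<eta>_def distrib_left)
    then show ?thesis using that(2) by (simp add: sgn_mult pw)
  qed
  have "\<forall>\<^sub>F n in sequentially. sgn (1 + \<eta> n) \<noteq> 0" using \<eta> by (rule tendsto_imp_eventually_ne) simp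
  with nz have "\<forall>\<^sub>F n in sequentially. sgn (s + of_nat n) / sgn (1 + \<eta> n) = sgn (T n) ^ degree p"
    by eventually_elim (rule eq)
  moreover have "(\<lambda>n. sgn (s + of_nat n) / sgn (1 + \<eta> n)) \<longlonglongrightarrow> 1 / 1" by (intro tendsto_divide sn \<eta>) auto
  ultimately have one: "(\<lambda>n. sgn (T n) ^ degree p) \<longlonglongrightarrow> 1" using Lim_transform_eventually by fastforce
  have "\<forall>n. sgn (T n) \<in> cball 0 1" by (simp add: norm_sgn)
  then obtain \<xi> r where r: "strict_mono (r :: nat \<Rightarrow> nat)" "(\<lambda>n. sgn (T (r n))) \<longlonglongrightarrow> \<xi>"
    using compact_cball[of "0::complex" 1] unfolding compact_def o_def by meson
  have "(\<lambda>n. sgn (T (r n)) ^ degree p) \<longlonglongrightarrow> 1" using LIMSEQ_subseq_LIMSEQ[OF one r(1)] by (simp add: o_def)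
  moreover have "(\<lambda>n. sgn (T (r n)) ^ degree p) \<longlonglongrightarrow> \<xi> ^ degree p" by (intro tendsto_power r)
  ultimately have \<xi>: "\<xi> ^ degree p = 1" using LIMSEQ_unique by blast
  have "(\<lambda>n. g (T (r n))) \<longlonglongrightarrow> c \<xi>"
  proof (rule LIMSEQ_I)
    fix \<epsilon> :: real assume "\<epsilon> > 0"
    then obtain \<delta> R where \<delta>: "\<delta> > 0" and R: "\<And>t. norm t \<ge> R \<Longrightarrow> norm (t - norm t * \<xi>) \<le> \<delta> * norm t \<Longrightarrow> norm (g t - c \<xi>) < \<epsilon>"
      using lim[OF \<xi>] unfolding sector_limit_def by metis
    have "\<forall>\<^sub>F n in sequentially. norm (T (r n)) \<ge> max R 1"
      using filterlim_compose[OF inf filterlim_subseq[OF r(1)]] unfolding filterlim_at_top by blast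
    moreover have "\<forall>\<^sub>F n in sequentially. norm (sgn (T (r n)) - \<xi>) < \<delta>"
      using tendstoD[OF r(2) \<delta>] by (simp add: dist_norm)
    ultimately have "\<forall>\<^sub>F n in sequentially. norm (g (T (r n)) - c \<xi>) < \<epsilon>"
    proof eventually_elim
      case (elim n)
      define t where "t = T (r n)"
      have t: "norm t \<ge> R" "norm t \<ge> 1" using elim by (auto simp: t_def)
      have "t - norm t * \<xi> = norm t * (sgn t - \<xi>)" using t(2) by (simp add: sgn_eq right_diff_distrib)
      then have "norm (t - norm t * \<xi>) = norm t * norm (sgn t - \<xi>)" by (simp add: norm_mult)
      also have "\<dots> \<le> norm t * \<delta>" using elim(2) by (intro mult_left_mono) (auto simp: t_def)
      finally show ?case using R[OF t(1)] by (simp add: t_def mult.commute)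
    qed
    then show "\<exists>no. \<forall>n\<ge>no. norm (g (T (r n)) - c \<xi>) < \<epsilon>" by (simp add: eventually_sequentially)
  qed
  then show ?thesis using that r(1) \<xi> by blast
qed

text \<open>Iterating \<open>unit_step\<close> raises \<open>p\<close> by one each time. The factor
  exp (- n) makes the errors summable, with a sum comparable to the bound for the first step, and
  \<open>chain_limit\<close> identifies the end of the chain. Which root of unity occurs depends on
  z and t.\<close>

theorem limit_estimate:
  assumes dG: "\<And>z t. ((\<lambda>t. G z t) has_field_derivative ev r z t * exp (- ev p z t)) (at t)"
    and lim: "\<And>\<xi> z. \<xi> ^ degree p = 1 \<Longrightarrow> sector_limit (G z) \<xi> (c \<xi>)"
  shows "\<exists>K::nat. \<forall>z t. \<exists>\<xi>. \<xi> ^ degree p = 1 \<and>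
    norm (G z t - c \<xi>) \<le> K * (1 + norm z + norm (ev p z t)) ^ K * exp (- Re (ev p z t))"
proof -
  obtain K :: nat where K: "\<And>z t. \<exists>t'. ev p z t' = ev p z t + 1 \<and>
    norm (G z t' - G z t) \<le> K * (1 + norm z + norm (ev p z t)) ^ K * exp (- Re (ev p z t))"
    using unit_step[OF dG] by blast
  then obtain F where F: "\<And>z t. ev p z (F z t) = ev p z t + 1"
    "\<And>z t. norm (G z (F z t) - G z t) \<le> K * (1 + norm z + norm (ev p z t)) ^ K * exp (- Re (ev p z t))" by metis
  have summ: "summable (\<lambda>n. (1 + real n) ^ K * exp (- real n))"
  proof -
    have "(\<lambda>n. (1 + real n) ^ K * exp (- real n / 2)) \<longlonglongrightarrow> 0" by real_asymp
    then have "Bseq (\<lambda>n. (1 + real n) ^ K * exp (- real n / 2))" by (intro convergent_imp_Bseq convergentI)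
    then obtain B where "\<forall>n. norm ((1 + real n) ^ K * exp (- real n / 2)) \<le> B" by (rule BseqE)
    then have B: "norm ((1 + real n) ^ K * exp (- real n / 2)) \<le> B" for n by blast
    have ex: "exp (- real n / 2) = exp (- 1 / 2) ^ n" for n by (simp add: exp_of_nat_mult[symmetric])
    have "summable (\<lambda>n. B * exp (- 1 / 2) ^ n)" by (intro summable_mult summable_geometric) simp
    moreover have "norm ((1 + real n) ^ K * exp (- real n)) \<le> B * exp (- 1 / 2) ^ n" for n
    proof -
      have "norm ((1 + real n) ^ K * exp (- real n)) = ((1 + real n) ^ K * exp (- real n / 2)) * exp (- real n / 2)"
        by (simp add: mult.assoc exp_add[symmetric] norm_mult norm_power)
      also have "\<dots> \<le> B * exp (- real n / 2)"
        using B[of n] by (intro mult_right_mono) auto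
      also have "\<dots> = B * exp (- 1 / 2) ^ n" by (simp only: ex)
      finally show ?thesis .
    qed
    ultimately show ?thesis by (rule summable_comparison_test'[where N = 0])
  qed
  define C where "C = nat \<lceil>suminf (\<lambda>n. (1 + real n) ^ K * exp (- real n))\<rceil>"
  have C: "(\<Sum>i<n. (1 + real i) ^ K * exp (- real i)) \<le> C" for n
    by (rule order_trans[OF sum_le_suminf[OF summ]]) (auto simp: C_def intro: real_nat_ceiling_ge)
  define L where "L = K * C + K"
  have "\<exists>\<xi>. \<xi> ^ degree p = 1 \<and>
    norm (G z t - c \<xi>) \<le> L * (1 + norm z + norm (ev p z t)) ^ L * exp (- Re (ev p z t))" for z t
  proof -
    define s where "s = ev p z t"
    define M where "M = 1 + norm z + norm s"
    have M: "M \<ge> 1" by (simp add: M_def)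
    define T where "T n = (F z ^^ n) t" for n
    have T: "ev p z (T n) = s + of_nat n" for n by (induction n) (simp_all add: T_def s_def F)
    have step: "norm (G z (T (Suc n)) - G z (T n)) \<le> K * M ^ K * exp (- Re s) * ((1 + real n) ^ K * exp (- real n))" for n
    proof -
      have "1 + norm z + norm (ev p z (T n)) \<le> M + real n"
        unfolding T M_def using norm_triangle_ineq[of s "of_nat n"] by simp
      also have "\<dots> \<le> M * (1 + real n)" using mult_right_mono[OF M, of "real n"] by (simp add: distrib_left)
      finally have "(1 + norm z + norm (ev p z (T n))) ^ K \<le> (M * (1 + real n)) ^ K" by (intro power_mono) auto
      then have "K * (1 + norm z + norm (ev p z (T n))) ^ K * exp (- Re (ev p z (T n))) \<le> K * (M * (1 + real n)) ^ K * exp (- Re (ev p z (T n)))"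
        by (intro mult_right_mono mult_left_mono) auto
      also have "\<dots> = K * M ^ K * exp (- Re s) * ((1 + real n) ^ K * exp (- real n))"
        by (simp only: T power_mult_distrib plus_complex.sel complex_Re_of_nat minus_add_distrib exp_add mult_ac)
      finally show ?thesis using F(2)[of z "T n"] by (simp add: T_def)
    qed
    have bd: "norm (G z (T n) - G z t) \<le> L * M ^ L * exp (- Re s)" for n
    proof -
      have "norm (G z (T n) - G z (T 0)) = norm (\<Sum>i<n. G z (T (Suc i)) - G z (T i))" by (subst sum_lessThan_telescope) simp
      also have "\<dots> \<le> (\<Sum>i<n. K * M ^ K * exp (- Re s) * ((1 + real i) ^ K * exp (- real i)))" by (intro sum_norm_le step)
      also have "\<dots> = K * M ^ K * exp (- Re s) * (\<Sum>i<n. (1 + real i) ^ K * exp (- real i))" by (simp add: sum_distrib_left)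
      also have "\<dots> \<le> K * M ^ K * exp (- Re s) * C" using M by (intro mult_left_mono C) auto
      also have "\<dots> = (real (K * C) * M ^ K) * exp (- Re s)" by simp
      also have "\<dots> \<le> (L * M ^ L) * exp (- Re s)"
        using M by (intro mult_right_mono mult_mono power_increasing) (auto simp: L_def)
      finally show ?thesis by (simp add: T_def)
    qed
    obtain r \<xi> where r: "strict_mono (r :: nat \<Rightarrow> nat)" "\<xi> ^ degree p = 1" "(\<lambda>n. G z (T (r n))) \<longlonglongrightarrow> c \<xi>"
      by (rule chain_limit[OF lim T])
    have "(\<lambda>n. norm (G z (T (r n)) - G z t)) \<longlonglongrightarrow> norm (c \<xi> - G z t)" by (intro tendsto_intros r)
    then have "norm (c \<xi> - G z t) \<le> L * M ^ L * exp (- Re s)"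
      by (rule LIMSEQ_le_const2) (use bd in blast)
    then show ?thesis using r(2) by (intro exI[of _ \<xi>]) (simp add: norm_minus_commute M_def s_def)
  qed
  then show ?thesis by blast
qed

text \<open>The function (g - c) exp (p) is entire of polynomial growth, so by Liouville's theorem
  it is a polynomial q with q' = r + p' q. For nonzero q the degree of p' q exceeds those of q' and
  \<open>r\<close>.\<close>

theorem equal_limits_trivial:
  assumes dG: "\<And>t. (g has_field_derivative ev r z t * exp (- ev p z t)) (at t)"
    and bound: "\<And>t. norm (g t - c) \<le> real K * (1 + norm z + norm (ev p z t)) ^ K * exp (- Re (ev p z t))"
    and rdeg: "degree r + 1 < degree p"
  shows "slice z r = 0"
proof -
  define h where "h t = (g t - c) * exp (ev p z t)" for t
  have dh: "(h has_field_derivative ev r z t + ev (pderiv p) z t * h t) (at t)" for t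
  proof -
    have "(h has_field_derivative (ev r z t * exp (- ev p z t)) * exp (ev p z t) + (exp (ev p z t) * ev (pderiv p) z t) * (g t - c)) (at t)"
      unfolding h_def
      by (rule DERIV_mult[OF DERIV_diff[OF dG DERIV_const, simplified] DERIV_fun_exp[OF ev_deriv_t]])
    moreover have e1: "exp (- ev p z t) * exp (ev p z t) = 1" by (simp add: exp_add[symmetric])
    have "(ev r z t * exp (- ev p z t)) * exp (ev p z t) + (exp (ev p z t) * ev (pderiv p) z t) * (g t - c)
      = ev r z t + ev (pderiv p) z t * h t"
      unfolding mult.assoc e1 h_def by (simp add: mult_ac)
    ultimately show ?thesis by simp
  qed
  obtain K2 :: nat where K2: "\<And>z t. norm (ev p z t) \<le> K2 * (1 + norm z + norm t) ^ K2" using ev_bound by blast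
  obtain L :: nat where "\<forall>(M::real) (x::real). M \<ge> 1 \<longrightarrow> 0 \<le> x \<longrightarrow> x \<le> K2 * M ^ K2 \<longrightarrow> real K * (M + x) ^ K \<le> real L * M ^ L"
    using poly_bound_compose[where K = K and K' = K2] by (elim exE)
  then have L: "real K * (M + x) ^ K \<le> real L * M ^ L" if "M \<ge> 1" "0 \<le> x" "x \<le> K2 * M ^ K2" for M x :: real
    using that by simp
  have hb: "norm (h t) \<le> (real L * 2 ^ L) * norm t ^ L" if "1 + norm z \<le> norm t" for t
  proof -
    have "norm (h t) \<le> (real K * (1 + norm z + norm (ev p z t)) ^ K * exp (- Re (ev p z t))) * exp (Re (ev p z t))"
      unfolding h_def norm_mult norm_exp_eq_Re using bound by (intro mult_right_mono) auto
    also have "\<dots> = real K * (1 + norm z + norm (ev p z t)) ^ K" by (simp add: mult.assoc exp_add[symmetric])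
    also have "\<dots> \<le> real K * ((1 + norm z + norm t) + norm (ev p z t)) ^ K" by (intro mult_left_mono power_mono) auto
    also have "\<dots> \<le> L * (1 + norm z + norm t) ^ L" by (rule L[OF _ _ K2]) auto
    also have "\<dots> \<le> L * (2 * norm t) ^ L" using that by (intro mult_left_mono power_mono) auto
    finally show ?thesis by (simp add: power_mult_distrib)
  qed
  have "h holomorphic_on UNIV" using dh by (auto simp: holomorphic_on_def field_differentiable_def intro: has_field_derivative_at_within)
  then have hs: "h t = (\<Sum>k\<le>L. (deriv ^^ k) h 0 / fact k * t ^ k)" for t
    by (rule Liouville_polynomial[OF _ hb])
  define q where "q = (\<Sum>k\<le>L. monom ((deriv ^^ k) h 0 / fact k) k)"
  have hq: "h = poly q" by (rule ext) (simp add: hs q_def poly_sum poly_monom)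
  have "poly (pderiv q) t = poly (slice z r + slice z (pderiv p) * q) t" for t
    using DERIV_unique[OF poly_DERIV[of q t] dh[unfolded hq, of t]] by (simp add: ev_def)
  then have e: "pderiv q = slice z r + slice z (pderiv p) * q" by (simp add: poly_eq_poly_eq_iff[symmetric] fun_eq_iff)
  have "q = 0"
  proof (rule ccontr)
    assume q0: "q \<noteq> 0"
    have "degree (slice z (pderiv p)) = degree p - 1"
      using degree_slice_monic[OF monic, of z] by (simp add: pderiv_slice[symmetric] degree_pderiv)
    moreover have "slice z (pderiv p) \<noteq> 0"
      using degree_slice_monic(1)[OF monic, of z] deg by (simp add: pderiv_slice[symmetric] pderiv_eq_0_iff)
    ultimately have "degree (slice z (pderiv p) * q) = degree p - 1 + degree q" using q0 by (simp add: degree_mult_eq)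
    moreover have "degree (pderiv q - slice z r) < degree p - 1 + degree q"
    proof (rule degree_diff_less)
      show "degree (pderiv q) < degree p - 1 + degree q" using rdeg by (simp add: degree_pderiv)
      show "degree (slice z r) < degree p - 1 + degree q" using rdeg degree_slice_le[of z r] by linarith
    qed
    moreover have "slice z (pderiv p) * q = pderiv q - slice z r" using e by simp
    ultimately show False by simp
  qed
  then show ?thesis using e by simp
qed

end

section \<open>Interpolation on the fibres of a first integral\<close>

text \<open>The Fredholm alternative: a functional vanishing on the kernel is a combination of the
  rows. Over a domain elimination multiplies by pivots instead of dividing, and \<open>q\<close>
  collects them.\<close>

lemma fredholm:
  fixes \<rho> :: "'k \<Rightarrow> 'j \<Rightarrow> 'a::idom"
  assumes "finite A" "finite J"
  shows "(\<exists>w. (\<forall>k\<in>A. (\<Sum>j\<in>J. \<rho> k j * w j) = 0) \<and> (\<Sum>j\<in>J. y j * w j) \<noteq> 0) \<or>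
    (\<exists>q c. q \<noteq> 0 \<and> (\<forall>j\<in>J. q * y j = (\<Sum>k\<in>A. c k * \<rho> k j)))"
  using assms(1)
proof (induction A arbitrary: \<rho> y)
  case empty
  show ?case
  proof (cases "\<forall>j\<in>J. y j = 0")
    case True
    then show ?thesis by (intro disjI2 exI[of _ 1]) auto
  next
    case False
    then obtain i where i: "i \<in> J" "y i \<noteq> 0" by auto
    then have "(\<Sum>j\<in>J. y j * (if j = i then 1 else 0)) = y i" using assms(2) by (simp add: if_distrib sum.delta cong: if_cong)
    then show ?thesis using i by (intro disjI1 exI[of _ "\<lambda>j. if j = i then 1 else 0"]) auto
  qed
next
  case (insert a A)
  show ?case
  proof (cases "\<forall>j\<in>J. \<rho> a j = 0")
    case True
    then have z: "(\<Sum>j\<in>J. \<rho> a j * w j) = 0" for w by (intro sum.neutral) auto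
    from insert.IH[of \<rho> y] show ?thesis
    proof (elim disjE exE conjE)
      fix w assume "\<forall>k\<in>A. (\<Sum>j\<in>J. \<rho> k j * w j) = 0" "(\<Sum>j\<in>J. y j * w j) \<noteq> 0"
      then show ?thesis using z by (intro disjI1 exI[of _ w]) auto
    next
      fix q c assume "q \<noteq> 0" "\<forall>j\<in>J. q * y j = (\<Sum>k\<in>A. c k * \<rho> k j)"
      then show ?thesis using insert.hyps True by (intro disjI2 exI[of _ q] exI[of _ c]) auto
    qed
  next
    case False
    then obtain i where i: "i \<in> J" "\<rho> a i \<noteq> 0" by auto
    define \<rho>' where "\<rho>' k j = \<rho> a i * \<rho> k j - \<rho> k i * \<rho> a j" for k j
    define y' where "y' j = \<rho> a i * y j - y i * \<rho> a j" for j
    from insert.IH[of \<rho>' y'] show ?thesis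
    proof (elim disjE exE conjE)
      fix w assume w: "\<forall>k\<in>A. (\<Sum>j\<in>J. \<rho>' k j * w j) = 0" "(\<Sum>j\<in>J. y' j * w j) \<noteq> 0"
      define s where "s = (\<Sum>j\<in>J. \<rho> a j * w j)"
      define v where "v j = \<rho> a i * w j - (if j = i then s else 0)" for j
      have v: "(\<Sum>j\<in>J. g j * v j) = (\<Sum>j\<in>J. (\<rho> a i * g j - g i * \<rho> a j) * w j)" for g
      proof -
        have "(\<Sum>j\<in>J. g j * v j) = (\<Sum>j\<in>J. \<rho> a i * g j * w j) - (\<Sum>j\<in>J. if j = i then g i * s else 0)"
          unfolding sum_subtractf[symmetric] v_def by (intro sum.cong) (auto simp: algebra_simps)
        also have "(\<Sum>j\<in>J. if j = i then g i * s else 0) = g i * s" using i assms(2) by (simp add: sum.delta)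
        finally show ?thesis by (simp add: s_def sum_distrib_left left_diff_distrib sum_subtractf mult.assoc)
      qed
      have "(\<Sum>j\<in>J. \<rho> k j * v j) = 0" if "k \<in> insert a A" for k
        using that w(1) unfolding v \<rho>'_def by (auto simp: mult.commute)
      moreover have "(\<Sum>j\<in>J. y j * v j) \<noteq> 0" using w(2) unfolding v y'_def .
      ultimately show ?thesis by (intro disjI1 exI[of _ v]) auto
    next
      fix q c assume q: "q \<noteq> 0" "\<forall>j\<in>J. q * y' j = (\<Sum>k\<in>A. c k * \<rho>' k j)"
      define c' where "c' k = (if k = a then q * y i - (\<Sum>k\<in>A. c k * \<rho> k i) else \<rho> a i * c k)" for k
      have "(q * \<rho> a i) * y j = (\<Sum>k\<in>insert a A. c' k * \<rho> k j)" if j: "j \<in> J" for j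
      proof -
        have "(\<Sum>k\<in>A. c' k * \<rho> k j) = (\<Sum>k\<in>A. \<rho> a i * c k * \<rho> k j)"
          using insert.hyps by (intro sum.cong) (auto simp: c'_def)
        then have "(\<Sum>k\<in>insert a A. c' k * \<rho> k j) = (q * y i - (\<Sum>k\<in>A. c k * \<rho> k i)) * \<rho> a j + (\<Sum>k\<in>A. \<rho> a i * c k * \<rho> k j)"
          using insert.hyps by (simp add: c'_def)
        also have "\<dots> = q * y i * \<rho> a j + (\<Sum>k\<in>A. c k * \<rho>' k j)"
          by (simp add: \<rho>'_def sum_subtractf algebra_simps sum_distrib_left)
        also have "\<dots> = q * y i * \<rho> a j + q * y' j" using q(2) j by simp
        finally show ?thesis by (simp add: y'_def algebra_simps)
      qed
      then show ?thesis using q(1) i(2) by (intro disjI2 exI[of _ "q * \<rho> a i"] exI[of _ c']) auto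
    qed
  qed
qed

lemma underdetermined_system:
  fixes \<rho> :: "'k \<Rightarrow> 'j \<Rightarrow> 'a::field"
  assumes "finite A" "finite J" "card A < card J"
  shows "\<exists>w. (\<exists>j\<in>J. w j \<noteq> 0) \<and> (\<forall>k\<in>A. (\<Sum>j\<in>J. \<rho> k j * w j) = 0)"
  using assms
proof (induction A arbitrary: \<rho> J)
  case empty
  then show ?case by (intro exI[of _ "\<lambda>_. 1"]) (auto simp: card_gt_0_iff)
next
  case (insert a A)
  show ?case
  proof (cases "\<forall>j\<in>J. \<rho> a j = 0")
    case True
    have "card A < card J" using insert by simp
    then obtain w where "\<exists>j\<in>J. w j \<noteq> 0" "\<forall>k\<in>A. (\<Sum>j\<in>J. \<rho> k j * w j) = 0"
      using insert.IH[OF insert.prems(1)] by blast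
    then show ?thesis using True by (intro exI[of _ w]) auto
  next
    case False
    then obtain i where i: "i \<in> J" "\<rho> a i \<noteq> 0" by auto
    define \<rho>' where "\<rho>' k j = \<rho> a i * \<rho> k j - \<rho> k i * \<rho> a j" for k j
    have "card A < card (J - {i})" using insert i by simp
    then obtain w where w: "\<exists>j\<in>J-{i}. w j \<noteq> 0" "\<forall>k\<in>A. (\<Sum>j\<in>J-{i}. \<rho>' k j * w j) = 0"
      using insert.IH[of "J - {i}" \<rho>'] insert.prems by auto
    define s where "s = (\<Sum>j\<in>J-{i}. \<rho> a j * w j)"
    define v where "v j = (if j = i then - s else \<rho> a i * w j)" for j
    have v: "(\<Sum>j\<in>J. g j * v j) = (\<Sum>j\<in>J-{i}. (\<rho> a i * g j - g i * \<rho> a j) * w j)" for g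
    proof -
      have "(\<Sum>j\<in>J. g j * v j) = g i * v i + (\<Sum>j\<in>J-{i}. g j * v j)" using i insert.prems by (simp add: sum.remove)
      also have "(\<Sum>j\<in>J-{i}. g j * v j) = (\<Sum>j\<in>J-{i}. \<rho> a i * g j * w j)" by (intro sum.cong) (auto simp: v_def)
      finally show ?thesis by (simp add: v_def s_def sum_distrib_left left_diff_distrib sum_subtractf mult.assoc)
    qed
    have "(\<Sum>j\<in>J. \<rho> k j * v j) = 0" if "k \<in> insert a A" for k
      using that w(2) unfolding v \<rho>'_def by (auto simp: mult.commute)
    moreover have "\<exists>j\<in>J. v j \<noteq> 0" using w(1) i by (auto simp: v_def)
    ultimately show ?thesis by blast
  qed
qed

section \<open>Interpolation at the roots of a polynomial\<close>

definition lagrange_sum :: "complex list \<Rightarrow> (complex \<Rightarrow> complex) \<Rightarrow> complex poly" where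
  "lagrange_sum xs v = (\<Sum>i<length xs. smult (v (xs ! i)) (\<Prod>l\<in>{..<length xs} - {i}. [:- (xs ! l), 1:]))"

lemma root_list_prod: "(\<Prod>x\<leftarrow>xs. [:- x, 1:]) = (\<Prod>l<length xs. [:- (xs ! l), 1:])"
  for xs :: "complex list"
  by (simp add: prod.list_conv_set_nth atLeast0LessThan)

lemma root_list_monic: "lead_coeff (\<Prod>x\<leftarrow>xs. [:- x, 1:]) = 1" "degree (\<Prod>x\<leftarrow>xs. [:- x, 1:]) = length xs"
  for xs :: "complex list"
proof -
  have "lead_coeff (\<Prod>x\<leftarrow>xs. [:- x, 1:]) = 1 \<and> degree (\<Prod>x\<leftarrow>xs. [:- x, 1:]) = length xs"
  proof (induction xs)
    case (Cons a xs)
    then have "(\<Prod>x\<leftarrow>xs. [:- x, 1:]) \<noteq> 0" by auto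
    then show ?case using Cons unfolding list.map prod_list.Cons lead_coeff_mult by (subst degree_mult_eq) auto
  qed simp
  then show "lead_coeff (\<Prod>x\<leftarrow>xs. [:- x, 1:]) = 1" "degree (\<Prod>x\<leftarrow>xs. [:- x, 1:]) = length xs" by auto
qed

lemma pderiv_root_list:
  "pderiv (\<Prod>x\<leftarrow>xs. [:- x, 1:]) = (\<Sum>i<length xs. \<Prod>l\<in>{..<length xs} - {i}. [:- (xs ! l), 1:])"
  for xs :: "complex list"
  unfolding root_list_prod pderiv_prod by (simp add: pderiv_pCons)

lemma degree_lagrange_sum: "xs \<noteq> [] \<Longrightarrow> degree (lagrange_sum xs v) < length xs"
  unfolding lagrange_sum_def
proof (rule degree_sum_less)
  fix i assume "xs \<noteq> []" "i \<in> {..<length xs}"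
  have "degree (smult (v (xs ! i)) (\<Prod>l\<in>{..<length xs} - {i}. [:- (xs ! l), 1:])) \<le> degree (\<Prod>l\<in>{..<length xs} - {i}. [:- (xs ! l), 1:])"
    by (rule degree_smult_le)
  also have "\<dots> \<le> (\<Sum>l\<in>{..<length xs} - {i}. degree [:- (xs ! l), 1:])"
    using degree_prod_sum_le[of "{..<length xs} - {i}" "\<lambda>l. [:- (xs ! l), 1:]"] by (simp add: o_def)
  also have "\<dots> < length xs" using \<open>i \<in> _\<close> by simp
  finally show "degree (smult (v (xs ! i)) (\<Prod>l\<in>{..<length xs} - {i}. [:- (xs ! l), 1:])) < length xs" .
qed simp

text \<open>The derivative is the sum of the products that omit one root, and g - g(x) is divisible
  by the factor omitted. As nothing is divided by the derivative, repeated roots are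
  allowed.\<close>

lemma root_list_dvd_lagrange_sum:
  "(\<Prod>x\<leftarrow>xs. [:- x, 1:]) dvd g * pderiv (\<Prod>x\<leftarrow>xs. [:- x, 1:]) - lagrange_sum xs (poly g)"
proof -
  have "(\<Prod>x\<leftarrow>xs. [:- x, 1:]) dvd (g - [:poly g (xs ! i):]) * (\<Prod>l\<in>{..<length xs} - {i}. [:- (xs ! l), 1:])"
    if "i < length xs" for i
  proof -
    have "[:- (xs ! i), 1:] dvd g - [:poly g (xs ! i):]" by (simp add: poly_eq_0_iff_dvd[symmetric])
    moreover have "(\<Prod>x\<leftarrow>xs. [:- x, 1:]) = [:- (xs ! i), 1:] * (\<Prod>l\<in>{..<length xs} - {i}. [:- (xs ! l), 1:])"
      unfolding root_list_prod using that by (simp add: prod.remove)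
    ultimately show ?thesis by (simp only: mult_dvd_mono dvd_refl)
  qed
  then have "(\<Prod>x\<leftarrow>xs. [:- x, 1:]) dvd (\<Sum>i<length xs. (g - [:poly g (xs ! i):]) * (\<Prod>l\<in>{..<length xs} - {i}. [:- (xs ! l), 1:]))"
    by (intro dvd_sum) auto
  also have "\<dots> = g * pderiv (\<Prod>x\<leftarrow>xs. [:- x, 1:]) - lagrange_sum xs (poly g)"
    unfolding pderiv_root_list lagrange_sum_def sum_distrib_left
    by (simp add: sum_subtractf left_diff_distrib del: mult_pCons_left)  simp
  finally show ?thesis .
qed

lemma poly_lagrange_sum:
  assumes "t \<in> set xs"
  shows "poly (lagrange_sum xs v) t = v t * poly (pderiv (\<Prod>x\<leftarrow>xs. [:- x, 1:])) t"
proof -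
  obtain j where j: "j < length xs" "xs ! j = t" using assms by (auto simp: in_set_conv_nth)
  have key: "v (xs ! i) * poly (\<Prod>l\<in>{..<length xs} - {i}. [:- (xs ! l), 1:]) t = v t * poly (\<Prod>l\<in>{..<length xs} - {i}. [:- (xs ! l), 1:]) t" for i
  proof (cases "xs ! i = t")
    case False
    then have "j \<in> {..<length xs} - {i}" using j by auto
    then have "poly (\<Prod>l\<in>{..<length xs} - {i}. [:- (xs ! l), 1:]) t = 0"
      unfolding poly_prod using j by (intro prod_zero) auto
    then show ?thesis by simp
  qed simp
  show ?thesis unfolding lagrange_sum_def pderiv_root_list poly_sum poly_smult sum_distrib_left
    by (intro sum.cong refl key)
qed

lemma coeff_root_prod_bound:
  fixes x :: "'i \<Rightarrow> complex"
  assumes "finite A" "\<And>l. l \<in> A \<Longrightarrow> norm (x l) \<le> R"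
  shows "norm (coeff (\<Prod>l\<in>A. [:- x l, 1:]) b) \<le> (1 + R) ^ card A"
  using assms
proof (induction A arbitrary: b)
  case empty
  then show ?case by (simp add: coeff_1)
next
  case (insert a A)
  have xa: "norm (x a) \<le> R" using insert.prems by simp
  then have R: "0 \<le> R" using norm_ge_zero order_trans by blast
  have IH: "norm (coeff (\<Prod>l\<in>A. [:- x l, 1:]) b) \<le> (1 + R) ^ card A" for b using insert by simp
  define q where "q = (\<Prod>l\<in>A. [:- x l, 1:])"
  have "coeff ([:- x a, 1:] * q) b = - x a * coeff q b + (case b of 0 \<Rightarrow> 0 | Suc b \<Rightarrow> coeff q b)"
    by (simp add: coeff_pCons split: nat.split)
  also have "norm \<dots> \<le> norm (x a) * norm (coeff q b) + norm (case b of 0 \<Rightarrow> 0 | Suc b \<Rightarrow> coeff q b)"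
    using norm_triangle_ineq[of "- x a * coeff q b"] by (simp add: norm_mult)
  also have "\<dots> \<le> R * (1 + R) ^ card A + (1 + R) ^ card A"
    using IH R xa unfolding q_def[symmetric]
    by (intro add_mono mult_mono) (auto split: nat.split)
  also have "\<dots> = (1 + R) ^ card (insert a A)" using insert.hyps by (simp add: distrib_right)
  finally show ?case using insert.hyps by (simp add: q_def)
qed

lemma coeff_lagrange_sum_bound:
  fixes R V :: real
  assumes R: "\<And>x. x \<in> set xs \<Longrightarrow> norm x \<le> R" "0 \<le> R" and V: "\<And>x. x \<in> set xs \<Longrightarrow> norm (v x) \<le> V"
  shows "norm (coeff (lagrange_sum xs v) b) \<le> length xs * (V * (1 + R) ^ length xs)"
proof -
  have "norm (coeff (lagrange_sum xs v) b) \<le> (\<Sum>i<length xs. norm (v (xs ! i)) * norm (coeff (\<Prod>l\<in>{..<length xs} - {i}. [:- (xs ! l), 1:]) b))"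
    unfolding lagrange_sum_def coeff_sum coeff_smult by (rule order_trans[OF norm_sum]) (simp add: norm_mult)
  also have "\<dots> \<le> (\<Sum>i<length xs. V * (1 + R) ^ length xs)"
  proof (intro sum_mono mult_mono)
    fix i assume "i \<in> {..<length xs}"
    then show "norm (v (xs ! i)) \<le> V" by (intro V) simp
    then show "0 \<le> V" using norm_ge_zero order_trans by blast
    have "norm (coeff (\<Prod>l\<in>{..<length xs} - {i}. [:- (xs ! l), 1:]) b) \<le> (1 + R) ^ card ({..<length xs} - {i})"
      by (intro coeff_root_prod_bound R(1)) auto
    also have "\<dots> \<le> (1 + R) ^ length xs"
      using R(2) card_mono[of "{..<length xs}" "{..<length xs} - {i}"] by (intro power_increasing) auto
    finally show "norm (coeff (\<Prod>l\<in>{..<length xs} - {i}. [:- (xs ! l), 1:]) b) \<le> (1 + R) ^ length xs" .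
  qed auto
  finally show ?thesis by simp
qed

lemma lagrange_sum_diff: "lagrange_sum xs v - lagrange_sum xs v' = lagrange_sum xs (\<lambda>x. v x - v' x)"
  by (simp add: lagrange_sum_def sum_subtractf smult_diff_left)

lemma ev_tendsto:
  assumes "\<And>n. degree (f n) \<le> d" "degree g \<le> d" "\<And>b. (\<lambda>n. poly (coeff (f n) b) z) \<longlonglongrightarrow> poly (coeff g b) z"
  shows "(\<lambda>n. ev (f n) z t) \<longlonglongrightarrow> ev g z t"
  unfolding ev_sum[OF assms(1)] ev_sum[OF assms(2)] by (intro tendsto_intros assms(3))

lemma ev_compose: "ev (poly (map_poly cc a) f) z t = poly a (ev f z t)"
  by (induction a) (simp_all add: map_poly_pCons cc ev ev_cc)

lemma slice_minus_const_roots: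
  assumes "lead_coeff P = 1" "degree P > 0"
  obtains xs where "slice z P - [:\<beta>:] = (\<Prod>x\<leftarrow>xs. [:- x, 1:])" "length xs = degree P"
    "\<And>t. t \<in> set xs \<longleftrightarrow> ev P z t = \<beta>"
proof -
  have 1: "lead_coeff (slice z P - [:\<beta>:]) = 1" "degree (slice z P - [:\<beta>:]) = degree P"
  proof -
    have "coeff (slice z P - [:\<beta>:]) k = coeff (slice z P) k" if "k \<ge> degree P" for k
      using that assms(2) by (simp add: coeff_pCons split: nat.split)
    then show d: "degree (slice z P - [:\<beta>:]) = degree P"
      using degree_slice_monic[OF assms(1), of z] assms
      by (intro antisym degree_le le_degree) (auto simp: coeff_eq_0)
    show "lead_coeff (slice z P - [:\<beta>:]) = 1" unfolding d
      using degree_slice_monic[OF assms(1), of z] assms by (simp add: coeff_pCons split: nat.split)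
  qed
  obtain xs where xs: "slice z P - [:\<beta>:] = (\<Prod>x\<leftarrow>xs. [:- x, 1:])" "length xs = degree (slice z P - [:\<beta>:])"
    by (rule monic_root_list[OF 1(1)])
  have "t \<in> set xs \<longleftrightarrow> ev P z t = \<beta>" for t
    unfolding root_list_iff[symmetric] xs(1)[symmetric] by (simp add: ev_def)
  then show ?thesis using that[of xs] xs 1(2) by simp
qed

lemma compose_degree:
  assumes p: "lead_coeff p = 1" "degree p > 0" and P: "lead_coeff P = 1" "degree P > 0"
    and eq: "p = poly (map_poly cc B) P"
  shows "degree p = degree B * degree P" "lead_coeff B = 1" "degree B > 0"
proof -
  have s: "slice 0 p = pcompose B (slice 0 P)"
  proof -
    have "poly (slice 0 p) t = poly (pcompose B (slice 0 P)) t" for t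
      using ev_compose[of B P 0 t] by (simp add: ev_def poly_pcompose eq)
    then show ?thesis by (simp add: poly_eq_poly_eq_iff[symmetric] fun_eq_iff)
  qed
  note P0 = degree_slice_monic[OF P(1), of 0] and p0 = degree_slice_monic[OF p(1), of 0]
  show d: "degree p = degree B * degree P" using arg_cong[OF s, of degree] by (simp add: p0 P0 degree_pcompose)
  have "lead_coeff (pcompose B (slice 0 P)) = lead_coeff B * lead_coeff (slice 0 P) ^ degree B"
    using P by (intro lead_coeff_comp) (simp add: P0)
  then show "lead_coeff B = 1" using p0(2) P0(2) unfolding s by simp
  show "degree B > 0" using d p(2) by (cases "degree B") auto
qed

section \<open>The primitive on the fibres of P\<close>

locale fibration = twisted p r u + minimal_integral p P for p r u P
begin

definition B :: "complex poly" where "B = (SOME q. p = poly (map_poly cc q) P)"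

lemma p_B: "p = poly (map_poly cc B) P"
  unfolding B_def by (rule someI_ex) (use decomposition in blast)

lemma ev_p: "ev p z t = poly B (ev P z t)"
  by (subst p_B) (rule ev_compose)

definition c :: "complex \<Rightarrow> complex" where
  "c \<xi> = (SOME c. \<forall>z. sector_limit (G z) \<xi> c)"

lemma c: "\<xi> ^ degree p = 1 \<Longrightarrow> sector_limit (G z) \<xi> (c \<xi>)"
  unfolding c_def using someI_ex[OF sector_limit_exists] by blast

text \<open>On a fibre \<open>P = \<beta>\<close> the function \<open>G * pderiv P\<close> is interpolated by a polynomial \<open>W\<close> in \<open>t\<close>. Its
  coefficients are entire in \<open>z\<close>, and of polynomial growth by the limit estimate, with an exponent
  that does not depend on \<open>\<beta>\<close>.\<close>

lemma fibre_polynomial: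
  "\<exists>N. \<forall>\<beta>. \<exists>W. degree W < degree P \<and> (\<forall>b. degree (coeff W b) \<le> N) \<and>
    (\<forall>z t. ev P z t = \<beta> \<longrightarrow> ev W z t = G z t * ev (pderiv P) z t \<and>
      ev (pderiv P) z t * ev (X W) z t - ev W z t * ev (X (pderiv P)) z t =
      (ev (pderiv P) z t)\<^sup>2 * ((ev (pderiv p) z t * ev u z t - ev (dz p) z t * ev r z t) * exp (- poly B \<beta>)))"
proof -
  obtain K :: nat where K: "\<And>z t. \<exists>\<xi>. \<xi> ^ degree p = 1 \<and>
    norm (G z t - c \<xi>) \<le> K * (1 + norm z + norm (ev p z t)) ^ K * exp (- Re (ev p z t))"
    using limit_estimate[OF G_deriv_t c] by blast
  obtain K3 :: nat where K3: "\<And>z t. norm t \<le> K3 * (1 + norm z + norm (ev p z t)) ^ K3" using root_bound by blast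
  define C where "C = (\<Sum>\<xi> | \<xi> ^ degree p = 1. norm (c \<xi>))"
  have fin: "finite {\<xi>::complex. \<xi> ^ degree p = 1}" using deg by (intro finite_roots_unity) auto
  have C: "norm (c \<xi>) \<le> C" if "\<xi> ^ degree p = 1" for \<xi>
    unfolding C_def using that fin by (intro member_le_sum) auto
  have C0: "C \<ge> 0" unfolding C_def by (intro sum_nonneg) auto
  define e where "e = degree P"
  \<comment> \<open>\<open>K\<close> accounts for the growth in z of the values of \<open>G\<close>
    on the fibre, \<open>K3 * e\<close> for that of the products of roots. \<beta> enters through
    \<open>s\<close> and \<open>E\<close> only, which affect the factor \<open>A\<close> but not the
    exponent.\<close>
  define N where "N = K + K3 * e"
  show ?thesis
  proof (intro exI[of _ N] allI)
    fix \<beta>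
    define s where "s = norm (poly B \<beta>)"
    define E where "E = exp (- Re (poly B \<beta>))"
    have s0: "s \<ge> 0" by (simp add: s_def)
    have E0: "E \<ge> 0" by (simp add: E_def)
    have "\<forall>z. \<exists>xs. slice z P - [:\<beta>:] = (\<Prod>x\<leftarrow>xs. [:- x, 1:]) \<and> length xs = e \<and> (\<forall>t. t \<in> set xs \<longleftrightarrow> ev P z t = \<beta>)"
      using slice_minus_const_roots[OF P(2,3)] unfolding e_def by metis
    then obtain xs where xs: "\<And>z. slice z P - [:\<beta>:] = (\<Prod>x\<leftarrow>xs z. [:- x, 1:])" "\<And>z. length (xs z) = e"
      "\<And>z t. t \<in> set (xs z) \<longleftrightarrow> ev P z t = \<beta>" by (auto simp: choice_iff)
    have ne: "xs z \<noteq> []" for z using xs(2)[of z] P(3) by (auto simp: e_def)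
    have dr: "pderiv (\<Prod>x\<leftarrow>xs z. [:- x, 1:]) = slice z (pderiv P)" for z
      unfolding xs(1)[symmetric] by (simp add: pderiv_diff pderiv_slice pderiv_pCons)
    have R: "norm t \<le> K3 * (1 + norm z + s) ^ K3" if "t \<in> set (xs z)" for z t
      using K3[of t z] that unfolding xs(3) by (simp add: ev_p s_def)
    have V: "norm (G z t) \<le> C + K * (1 + norm z + s) ^ K * E" if "t \<in> set (xs z)" for z t
    proof -
      have evp: "ev p z t = poly B \<beta>" using that unfolding xs(3) by (simp add: ev_p)
      obtain \<xi> where \<xi>: "\<xi> ^ degree p = 1" "norm (G z t - c \<xi>) \<le> K * (1 + norm z + s) ^ K * E"
        using K[of z t] unfolding evp s_def E_def by blast
      have "norm (G z t) \<le> norm (c \<xi>) + norm (G z t - c \<xi>)" using norm_triangle_sub by blast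
      then show ?thesis using \<xi> C[OF \<xi>(1)] by linarith
    qed
    define w where "w b z = coeff (lagrange_sum (xs z) (G z)) b" for b z
    have wb: "norm (w b z) \<le> e * ((C + K * (1 + norm z + s) ^ K * E) * (1 + K3 * (1 + norm z + s) ^ K3) ^ e)" for b z
      unfolding w_def xs(2)[symmetric, of z] by (rule coeff_lagrange_sum_bound) (use R V s0 in auto)
    define A where "A = e * ((C + K * (2 + s) ^ K * E) * (1 + K3 * (2 + s) ^ K3) ^ e)"
    have wA: "norm (w b z) \<le> A * norm z ^ N" if z: "norm z \<ge> 1" for b z
    proof -
      have z0: "1 + norm z + s \<le> (2 + s) * norm z"
        using z mult_left_mono[OF z s0] by (simp add: algebra_simps)
      have pw: "(1 + norm z + s) ^ k \<le> (2 + s) ^ k * norm z ^ k" for k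
        unfolding power_mult_distrib[symmetric] using z0 s0 by (intro power_mono) auto
      have "C + K * (1 + norm z + s) ^ K * E \<le> C * norm z ^ K + K * ((2 + s) ^ K * norm z ^ K) * E"
        using pw C0 E0 one_le_power[OF z, of K] by (intro add_mono mult_right_mono mult_left_mono) (auto simp: mult_le_cancel_left1)
      also have "\<dots> = (C + K * (2 + s) ^ K * E) * norm z ^ K" by (simp add: algebra_simps)
      finally have 1: "C + K * (1 + norm z + s) ^ K * E \<le> (C + K * (2 + s) ^ K * E) * norm z ^ K" .
      have "1 + K3 * (1 + norm z + s) ^ K3 \<le> norm z ^ K3 + K3 * ((2 + s) ^ K3 * norm z ^ K3)"
        using pw one_le_power[OF z, of K3] by (intro add_mono mult_left_mono) auto
      also have "\<dots> = (1 + K3 * (2 + s) ^ K3) * norm z ^ K3" by (simp add: algebra_simps)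
      finally have "(1 + K3 * (1 + norm z + s) ^ K3) ^ e \<le> ((1 + K3 * (2 + s) ^ K3) * norm z ^ K3) ^ e"
        using s0 by (intro power_mono) auto
      also have "\<dots> = (1 + K3 * (2 + s) ^ K3) ^ e * norm z ^ (K3 * e)" by (simp add: power_mult_distrib power_mult)
      finally have 2: "(1 + K3 * (1 + norm z + s) ^ K3) ^ e \<le> (1 + K3 * (2 + s) ^ K3) ^ e * norm z ^ (K3 * e)" .
      have "norm (w b z) \<le> e * (((C + K * (2 + s) ^ K * E) * norm z ^ K) * ((1 + K3 * (2 + s) ^ K3) ^ e * norm z ^ (K3 * e)))"
        by (rule order_trans[OF wb mult_left_mono[OF mult_mono[OF 1 2]]]) (use s0 C0 E0 in auto)
      also have "\<dots> = A * norm z ^ N" by (simp add: A_def N_def power_add mult_ac)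
      finally show ?thesis .
    qed
    have "\<exists>H W. G_approx n * pderiv P = H * (P - cc \<beta>) + W \<and> degree W < e" for n
    proof -
      have m: "degree (P - cc \<beta>) = e" "lead_coeff (P - cc \<beta>) = 1"
      proof -
        have "coeff (P - cc \<beta>) k = coeff P k" if "k \<ge> degree P" for k
          using that P(3) by (simp add: cc_def coeff_pCons split: nat.split)
        then show d: "degree (P - cc \<beta>) = e"
          using P by (intro antisym degree_le le_degree) (auto simp: coeff_eq_0 e_def)
        show "lead_coeff (P - cc \<beta>) = 1" unfolding d
          using P by (simp add: e_def cc_def coeff_pCons split: nat.split)
      qed
      obtain H W where "G_approx n * pderiv P = H * (P - cc \<beta>) + W" "W = 0 \<or> degree W < degree (P - cc \<beta>)"
        by (rule monic_division[OF m(2)])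
      then show ?thesis using m(1) P(3) by (intro exI[of _ H] exI[of _ W]) (auto simp: e_def)
    qed
    then have "\<forall>n. \<exists>H W. G_approx n * pderiv P = H * (P - cc \<beta>) + W \<and> degree W < e" by blast
    then obtain H W where HW: "\<And>n. G_approx n * pderiv P = H n * (P - cc \<beta>) + W n" "\<And>n. degree (W n) < e"
      unfolding choice_iff by blast
    \<comment> \<open>Both sides have degree below \<open>e\<close> and are congruent to the same
      product modulo \<open>slice z P - [:\<beta>:]\<close>, whether or not its roots are
      simple.\<close>
    have slW: "slice z (W n) = lagrange_sum (xs z) (ev (G_approx n) z)" for z n
    proof -
      define f where "f = slice z P - [:\<beta>:]"
      have f: "lead_coeff f = 1" "degree f = e"
        unfolding f_def xs(1) by (rule root_list_monic(1), simp only: root_list_monic(2) xs(2))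
      have "f dvd slice z (G_approx n) * slice z (pderiv P) - lagrange_sum (xs z) (poly (slice z (G_approx n)))"
        using root_list_dvd_lagrange_sum[of "xs z" "slice z (G_approx n)"] unfolding dr unfolding f_def xs(1) .
      moreover have "slice z (G_approx n) * slice z (pderiv P) = slice z (H n) * f + slice z (W n)"
      proof -
        have "slice z (cc \<beta>) = [:\<beta>:]" by (rule poly_eqI) (simp add: coeff_slice cc_def coeff_pCons split: nat.split)
        then have "slice z (H n * (P - cc \<beta>) + W n) = slice z (H n) * f + slice z (W n)" by (simp add: slice f_def)
        then show ?thesis unfolding HW(1)[symmetric] by (simp add: slice)
      qed
      ultimately have "f dvd slice z (H n) * f + (slice z (W n) - lagrange_sum (xs z) (poly (slice z (G_approx n))))" by (simp add: algebra_simps)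
      then have "f dvd slice z (W n) - lagrange_sum (xs z) (poly (slice z (G_approx n)))" by (simp add: dvd_add_right_iff)
      moreover have "degree (slice z (W n) - lagrange_sum (xs z) (poly (slice z (G_approx n)))) < degree f"
        unfolding f by (rule degree_diff_less) (use HW(2) degree_slice_le le_less_trans degree_lagrange_sum[OF ne] xs(2) in metis)+
      ultimately have "slice z (W n) - lagrange_sum (xs z) (poly (slice z (G_approx n))) = 0"
        by (rule monic_dvd_small[OF f(1)])
      then show ?thesis by (simp add: ev_def[abs_def])
    qed
    \<comment> \<open>For bounded z the roots are bounded, so the interpolation coefficients
      converge uniformly. The limits are entire in z, although no continuous choice of the roots has
      been made.\<close>
    have ul: "uniform_limit (cball 0 \<rho>) (\<lambda>n z. poly (coeff (W n) b) z) (w b) sequentially" for \<rho> b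
    proof (rule uniform_limitI)
      fix \<epsilon> :: real assume \<epsilon>: "\<epsilon> > 0"
      define R' where "R' = K3 * (1 + \<bar>\<rho>\<bar> + s) ^ K3"
      have R'0: "R' \<ge> 0" using s0 by (simp add: R'_def)
      have e0: "real e > 0" using P(3) by (simp add: e_def)
      define \<epsilon>' where "\<epsilon>' = \<epsilon> / (2 * (e * (1 + R') ^ e))"
      have pos: "e * (1 + R') ^ e > 0" using e0 R'0 by simp
      have \<epsilon>': "\<epsilon>' > 0" unfolding \<epsilon>'_def using pos \<epsilon> by simp
      have \<epsilon>'': "e * (\<epsilon>' * (1 + R') ^ e) < \<epsilon>"
      proof -
        have "e * (\<epsilon>' * (1 + R') ^ e) = \<epsilon>' * (e * (1 + R') ^ e)" by simp
        also have "\<dots> = \<epsilon> / 2"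
        proof -
          have "\<epsilon> / (2 * Q) * Q = \<epsilon> / 2" if "Q > 0" for Q :: real using that by simp
          then show ?thesis unfolding \<epsilon>'_def using pos by blast
        qed
        finally show ?thesis using \<epsilon> by simp
      qed
      from uniform_limitD[OF G_uniform[of "max \<bar>\<rho>\<bar> R'"] \<epsilon>']
      have "\<forall>\<^sub>F n in sequentially. \<forall>(z,t)\<in>cball 0 (max \<bar>\<rho>\<bar> R') \<times> cball 0 (max \<bar>\<rho>\<bar> R'). dist (ev (G_approx n) z t) (G z t) < \<epsilon>'"
        by (simp add: case_prod_beta)
      then show "\<forall>\<^sub>F n in sequentially. \<forall>z\<in>cball 0 \<rho>. dist (poly (coeff (W n) b) z) (w b z) < \<epsilon>"
      proof eventually_elim
        case (elim n)
        show ?case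
        proof
          fix z :: complex assume z: "z \<in> cball 0 \<rho>"
          have R'': "norm t \<le> R'" if "t \<in> set (xs z)" for t
          proof -
            have "K3 * (1 + norm z + s) ^ K3 \<le> R'" unfolding R'_def using z s0
              by (intro mult_left_mono power_mono) auto
            then show ?thesis using R[OF that] by linarith
          qed
          have "poly (coeff (W n) b) z - w b z = coeff (lagrange_sum (xs z) (\<lambda>t. ev (G_approx n) z t - G z t)) b"
            unfolding w_def lagrange_sum_diff[symmetric] slW[symmetric] by (simp add: coeff_slice)
          also have "norm \<dots> \<le> length (xs z) * (\<epsilon>' * (1 + R') ^ length (xs z))"
          proof (rule coeff_lagrange_sum_bound)
            fix t assume t: "t \<in> set (xs z)"
            have "(z, t) \<in> cball 0 (max \<bar>\<rho>\<bar> R') \<times> cball 0 (max \<bar>\<rho>\<bar> R')" using z R''[OF t] by auto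
            then have "dist (ev (G_approx n) z t) (G z t) < \<epsilon>'" using elim by fast
            then show "norm (ev (G_approx n) z t - G z t) \<le> \<epsilon>'" by (simp add: dist_norm)
          qed (use R'' R'0 in auto)
          finally show "dist (poly (coeff (W n) b) z) (w b z) < \<epsilon>" using \<epsilon>'' by (simp add: xs(2) dist_norm)
        qed
      qed
    qed
    have "\<exists>w'. \<forall>z. (w b has_field_derivative w' z) (at z) \<and> (\<lambda>n. poly (pderiv (coeff (W n) b)) z) \<longlonglongrightarrow> w' z" for b
    proof -
      have "\<exists>g'. \<forall>x\<in>UNIV. (w b has_field_derivative g' x) (at x) \<and> (\<lambda>n. poly (pderiv (coeff (W n) b)) x) \<longlonglongrightarrow> g' x"
      proof (rule has_complex_derivative_uniform_sequence[of UNIV "\<lambda>n z. poly (coeff (W n) b) z" "\<lambda>n z. poly (pderiv (coeff (W n) b)) z" "w b"])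
        fix x :: complex
        have "uniform_limit (cball x 1) (\<lambda>n z. poly (coeff (W n) b) z) (w b) sequentially"
          by (rule uniform_limit_on_subset[OF ul[where \<rho> = "norm x + 1"]]) (simp add: cball_subset_cball_iff dist_norm)
        then show "\<exists>d>0. cball x d \<subseteq> UNIV \<and> uniform_limit (cball x d) (\<lambda>n z. poly (coeff (W n) b) z) (w b) sequentially"
          by (intro exI[of _ 1]) auto
      qed (auto intro: poly_DERIV)
      then show ?thesis by blast
    qed
    then have "\<forall>b. \<exists>w'. \<forall>z. (w b has_field_derivative w' z) (at z) \<and> (\<lambda>n. poly (pderiv (coeff (W n) b)) z) \<longlonglongrightarrow> w' z" by blast
    then obtain w' where w': "\<And>b z. (w b has_field_derivative w' b z) (at z)"
      "\<And>b z. (\<lambda>n. poly (pderiv (coeff (W n) b)) z) \<longlonglongrightarrow> w' b z" unfolding choice_iff by blast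
    define q where "q b = (\<Sum>k\<le>N. monom ((deriv ^^ k) (w b) 0 / fact k) k)" for b
    have wq: "w b z = poly (q b) z" for b z
    proof -
      have "w b holomorphic_on UNIV" using w'(1) by (auto simp: holomorphic_on_def field_differentiable_def intro: has_field_derivative_at_within)
      then have "w b z = (\<Sum>k\<le>N. (deriv ^^ k) (w b) 0 / fact k * z ^ k)"
        by (rule Liouville_polynomial[OF _ wA])
      then show ?thesis by (simp add: q_def poly_sum poly_monom)
    qed
    have dq: "degree (q b) \<le> N" for b
      unfolding q_def by (intro degree_sum_le) (auto intro: order_trans[OF degree_monom_le])
    have qb: "q b = 0" if "b \<ge> e" for b
    proof -
      have "poly (q b) z = 0" for z
        unfolding wq[symmetric] w_def using degree_lagrange_sum[OF ne[of z], of "G z"] xs(2)[of z] that by (intro coeff_eq_0) simp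
      then show ?thesis using poly_all_0_iff_0 by blast
    qed
    define W0 where "W0 = (\<Sum>b<e. monom (q b) b)"
    have cW: "coeff W0 b = q b" for b
      unfolding W0_def coeff_sum using qb[of b] by (cases "b < e") (simp_all add: sum.delta)
    have slW0: "slice z W0 = lagrange_sum (xs z) (G z)" for z
      by (intro poly_eqI) (simp add: coeff_slice cW wq[symmetric] w_def)
    have dW0: "degree W0 < e"
      using P(3) unfolding W0_def e_def by (intro degree_sum_less) (auto intro: le_less_trans[OF degree_monom_le])
    have lW: "(\<lambda>n. poly (coeff (W n) b) z) \<longlonglongrightarrow> poly (coeff W0 b) z" for b z
      using tendsto_uniform_limitI[OF ul[where \<rho> = "norm z" and b = b], of z] by (simp add: cW wq)
    have dw: "poly (pderiv (q b)) z = w' b z" for b z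
    proof -
      have "w b = poly (q b)" using wq by auto
      then have "(poly (q b) has_field_derivative w' b z) (at z)" using w'(1)[of b z] by simp
      with poly_DERIV show ?thesis by (rule DERIV_unique)
    qed
    show "\<exists>W. degree W < degree P \<and> (\<forall>b. degree (coeff W b) \<le> N) \<and>
    (\<forall>z t. ev P z t = \<beta> \<longrightarrow> ev W z t = G z t * ev (pderiv P) z t \<and>
      ev (pderiv P) z t * ev (X W) z t - ev W z t * ev (X (pderiv P)) z t =
      (ev (pderiv P) z t)\<^sup>2 * ((ev (pderiv p) z t * ev u z t - ev (dz p) z t * ev r z t) * exp (- poly B \<beta>)))"
    proof (intro exI[of _ W0] conjI allI impI)
      show "degree W0 < degree P" using dW0 by (simp add: e_def)
      show "degree (coeff W0 b) \<le> N" for b by (simp add: cW dq)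
      fix z t assume zt: "ev P z t = \<beta>"
      then have t: "t \<in> set (xs z)" by (simp add: xs(3))
      show "ev W0 z t = G z t * ev (pderiv P) z t"
        unfolding ev_def[of W0] slW0 poly_lagrange_sum[OF t] dr by (simp add: ev_def)
      have le: "degree (W n) \<le> e" "degree W0 \<le> e" for n using HW(2)[of n] dW0 by auto
      have l1: "(\<lambda>n. ev (W n) z t) \<longlonglongrightarrow> ev W0 z t"
        by (rule ev_tendsto[where d = e]) (use le lW in auto)
      have l2: "(\<lambda>n. ev (dz (W n)) z t) \<longlonglongrightarrow> ev (dz W0) z t"
        by (rule ev_tendsto[where d = e])
          (use le w'(2) in \<open>auto simp: coeff_dz cW dw intro: order_trans[OF degree_dz_le]\<close>)
      have l3: "(\<lambda>n. ev (pderiv (W n)) z t) \<longlonglongrightarrow> ev (pderiv W0) z t"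
      proof (rule ev_tendsto[where d = e])
        show "degree (pderiv (W n)) \<le> e" for n using HW(2)[of n] by (simp add: degree_pderiv)
        show "degree (pderiv W0) \<le> e" using dW0 by (simp add: degree_pderiv)
        show "(\<lambda>n. poly (coeff (pderiv (W n)) b) z) \<longlonglongrightarrow> poly (coeff (pderiv W0) b) z" for b
          unfolding coeff_pderiv poly_mult by (intro tendsto_intros lW)
      qed
      let ?E = "\<lambda>f. ev f z t"
      have "(\<lambda>n. ?E (pderiv P) * (?E (pderiv p) * ?E (dz (W n)) - ?E (dz p) * ?E (pderiv (W n))) - ?E (W n) * ?E (X (pderiv P)))
        \<longlonglongrightarrow> ?E (pderiv P) * (?E (pderiv p) * ?E (dz W0) - ?E (dz p) * ?E (pderiv W0)) - ?E W0 * ?E (X (pderiv P))"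
        by (intro tendsto_intros l1 l2 l3)
      moreover have "?E (pderiv P) * (?E (pderiv p) * ?E (dz (W n)) - ?E (dz p) * ?E (pderiv (W n))) - ?E (W n) * ?E (X (pderiv P))
        = (?E (pderiv P))\<^sup>2 * (?E (pderiv p) * ?E (dz (G_approx n)) - ?E (dz p) * ?E (pderiv (G_approx n)))" for n
      proof -
        \<comment> \<open>\<open>X\<close> annihilates \<open>P - cc \<beta>\<close>, so on the
          fibre the multiple of it contributes neither to \<open>W n\<close> nor to its derivative.
          The quotient rule then leaves the derivative of \<open>G_approx n\<close> alone.\<close>
        have Wn: "W n = G_approx n * pderiv P - H n * (P - cc \<beta>)" using HW(1)[of n] by simp
        have "X (P - cc \<beta>) = 0" by (simp add: XD P X_cc)
        then have XW: "X (W n) = X (G_approx n) * pderiv P + G_approx n * X (pderiv P) - X (H n) * (P - cc \<beta>)"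
          unfolding Wn by (simp add: XD)
        have "pderiv P * X (W n) - W n * X (pderiv P) = (pderiv P)\<^sup>2 * X (G_approx n)
          + (P - cc \<beta>) * (H n * X (pderiv P) - pderiv P * X (H n))"
          by (subst XW, subst Wn) (simp add: algebra_simps power2_eq_square)
        then have "?E (pderiv P * X (W n) - W n * X (pderiv P)) = ?E ((pderiv P)\<^sup>2 * X (G_approx n)
          + (P - cc \<beta>) * (H n * X (pderiv P) - pderiv P * X (H n)))" by simp
        then show ?thesis by (simp add: ev ev_cc zt X_def)
      qed
      moreover have "(\<lambda>n. (?E (pderiv P))\<^sup>2 * (?E (pderiv p) * ?E (dz (G_approx n)) - ?E (dz p) * ?E (pderiv (G_approx n))))
        \<longlonglongrightarrow> (?E (pderiv P))\<^sup>2 * (?E (pderiv p) * (?E u * exp (- ?E p)) - ?E (dz p) * (?E r * exp (- ?E p)))"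
        by (intro tendsto_intros G_approx_t_limit G_approx_z_limit)
      ultimately have "?E (pderiv P) * (?E (pderiv p) * ?E (dz W0) - ?E (dz p) * ?E (pderiv W0)) - ?E W0 * ?E (X (pderiv P))
        = (?E (pderiv P))\<^sup>2 * (?E (pderiv p) * (?E u * exp (- ?E p)) - ?E (dz p) * (?E r * exp (- ?E p)))"
        using LIMSEQ_unique by simp
      then show "?E (pderiv P) * ?E (X W0) - ?E W0 * ?E (X (pderiv P)) =
        (?E (pderiv P))\<^sup>2 * ((?E (pderiv p) * ?E u - ?E (dz p) * ?E r) * exp (- poly B \<beta>))"
        by (simp add: X_def ev ev_p zt left_diff_distrib mult.assoc)
    qed
  qed
qed

end

section \<open>Elimination with the fibre value as a parameter\<close>

lemma coeff_cc_mult: "coeff (coeff (cc c * f) s) d = c * coeff (coeff f s) d"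
  by (simp add: cc_def)

lemma ev_double_sum:
  assumes "degree f < e" "\<And>s. degree (coeff f s) \<le> M"
  shows "ev f z t = (\<Sum>(s,d)\<in>{..<e}\<times>{..M}. coeff (coeff f s) d * (z ^ d * t ^ s))"
proof -
  have "ev f z t = (\<Sum>s\<le>degree f. poly (coeff f s) z * t ^ s)" by (rule ev_sum) simp
  also have "\<dots> = (\<Sum>s<e. poly (coeff f s) z * t ^ s)"
    using assms(1) by (intro sum.mono_neutral_left) (auto simp: coeff_eq_0)
  also have "\<dots> = (\<Sum>s<e. \<Sum>d\<le>M. coeff (coeff f s) d * (z ^ d * t ^ s))"
    by (simp add: poly_eq_sum_le[OF assms(2)] sum_distrib_right mult.assoc)
  finally show ?thesis by (simp add: sum.cartesian_product)
qed

lemma coeff_degree_bound: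
  assumes "finite F"
  shows "\<exists>M. \<forall>f\<in>F. \<forall>s. degree (coeff (f::bipoly) s) \<le> M"
proof (intro exI ballI allI)
  fix f s assume f: "f \<in> F"
  have "degree (coeff f s) \<le> (\<Sum>s\<le>degree f. degree (coeff f s))"
    by (cases "s \<le> degree f") (auto intro: member_le_sum simp: coeff_eq_0)
  also have "\<dots> \<le> (\<Sum>f\<in>F. \<Sum>s\<le>degree f. degree (coeff f s))"
    using assms f by (intro member_le_sum[of f F]) auto
  finally show "degree (coeff f s) \<le> (\<Sum>f\<in>F. \<Sum>s\<le>degree f. degree (coeff f s))" .
qed

lemma adic_expansion_support:
  fixes f g :: "'a::idom poly"
  assumes g: "lead_coeff g = 1" "degree g > 0"
  shows "\<exists>\<mu> n. (\<forall>k. degree (\<mu> k) < degree g) \<and> (\<forall>k>n. \<mu> k = 0) \<and> (\<forall>N\<ge>n. f = (\<Sum>k\<le>N. g ^ k * \<mu> k))"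
proof -
  obtain n \<mu> where \<mu>: "f = (\<Sum>k\<le>n. g ^ k * \<mu> k)" "\<And>k. degree (\<mu> k) < degree g"
    using adic_expansion[OF g] by blast
  have "f = (\<Sum>k\<le>N. g ^ k * (if k \<le> n then \<mu> k else 0))" if "N \<ge> n" for N
  proof -
    have "(\<Sum>k\<le>N. g ^ k * (if k \<le> n then \<mu> k else 0)) = (\<Sum>k\<le>n. g ^ k * (if k \<le> n then \<mu> k else 0))"
      using that by (intro sum.mono_neutral_right) auto
    then show ?thesis using \<mu>(1) by simp
  qed
  then show ?thesis using \<mu>(2) g(2) by (intro exI[of _ "\<lambda>k. if k \<le> n then \<mu> k else 0"] exI[of _ n]) auto
qed

text \<open>A multiple root over some z in \<open>Z\<close> forces \<beta> to be a critical value of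
  \<open>slice z P\<close>, and these are finitely many.\<close>

lemma simple_roots_large:
  assumes P: "lead_coeff P = 1" "degree P > 0" and Z: "finite Z"
  shows "\<exists>R. \<forall>\<beta>. norm \<beta> \<ge> R \<longrightarrow> (\<forall>z\<in>Z. \<forall>t. ev P z t = \<beta> \<longrightarrow> ev (pderiv P) z t \<noteq> 0)"
proof -
  define S where "S = (\<Union>z\<in>Z. (\<lambda>t. ev P z t) ` {t. poly (slice z (pderiv P)) t = 0})"
  have "slice z (pderiv P) \<noteq> 0" for z
    using degree_slice_monic[OF P(1), of z] P(2) by (simp add: pderiv_slice[symmetric] pderiv_eq_0_iff)
  then have S: "finite S" unfolding S_def using Z by (intro finite_UN_I finite_imageI poly_roots_finite) auto
  show ?thesis
  proof (intro exI[of _ "1 + (\<Sum>\<beta>\<in>S. norm \<beta>)"] allI impI ballI notI)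
    fix \<beta> z t assume \<beta>: "1 + (\<Sum>\<beta>\<in>S. norm \<beta>) \<le> norm \<beta>" and "z \<in> Z" "ev P z t = \<beta>" "ev (pderiv P) z t = 0"
    then have "\<beta> \<in> S" by (auto simp: S_def ev_def)
    then have "norm \<beta> \<le> (\<Sum>\<beta>\<in>S. norm \<beta>)" using S by (intro member_le_sum) auto
    then show False using \<beta> by simp
  qed
qed

lemma vanishing_on_simple_fibre:
  assumes P: "lead_coeff P = 1" "degree P > 0"
    and simple: "\<And>t. ev P z t = \<beta> \<Longrightarrow> ev (pderiv P) z t \<noteq> 0"
    and F: "degree F < degree P" "\<And>t. ev P z t = \<beta> \<Longrightarrow> poly F t = 0"
  shows "F = 0"
proof (rule ccontr)
  assume F0: "F \<noteq> 0"
  obtain xs where xs: "slice z P - [:\<beta>:] = (\<Prod>x\<leftarrow>xs. [:- x, 1:])" "length xs = degree P" "\<And>t. t \<in> set xs \<longleftrightarrow> ev P z t = \<beta>"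
    using slice_minus_const_roots[OF P] by metis
  have "distinct xs"
  proof (rule ccontr)
    assume "\<not> distinct xs"
    then obtain as x bs cs where d: "xs = as @ [x] @ bs @ [x] @ cs" using not_distinct_decomp by blast
    have "\<exists>g. (\<Prod>x\<leftarrow>xs. [:- x, 1:]) = [:- x, 1:] * ([:- x, 1:] * g)"
      by (rule exI[of _ "(\<Prod>x\<leftarrow>as @ bs @ cs. [:- x, 1:])"]) (simp add: d mult_ac del: mult_pCons_left mult_pCons_right)
    then obtain g where g: "slice z P - [:\<beta>:] = [:- x, 1:] * ([:- x, 1:] * g)" unfolding xs(1) by blast
    have "poly (pderiv (slice z P - [:\<beta>:])) x = 0"
      unfolding g by (simp only: pderiv_mult) simp
    then have "ev (pderiv P) z x = 0" by (simp add: pderiv_diff pderiv_slice pderiv_pCons ev_def)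
    moreover have "ev P z x = \<beta>" using xs(3)[of x] d by simp
    ultimately show False using simple by blast
  qed
  then have "card (set xs) = degree P" using xs(2) distinct_card by metis
  moreover have "set xs \<subseteq> {t. poly F t = 0}" using xs(3) F(2) by blast
  then have "card (set xs) \<le> card {t. poly F t = 0}" using poly_roots_finite[OF F0] by (intro card_mono)
  moreover have "card {t. poly F t = 0} \<le> degree F" by (rule card_poly_roots_bound[OF F0])
  ultimately show False using F(1) by simp
qed

text \<open>Over each of M + 1 values of z the fibre has \<open>degree P\<close> distinct points,
  too many for the roots of a nonzero slice of \<open>F\<close>. Coefficients of degree at most M
  with M + 1 zeros are zero.\<close>

lemma vanishing_on_simple_fibres:
  assumes P: "lead_coeff P = 1" "degree P > 0"
    and simple: "\<And>z t. z \<in> of_nat ` {..M} \<Longrightarrow> ev P z t = \<beta> \<Longrightarrow> ev (pderiv P) z t \<noteq> 0"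
    and F: "degree F < degree P" "\<And>s. degree (coeff F s) \<le> M" "\<And>z t. ev P z t = \<beta> \<Longrightarrow> ev F z t = 0"
  shows "F = 0"
proof (rule poly_eqI)
  fix s
  have "poly (coeff F s) z = 0" if "z \<in> of_nat ` {..M}" for z
  proof -
    have "slice z F = 0"
      by (rule vanishing_on_simple_fibre[OF P simple[OF that]])
        (use F(1) degree_slice_le[of z F] F(3) in \<open>auto simp: ev_def\<close>)
    then show ?thesis using coeff_slice[of z F s] by simp
  qed
  then have sub: "of_nat ` {..M} \<subseteq> {z. poly (coeff F s) z = 0}" by blast
  show "coeff F s = coeff 0 s"
  proof (rule ccontr)
    assume "coeff F s \<noteq> coeff 0 s"
    then have nz: "coeff F s \<noteq> 0" by simp
    have "card ((of_nat :: nat \<Rightarrow> complex) ` {..M}) = Suc M" by (subst card_image) (auto simp: inj_on_def)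
    moreover have "card ((of_nat :: nat \<Rightarrow> complex) ` {..M}) \<le> card {z. poly (coeff F s) z = 0}"
      using sub poly_roots_finite[OF nz] by (intro card_mono)
    ultimately show False using card_poly_roots_bound[OF nz] F(2)[of s] by linarith
  qed
qed

context fibration
begin

text \<open>The operator \<open>W \<mapsto> pderiv P * X W - W * X (pderiv P)\<close> on the fibres \<open>P = \<beta>\<close> is a finite linear
  system over the polynomials in \<open>\<beta>\<close>. Its kernel consists of the multiples of \<open>pderiv P\<close>, so the
  defect of \<open>W\<close> from such a multiple is a rational combination of the equations.\<close>

lemma elimination:
  assumes b: "b < degree P"
  shows "\<exists>q Q R. q \<noteq> 0 \<and> (\<forall>\<beta> W. norm \<beta> \<ge> R \<longrightarrow> degree W < degree P \<longrightarrow> (\<forall>b. degree (coeff W b) \<le> N) \<longrightarrow>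
    (\<forall>z t. ev P z t = \<beta> \<longrightarrow> ev (pderiv P) z t * ev (X W) z t - ev W z t * ev (X (pderiv P)) z t =
      (ev (pderiv P) z t)\<^sup>2 * ((ev (pderiv p) z t * ev u z t - ev (dz p) z t * ev r z t) * exp (- poly B \<beta>))) \<longrightarrow>
    poly q \<beta> * (of_nat (degree P) * coeff (coeff W b) 0 - coeff (coeff W (degree P - 1)) 0 * coeff (at0 (pderiv P)) b)
      = poly Q \<beta> * exp (- poly B \<beta>))"
proof -
  define e where "e = degree P"
  have e: "e > 0" "b < e" using P(3) b by (auto simp: e_def)
  \<comment> \<open>The unknowns, coefficients of \<open>W\<close>, are indexed by (degree in z,
    degree in t). The equations \<open>A\<close> below use the opposite order, (degree in t, degree
    in z).\<close>
  define J where "J = {..N} \<times> {..<e}"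
  have J: "finite J" by (simp add: J_def)
  define bas :: "nat \<times> nat \<Rightarrow> bipoly" where "bas j = monom (monom 1 (fst j)) (snd j)" for j
  have bas: "coeff (coeff (bas j) s) d = (if j = (d, s) then 1 else 0)" for j s d
    by (cases j) (auto simp: bas_def)
  define m where "m j = pderiv P * X (bas j) - bas j * X (pderiv P)" for j
  define S where "S = (pderiv P)\<^sup>2 * (pderiv p * u - dz p * r)"
  have "\<forall>j. \<exists>\<mu> n. (\<forall>k. degree (\<mu> k) < e) \<and> (\<forall>N\<ge>n. m j = (\<Sum>k\<le>N. P ^ k * \<mu> k))"
    unfolding e_def using adic_expansion_support[OF P(2,3)] by blast
  then obtain \<mu> nm where \<mu>: "\<And>j k. degree (\<mu> j k) < e" "\<And>j N. N \<ge> nm j \<Longrightarrow> m j = (\<Sum>k\<le>N. P ^ k * \<mu> j k)"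
    unfolding choice_iff by metis
  obtain \<sigma> ns where \<sigma>: "\<And>k. degree (\<sigma> k) < e" "\<And>N. N \<ge> ns \<Longrightarrow> S = (\<Sum>k\<le>N. P ^ k * \<sigma> k)"
    unfolding e_def using adic_expansion_support[OF P(2,3), of S] by metis
  define n where "n = ns + (\<Sum>j\<in>J. nm j)"
  have mn: "m j = (\<Sum>k\<le>n. P ^ k * \<mu> j k)" if "j \<in> J" for j
    using that J by (intro \<mu>(2)) (auto simp: n_def intro: order_trans[OF member_le_sum[of j J nm]])
  have Sn: "S = (\<Sum>k\<le>n. P ^ k * \<sigma> k)" by (intro \<sigma>(2)) (simp add: n_def)
  obtain M where M: "\<forall>f\<in>(\<sigma> ` {..n}) \<union> (\<lambda>(j,k). \<mu> j k) ` (J \<times> {..n}). \<forall>s. degree (coeff f s) \<le> M"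
    using coeff_degree_bound[of "(\<sigma> ` {..n}) \<union> (\<lambda>(j,k). \<mu> j k) ` (J \<times> {..n})"] J by auto
  have M1: "degree (coeff (\<sigma> k) s) \<le> M" if "k \<le> n" for k s using M that by auto
  have M2: "degree (coeff (\<mu> j k) s) \<le> M" if "k \<le> n" "j \<in> J" for j k s using M that by fast
  define A where "A = {..<e} \<times> {..M}"
  have A: "finite A" by (simp add: A_def)
  define \<rho> where "\<rho> a j = (\<Sum>k\<le>n. monom (coeff (coeff (\<mu> j k) (fst a)) (snd a)) k)" for a j
  define \<tau> where "\<tau> a = (\<Sum>k\<le>n. monom (coeff (coeff (\<sigma> k) (fst a)) (snd a)) k)" for a
  define g where "g = coeff (at0 (pderiv P)) b"
  \<comment> \<open>The functional giving, on z = 0, the coefficient \<open>b\<close> of e W -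
    W_(e-1) \<open>pderiv P\<close>. It vanishes on constant multiples of \<open>pderiv P\<close>,
    whose coefficient of degree e - 1 is e times the multiplier.\<close>
  define y :: "nat \<times> nat \<Rightarrow> complex poly" where
    "y j = (if j = (0, b) then of_nat e else 0) - (if j = (0, e - 1) then [:g:] else 0)" for j
  have J0: "(0, b) \<in> J" "(0, e - 1) \<in> J" using e by (auto simp: J_def)
  have yx: "(\<Sum>j\<in>J. y j * x j) = of_nat e * x (0, b) - [:g:] * x (0, e - 1)" for x
  proof -
    have "(\<Sum>j\<in>J. y j * x j) = (\<Sum>j\<in>J. if j = (0, b) then of_nat e * x j else 0) - (\<Sum>j\<in>J. if j = (0, e - 1) then [:g:] * x j else 0)"
      unfolding sum_subtractf[symmetric] y_def by (intro sum.cong) (auto simp: left_diff_distrib)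
    then show ?thesis using J J0 by (simp add: sum.delta)
  qed
  have yx': "(\<Sum>j\<in>J. poly (y j) \<beta> * x j) = of_nat e * x (0, b) - g * x (0, e - 1)" for x \<beta>
  proof -
    have "(\<Sum>j\<in>J. poly (y j) \<beta> * x j) = (\<Sum>j\<in>J. if j = (0, b) then of_nat e * x j else 0) - (\<Sum>j\<in>J. if j = (0, e - 1) then g * x j else 0)"
      unfolding sum_subtractf[symmetric] y_def by (intro sum.cong) (auto simp: left_diff_distrib)
    then show ?thesis using J J0 by (simp add: sum.delta)
  qed
  from fredholm[OF A J, of \<rho> y] show ?thesis
  proof (elim disjE exE conjE)
    \<comment> \<open>With \<open>P\<close> substituted for \<beta>, a kernel vector becomes a
      polynomial \<open>W\<close> for which W / \<open>pderiv P\<close> is a rational first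
      integral; by \<open>rational_integral_trivial\<close> the functional \<open>y\<close> vanishes
      on it.\<close>
    fix w assume w: "\<forall>k\<in>A. (\<Sum>j\<in>J. \<rho> k j * w j) = 0" and yw: "(\<Sum>j\<in>J. y j * w j) \<noteq> 0"
    define l where "l = (\<Sum>j\<in>J. degree (w j))"
    have l: "degree (w j) \<le> l" if "j \<in> J" for j unfolding l_def using that J by (intro member_le_sum) auto
    define \<nu> where "\<nu> k = (\<Sum>j\<in>J. cc (coeff (w j) k) * bas j)" for k
    define W where "W = (\<Sum>k\<le>l. P ^ k * \<nu> k)"
    define wP where "wP j = poly (map_poly cc (w j)) P" for j
    have W: "W = (\<Sum>j\<in>J. wP j * bas j)"
    proof -
      have "wP j = (\<Sum>k\<le>l. cc (coeff (w j) k) * P ^ k)" if "j \<in> J" for j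
        unfolding wP_def using l[OF that] degree_map_poly_leI[of cc "w j"]
        by (subst poly_eq_sum_le[of _ l]) (auto simp: cc coeff_map_poly)
      then have "(\<Sum>j\<in>J. wP j * bas j) = (\<Sum>j\<in>J. \<Sum>k\<le>l. P ^ k * (cc (coeff (w j) k) * bas j))"
        by (intro sum.cong) (auto simp: sum_distrib_left sum_distrib_right mult_ac)
      also have "\<dots> = (\<Sum>k\<le>l. \<Sum>j\<in>J. P ^ k * (cc (coeff (w j) k) * bas j))" by (rule sum.swap)
      finally show ?thesis by (simp add: W_def \<nu>_def sum_distrib_left)
    qed
    have XwP: "X (wP j) = 0" for j
    proof -
      have "X (poly (map_poly cc q) P) = 0" for q
        by (induction q) (simp_all add: map_poly_pCons cc XD X_cc P)
      then show ?thesis by (simp add: wP_def)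
    qed
    have "X W * pderiv P - W * X (pderiv P) = (\<Sum>j\<in>J. wP j * m j)"
      unfolding W m_def XD(8) sum_distrib_right sum_subtractf[symmetric]
      by (intro sum.cong refl) (simp add: XD XwP algebra_simps)
    also have "\<dots> = 0"
    proof (rule ev_eqI)
      fix z t
      define \<beta> where "\<beta> = ev P z t"
      have "ev (\<Sum>j\<in>J. wP j * m j) z t = (\<Sum>j\<in>J. poly (w j) \<beta> * (\<Sum>k\<le>n. \<beta> ^ k * ev (\<mu> j k) z t))"
        by (auto simp: ev wP_def ev_compose mn \<beta>_def intro!: sum.cong)
      also have "\<dots> = (\<Sum>j\<in>J. poly (w j) \<beta> * (\<Sum>k\<le>n. \<beta> ^ k * (\<Sum>a\<in>A. coeff (coeff (\<mu> j k) (fst a)) (snd a) * (z ^ snd a * t ^ fst a))))"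
        using \<mu>(1) M2 by (intro sum.cong refl arg_cong2[of _ _ _ _ "(*)"]) (auto simp: ev_double_sum[of _ e M] A_def case_prod_beta)
      also have "\<dots> = (\<Sum>j\<in>J. \<Sum>a\<in>A. poly (\<rho> a j * w j) \<beta> * (z ^ snd a * t ^ fst a))"
      proof (intro sum.cong refl)
        fix j
        have "(\<Sum>k\<le>n. \<beta> ^ k * (\<Sum>a\<in>A. coeff (coeff (\<mu> j k) (fst a)) (snd a) * (z ^ snd a * t ^ fst a)))
          = (\<Sum>a\<in>A. poly (\<rho> a j) \<beta> * (z ^ snd a * t ^ fst a))"
          unfolding \<rho>_def sum_distrib_left poly_sum poly_monom sum_distrib_right
          by (subst sum.swap) (simp add: mult_ac)
        then show "poly (w j) \<beta> * (\<Sum>k\<le>n. \<beta> ^ k * (\<Sum>a\<in>A. coeff (coeff (\<mu> j k) (fst a)) (snd a) * (z ^ snd a * t ^ fst a)))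
          = (\<Sum>a\<in>A. poly (\<rho> a j * w j) \<beta> * (z ^ snd a * t ^ fst a))"
          by (simp add: sum_distrib_left mult_ac)
      qed
      also have "\<dots> = (\<Sum>a\<in>A. poly (\<Sum>j\<in>J. \<rho> a j * w j) \<beta> * (z ^ snd a * t ^ fst a))"
        by (subst sum.swap) (simp add: poly_sum sum_distrib_right)
      also have "\<dots> = 0" using w by (intro sum.neutral) auto
      finally show "ev (\<Sum>j\<in>J. wP j * m j) z t = ev 0 z t" by (simp add: ev)
    qed
    finally have XW: "X (\<Sum>k\<le>l. P ^ k * \<nu> k) * pderiv P = (\<Sum>k\<le>l. P ^ k * \<nu> k) * X (pderiv P)" by (simp add: W_def)
    have d\<nu>: "degree (\<nu> k) < degree P" for k
    proof -
      have "degree (cc (coeff (w j) k) * bas j) < degree P" if "j \<in> J" for j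
        using that e degree_monom_le[of "monom (1::complex) (fst j)" "snd j"] unfolding cc_def bas_def J_def e_def
        by (auto intro: le_less_trans[OF degree_smult_le] simp: mult_pCons_left)
      then show ?thesis unfolding \<nu>_def using P(3) by (intro degree_sum_less) auto
    qed
    have c\<nu>: "coeff (at0 (\<nu> k)) s = coeff (w (0, s)) k" if "s < e" for k s
    proof -
      have "coeff (at0 (\<nu> k)) s = coeff (coeff (\<nu> k) s) 0" by (simp add: coeff_at0 poly_0_coeff_0)
      also have "\<dots> = (\<Sum>j\<in>J. coeff (w j) k * (if j = (0, s) then 1 else 0))"
        unfolding \<nu>_def coeff_sum coeff_cc_mult bas ..
      also have "\<dots> = coeff (w (0, s)) k" using J that by (simp add: if_distrib sum.delta J_def cong: if_cong)
      finally show ?thesis .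
    qed
    have "coeff (of_nat e * w (0, b) - [:g:] * w (0, e - 1)) k = 0" for k
    proof (cases "k \<le> l")
      case True
      have "of_nat e * \<nu> k = cc (coeff (at0 (\<nu> k)) (e - 1)) * pderiv P"
        unfolding e_def by (rule rational_integral_trivial[OF XW d\<nu> True])
      then have "coeff (at0 (of_nat e * \<nu> k)) b = coeff (at0 (cc (coeff (at0 (\<nu> k)) (e - 1)) * pderiv P)) b" by simp
      moreover have "at0 (cc x) = [:x:]" for x
        by (rule poly_eqI) (simp add: coeff_at0 cc_def coeff_pCons split: nat.split)
      ultimately have "of_nat e * coeff (at0 (\<nu> k)) b = coeff (at0 (\<nu> k)) (e - 1) * g"
        unfolding at0(4) at0(10) by (simp add: g_def of_nat_poly)
      then show ?thesis using e c\<nu>[of b] c\<nu>[of "e - 1"] by (simp add: of_nat_poly mult.commute)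
    next
      case False
      then have "coeff (w (0, b)) k = 0" "coeff (w (0, e - 1)) k = 0" using l[OF J0(1)] l[OF J0(2)] by (auto intro!: coeff_eq_0)
      then show ?thesis by (simp add: of_nat_poly)
    qed
    then have "(\<Sum>j\<in>J. y j * w j) = 0" unfolding yx by (intro poly_eqI) simp
    then show ?thesis using yw by simp
  next
    fix q cf assume q: "q \<noteq> 0" "\<forall>j\<in>J. q * y j = (\<Sum>k\<in>A. cf k * \<rho> k j)"
    define Q where "Q = (\<Sum>a\<in>A. cf a * \<tau> a)"
    obtain R where R: "\<forall>\<beta>. norm \<beta> \<ge> R \<longrightarrow> (\<forall>z\<in>of_nat ` {..M}. \<forall>t. ev P z t = \<beta> \<longrightarrow> ev (pderiv P) z t \<noteq> 0)"
      using simple_roots_large[OF P(2,3), of "of_nat ` {..M}"] by auto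
    show ?thesis
    proof (rule exI[of _ q], rule exI[of _ Q], rule exI[of _ R], intro conjI allI impI q(1))
      fix \<beta> W
      assume \<beta>: "norm \<beta> \<ge> R" and W: "degree W < degree P" "\<forall>b. degree (coeff W b) \<le> N"
        and rel: "\<forall>z t. ev P z t = \<beta> \<longrightarrow> ev (pderiv P) z t * ev (X W) z t - ev W z t * ev (X (pderiv P)) z t =
          (ev (pderiv P) z t)\<^sup>2 * ((ev (pderiv p) z t * ev u z t - ev (dz p) z t * ev r z t) * exp (- poly B \<beta>))"
      define x where "x j = coeff (coeff W (snd j)) (fst j)" for j
      have Wx: "W = (\<Sum>j\<in>J. cc (x j) * bas j)"
      proof (intro poly_eqI)
        fix s d
        have "coeff (coeff (\<Sum>j\<in>J. cc (x j) * bas j) s) d = (\<Sum>j\<in>J. if j = (d, s) then x j else 0)"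
          unfolding coeff_sum coeff_cc_mult bas by (intro sum.cong) auto
        also have "\<dots> = (if (d, s) \<in> J then x (d, s) else 0)" using J by (simp add: sum.delta)
        also have "\<dots> = coeff (coeff W s) d"
        proof (cases "(d, s) \<in> J")
          case False
          then have "s \<ge> e \<or> d > N" by (auto simp: J_def)
          then have "coeff (coeff W s) d = 0"
          proof
            assume "s \<ge> e"
            then have "coeff W s = 0" using W(1) by (intro coeff_eq_0) (simp add: e_def)
            then show ?thesis by simp
          next
            assume "d > N"
            then show ?thesis using W(2) by (intro coeff_eq_0) (metis le_less_trans)
          qed
          then show ?thesis using False by simp
        qed (simp add: x_def)
        finally show "coeff (coeff W s) d = coeff (coeff (\<Sum>j\<in>J. cc (x j) * bas j) s) d" by simp
      qed
      define ex where "ex = exp (- poly B \<beta>)"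
      \<comment> \<open>The relation is given only at the points of the fibre. Replacing
        \<open>P\<close> by \<beta> in the adic expansions gives a representative of degree below
        \<open>degree P\<close>, which is small enough to vanish identically.\<close>
      define F where "F = (\<Sum>j\<in>J. cc (x j) * (\<Sum>k\<le>n. cc (\<beta> ^ k) * \<mu> j k)) - cc ex * (\<Sum>k\<le>n. cc (\<beta> ^ k) * \<sigma> k)"
      have "F = 0"
      proof (rule vanishing_on_simple_fibres[OF P(2,3)])
        show "ev (pderiv P) z t \<noteq> 0" if "z \<in> of_nat ` {..M}" "ev P z t = \<beta>" for z t using R \<beta> that by blast
        have dcc: "degree (cc c * f) < degree P" if "degree f < degree P" for c f
          using that by (simp add: cc_def le_less_trans[OF degree_smult_le])
        show "degree F < degree P"
          unfolding F_def using P(3) \<mu>(1) \<sigma>(1) by (intro degree_diff_less degree_sum_less dcc) (auto simp: e_def)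
        show "degree (coeff F s) \<le> M" for s
        proof (rule degree_le, intro allI impI)
          fix d assume "M < d"
          then have "coeff (coeff (\<sigma> k) s) d = 0" "j \<in> J \<Longrightarrow> coeff (coeff (\<mu> j k) s) d = 0" if "k \<le> n" for j k
            using M1[OF that, of s] M2[OF that, of j s] by (auto intro: coeff_eq_0)
          then show "coeff (coeff F s) d = 0" unfolding F_def coeff_diff coeff_sum coeff_cc_mult by (simp add: sum.neutral)
        qed
        fix z t assume zt: "ev P z t = \<beta>"
        have "ev F z t = (\<Sum>j\<in>J. x j * ev (m j) z t) - ex * ev S z t"
          by (simp add: F_def ev ev_cc mn Sn zt)
        also have "(\<Sum>j\<in>J. x j * ev (m j) z t) = ev (pderiv P * X W - W * X (pderiv P)) z t"
        proof -
          have "pderiv P * X W - W * X (pderiv P) = (\<Sum>j\<in>J. cc (x j) * m j)"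
            unfolding Wx m_def XD(8) sum_distrib_left sum_distrib_right sum_subtractf[symmetric]
            by (intro sum.cong refl) (simp add: XD X_cc algebra_simps)
          then show ?thesis by (simp add: ev ev_cc)
        qed
        also have "\<dots> = ex * ev S z t"
          using rel zt by (simp add: ev S_def ex_def algebra_simps)
        finally show "ev F z t = 0" by simp
      qed
      have key: "(\<Sum>j\<in>J. poly (\<rho> a j) \<beta> * x j) = ex * poly (\<tau> a) \<beta>" for a
      proof -
        have "coeff (coeff F (fst a)) (snd a) = 0" using \<open>F = 0\<close> by simp
        then have "(\<Sum>j\<in>J. x j * (\<Sum>k\<le>n. \<beta> ^ k * coeff (coeff (\<mu> j k) (fst a)) (snd a))) - ex * (\<Sum>k\<le>n. \<beta> ^ k * coeff (coeff (\<sigma> k) (fst a)) (snd a)) = 0"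
          unfolding F_def coeff_diff coeff_sum coeff_cc_mult .
        then show ?thesis by (simp add: \<rho>_def \<tau>_def poly_sum poly_monom mult_ac)
      qed
      have "poly q \<beta> * (of_nat e * x (0, b) - g * x (0, e - 1)) = (\<Sum>j\<in>J. poly (q * y j) \<beta> * x j)"
        unfolding yx'[of \<beta> x, symmetric] by (simp add: sum_distrib_left mult.assoc)
      also have "\<dots> = (\<Sum>j\<in>J. \<Sum>a\<in>A. poly (cf a) \<beta> * (poly (\<rho> a j) \<beta> * x j))"
        using q(2) by (intro sum.cong) (auto simp: poly_sum sum_distrib_right mult.assoc)
      also have "\<dots> = (\<Sum>a\<in>A. poly (cf a) \<beta> * (\<Sum>j\<in>J. poly (\<rho> a j) \<beta> * x j))"
        by (subst sum.swap) (simp add: sum_distrib_left)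
      also have "\<dots> = poly Q \<beta> * ex" unfolding key by (simp add: Q_def poly_sum sum_distrib_right sum_distrib_left mult_ac)
      finally show "poly q \<beta> * (of_nat (degree P) * coeff (coeff W b) 0 - coeff (coeff W (degree P - 1)) 0 * coeff (at0 (pderiv P)) b)
        = poly Q \<beta> * exp (- poly B \<beta>)"
        by (simp only: x_def e_def g_def ex_def fst_conv snd_conv mult.commute[of "coeff (coeff W (degree P - 1)) 0"])
    qed
  qed
qed

end

section \<open>Comparison of the limits in different directions\<close>

lemma poly_bounded_below:
  assumes "q \<noteq> (0 :: complex poly)"
  shows "\<exists>d>0. \<exists>R. \<forall>x. norm x \<ge> R \<longrightarrow> norm (poly q x) \<ge> d"
proof (cases q)
  case (pCons a q')
  show ?thesis
  proof (cases "q' = 0")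
    case True
    then show ?thesis using pCons assms by (intro exI[of _ "norm a"]) auto
  next
    case False
    then show ?thesis using poly_infinity[of q' 1 a] pCons by (intro exI[of _ 1]) auto
  qed
qed

lemma sector_limit_add:
  assumes "sector_limit f \<xi> a" "sector_limit g \<xi> b"
  shows "sector_limit (\<lambda>t. f t + g t) \<xi> (a + b)"
  unfolding sector_limit_def
proof (intro allI impI)
  fix \<epsilon> :: real assume \<epsilon>: "\<epsilon> > 0"
  then have "\<epsilon> / 2 > 0" by simp
  then obtain \<delta>1 R1 \<delta>2 R2 where f1: "\<delta>1 > 0" "\<And>t. norm t \<ge> R1 \<Longrightarrow> norm (t - complex_of_real (norm t) * \<xi>) \<le> \<delta>1 * norm t \<Longrightarrow> norm (f t - a) < \<epsilon> / 2"
    and g2: "\<delta>2 > 0" "\<And>t. norm t \<ge> R2 \<Longrightarrow> norm (t - complex_of_real (norm t) * \<xi>) \<le> \<delta>2 * norm t \<Longrightarrow> norm (g t - b) < \<epsilon> / 2"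
    using assms unfolding sector_limit_def by metis
  show "\<exists>\<delta>>0. \<exists>R. \<forall>t. norm t \<ge> R \<longrightarrow> norm (t - complex_of_real (norm t) * \<xi>) \<le> \<delta> * norm t \<longrightarrow> norm (f t + g t - (a + b)) < \<epsilon>"
  proof (rule exI[of _ "min \<delta>1 \<delta>2"], intro conjI, goal_cases)
    case 2
    show ?case
  proof (rule exI[of _ "max R1 R2"], intro allI impI)
    fix t :: complex assume t: "norm t \<ge> max R1 R2" "norm (t - complex_of_real (norm t) * \<xi>) \<le> min \<delta>1 \<delta>2 * norm t"
    have "min \<delta>1 \<delta>2 * norm t \<le> \<delta>1 * norm t" "min \<delta>1 \<delta>2 * norm t \<le> \<delta>2 * norm t" by (intro mult_right_mono; simp)+
    have "norm (f t - a) < \<epsilon> / 2" by (rule f1(2)) (use t \<open>min \<delta>1 \<delta>2 * norm t \<le> \<delta>1 * norm t\<close> in linarith)+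
    moreover have "norm (g t - b) < \<epsilon> / 2" by (rule g2(2)) (use t \<open>min \<delta>1 \<delta>2 * norm t \<le> \<delta>2 * norm t\<close> in linarith)+
    ultimately show "norm (f t + g t - (a + b)) < \<epsilon>" using norm_triangle_ineq[of "f t - a" "g t - b"] by (simp add: algebra_simps)
  qed
  qed (use f1 g2 in auto)
qed

lemma sector_limit_cmult:
  assumes "sector_limit f \<xi> a"
  shows "sector_limit (\<lambda>t. w * f t) \<xi> (w * a)"
  unfolding sector_limit_def
proof (intro allI impI)
  fix \<epsilon> :: real assume \<epsilon>: "\<epsilon> > 0"
  have pos: "1 + norm w > 0" by (simp add: add_pos_nonneg)
  then have "\<epsilon> / (1 + norm w) > 0" using \<epsilon> by simp
  then obtain \<delta> R where 1: "\<delta> > 0" "\<And>t. norm t \<ge> R \<Longrightarrow> norm (t - complex_of_real (norm t) * \<xi>) \<le> \<delta> * norm t \<Longrightarrow> norm (f t - a) < \<epsilon> / (1 + norm w)"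
    using assms unfolding sector_limit_def by metis
  have "norm (w * f t - w * a) < \<epsilon>" if "norm (f t - a) < \<epsilon> / (1 + norm w)" for t
  proof -
    have "norm (w * f t - w * a) = norm w * norm (f t - a)" by (simp add: norm_mult right_diff_distrib[symmetric])
    also have "\<dots> \<le> (1 + norm w) * norm (f t - a)" by (intro mult_right_mono) auto
    also have "\<dots> < \<epsilon>" using that pos by (simp add: pos_less_divide_eq mult.commute)
    finally show ?thesis .
  qed
  then show "\<exists>\<delta>>0. \<exists>R. \<forall>t. norm t \<ge> R \<longrightarrow> norm (t - complex_of_real (norm t) * \<xi>) \<le> \<delta> * norm t \<longrightarrow> norm (w * f t - w * a) < \<epsilon>"
    using 1 by blast
qed

lemma sector_limit_sum:
  assumes "finite J" "\<And>i. i \<in> J \<Longrightarrow> sector_limit (f i) \<xi> (a i)"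
  shows "sector_limit (\<lambda>t. \<Sum>i\<in>J. w i * f i t) \<xi> (\<Sum>i\<in>J. w i * a i)"
  using assms
proof (induction J)
  case empty
  then show ?case by (auto simp: sector_limit_def intro: exI[of _ 1])
qed (simp add: sector_limit_add sector_limit_cmult)

context fibration
begin

lemmas B_facts = compose_degree[OF monic deg P(2,3) p_B]

text \<open>\<open>\<kappa> \<beta>\<close> is the candidate for the nearly constant value of
  \<open>G\<close> on the fibre, read off at z = 0. By \<open>elimination\<close> the deviation is a
  rational function of \<beta> times exp (- B(\<beta>)). For \<beta> = (\<xi> \<nu>)^e the fibre has
  a point close to \<xi> \<nu>; there this error tends to zero while \<open>G\<close> tends to
  \<open>c \<xi>\<close>.\<close>

lemma fibre_limit:
  "\<exists>\<kappa>. \<forall>\<xi>. \<xi> ^ degree p = 1 \<longrightarrow> (\<lambda>\<nu>. \<kappa> ((\<xi> * of_nat \<nu>) ^ degree P)) \<longlonglongrightarrow> c \<xi>"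
proof -
  define e where "e = degree P"
  have e: "e > 0" using P(3) by (simp add: e_def)
  interpret P': plane P by unfold_locales (use P in auto)
  obtain N where "\<forall>\<beta>. \<exists>W. degree W < degree P \<and> (\<forall>b. degree (coeff W b) \<le> N) \<and>
    (\<forall>z t. ev P z t = \<beta> \<longrightarrow> ev W z t = G z t * ev (pderiv P) z t \<and>
      ev (pderiv P) z t * ev (X W) z t - ev W z t * ev (X (pderiv P)) z t =
      (ev (pderiv P) z t)\<^sup>2 * ((ev (pderiv p) z t * ev u z t - ev (dz p) z t * ev r z t) * exp (- poly B \<beta>)))"
    using fibre_polynomial by (elim exE)
  then obtain W where W: "\<And>\<beta>. degree (W \<beta>) < degree P" "\<And>\<beta> b. degree (coeff (W \<beta>) b) \<le> N"
    "\<And>\<beta> z t. ev P z t = \<beta> \<Longrightarrow> ev (W \<beta>) z t = G z t * ev (pderiv P) z t"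
    "\<And>\<beta> z t. ev P z t = \<beta> \<Longrightarrow> ev (pderiv P) z t * ev (X (W \<beta>)) z t - ev (W \<beta>) z t * ev (X (pderiv P)) z t =
      (ev (pderiv P) z t)\<^sup>2 * ((ev (pderiv p) z t * ev u z t - ev (dz p) z t * ev r z t) * exp (- poly B \<beta>))"
    unfolding choice_iff by blast
  define y where "y b \<beta> = of_nat e * coeff (coeff (W \<beta>) b) 0 - coeff (coeff (W \<beta>) (e - 1)) 0 * coeff (at0 (pderiv P)) b" for b \<beta>
  have "\<exists>q Q R. q \<noteq> 0 \<and> (\<forall>\<beta>. norm \<beta> \<ge> R \<longrightarrow> poly q \<beta> * y b \<beta> = poly Q \<beta> * exp (- poly B \<beta>))" if b: "b < e" for b
  proof -
    obtain q Q R where q: "q \<noteq> 0" and 1: "\<forall>\<beta> W. norm \<beta> \<ge> R \<longrightarrow> degree W < degree P \<longrightarrow> (\<forall>b. degree (coeff W b) \<le> N) \<longrightarrow>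
    (\<forall>z t. ev P z t = \<beta> \<longrightarrow> ev (pderiv P) z t * ev (X W) z t - ev W z t * ev (X (pderiv P)) z t =
      (ev (pderiv P) z t)\<^sup>2 * ((ev (pderiv p) z t * ev u z t - ev (dz p) z t * ev r z t) * exp (- poly B \<beta>))) \<longrightarrow>
    poly q \<beta> * (of_nat (degree P) * coeff (coeff W b) 0 - coeff (coeff W (degree P - 1)) 0 * coeff (at0 (pderiv P)) b)
      = poly Q \<beta> * exp (- poly B \<beta>)"
      using elimination[OF b[unfolded e_def], of N] by (elim exE conjE)
    have "poly q \<beta> * y b \<beta> = poly Q \<beta> * exp (- poly B \<beta>)" if "norm \<beta> \<ge> R" for \<beta>
      using 1[rule_format, of \<beta> "W \<beta>", OF that W(1) W(2) W(4)] unfolding y_def e_def by simp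
    then show ?thesis using q by blast
  qed
  then have "\<forall>b. \<exists>q Q R. b < e \<longrightarrow> q \<noteq> 0 \<and> (\<forall>\<beta>. norm \<beta> \<ge> R \<longrightarrow> poly q \<beta> * y b \<beta> = poly Q \<beta> * exp (- poly B \<beta>))" by blast
  then obtain q Q R where qQ: "\<And>b. b < e \<Longrightarrow> q b \<noteq> 0"
    "\<And>b \<beta>. b < e \<Longrightarrow> norm \<beta> \<ge> R b \<Longrightarrow> poly (q b) \<beta> * y b \<beta> = poly (Q b) \<beta> * exp (- poly B \<beta>)"
    unfolding choice_iff by metis
  have "\<forall>b. \<exists>d R. b < e \<longrightarrow> d > 0 \<and> (\<forall>x. norm x \<ge> R \<longrightarrow> norm (poly (q b) x) \<ge> d)"
    using poly_bounded_below[OF qQ(1)] by blast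
  then obtain d R' where dR: "\<And>b. b < e \<Longrightarrow> d b > 0" "\<And>b x. b < e \<Longrightarrow> norm x \<ge> R' b \<Longrightarrow> norm (poly (q b) x) \<ge> d b"
    unfolding choice_iff by metis
  have "slice 0 (pderiv P) \<noteq> 0"
    using degree_slice_monic[OF P(2), of 0] P(3) by (simp add: pderiv_slice[symmetric] pderiv_eq_0_iff)
  then obtain dP RP where dP: "dP > 0" "\<And>t. norm t \<ge> RP \<Longrightarrow> norm (ev (pderiv P) 0 t) \<ge> dP"
    using poly_bounded_below unfolding ev_def by metis
  define \<kappa> where "\<kappa> \<beta> = coeff (coeff (W \<beta>) (e - 1)) 0 / of_nat e" for \<beta>
  have ev0: "ev f 0 t = (\<Sum>b<e. coeff (coeff f b) 0 * t ^ b)" if "degree f < e" for f t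
  proof -
    have "ev f 0 t = (\<Sum>b\<le>e - 1. poly (coeff f b) 0 * t ^ b)" using that by (intro ev_sum) simp
    moreover have "{..e - 1} = {..<e}" using e by auto
    ultimately show ?thesis by (simp add: poly_0_coeff_0)
  qed
  have diff: "of_nat e * (G 0 t - \<kappa> \<beta>) * ev (pderiv P) 0 t = (\<Sum>b<e. y b \<beta> * t ^ b)" if t: "ev P 0 t = \<beta>" for t \<beta>
  proof -
    have "degree (pderiv P) < e" using P(3) by (simp add: degree_pderiv e_def)
    then have "(\<Sum>b<e. y b \<beta> * t ^ b) = of_nat e * ev (W \<beta>) 0 t - coeff (coeff (W \<beta>) (e - 1)) 0 * ev (pderiv P) 0 t"
      using W(1)[of \<beta>] by (simp add: ev0 e_def y_def coeff_at0 poly_0_coeff_0 sum_distrib_left sum_subtractf left_diff_distrib mult.assoc)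
    then show ?thesis using e W(3)[OF t] by (simp add: \<kappa>_def algebra_simps)
  qed
  have "(\<lambda>\<nu>. \<kappa> ((\<xi> * of_nat \<nu>) ^ degree P)) \<longlonglongrightarrow> c \<xi>" if \<xi>: "\<xi> ^ degree p = 1" for \<xi>
  proof -
    have n\<xi>: "norm \<xi> = 1" using power_eq_1_iff[OF \<xi>] deg by auto
    define \<beta> where "\<beta> \<nu> = (\<xi> * of_nat \<nu>) ^ e" for \<nu> :: nat
    have n\<beta>: "norm (\<beta> \<nu>) = real \<nu> ^ e" for \<nu> by (simp add: \<beta>_def norm_power norm_mult n\<xi>)
    have "\<forall>\<nu>. \<exists>t'. ev P 0 t' = \<beta> \<nu> \<and> norm (\<xi> * of_nat \<nu> - t') ^ e \<le> norm (ev P 0 (\<xi> * of_nat \<nu>) - \<beta> \<nu>)"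
      unfolding e_def using P'.ev_near_root by metis
    then obtain T where T: "\<And>\<nu>. ev P 0 (T \<nu>) = \<beta> \<nu>" "\<And>\<nu>. norm (\<xi> * of_nat \<nu> - T \<nu>) ^ e \<le> norm (ev P 0 (\<xi> * of_nat \<nu>) - \<beta> \<nu>)"
      unfolding choice_iff by blast
    obtain C where C: "C \<ge> 0" "\<And>t. norm t \<ge> 1 \<Longrightarrow> norm (ev P'.low 0 t) \<le> C * norm t ^ (e - 1)"
      using ev_bound_degree[OF P'.low_degree, of 0] unfolding e_def by auto
    \<comment> \<open>P(0, t) - t^e is of order |t|^(e-1), so the distance to the nearest point of
      the fibre is of order \<nu>^(1 - 1/e), eventually below every fixed fraction of \<nu>.\<close>
    have near: "\<forall>\<^sub>F \<nu> in sequentially. norm (\<xi> * of_nat \<nu> - T \<nu>) \<le> \<delta> * \<nu>" if \<delta>: "\<delta> > 0" for \<delta> :: real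
    proof (rule eventually_sequentiallyI)
      fix \<nu> assume \<nu>: "nat \<lceil>C / \<delta> ^ e\<rceil> + 1 \<le> \<nu>"
      then have 1: "C \<le> \<delta> ^ e * \<nu>" "real \<nu> \<ge> 1"
      proof -
        have "C / \<delta> ^ e \<le> \<nu>" using \<nu> by linarith
        then show "C \<le> \<delta> ^ e * \<nu>" using \<delta> by (simp add: pos_divide_le_eq mult.commute)
      qed (use \<nu> in simp)
      have "norm (\<xi> * of_nat \<nu> - T \<nu>) ^ e \<le> norm (ev P'.low 0 (\<xi> * of_nat \<nu>))"
        using T(2)[of \<nu>] P'.ev_p_low[of 0 "\<xi> * of_nat \<nu>"] by (simp add: \<beta>_def e_def)
      also have "\<dots> \<le> C * real \<nu> ^ (e - 1)" using C(2)[of "\<xi> * of_nat \<nu>"] 1(2) by (simp add: norm_mult n\<xi>)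
      also have "\<dots> \<le> (\<delta> ^ e * \<nu>) * real \<nu> ^ (e - 1)" using 1 by (intro mult_right_mono) auto
      also have "\<dots> = (\<delta> * \<nu>) ^ e" using e by (cases e) (auto simp: power_mult_distrib mult_ac)
      finally have "norm (\<xi> * of_nat \<nu> - T \<nu>) ^ e \<le> (\<delta> * \<nu>) ^ e" .
      then show "norm (\<xi> * of_nat \<nu> - T \<nu>) \<le> \<delta> * \<nu>"
        using power_mono_iff[of "norm (\<xi> * of_nat \<nu> - T \<nu>)" "\<delta> * \<nu>" e] \<delta> e by simp
    qed
    have GT: "(\<lambda>\<nu>. G 0 (T \<nu>)) \<longlonglongrightarrow> c \<xi>"
    proof (rule LIMSEQ_I)
      fix \<epsilon> :: real assume "\<epsilon> > 0"
      then obtain \<delta> S where \<delta>: "\<delta> > 0" and S: "\<And>t. norm t \<ge> S \<Longrightarrow> norm (t - norm t * \<xi>) \<le> \<delta> * norm t \<Longrightarrow> norm (G 0 t - c \<xi>) < \<epsilon>"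
        using c[OF \<xi>, of 0] unfolding sector_limit_def by metis
      define \<delta>' where "\<delta>' = min (1/2) (\<delta> / 4)"
      have \<delta>': "\<delta>' > 0" "\<delta>' \<le> 1/2" "4 * \<delta>' \<le> \<delta>" using \<delta> by (auto simp: \<delta>'_def)
      have "\<forall>\<^sub>F \<nu> in sequentially. real \<nu> \<ge> 2 * S" by real_asymp
      with near[OF \<delta>'(1)] have "\<forall>\<^sub>F \<nu> in sequentially. norm (G 0 (T \<nu>) - c \<xi>) < \<epsilon>"
      proof eventually_elim
        case (elim \<nu>)
        have "\<bar>norm (\<xi> * of_nat \<nu>) - norm (T \<nu>)\<bar> \<le> \<delta>' * \<nu>" using elim(1) norm_triangle_ineq3 order_trans by blast
        then have a: "\<bar>real \<nu> - norm (T \<nu>)\<bar> \<le> \<delta>' * \<nu>" by (simp add: norm_mult n\<xi>)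
        have b: "\<delta>' * \<nu> \<le> \<nu> / 2" using mult_right_mono[OF \<delta>'(2), of "real \<nu>"] by simp
        have h: "norm (T \<nu>) \<ge> \<nu> / 2" using a b by linarith
        have "norm (T \<nu> - norm (T \<nu>) * \<xi>) \<le> norm (T \<nu> - \<xi> * of_nat \<nu>) + norm (\<xi> * of_nat \<nu> - norm (T \<nu>) * \<xi>)"
          using norm_triangle_ineq[of "T \<nu> - \<xi> * of_nat \<nu>" "\<xi> * of_nat \<nu> - norm (T \<nu>) * \<xi>"] by simp
        also have "\<xi> * of_nat \<nu> - norm (T \<nu>) * \<xi> = of_real (real \<nu> - norm (T \<nu>)) * \<xi>" by (simp add: algebra_simps)
        also have "norm (of_real (real \<nu> - norm (T \<nu>)) * \<xi>) = \<bar>real \<nu> - norm (T \<nu>)\<bar>" by (simp only: norm_mult norm_of_real n\<xi> mult_1_right)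
        also have "norm (T \<nu> - \<xi> * of_nat \<nu>) + \<bar>real \<nu> - norm (T \<nu>)\<bar> \<le> \<delta>' * \<nu> + \<delta>' * \<nu>"
          using a elim(1) by (intro add_mono) (simp_all add: norm_minus_commute)
        also have "\<dots> \<le> 4 * \<delta>' * norm (T \<nu>)" using mult_left_mono[OF h, of "4 * \<delta>'"] \<delta>'(1) by simp
        also have "\<dots> \<le> \<delta> * norm (T \<nu>)" using \<delta>'(3) by (intro mult_right_mono) auto
        finally show ?case by (intro S) (use h elim(2) in auto)
      qed
      then show "\<exists>no. \<forall>n\<ge>no. norm (G 0 (T n) - c \<xi>) < \<epsilon>" by (simp add: eventually_sequentially)
    qed
    have trm: "(\<lambda>\<nu>. y b (\<beta> \<nu>) * T \<nu> ^ b / (of_nat e * ev (pderiv P) 0 (T \<nu>))) \<longlonglongrightarrow> 0" if b: "b < e" for b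
    proof -
      \<comment> \<open>On the fibre exp (- B(\<beta>)) is exp (- p), so the numerator is
        \<open>f\<close> times exp (- p) at \<open>T \<nu>\<close>, and \<open>cone_decay\<close>
        applies.\<close>
      define f where "f = poly (map_poly cc (Q b)) P * monom 1 b"
      obtain \<delta> \<rho> where \<delta>: "\<delta> > 0" "\<rho> \<ge> 1" and decay: "\<And>s. Re s \<ge> \<rho> \<Longrightarrow> \<bar>Im s\<bar> \<le> \<delta> * Re s \<Longrightarrow>
        norm (ev f 0 (\<xi> * s) * exp (- ev p 0 (\<xi> * s))) \<le> exp (- Re s / 4)"
        using cone_decay[OF \<xi> order_refl, of f] by (metis norm_zero order_refl)
      define \<delta>' where "\<delta>' = min (1/2) (\<delta> / 2)"
      have \<delta>': "\<delta>' > 0" "\<delta>' \<le> 1/2" "2 * \<delta>' \<le> \<delta>" using \<delta> by (auto simp: \<delta>'_def)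
      have "\<forall>\<^sub>F \<nu> in sequentially. real \<nu> \<ge> 2 * \<rho>" by real_asymp
      moreover have "\<forall>\<^sub>F \<nu> in sequentially. real \<nu> \<ge> 2 * RP" by real_asymp
      moreover have "\<forall>\<^sub>F \<nu> in sequentially. real \<nu> \<ge> R b" by real_asymp
      moreover have "\<forall>\<^sub>F \<nu> in sequentially. real \<nu> \<ge> R' b" by real_asymp
      ultimately have "\<forall>\<^sub>F \<nu> in sequentially. norm (y b (\<beta> \<nu>) * T \<nu> ^ b / (of_nat e * ev (pderiv P) 0 (T \<nu>)))
        \<le> exp (- real \<nu> / 8) * (1 / (d b * (real e * dP)))"
        using near[OF \<delta>'(1)]
      proof eventually_elim
        case (elim \<nu>)
        define s where "s = T \<nu> / \<xi>"
        have \<xi>0: "\<xi> \<noteq> 0" using n\<xi> by auto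
        have Ts: "T \<nu> = \<xi> * s" using \<xi>0 by (simp add: s_def)
        have "norm (of_nat \<nu> - s) = norm (\<xi> * (of_nat \<nu> - s))" by (simp add: norm_mult n\<xi>)
        also have "\<dots> \<le> \<delta>' * \<nu>" using elim(5) by (simp add: Ts right_diff_distrib)
        finally have s\<nu>: "norm (of_nat \<nu> - s) \<le> \<delta>' * \<nu>" .
        have re: "\<bar>real \<nu> - Re s\<bar> \<le> \<delta>' * \<nu>" and im: "\<bar>Im s\<bar> \<le> \<delta>' * \<nu>"
          using order_trans[OF abs_Re_le_cmod s\<nu>] order_trans[OF abs_Im_le_cmod s\<nu>] by simp_all
        have b2: "\<delta>' * \<nu> \<le> \<nu> / 2" using mult_right_mono[OF \<delta>'(2), of "real \<nu>"] by simp
        have hs: "Re s \<ge> \<nu> / 2" using re b2 by linarith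
        have "\<delta>' * \<nu> \<le> \<delta>' * (2 * Re s)" using hs \<delta>'(1) by (intro mult_left_mono) auto
        also have "\<dots> \<le> \<delta> * Re s" using mult_right_mono[OF \<delta>'(3), of "Re s"] hs by simp
        finally have "\<bar>Im s\<bar> \<le> \<delta> * Re s" using im by linarith
        then have D: "norm (ev f 0 (T \<nu>) * exp (- ev p 0 (T \<nu>))) \<le> exp (- Re s / 4)"
          unfolding Ts using hs elim(1) by (intro decay) auto
        have ex: "exp (- Re s / 4) \<le> exp (- real \<nu> / 8)" using hs by simp
        have "real \<nu> \<ge> 1" using elim(1) \<delta>(2) by linarith
        then have "real \<nu> ^ 1 \<le> real \<nu> ^ e" using e by (intro power_increasing) auto
        then have nb: "norm (\<beta> \<nu>) \<ge> \<nu>" by (simp add: n\<beta>)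
        have q1: "norm (poly (q b) (\<beta> \<nu>)) \<ge> d b" using nb elim(4) by (intro dR(2)[OF b]) linarith
        have P1: "norm (ev (pderiv P) 0 (T \<nu>)) \<ge> dP"
          using hs elim(2) complex_Re_le_cmod[of s] by (intro dP(2)) (simp add: Ts norm_mult n\<xi>)
        have "poly (q b) (\<beta> \<nu>) * y b (\<beta> \<nu>) = poly (Q b) (\<beta> \<nu>) * exp (- poly B (\<beta> \<nu>))"
          using nb elim(3) by (intro qQ(2)[OF b]) linarith
        moreover have q0: "poly (q b) (\<beta> \<nu>) \<noteq> 0" using q1 dR(1)[OF b] by auto
        ultimately have "y b (\<beta> \<nu>) = poly (Q b) (\<beta> \<nu>) * exp (- poly B (\<beta> \<nu>)) / poly (q b) (\<beta> \<nu>)"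
          by (simp add: eq_divide_eq mult.commute)
        then have "y b (\<beta> \<nu>) * T \<nu> ^ b / (of_nat e * ev (pderiv P) 0 (T \<nu>))
          = (ev f 0 (T \<nu>) * exp (- ev p 0 (T \<nu>))) * (1 / (poly (q b) (\<beta> \<nu>) * (of_nat e * ev (pderiv P) 0 (T \<nu>))))"
          by (simp add: f_def ev ev_compose ev_monom ev_p T(1))
        then have "norm (y b (\<beta> \<nu>) * T \<nu> ^ b / (of_nat e * ev (pderiv P) 0 (T \<nu>)))
          = norm (ev f 0 (T \<nu>) * exp (- ev p 0 (T \<nu>))) * (1 / (norm (poly (q b) (\<beta> \<nu>)) * (real e * norm (ev (pderiv P) 0 (T \<nu>)))))"
          by (simp only: norm_mult norm_divide norm_one norm_of_nat)
        also have "\<dots> \<le> exp (- real \<nu> / 8) * (1 / (d b * (real e * dP)))"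
          using order_trans[OF D ex] q1 P1 dR(1)[OF b] dP(1) e
          by (intro mult_mono divide_left_mono) (auto intro!: mult_pos_pos mult_left_mono)
        finally show ?case .
      qed
      moreover have "(\<lambda>\<nu>. exp (- real \<nu> / 8) * (1 / (d b * (real e * dP)))) \<longlonglongrightarrow> 0" by real_asymp
      ultimately show ?thesis by (rule Lim_null_comparison)
    qed
    have "(\<lambda>\<nu>. \<Sum>b<e. y b (\<beta> \<nu>) * T \<nu> ^ b / (of_nat e * ev (pderiv P) 0 (T \<nu>))) \<longlonglongrightarrow> (\<Sum>b<e. 0)"
      by (intro tendsto_sum trm) simp
    moreover have "\<forall>\<^sub>F \<nu> in sequentially. (\<Sum>b<e. y b (\<beta> \<nu>) * T \<nu> ^ b / (of_nat e * ev (pderiv P) 0 (T \<nu>))) = G 0 (T \<nu>) - \<kappa> (\<beta> \<nu>)"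
    proof -
      have "\<forall>\<^sub>F \<nu> in sequentially. real \<nu> \<ge> 2 * RP" by real_asymp
      with near[of "1/2", simplified] show ?thesis
      proof eventually_elim
        case (elim \<nu>)
        have "norm (\<xi> * of_nat \<nu>) \<le> norm (T \<nu>) + norm (\<xi> * of_nat \<nu> - T \<nu>)" by (rule norm_triangle_sub)
        then have "norm (T \<nu>) \<ge> RP" using elim by (simp add: norm_mult n\<xi>)
        then have "ev (pderiv P) 0 (T \<nu>) \<noteq> 0" using dP by fastforce
        then show ?case using e diff[OF T(1)[of \<nu>]] by (simp add: sum_divide_distrib[symmetric] divide_eq_eq mult_ac)
      qed
    qed
    ultimately have "(\<lambda>\<nu>. G 0 (T \<nu>) - \<kappa> (\<beta> \<nu>)) \<longlonglongrightarrow> 0" using Lim_transform_eventually by fastforce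
    then have "(\<lambda>\<nu>. G 0 (T \<nu>) - (G 0 (T \<nu>) - \<kappa> (\<beta> \<nu>))) \<longlonglongrightarrow> c \<xi> - 0" by (intro tendsto_diff GT)
    then show ?thesis by (simp add: \<beta>_def e_def)
  qed
  then show ?thesis by blast
qed

text \<open>The sequence of fibre values in \<open>fibre_limit\<close> depends on \<xi> only through
  \<open>\<xi> ^ degree P\<close>, so both limits belong to the same sequence.\<close>

lemma limits_agree:
  assumes "\<xi> ^ degree p = 1" "\<xi>' ^ degree p = 1" "\<xi> ^ degree P = \<xi>' ^ degree P"
  shows "c \<xi> = c \<xi>'"
proof -
  obtain \<kappa> where \<kappa>: "\<And>\<xi>. \<xi> ^ degree p = 1 \<Longrightarrow> (\<lambda>\<nu>. \<kappa> ((\<xi> * of_nat \<nu>) ^ degree P)) \<longlonglongrightarrow> c \<xi>"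
    using fibre_limit by blast
  have "(\<lambda>\<nu>. \<kappa> ((\<xi> * of_nat \<nu>) ^ degree P)) = (\<lambda>\<nu>. \<kappa> ((\<xi>' * of_nat \<nu>) ^ degree P))"
    using assms(3) by (simp add: power_mult_distrib)
  then show ?thesis using \<kappa>[OF assms(1)] \<kappa>[OF assms(2)] LIMSEQ_unique by simp
qed

end

text \<open>When dp and dP are proportional, P^k dP is closed and remains so after multiplication by
  exp (- p). These forms supply the primitives with which the given one is compared.\<close>

lemma dz_pderiv_power:
  assumes "dz p * pderiv P = pderiv p * dz P"
  shows "dz (P ^ k * pderiv P) - dz p * (P ^ k * pderiv P) = pderiv (P ^ k * dz P) - pderiv p * (P ^ k * dz P)"
proof -
  note zD = derivationD[OF dz_derivation] and tD = derivationD[OF pderiv_derivation]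
  have "dz (P ^ k) * pderiv P = pderiv (P ^ k) * dz P"
  proof (induction k)
    case (Suc k)
    have "dz (P ^ Suc k) * pderiv P = dz P * P ^ k * pderiv P + P * (dz (P ^ k) * pderiv P)"
      unfolding power_Suc zD by (simp add: algebra_simps)
    also have "\<dots> = pderiv (P ^ Suc k) * dz P"
      unfolding Suc power_Suc tD by (simp add: algebra_simps)
    finally show ?case .
  qed (simp add: zD)
  moreover have "dz p * (P ^ k * pderiv P) = pderiv p * (P ^ k * dz P)" using assms by (simp add: algebra_simps)
  ultimately show ?thesis by (simp add: zD tD dz_pderiv_commute mult.commute)
qed

context fibration
begin

text \<open>The forms \<open>P ^ k * pderiv P\<close> for \<open>k < m - 1\<close>, where \<open>m = degree B\<close>, together with \<open>r\<close> are \<open>m\<close> vectors,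
  and the limits take at most \<open>m\<close> values. Hence some combination has all limits equal, and vanishes.\<close>

theorem integrand_decomposition:
  assumes rdeg: "degree r + 1 < degree p"
  shows "\<exists>a. r = poly (map_poly cc a) P * pderiv P"
proof -
  define e where "e = degree P"
  define D where "D = degree p"
  obtain m where m: "degree B = Suc m" using B_facts(3) by (cases "degree B") auto
  have D: "D = Suc m * e" using B_facts(1) by (simp add: D_def e_def m)
  have e: "e > 0" using P(3) by (simp add: e_def)
  define rr where "rr i = (case i of 0 \<Rightarrow> r | Suc k \<Rightarrow> P ^ k * pderiv P)" for i
  define uu where "uu i = (case i of 0 \<Rightarrow> u | Suc k \<Rightarrow> P ^ k * dz P)" for i
  have XP: "dz p * pderiv P = pderiv p * dz P" using P(1) by (simp add: X_def)
  have fib: "fibration p (rr i) (uu i) P" for i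
  proof (unfold_locales)
    show "dz (rr i) - dz p * rr i = pderiv (uu i) - pderiv p * uu i"
      using closed dz_pderiv_power[OF XP] by (cases i) (simp_all add: rr_def uu_def)
  qed
  have tw: "twisted p (rr i) (uu i)" for i using fib unfolding fibration_def by blast
  define GG where "GG i = twisted.G p (rr i) (uu i)" for i
  define C where "C i = fibration.c p (rr i) (uu i)" for i
  have dGG: "((\<lambda>t. GG i z t) has_field_derivative ev (rr i) z t * exp (- ev p z t)) (at t)" for i z t
    unfolding GG_def by (rule twisted.G_deriv_t[OF tw])
  have CC: "\<xi> ^ D = 1 \<Longrightarrow> sector_limit (GG i z) \<xi> (C i \<xi>)" for i z \<xi>
    unfolding GG_def C_def D_def by (rule fibration.c[OF fib])
  have agree: "\<xi> ^ D = 1 \<Longrightarrow> \<xi>' ^ D = 1 \<Longrightarrow> \<xi> ^ e = \<xi>' ^ e \<Longrightarrow> C i \<xi> = C i \<xi>'" for i \<xi> \<xi>'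
    unfolding C_def D_def e_def by (rule fibration.limits_agree[OF fib])
  \<comment> \<open>All limits are compared with the one in direction 1, so the class of 1 gives no
    equation. At most \<open>m\<close> equations remain for \<open>Suc m\<close>
    coefficients.\<close>
  define A where "A = (\<lambda>\<xi>::complex. \<xi> ^ e) ` {\<xi>. \<xi> ^ D = 1} - {1}"
  define sel where "sel \<zeta> = (SOME \<xi>::complex. \<xi> ^ D = 1 \<and> \<xi> ^ e = \<zeta>)" for \<zeta>
  have sel: "sel (\<xi> ^ e) ^ D = 1 \<and> sel (\<xi> ^ e) ^ e = \<xi> ^ e" if "\<xi> ^ D = 1" for \<xi>
    unfolding sel_def by (rule someI[of _ \<xi>]) (use that in simp)
  have sub: "insert 1 A \<subseteq> {\<zeta>. \<zeta> ^ Suc m = 1}"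
    by (auto simp: A_def D power_mult[symmetric] mult.commute simp del: power_Suc)
  have fin: "finite {\<zeta>::complex. \<zeta> ^ Suc m = 1}" by (rule finite_roots_unity) simp
  have A: "finite A" using finite_subset[OF sub fin] by simp
  have "card (insert 1 A) \<le> card {\<zeta>::complex. \<zeta> ^ Suc m = 1}" by (rule card_mono[OF fin sub])
  also have "\<dots> \<le> Suc m" by (rule card_roots_unity) simp
  finally have cA: "card A < card {..<Suc m}" by (subst (asm) card_insert_disjoint[OF A]) (simp_all add: A_def)
  obtain w where w: "\<exists>j\<in>{..<Suc m}. w j \<noteq> 0" "\<forall>\<zeta>\<in>A. (\<Sum>i\<in>{..<Suc m}. (C i (sel \<zeta>) - C i 1) * w i) = 0"
    using underdetermined_system[OF A finite_lessThan cA, of "\<lambda>\<zeta> i. C i (sel \<zeta>) - C i 1"] by blast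
  define R where "R = (\<Sum>i<Suc m. cc (w i) * rr i)"
  define g where "g z t = (\<Sum>i<Suc m. w i * GG i z t)" for z t
  define c0 where "c0 = (\<Sum>i<Suc m. w i * C i 1)"
  have dg: "((\<lambda>t. g z t) has_field_derivative ev R z t * exp (- ev p z t)) (at t)" for z t
  proof -
    have "((\<lambda>t. g z t) has_field_derivative (\<Sum>i<Suc m. w i * (ev (rr i) z t * exp (- ev p z t)))) (at t)"
      unfolding g_def by (intro DERIV_sum DERIV_cmult dGG)
    moreover have "(\<Sum>i<Suc m. w i * (ev (rr i) z t * exp (- ev p z t))) = ev R z t * exp (- ev p z t)"
      by (simp only: R_def ev(8) ev(4) ev_cc sum_distrib_right mult.assoc)
    ultimately show ?thesis by simp
  qed
  have lim: "sector_limit (g z) \<xi> c0" if \<xi>: "\<xi> ^ degree p = 1" for z \<xi>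
  proof -
    have \<xi>D: "\<xi> ^ D = 1" using \<xi> by (simp add: D_def)
    have "(\<Sum>i<Suc m. w i * C i \<xi>) = c0"
    proof (cases "\<xi> ^ e = 1")
      case True
      then have "C i \<xi> = C i 1" for i using \<xi>D by (intro agree) auto
      then show ?thesis by (simp add: c0_def)
    next
      case False
      then have "\<xi> ^ e \<in> A" using \<xi>D by (auto simp: A_def)
      then have "(\<Sum>i<Suc m. (C i (sel (\<xi> ^ e)) - C i 1) * w i) = 0" using w(2) by blast
      moreover have "C i (sel (\<xi> ^ e)) = C i \<xi>" for i using sel[OF \<xi>D] \<xi>D by (intro agree) auto
      ultimately have "(\<Sum>i<Suc m. w i * C i \<xi> - w i * C i 1) = 0" by (simp add: algebra_simps)
      then show ?thesis unfolding sum_subtractf c0_def by simp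
    qed
    moreover have "sector_limit (\<lambda>t. \<Sum>i<Suc m. w i * GG i z t) \<xi> (\<Sum>i<Suc m. w i * C i \<xi>)"
      by (rule sector_limit_sum) (use CC[OF \<xi>D] in auto)
    ultimately show ?thesis by (simp only: g_def[abs_def])
  qed
  have "\<exists>K::nat. \<forall>z t. \<exists>\<xi>::complex. \<xi> ^ degree p = 1 \<and>
    norm (g z t - c0) \<le> K * (1 + norm z + norm (ev p z t)) ^ K * exp (- Re (ev p z t))"
    by (rule limit_estimate) (rule dg, rule lim)
  then obtain K :: nat where K: "\<And>z t. \<exists>\<xi>::complex. \<xi> ^ degree p = 1 \<and>
    norm (g z t - c0) \<le> K * (1 + norm z + norm (ev p z t)) ^ K * exp (- Re (ev p z t))" by blast
  have Rdeg: "degree R + 1 < degree p"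
  proof -
    have "degree (cc (w i) * rr i) < D - 1" if i: "i < Suc m" for i
    proof -
      have "degree (cc (w i) * rr i) \<le> degree (rr i)" by (simp add: cc_def degree_smult_le)
      also have "degree (rr i) < D - 1"
      proof (cases i)
        case 0
        then show ?thesis using rdeg by (simp add: rr_def D_def)
      next
        case (Suc k)
        have "degree (rr i) \<le> degree (P ^ k) + degree (pderiv P)" by (simp add: Suc rr_def degree_mult_le)
        also have "\<dots> \<le> e * k + (e - 1)"
          by (intro add_mono order_trans[OF degree_power_le]) (simp_all add: e_def degree_pderiv)
        also have "\<dots> < D - 1"
        proof -
          have "k + 2 \<le> Suc m" using i Suc by simp
          then have "(k + 2) * e \<le> D" unfolding D by (rule mult_right_mono) simp
          then show ?thesis using e by (simp add: algebra_simps)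
        qed
        finally show ?thesis .
      qed
      finally show ?thesis .
    qed
    then have "degree R < D - 1" unfolding R_def using rdeg by (intro degree_sum_less) (auto simp: D_def)
    then show ?thesis by (simp add: D_def)
  qed
  have "slice z R = 0" for z
    by (rule equal_limits_trivial[OF dg _ Rdeg, where c = c0 and K = K]) (use K in blast)
  then have R0: "R = 0" by (intro bipoly_eqI) (simp add: slice)
  define a where "a = (\<Sum>k<m. monom (w (Suc k)) k)"
  have "R = cc (w 0) * r + poly (map_poly cc a) P * pderiv P"
  proof (rule ev_eqI)
    fix z t
    have "ev R z t = w 0 * ev r z t + (\<Sum>k<m. w (Suc k) * (ev P z t ^ k * ev (pderiv P) z t))"
      unfolding R_def sum.lessThan_Suc_shift by (simp add: ev ev_cc rr_def)
    then show "ev R z t = ev (cc (w 0) * r + poly (map_poly cc a) P * pderiv P) z t"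
      by (simp add: ev ev_cc ev_compose a_def poly_sum poly_monom sum_distrib_right mult.assoc)
  qed
  then have eq: "cc (w 0) * r + poly (map_poly cc a) P * pderiv P = 0" using R0 by simp
  \<comment> \<open>The forms P^k dP are independent: otherwise a(P) = 0, and \<open>P\<close> takes
    every value already on z = 0.\<close>
  have w0: "w 0 \<noteq> 0"
  proof
    assume w0: "w 0 = 0"
    interpret P': plane P by unfold_locales (use P in auto)
    have "poly (map_poly cc a) P = 0" using eq P'.pderiv_p(1) by (simp add: w0 cc)
    then have "poly a (ev P z t) = 0" for z t using ev_compose[of a P z t] by (simp add: ev)
    then have "poly a \<beta> = 0" for \<beta> using P'.ev_near_root[of 0 \<beta>] by metis
    then have a0: "a = 0" using poly_all_0_iff_0 by blast
    have "w (Suc k) = coeff a k" if "k < m" for k using that by (simp add: a_def coeff_sum sum.delta)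
    then have "w j = 0" if "j < Suc m" for j using that a0 w0 by (cases j) auto
    then show False using w(1) by auto
  qed
  have "r = poly (map_poly cc (smult (- 1 / w 0) a)) P * pderiv P"
  proof (rule ev_eqI)
    fix z t
    have "w 0 * ev r z t + poly a (ev P z t) * ev (pderiv P) z t = 0"
      using arg_cong[OF eq, of "\<lambda>f. ev f z t"] by (simp add: ev ev_cc ev_compose)
    then have "ev r z t = - (poly a (ev P z t) * ev (pderiv P) z t) / w 0"
      unfolding nonzero_eq_divide_eq[OF w0] by (simp add: eq_neg_iff_add_eq_0 mult.commute)
    then show "ev r z t = ev (poly (map_poly cc (smult (- 1 / w 0) a)) P * pderiv P) z t"
      by (simp add: ev ev_compose)
  qed
  then show ?thesis by blast
qed

end

lemma (in plane) minimal_integral_exists: "\<exists>P. minimal_integral p P"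
proof -
  obtain f where f: "X f = 0" "degree f > 0" and min: "\<And>g. X g = 0 \<and> degree g > 0 \<Longrightarrow> degree f \<le> degree g"
    using ex_has_least_nat[of "\<lambda>f. X f = 0 \<and> degree f > 0" p degree] X_p deg by blast
  obtain c where c: "lead_coeff f = [:c:]" by (rule X_eq_0_lead[OF f(1)])
  have "c \<noteq> 0"
  proof
    assume "c = 0"
    then have "f = 0" using c by simp
    then show False using f(2) by simp
  qed
  define P where "P = cc (1 / c) * f"
  have dP: "degree P = degree f" using \<open>c \<noteq> 0\<close> by (simp add: P_def cc_def)
  have "lead_coeff P = 1" unfolding dP using c \<open>c \<noteq> 0\<close> by (simp add: P_def cc_def one_pCons)
  moreover have "X P = 0" by (simp add: P_def XD X_cc f(1))
  ultimately show ?thesis using f(2) min by (intro exI[of _ P]) (unfold_locales, auto simp: dP)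
qed

theorem plane_integral:
  assumes "lead_coeff p = 1" "degree p > 0" "dz r - dz p * r = pderiv u - pderiv p * u"
    and "r = 0 \<or> degree r + 1 < degree p"
  shows "\<exists>P B a. lead_coeff P = 1 \<and> degree P > 0 \<and> p = poly (map_poly cc B) P \<and> r = poly (map_poly cc a) P * pderiv P"
proof -
  interpret twisted p r u by unfold_locales (use assms in auto)
  obtain P where "minimal_integral p P" using minimal_integral_exists by blast
  then interpret minimal_integral p P .
  interpret fibration p r u P by unfold_locales
  have "\<exists>a. r = poly (map_poly cc a) P * pderiv P"
    using assms(4) integrand_decomposition by (auto intro: exI[of _ 0])
  then show ?thesis using P p_B by blast
qed

section \<open>From a general plane to the whole space\<close>

lemma ring_hom_poly: "is_ring_hom H \<Longrightarrow> H (poly F c) = poly (map_poly H F) (H c)"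
  by (induction F) (simp_all add: map_poly_pCons is_ring_homD)

lemma mpoly_ring_induct [case_names Const Var add mult]:
  fixes f :: "'n::finite mpoly"
  assumes C: "\<And>c. Q (Const c)" and V: "\<And>i. Q (Var i)"
    and add: "\<And>f g. Q f \<Longrightarrow> Q g \<Longrightarrow> Q (f + g)" and mult: "\<And>f g. Q f \<Longrightarrow> Q g \<Longrightarrow> Q (f * g)"
  shows "Q f"
proof (induction f rule: mpoly_induct)
  case zero
  show ?case using C[of 0] by (simp add: Const_def)
next
  case (single m c)
  have one: "Q 1" using C[of 1] by (simp add: Const_def single_one)
  have pw: "Q (Var i ^ k)" for i k using one V mult by (induction k) auto
  have "Q (\<Prod>i\<in>S. Var i ^ Poly_Mapping.lookup m i)" for S :: "'n set"
    by (induction S rule: infinite_finite_induct) (auto simp: one intro: mult pw)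
  then show ?case unfolding mpoly_single_eq by (intro mult C)
qed (rule add)

lemma mpoly_partial_Var: "mpoly_partial i (Var j) = (if i = j then 1 else 0)"
  by (simp add: Var_def mpoly_partial_single lookup_single single_one)

lemma chain_rule:
  fixes H :: "'n::finite mpoly \<Rightarrow> 'a::comm_ring_1"
  assumes H: "is_ring_hom H" and \<delta>: "derivation \<delta>" and C: "\<And>c. \<delta> (H (Const c)) = 0"
  shows "\<delta> (H f) = (\<Sum>i\<in>UNIV. H (mpoly_partial i f) * \<delta> (H (Var i)))"
proof (induction f rule: mpoly_ring_induct)
  case (Var j)
  have "(\<Sum>i\<in>UNIV. H (mpoly_partial i (Var j)) * \<delta> (H (Var i))) = (\<Sum>i\<in>UNIV. if i = j then \<delta> (H (Var i)) else 0)"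
    by (intro sum.cong) (simp_all add: mpoly_partial_Var is_ring_homD[OF H])
  then show ?case by simp
next
  case (mult f g)
  show ?case
    by (simp add: mpoly_partial_mult is_ring_homD(3,4)[OF H] derivationD(2)[OF \<delta>] mult sum.distrib sum_distrib_left sum_distrib_right algebra_simps)
qed (simp_all add: C mpoly_partial_Const mpoly_partial_add is_ring_homD[OF H] derivationD(1)[OF \<delta>] distrib_right sum.distrib)

definition val :: "('n::finite \<Rightarrow> complex) \<Rightarrow> 'n mpoly \<Rightarrow> complex" where
  "val v = insertion (\<lambda>c. c) v"

lemma val_hom: "is_ring_hom (val v)"
  unfolding val_def by (intro insertion_ring_hom is_ring_hom_id)

lemmas val = is_ring_homD[OF val_hom]

lemma val_simps: "val v (Const c) = c" "val v (Var i) = v i"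
  by (simp_all add: val_def insertion_Const insertion_Var is_ring_hom_id)

lemma val_cong:
  assumes "f \<in> mpoly_vars W" "\<And>i. i \<in> W \<Longrightarrow> v i = v' i"
  shows "val v f = val v' f"
  unfolding val_def insertion_def
proof (intro sum.cong refl arg_cong2[of _ _ _ _ "(*)"] prod.cong)
  fix m i assume "m \<in> Poly_Mapping.keys f"
  then have "Poly_Mapping.keys m \<subseteq> W" using assms(1) by (auto simp: mpoly_vars_def)
  then show "v i ^ Poly_Mapping.lookup m i = v' i ^ Poly_Mapping.lookup m i"
  proof (cases "i \<in> W")
    case False
    then have "i \<notin> Poly_Mapping.keys m" using \<open>Poly_Mapping.keys m \<subseteq> W\<close> by blast
    then have "Poly_Mapping.lookup m i = 0" by (simp add: in_keys_iff)
    then show ?thesis by simp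
  qed (simp add: assms(2))
qed

lemma mpoly_nonvanishing:
  fixes f :: "'n::{finite,linorder} mpoly"
  assumes "f \<noteq> 0"
  shows "\<exists>v. val v f \<noteq> 0"
proof -
  have "\<forall>f\<in>mpoly_vars W. (\<forall>v. val v f = 0) \<longrightarrow> f = 0" for W :: "'n set"
    using finite[of W]
  proof (induction W rule: finite_induct)
    case empty
    show ?case
    proof (intro ballI impI)
      fix f :: "'n mpoly" assume "f \<in> mpoly_vars {}" "\<forall>v. val v f = 0"
      then obtain c where "f = Const c" "val (\<lambda>_. 0) f = 0" by (auto simp: mpoly_vars_empty)
      then have "c = 0" by (simp add: val_simps)
      with \<open>f = Const c\<close> show "f = 0" by (simp add: Const_def)
    qed
  next
    case (insert x W)
    show ?case
    proof (intro ballI impI)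
      fix f :: "'n mpoly" assume f: "f \<in> mpoly_vars (insert x W)" "\<forall>v. val v f = 0"
      define F where "F = as_poly x f"
      have F: "coeff F k \<in> mpoly_vars W" for k
        using as_poly_over[OF f(1)] by (simp add: F_def poly_over_def)
      have "coeff F k = 0" for k
      proof -
        have "val v (coeff F k) = 0" for v
        proof -
          have "poly (map_poly (val v) F) t = 0" for t
          proof -
            let ?v = "v(x := t)"
            have "val v (coeff F k) = val ?v (coeff F k)" for k
              by (rule val_cong[OF F]) (use insert.hyps in auto)
            then have "map_poly (val v) F = map_poly (val ?v) F" by (intro poly_eqI) (simp add: coeff_map_poly val)
            moreover have "val ?v (poly F (Var x)) = 0" using f(2) by (simp add: F_def poly_as_poly)
            ultimately show ?thesis using ring_hom_poly[OF val_hom, of ?v F "Var x"] by (simp add: val_simps)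
          qed
          then have "map_poly (val v) F = 0" using poly_all_0_iff_0 by blast
          then have "coeff (map_poly (val v) F) k = 0" by simp
          then show ?thesis by (simp add: coeff_map_poly val)
        qed
        then show ?thesis using insert.IH F by blast
      qed
      then have "F = 0" by (intro poly_eqI) simp
      then show "f = 0" by (simp add: F_def as_poly_eq_0_iff)
    qed
  qed
  moreover have "f \<in> mpoly_vars UNIV" by (simp add: mpoly_vars_def)
  ultimately show ?thesis using assms by blast
qed

lemma mpoly_nonvanishing_finite:
  fixes F :: "'n::{finite,linorder} mpoly set"
  assumes "finite F"
  shows "\<exists>v. \<forall>f\<in>F. val v f = 0 \<longrightarrow> f = 0"
proof -
  have "(\<Prod>f\<in>{f\<in>F. f \<noteq> 0}. f) \<noteq> 0" using assms by (simp add: prod_zero_iff)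
  then obtain v where "val v (\<Prod>f\<in>{f\<in>F. f \<noteq> 0}. f) \<noteq> 0" using mpoly_nonvanishing by blast
  then have "(\<Prod>f\<in>{f\<in>F. f \<noteq> 0}. val v f) \<noteq> 0" by (simp add: val)
  then show ?thesis using assms by (intro exI[of _ v]) (auto simp: prod_zero_iff)
qed

lemma coeff_mult_top:
  assumes "degree f \<le> a" "degree g \<le> b"
  shows "coeff (f * g) (a + b) = coeff f a * coeff g b"
proof -
  have "coeff (f * g) (a + b) = (\<Sum>i\<le>a + b. coeff f i * coeff g (a + b - i))" by (rule coeff_mult)
  also have "\<dots> = (\<Sum>i\<in>{a}. coeff f i * coeff g (a + b - i))"
  proof (rule sum.mono_neutral_right)
    show "\<forall>i\<in>{..a + b} - {a}. coeff f i * coeff g (a + b - i) = 0"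
    proof
      fix i assume "i \<in> {..a + b} - {a}"
      then have "i > a \<or> a + b - i > b" by auto
      then show "coeff f i * coeff g (a + b - i) = 0" using assms by (auto simp: coeff_eq_0)
    qed
  qed auto
  finally show ?thesis by simp
qed

lemma coeff_prod_top:
  assumes "finite A" "\<And>i. i \<in> A \<Longrightarrow> degree (f i) \<le> n i"
  shows "degree (\<Prod>i\<in>A. f i) \<le> (\<Sum>i\<in>A. n i) \<and> coeff (\<Prod>i\<in>A. f i) (\<Sum>i\<in>A. n i) = (\<Prod>i\<in>A. coeff (f i) (n i))"
  using assms
proof (induction A)
  case (insert a A)
  then show ?case
    using coeff_mult_top[of "f a" "n a" "\<Prod>i\<in>A. f i" "\<Sum>i\<in>A. n i"] degree_mult_le[of "f a" "\<Prod>i\<in>A. f i"]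
    by (force intro: order_trans)
qed simp

lemma coeff_power_top:
  assumes "degree f \<le> n"
  shows "degree (f ^ k) \<le> n * k" "coeff (f ^ k) (n * k) = coeff f n ^ k"
proof -
  show "degree (f ^ k) \<le> n * k" using assms degree_power_le[of f k] mult_right_mono[of "degree f" n k] order_trans by fastforce
  show "coeff (f ^ k) (n * k) = coeff f n ^ k"
    using coeff_prod_top[of "{..<k}" "\<lambda>_. f" "\<lambda>_. n"] assms by (simp add: mult.commute)
qed

text \<open>f(x + T v) as a polynomial in T with x kept symbolic, so that being monic in T concerns
  all lines parallel to \<open>v\<close> at once.\<close>

definition line_subst :: "('n::finite \<Rightarrow> complex) \<Rightarrow> 'n mpoly \<Rightarrow> 'n mpoly poly" where
  "line_subst v = insertion (\<lambda>c. [:Const c:]) (\<lambda>i. [:Var i, Const (v i):])"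

lemma line_subst_hom: "is_ring_hom (line_subst v)"
  unfolding line_subst_def by (rule insertion_ring_hom[OF hom_CC])

lemmas line_subst = is_ring_homD[OF line_subst_hom]

lemma line_subst_simps: "line_subst v (Const c) = [:Const c:]" "line_subst v (Var i) = [:Var i, Const (v i):]"
  by (simp_all add: line_subst_def insertion_Const insertion_Var hom_CC)

lemma line_subst_at_0: "poly (line_subst v f) 0 = f"
  by (rule ring_hom_mpoly_eqI[OF is_ring_hom_comp[OF is_ring_hom_poly line_subst_hom] is_ring_hom_id])
    (simp_all add: line_subst_simps)

lemma pderiv_line_subst: "pderiv (line_subst v f) = line_subst v (\<Sum>i\<in>UNIV. Const (v i) * mpoly_partial i f)"
proof -
  have "pderiv (line_subst v f) = (\<Sum>i\<in>UNIV. line_subst v (mpoly_partial i f) * pderiv (line_subst v (Var i)))"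
    by (rule chain_rule[OF line_subst_hom pderiv_derivation]) (simp add: line_subst_simps pderiv_pCons)
  then show ?thesis by (simp add: line_subst line_subst_simps pderiv_pCons mult.commute)
qed

lemma partial_line_subst:
  fixes v :: "'n::{finite,linorder} \<Rightarrow> complex"
  shows "map_poly (mpoly_partial j) (line_subst v f) = line_subst v (mpoly_partial j f)"
proof -
  have "map_poly (mpoly_partial j) (line_subst v f)
    = (\<Sum>i\<in>UNIV. line_subst v (mpoly_partial i f) * map_poly (mpoly_partial j) (line_subst v (Var i)))"
    by (rule chain_rule[OF line_subst_hom map_poly_derivation[OF mpoly_partial_derivation]])
      (simp add: line_subst_simps map_poly_pCons mpoly_partial_Const)
  also have "\<dots> = (\<Sum>i\<in>UNIV. if i = j then line_subst v (mpoly_partial i f) else 0)"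
    by (intro sum.cong) (auto simp: line_subst_simps map_poly_pCons mpoly_partial_Const mpoly_partial_Var)
  finally show ?thesis by simp
qed

text \<open>The leading coefficient in T is the value at \<open>v\<close> of the homogeneous part of
  top degree D. Where it is nonzero, rescaling \<open>v\<close> by a D-th root of its inverse makes
  it one.\<close>

lemma generic_direction:
  fixes h :: "'n::{finite,linorder} mpoly"
  assumes "h \<notin> range Const"
  shows "\<exists>v. lead_coeff (line_subst v h) = 1 \<and> degree (line_subst v h) > 0"
proof -
  have h0: "h \<noteq> 0" using assms by (auto simp: Const_def image_iff) (metis single_zero)
  then have ne: "Poly_Mapping.keys h \<noteq> {}" by simp
  define D where "D = Max (monomial_degree ` Poly_Mapping.keys h)"
  have le: "monomial_degree m \<le> D" if "m \<in> Poly_Mapping.keys h" for m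
    unfolding D_def using that by (intro Max_ge) auto
  obtain m0 where m0: "m0 \<in> Poly_Mapping.keys h" "monomial_degree m0 = D"
    using Max_in[of "monomial_degree ` Poly_Mapping.keys h"] ne unfolding D_def by fastforce
  have D: "D > 0"
  proof (rule ccontr)
    assume "\<not> D > 0"
    then have "m = 0" if "m \<in> Poly_Mapping.keys h" for m using le[OF that] by (simp add: monomial_degree_0)
    then have "h = Const (Poly_Mapping.lookup h 0)"
      by (intro poly_mapping_eqI) (auto simp: Const_def lookup_single when_def in_keys_iff)
    then show False using assms by blast
  qed
  define T where "T = {m \<in> Poly_Mapping.keys h. monomial_degree m = D}"
  define top where "top = (\<Sum>m\<in>T. Poly_Mapping.single m (Poly_Mapping.lookup h m))"
  have T: "finite T" by (simp add: T_def)
  have "Poly_Mapping.lookup top m0 = (\<Sum>m\<in>T. if m = m0 then Poly_Mapping.lookup h m else 0)"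
    unfolding top_def lookup_sum_mpoly by (intro sum.cong) (auto simp: lookup_single when_def)
  also have "\<dots> = Poly_Mapping.lookup h m0" using T m0 by (simp add: T_def)
  finally have "top \<noteq> 0" using m0(1) by (auto simp: in_keys_iff)
  then obtain v where v: "val v top \<noteq> 0" using mpoly_nonvanishing by blast
  have val_top: "val v top = (\<Sum>m\<in>T. Poly_Mapping.lookup h m * (\<Prod>i\<in>UNIV. v i ^ Poly_Mapping.lookup m i))" for v
    unfolding top_def val(8) by (simp add: val_def insertion_single is_ring_hom_id)
  obtain l where l: "1 / val v top = l ^ D" using exists_complex_root[of D "1 / val v top"] D by auto
  define v' where "v' i = l * v i" for i
  have "val v' top = (\<Sum>m\<in>T. l ^ D * (Poly_Mapping.lookup h m * (\<Prod>i\<in>UNIV. v i ^ Poly_Mapping.lookup m i)))"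
    unfolding val_top
  proof (intro sum.cong refl)
    fix m assume "m \<in> T"
    then have "(\<Prod>i\<in>UNIV. l ^ Poly_Mapping.lookup m i) = l ^ D"
      by (simp add: T_def monomial_degree_def power_sum[symmetric])
    then show "Poly_Mapping.lookup h m * (\<Prod>i\<in>UNIV. v' i ^ Poly_Mapping.lookup m i) = l ^ D * (Poly_Mapping.lookup h m * (\<Prod>i\<in>UNIV. v i ^ Poly_Mapping.lookup m i))"
      by (simp add: v'_def power_mult_distrib prod.distrib mult_ac)
  qed
  also have "\<dots> = l ^ D * val v top" unfolding val_top by (simp add: sum_distrib_left)
  finally have one: "val v' top = 1" unfolding l[symmetric] using v by simp
  define mon where "mon m = (\<Prod>i\<in>UNIV. [:Var i, Const (v' i):] ^ Poly_Mapping.lookup m i)" for m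
  have mon: "degree (mon m) \<le> monomial_degree m" "coeff (mon m) (monomial_degree m) = Const (\<Prod>i\<in>UNIV. v' i ^ Poly_Mapping.lookup m i)" for m
  proof -
    have pw: "degree ([:Var i, Const (v' i):] ^ k) \<le> k" "coeff ([:Var i, Const (v' i):] ^ k) k = Const (v' i) ^ k" for i :: 'n and k
      using coeff_power_top[of "[:Var i, Const (v' i):]" 1 k] by auto
    show "degree (mon m) \<le> monomial_degree m" "coeff (mon m) (monomial_degree m) = Const (\<Prod>i\<in>UNIV. v' i ^ Poly_Mapping.lookup m i)"
      using coeff_prod_top[of UNIV "\<lambda>i. [:Var i, Const (v' i):] ^ Poly_Mapping.lookup m i" "Poly_Mapping.lookup m"] pw
      unfolding mon_def monomial_degree_def is_ring_homD(7,9)[OF is_ring_hom_Const] by (simp_all add: is_ring_homD(7,9)[OF is_ring_hom_Const])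
  qed
  have exp: "line_subst v' h = (\<Sum>m\<in>Poly_Mapping.keys h. [:Const (Poly_Mapping.lookup h m):] * mon m)"
    by (simp add: line_subst_def insertion_def mon_def)
  have dt: "degree ([:Const (Poly_Mapping.lookup h m):] * mon m) \<le> D" if "m \<in> Poly_Mapping.keys h" for m
    using le[OF that] mon(1)[of m] degree_mult_le[of "[:Const (Poly_Mapping.lookup h m):]" "mon m"] by simp
  have "coeff (line_subst v' h) D = (\<Sum>m\<in>Poly_Mapping.keys h. Const (Poly_Mapping.lookup h m) * coeff (mon m) D)"
    unfolding exp coeff_sum by simp
  also have "\<dots> = (\<Sum>m\<in>T. Const (Poly_Mapping.lookup h m) * coeff (mon m) D)"
  proof (rule sum.mono_neutral_right)
    show "\<forall>m\<in>Poly_Mapping.keys h - T. Const (Poly_Mapping.lookup h m) * coeff (mon m) D = 0"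
    proof
      fix m assume "m \<in> Poly_Mapping.keys h - T"
      then have "monomial_degree m < D" using le[of m] by (auto simp: T_def)
      then have "degree (mon m) < D" using mon(1)[of m] by simp
      then show "Const (Poly_Mapping.lookup h m) * coeff (mon m) D = 0" by (simp add: coeff_eq_0)
    qed
  qed (auto simp: T_def)
  also have "\<dots> = Const (val v' top)"
    unfolding val_top is_ring_homD(8)[OF is_ring_hom_Const] is_ring_homD(4)[OF is_ring_hom_Const]
    by (intro sum.cong refl) (use mon(2) in \<open>auto simp: T_def\<close>)
  finally have c1: "coeff (line_subst v' h) D = 1" by (simp add: one is_ring_homD[OF is_ring_hom_Const])
  have "degree (line_subst v' h) \<le> D" unfolding exp by (intro degree_sum_le dt) auto
  moreover have "degree (line_subst v' h) \<ge> D" using c1 by (intro le_degree) simp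
  ultimately have "degree (line_subst v' h) = D" by simp
  then show ?thesis using c1 D by (intro exI[of _ v']) auto
qed

section \<open>Hermite reduction and approximate roots\<close>

lemma Const_inverse_of_nat: "n > 0 \<Longrightarrow> of_nat n * Const (1 / of_nat n) = (1 :: 'n mpoly)"
  unfolding is_ring_homD(10)[OF is_ring_hom_Const, symmetric] is_ring_homD(4)[OF is_ring_hom_Const, symmetric]
  by (simp add: is_ring_homD(1)[OF is_ring_hom_Const])

lemma degree_pderiv_le: "degree (pderiv p) \<le> degree p - 1"
  by (intro degree_le) (simp add: coeff_pderiv coeff_eq_0)

text \<open>The operator q -> q' - p' q raises the degree by \<open>degree p - 1\<close> and
  multiplies the leading coefficient by the unit - \<open>degree p\<close>, so every term of degree
  at least \<open>degree p - 1\<close> can be removed. It is differentiation of q exp (- p) with the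
  exponential divided out.\<close>

lemma hermite_reduction:
  fixes p f :: "'n::{finite,linorder} mpoly poly"
  assumes p: "lead_coeff p = 1" "degree p > 0"
  shows "\<exists>q r. f = pderiv q - pderiv p * q + r \<and> (r = 0 \<or> degree r + 1 < degree p)"
proof (induction "if f = 0 then 0 else Suc (degree f)" arbitrary: f rule: less_induct)
  case less
  show ?case
  proof (cases "f = 0 \<or> degree f + 1 < degree p")
    case True
    then show ?thesis by (intro exI[of _ 0] exI[of _ f]) auto
  next
    case False
    define D where "D = degree p"
    define k where "k = degree f"
    have k: "k \<ge> D - 1" "f \<noteq> 0" using False by (auto simp: D_def k_def)
    have D: "D > 0" using p by (simp add: D_def)
    define q where "q = monom (- (lead_coeff f * Const (1 / of_nat D))) (k - (D - 1))"
    define g where "g = f - (pderiv q - pderiv p * q)"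
    note inv = Const_inverse_of_nat[OF D, where 'n = 'n]
    have dp: "degree (pderiv p) \<le> D - 1" "coeff (pderiv p) (D - 1) = of_nat D"
      using p D degree_pderiv_le[of p] by (auto simp: coeff_pderiv D_def)
    have dq: "degree q \<le> k - (D - 1)" unfolding q_def by (rule degree_monom_le)
    have dpq: "degree (pderiv p * q) \<le> k" "coeff (pderiv p * q) k = - lead_coeff f"
    proof -
      show "degree (pderiv p * q) \<le> k" using degree_mult_le[of "pderiv p" q] dp dq k by simp
      have "coeff (pderiv p * q) ((D - 1) + (k - (D - 1))) = of_nat D * - (lead_coeff f * Const (1 / of_nat D))"
        unfolding coeff_mult_top[OF dp(1) dq] dp(2) by (simp add: q_def)
      also have "\<dots> = - (lead_coeff f * (of_nat D * Const (1 / of_nat D)))" by (simp add: algebra_simps)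
      finally show "coeff (pderiv p * q) k = - lead_coeff f" unfolding inv using k by simp
    qed
    have "degree g \<le> k"
      unfolding g_def using dpq(1) degree_pderiv_le[of q] dq by (intro degree_diff_le) (auto simp: k_def)
    moreover have lf: "coeff f k = lead_coeff f" by (simp add: k_def)
    have "coeff g k = coeff (- pderiv q) k" unfolding g_def coeff_diff coeff_minus dpq(2) lf by simp
    moreover have "coeff (pderiv q) k = 0" using dq by (simp add: coeff_pderiv coeff_eq_0)
    ultimately have "g = 0 \<or> degree g < k"
      by (metis coeff_minus leading_coeff_0_iff le_neq_implies_less neg_0_equal_iff_equal)
    then have "(if g = 0 then 0 else Suc (degree g)) < (if f = 0 then 0 else Suc (degree f))" using k by (auto simp: k_def)
    then obtain q' r where "g = pderiv q' - pderiv p * q' + r" "r = 0 \<or> degree r + 1 < degree p" using less by blast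
    then show ?thesis by (intro exI[of _ "q + q'"] exI[of _ r]) (auto simp: g_def pderiv_add algebra_simps)
  qed
qed

lemma power_difference:
  fixes P Q :: "'a::comm_ring_1 poly"
  assumes P: "degree P \<le> e" "coeff P e = 1" and Q: "degree Q \<le> e" "coeff Q e = 1"
  obtains S where "P ^ Suc m - Q ^ Suc m = (P - Q) * S" "degree S \<le> e * m" "coeff S (e * m) = of_nat (Suc m)"
proof
  let ?S = "\<Sum>i<Suc m. Q ^ (Suc m - Suc i) * P ^ i"
  show "P ^ Suc m - Q ^ Suc m = (P - Q) * ?S" by (rule power_diff_sumr2)
  have t: "degree (Q ^ (Suc m - Suc i) * P ^ i) \<le> e * m \<and> coeff (Q ^ (Suc m - Suc i) * P ^ i) (e * m) = 1" if "i < Suc m" for i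
  proof -
    have eq: "e * (Suc m - Suc i) + e * i = e * m" using that by (simp flip: distrib_left)
    note q = coeff_power_top[OF Q(1), of "Suc m - Suc i"] and p = coeff_power_top[OF P(1), of i]
    show ?thesis
      using coeff_mult_top[OF q(1) p(1)] order_trans[OF degree_mult_le add_mono[OF q(1) p(1)]] q(2) p(2) P(2) Q(2)
      unfolding eq by simp
  qed
  show "degree ?S \<le> e * m" using t by (intro degree_sum_le) auto
  show "coeff ?S (e * m) = of_nat (Suc m)" unfolding coeff_sum using t by simp
qed

text \<open>The approximate root of Abhyankar and Moh. Its coefficients are found from the top; each
  new one enters the next condition linearly, with the invertible factor
  \<open>Suc m\<close>.\<close>

lemma approximate_root:
  fixes f :: "'n::{finite,linorder} mpoly poly"
  assumes f: "lead_coeff f = 1" "degree f = e * Suc m" and e: "e > 0"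
  shows "\<exists>P. degree P = e \<and> coeff P e = 1 \<and> (\<forall>i\<ge>e * m. coeff (f - P ^ Suc m) i = 0)"
proof -
  have "\<exists>P. degree P \<le> e \<and> coeff P e = 1 \<and> (\<forall>i\<ge>e * Suc m - j. coeff (f - P ^ Suc m) i = 0)" if "j \<le> e" for j
    using that
  proof (induction j)
    case 0
    have "coeff (f - monom 1 e ^ Suc m) i = 0" if "i \<ge> e * Suc m" for i
      using that f by (cases "i = e * Suc m") (auto simp: monom_power coeff_eq_0 simp del: power_Suc)
    then show ?case by (intro exI[of _ "monom 1 e"]) (auto simp: degree_monom_le)
  next
    case (Suc j)
    then obtain P where P: "degree P \<le> e" "coeff P e = 1" "\<forall>i\<ge>e * Suc m - j. coeff (f - P ^ Suc m) i = 0" by auto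
    define d where "d = e - Suc j"
    have d: "d < e" "d + e * m = e * Suc m - Suc j" using Suc.prems by (auto simp: d_def)
    define c where "c = coeff (f - P ^ Suc m) (d + e * m)"
    define P' where "P' = P + monom (c * Const (1 / of_nat (Suc m))) d"
    have P': "degree P' \<le> e" "coeff P' e = 1"
      unfolding P'_def using P d by (auto intro!: degree_add_le order_trans[OF degree_monom_le])
    obtain S where S: "P' ^ Suc m - P ^ Suc m = (P' - P) * S" "degree S \<le> e * m" "coeff S (e * m) = of_nat (Suc m)"
      by (rule power_difference[OF P' P(1,2)])
    have inv: "Const (1 / of_nat (Suc m)) * of_nat (Suc m) = (1 :: 'n mpoly)"
      using Const_inverse_of_nat[of "Suc m"] by (simp add: mult.commute del: of_nat_Suc)
    have dm: "degree (monom (c * Const (1 / of_nat (Suc m))) d) \<le> d" by (rule degree_monom_le)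
    have top: "coeff ((P' - P) * S) (d + e * m) = c"
      using coeff_mult_top[OF dm S(2)] S(3) inv by (simp add: P'_def mult.assoc del: of_nat_Suc)
    have deg: "degree ((P' - P) * S) \<le> d + e * m"
      using degree_mult_le[of "P' - P" S] dm S(2) by (simp add: P'_def)
    have eq: "f - P' ^ Suc m = (f - P ^ Suc m) - (P' - P) * S" using S(1) by (simp add: algebra_simps)
    have "coeff (f - P' ^ Suc m) i = 0" if "i \<ge> e * Suc m - Suc j" for i
    proof (cases "i = d + e * m")
      case True
      then show ?thesis unfolding eq using top by (simp add: c_def)
    next
      case False
      then have "i \<ge> e * Suc m - j" "i > d + e * m" using that d Suc.prems by auto
      then show ?thesis unfolding eq coeff_diff using P(3) deg by (simp add: coeff_eq_0)
    qed
    then show ?case using P' by blast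
  qed
  from this[of e] obtain P where "degree P \<le> e" "coeff P e = 1" "\<forall>i\<ge>e * m. coeff (f - P ^ Suc m) i = 0" by auto
  moreover from this have "degree P = e" by (intro antisym le_degree) auto
  ultimately show ?thesis by blast
qed

text \<open>In P^(m+1) - Q^(m+1) the cofactor of P - Q has degree exactly e m, its leading
  coefficient \<open>Suc m\<close> being nonzero. A nonzero difference would thus show up in degree
  at least e m.\<close>

lemma approximate_root_unique:
  fixes P Q :: "'a::{idom, ring_char_0} poly"
  assumes "degree P \<le> e" "coeff P e = 1" "degree Q \<le> e" "coeff Q e = 1"
    and small: "\<And>i. i \<ge> e * m \<Longrightarrow> coeff (P ^ Suc m - Q ^ Suc m) i = 0"
  shows "P = Q"
proof (rule ccontr)
  assume "P \<noteq> Q"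
  obtain S where S: "P ^ Suc m - Q ^ Suc m = (P - Q) * S" "degree S \<le> e * m" "coeff S (e * m) = of_nat (Suc m)"
    by (rule power_difference[OF assms(1-4)])
  have "S \<noteq> 0" using S(3) by (metis coeff_0 of_nat_eq_0_iff Suc_not_Zero)
  moreover have "degree S \<ge> e * m" using S(3) by (intro le_degree) (simp del: of_nat_Suc)
  ultimately have "(P - Q) * S \<noteq> 0" "degree ((P - Q) * S) \<ge> e * m" using \<open>P \<noteq> Q\<close> by (auto simp: degree_mult_eq)
  then show False using small[of "degree ((P - Q) * S)"] unfolding S(1) by simp
qed

lemma coeff_compose_small:
  assumes "\<And>i. i \<ge> m \<Longrightarrow> coeff E i = 0" "degree P \<le> e" "e > 0" "i \<ge> e * m"
  shows "coeff (poly (map_poly cc E) P) i = 0"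
proof (cases m)
  case 0
  then have "E = 0" using assms(1) by (intro poly_eqI) simp
  then show ?thesis by simp
next
  case (Suc k)
  have "degree (map_poly cc E) \<le> k"
    using assms(1) Suc by (intro degree_le) (simp add: coeff_map_poly cc)
  then have "poly (map_poly cc E) P = (\<Sum>j\<le>k. coeff (map_poly cc E) j * P ^ j)" by (rule poly_eq_sum_le)
  also have "degree \<dots> \<le> e * k"
  proof (rule degree_sum_le)
    fix j assume j: "j \<in> {..k}"
    have "degree (coeff (map_poly cc E) j * P ^ j) \<le> degree (P ^ j)"
      by (simp add: coeff_map_poly cc cc_def degree_smult_le)
    also have "\<dots> \<le> e * j" by (rule coeff_power_top(1)[OF assms(2)])
    also have "\<dots> \<le> e * k" using j by simp
    finally show "degree (coeff (map_poly cc E) j * P ^ j) \<le> e * k" .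
  qed simp
  also have "e * k < i" using assms(3,4) Suc by simp
  finally show ?thesis by (rule coeff_eq_0)
qed

lemma poly_map_sum_monom:
  fixes H :: "'a::idom \<Rightarrow> 'b::idom"
  assumes "is_ring_hom H"
  shows "poly (map_poly H (\<Sum>k\<le>N. monom (b k) k)) x = (\<Sum>k\<le>N. H (b k) * x ^ k)"
  using is_ring_homD(2)[OF assms]
  by (simp add: is_ring_homD(8)[OF is_ring_hom_map_poly[OF assms]] map_poly_monom poly_sum poly_monom)

text \<open>Restriction to the points z w of a line through the origin. Applied to the coefficients
  of \<open>line_subst v f\<close>, as in \<open>plane_subst\<close>, it gives f(z w + t v).\<close>

definition base_subst :: "('n::finite \<Rightarrow> complex) \<Rightarrow> 'n mpoly \<Rightarrow> complex poly" where
  "base_subst w = insertion (\<lambda>c. [:c:]) (\<lambda>i. [:0, w i:])"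

lemma base_subst_hom: "is_ring_hom (base_subst w)"
  unfolding base_subst_def by (rule insertion_ring_hom[OF is_ring_hom_pCons])

lemmas base_subst = is_ring_homD[OF base_subst_hom]

lemma base_subst_simps: "base_subst w (Const c) = [:c:]" "base_subst w (Var i) = [:0, w i:]"
  by (simp_all add: base_subst_def insertion_Const insertion_Var is_ring_hom_pCons)

lemma poly_base_subst: "poly (base_subst w f) s = val (\<lambda>i. s * w i) f"
  by (rule ring_hom_mpoly_eqI[OF is_ring_hom_comp[OF is_ring_hom_poly base_subst_hom] val_hom])
    (simp_all add: base_subst_simps val_simps)

definition plane_subst :: "('n::{finite,linorder} \<Rightarrow> complex) \<Rightarrow> 'n mpoly poly \<Rightarrow> bipoly" where
  "plane_subst w = map_poly (base_subst w)"

lemma plane_subst_hom: "is_ring_hom (plane_subst w)"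
  unfolding plane_subst_def by (rule is_ring_hom_map_poly[OF base_subst_hom])

lemmas plane_subst = is_ring_homD[OF plane_subst_hom]

lemma coeff_plane_subst: "coeff (plane_subst w f) k = base_subst w (coeff f k)"
  by (simp add: plane_subst_def coeff_map_poly base_subst)

lemma plane_subst_CC: "plane_subst w [:Const c:] = cc c"
  by (simp add: plane_subst_def map_poly_pCons base_subst base_subst_simps cc_def)

lemma degree_plane_subst_le: "degree (plane_subst w f) \<le> degree f"
  unfolding plane_subst_def by (rule degree_map_poly_leI) (simp add: base_subst)

lemma degree_plane_subst_monic:
  assumes "lead_coeff f = 1"
  shows "degree (plane_subst w f) = degree f" "lead_coeff (plane_subst w f) = 1"
proof -
  have c: "coeff (plane_subst w f) (degree f) = 1" by (simp add: coeff_plane_subst assms base_subst)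
  then have "degree f \<le> degree (plane_subst w f)" by (intro le_degree) simp
  then show "degree (plane_subst w f) = degree f"
    using degree_plane_subst_le[of w f] by (intro antisym)
  then show "lead_coeff (plane_subst w f) = 1" using c by simp
qed

lemma pderiv_plane_subst: "pderiv (plane_subst w f) = plane_subst w (pderiv f)"
  by (intro poly_eqI) (simp add: coeff_pderiv coeff_plane_subst base_subst del: of_nat_Suc)

text \<open>A composition on a sufficiently general plane determines one over all polynomials: its inner
  part is, up to a constant, the approximate root, and the coefficients of the adic expansions
  along the approximate root which are constant on the general plane are constant.\<close>

lemma lift_integral:
  fixes f g :: "'n::{finite,linorder} mpoly poly"
  assumes f: "lead_coeff f = 1" "degree f > 0"
    and plane: "\<And>w. \<exists>P B a. lead_coeff P = 1 \<and> degree P > 0 \<and> plane_subst w f = poly (map_poly cc B) P \<and>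
      plane_subst w g = poly (map_poly cc a) P * pderiv P"
  shows "\<exists>P B a. lead_coeff P = 1 \<and> degree P > 0 \<and> f = poly (map_poly (\<lambda>c. [:Const c:]) B) P \<and>
    g = poly (map_poly (\<lambda>c. [:Const c:]) a) P * pderiv P"
proof -
  \<comment> \<open>The degree of \<open>P\<close> depends on a plane that is not yet chosen. It
    divides \<open>degree f\<close>, so approximate roots for all divisors are prepared in
    advance.\<close>
  define E where "E = {e. e > 0 \<and> e dvd degree f}"
  have finE: "finite E" unfolding E_def using f(2) by (intro finite_subset[OF _ finite_divisors_nat[of "degree f"]]) auto
  have "\<exists>R m. degree R = e \<and> coeff R e = 1 \<and> degree f = e * Suc m \<and> (\<forall>i\<ge>e * m. coeff (f - R ^ Suc m) i = 0)" if eE: "e \<in> E" for e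
  proof -
    obtain k where k: "degree f = e * k" "e > 0" using eE by (auto simp: E_def)
    then obtain m where m: "k = Suc m" using f(2) by (cases k) auto
    show ?thesis using approximate_root[OF f(1) _ k(2), of m] k(1) unfolding m by blast
  qed
  then have "\<forall>e. \<exists>R m. e \<in> E \<longrightarrow> degree R = e \<and> coeff R e = 1 \<and> degree f = e * Suc m \<and> (\<forall>i\<ge>e * m. coeff (f - R ^ Suc m) i = 0)" by blast
  then obtain R m where R: "\<And>e. e \<in> E \<Longrightarrow> degree (R e) = e" "\<And>e. e \<in> E \<Longrightarrow> coeff (R e) e = 1"
    "\<And>e. e \<in> E \<Longrightarrow> degree f = e * Suc (m e)" "\<And>e i. e \<in> E \<Longrightarrow> i \<ge> e * m e \<Longrightarrow> coeff (f - R e ^ Suc (m e)) i = 0"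
    unfolding choice_iff by blast
  have Rm: "lead_coeff (R e) = 1" "degree (R e) > 0" if "e \<in> E" for e using R(1,2)[OF that] that by (auto simp: E_def)
  have "\<exists>\<mu> n. (\<forall>k. degree (\<mu> k) < e) \<and> (\<forall>k>n. \<mu> k = 0) \<and> (\<forall>N\<ge>n. F = (\<Sum>k\<le>N. R e ^ k * \<mu> k))" if "e \<in> E" for e F
    using adic_expansion_support[OF Rm[OF that]] unfolding R(1)[OF that] .
  then have *: "\<forall>e. \<exists>\<mu> n. e \<in> E \<longrightarrow> (\<forall>k. degree (\<mu> k) < e) \<and> (\<forall>k>n. \<mu> k = 0) \<and> (\<forall>N\<ge>n. F = (\<Sum>k\<le>N. R e ^ k * \<mu> k))" for F by blast
  obtain \<beta> nb where \<beta>: "\<And>e k. e \<in> E \<Longrightarrow> degree (\<beta> e k) < e" "\<And>e k. e \<in> E \<Longrightarrow> k > nb e \<Longrightarrow> \<beta> e k = 0"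
    "\<And>e N. e \<in> E \<Longrightarrow> N \<ge> nb e \<Longrightarrow> f = (\<Sum>k\<le>N. R e ^ k * \<beta> e k)" using *[of f] unfolding choice_iff by blast
  obtain \<gamma> ng where \<gamma>: "\<And>e k. e \<in> E \<Longrightarrow> degree (\<gamma> e k) < e" "\<And>e k. e \<in> E \<Longrightarrow> k > ng e \<Longrightarrow> \<gamma> e k = 0"
    "\<And>e N. e \<in> E \<Longrightarrow> N \<ge> ng e \<Longrightarrow> g = (\<Sum>k\<le>N. R e ^ k * \<gamma> e k)" using *[of g] unfolding choice_iff by blast
  define b where "b e k = val (\<lambda>_. 0) (coeff (\<beta> e k) 0)" for e k
  define c where "c e k = val (\<lambda>_. 0) (coeff (\<gamma> e k) (e - 1))" for e k
  define tf where "tf e k = \<beta> e k - [:Const (b e k):]" for e k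
  define tg where "tg e k = of_nat e * \<gamma> e k - [:Const (c e k):] * pderiv (R e)" for e k
  \<comment> \<open>The coefficients of all deviations from the desired constant digits, for every
    candidate \<open>e\<close>. A point \<open>w\<close> at which no nonzero one vanishes makes a
    deviation zero as soon as it is zero on the plane.\<close>
  define T where "T = (\<Union>e\<in>E. \<Union>k\<le>nb e + ng e. coeff (tf e k) ` {..degree (tf e k)} \<union> coeff (tg e k) ` {..degree (tg e k)})"
  have "finite T" unfolding T_def using finE by auto
  then obtain w where w: "\<And>x. x \<in> T \<Longrightarrow> val w x = 0 \<Longrightarrow> x = 0" using mpoly_nonvanishing_finite by blast
  have vanish: "q = 0" if "plane_subst w q = 0" "coeff q ` {..degree q} \<subseteq> T" for q
  proof -
    have "coeff q (degree q) = 0"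
    proof (rule w)
      have "base_subst w (coeff q (degree q)) = 0" using that(1) coeff_plane_subst[of w q "degree q"] by simp
      then show "val w (coeff q (degree q)) = 0" using poly_base_subst[of w "coeff q (degree q)" 1] by simp
    qed (use that(2) in auto)
    then show ?thesis by simp
  qed
  obtain P B a where P: "lead_coeff P = 1" "degree P > 0" "plane_subst w f = poly (map_poly cc B) P"
    "plane_subst w g = poly (map_poly cc a) P * pderiv P" using plane[of w] by blast
  define e where "e = degree P"
  note fw = degree_plane_subst_monic[OF f(1), of w]
  have cd: "degree f = degree B * e" "lead_coeff B = 1" "degree B > 0"
    using compose_degree[OF fw(2) _ P(1,2,3)] f(2) fw(1) by (auto simp: e_def)
  have e: "e \<in> E" "e > 0" using cd(1) P(2) by (auto simp: E_def e_def)
  have "e * degree B = e * Suc (m e)" using R(3)[OF e(1)] cd(1) by (simp only: mult.commute)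
  then have dB: "degree B = Suc (m e)" using nat_mult_eq_cancel1[OF e(2)] by blast
  \<comment> \<open>Completing the power: \<open>B\<close> agrees with (T + s)^(m+1), m =
    \<open>m e\<close>, in degrees at least m. So P + s is an approximate root of the restricted
    \<open>f\<close>, and by uniqueness the restriction of \<open>R e\<close>.\<close>
  define s where "s = coeff B (m e) / of_nat (Suc (m e))"
  define Q where "Q = plane_subst w (R e)"
  note Qm = degree_plane_subst_monic[OF Rm(1)[OF e(1)], of w, folded Q_def, unfolded R(1)[OF e(1)]]
  have PQ: "P + cc s = Q"
  proof (rule approximate_root_unique)
    show dP: "degree (P + cc s) \<le> e" "coeff (P + cc s) e = 1"
      using P(1) e(2) by (auto simp: e_def cc_def coeff_pCons split: nat.split intro!: degree_add_le)
    show "degree Q \<le> e" "coeff Q e = 1" using Qm by auto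
    fix i assume i: "i \<ge> e * m e"
    define H where "H = B - [:s, 1:] ^ Suc (m e)"
    have H: "coeff H i = 0" if im: "i \<ge> m e" for i
    proof -
      consider "i = m e" | "i = Suc (m e)" | "i > Suc (m e)" using im by linarith
      then show ?thesis
      proof cases
        case 1
        have "coeff ([:s, 1:] ^ Suc (m e)) (m e) = of_nat (Suc (m e) choose m e) * 1 ^ m e * s ^ (Suc (m e) - m e)"
          by (rule coeff_linear_poly_power) simp
        also have "Suc (m e) choose m e = Suc (m e)" using binomial_symmetric[of "m e" "Suc (m e)"] by simp
        finally show ?thesis unfolding 1 H_def coeff_diff by (simp add: s_def del: of_nat_Suc power_Suc)
      next
        case 2
        have "coeff ([:s, 1:] ^ Suc (m e)) (Suc (m e)) = of_nat (Suc (m e) choose Suc (m e)) * 1 ^ Suc (m e) * s ^ (Suc (m e) - Suc (m e))"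
          by (rule coeff_linear_poly_power) simp
        then show ?thesis unfolding 2 H_def coeff_diff using cd(2) by (simp add: dB del: power_Suc)
      next
        case 3
        have "degree ([:s, 1:] ^ Suc (m e)) \<le> 1 * Suc (m e)" by (rule coeff_power_top) simp
        then show ?thesis unfolding H_def coeff_diff using 3 dB by (simp add: coeff_eq_0 del: power_Suc)
      qed
    qed
    have "plane_subst w f - (P + cc s) ^ Suc (m e) = poly (map_poly cc H) P"
      by (rule ev_eqI) (simp only: P(3) ev ev_cc ev_compose H_def poly_diff poly_power poly_pCons poly_0 mult_zero_right mult_1_right add_0_right add.commute)
    then have 1: "coeff (plane_subst w f - (P + cc s) ^ Suc (m e)) i = 0"
      using coeff_compose_small[OF H _ e(2) i, of P] by (simp add: e_def del: power_Suc)
    have "plane_subst w f - Q ^ Suc (m e) = plane_subst w (f - R e ^ Suc (m e))" by (simp only: Q_def plane_subst)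
    then have 2: "coeff (plane_subst w f - Q ^ Suc (m e)) i = 0"
      using R(4)[OF e(1) i] by (simp add: coeff_plane_subst base_subst del: power_Suc)
    show "coeff ((P + cc s) ^ Suc (m e) - Q ^ Suc (m e)) i = 0" using 1 2 unfolding coeff_diff by simp
  qed
  define B' where "B' = pcompose B [:- s, 1:]"
  define a' where "a' = pcompose a [:- s, 1:]"
  have shift: "poly (map_poly cc q) P = poly (map_poly cc (pcompose q [:- s, 1:])) Q" for q
    by (rule ev_eqI) (simp add: PQ[symmetric] ev_compose ev ev_cc poly_pcompose)
  have fQ: "plane_subst w f = poly (map_poly cc B') Q" unfolding P(3) B'_def by (rule shift)
  have "pderiv P = pderiv Q" unfolding PQ[symmetric] by (simp add: pderiv_add cc_def pderiv_pCons)
  then have gQ: "plane_subst w g = poly (map_poly cc a') Q * pderiv Q" unfolding P(4) a'_def by (simp add: shift)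
  define N where "N = nb e + ng e + degree B' + degree a'"
  have sumQ: "poly (map_poly cc q) Q = (\<Sum>k\<le>N. Q ^ k * cc (coeff q k))" if "degree q \<le> N" for q
    using degree_map_poly_leI[of cc q] that by (subst poly_eq_sum_le[of _ N]) (auto simp: cc coeff_map_poly mult.commute)
  have Qe: "lead_coeff Q = 1" "degree Q > 0" "degree Q = e" using Qm e(2) by auto
  have \<beta>c: "plane_subst w (\<beta> e k) = cc (coeff B' k)" if k: "k \<le> N" for k
  proof -
    have "(\<Sum>k\<le>N. Q ^ k * plane_subst w (\<beta> e k)) = plane_subst w f"
      using arg_cong[OF \<beta>(3)[OF e(1), of N], of "plane_subst w"] by (simp add: plane_subst Q_def N_def)
    also have "\<dots> = (\<Sum>k\<le>N. Q ^ k * cc (coeff B' k))" unfolding fQ by (rule sumQ) (simp add: N_def)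
    finally have "(\<Sum>k\<le>N. Q ^ k * (plane_subst w (\<beta> e k) - cc (coeff B' k))) = 0"
      by (simp add: right_diff_distrib sum_subtractf)
    then have "plane_subst w (\<beta> e k) - cc (coeff B' k) = 0"
    proof (rule adic_unique[OF Qe(1,2) _ _ k])
      fix k show "degree (plane_subst w (\<beta> e k) - cc (coeff B' k)) < degree Q"
        unfolding Qe(3) using e(2) le_less_trans[OF degree_plane_subst_le \<beta>(1)[OF e(1)]]
        by (intro degree_diff_less) (auto simp: cc_def)
    qed
    then show ?thesis by simp
  qed
  have \<gamma>c: "plane_subst w (\<gamma> e k) = cc (coeff a' k) * pderiv Q" if k: "k \<le> N" for k
  proof -
    have "(\<Sum>k\<le>N. Q ^ k * plane_subst w (\<gamma> e k)) = plane_subst w g"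
      using arg_cong[OF \<gamma>(3)[OF e(1), of N], of "plane_subst w"] by (simp add: plane_subst Q_def N_def)
    also have "\<dots> = (\<Sum>k\<le>N. Q ^ k * (cc (coeff a' k) * pderiv Q))"
      unfolding gQ by (subst sumQ) (simp_all add: N_def sum_distrib_right mult.assoc)
    finally have "(\<Sum>k\<le>N. Q ^ k * (plane_subst w (\<gamma> e k) - cc (coeff a' k) * pderiv Q)) = 0"
      by (simp add: right_diff_distrib sum_subtractf)
    then have "plane_subst w (\<gamma> e k) - cc (coeff a' k) * pderiv Q = 0"
    proof (rule adic_unique[OF Qe(1,2) _ _ k])
      fix k
      have "degree (cc (coeff a' k) * pderiv Q) \<le> degree (pderiv Q)" by (simp add: cc_def degree_smult_le)
      also have "\<dots> < e" using Qe(2,3) by (simp add: degree_pderiv)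
      finally show "degree (plane_subst w (\<gamma> e k) - cc (coeff a' k) * pderiv Q) < degree Q"
        unfolding Qe(3) using le_less_trans[OF degree_plane_subst_le \<gamma>(1)[OF e(1)]]
        by (intro degree_diff_less) auto
    qed
    then show ?thesis by simp
  qed
  have at_0: "val (\<lambda>_. 0) (coeff q i) = poly (coeff (plane_subst w q) i) 0" for q i
    by (simp add: coeff_plane_subst poly_base_subst)
  have tf0: "tf e k = 0" if k: "k \<le> N" for k
  proof (cases "k \<le> nb e + ng e")
    case True
    have "b e k = coeff B' k" unfolding b_def at_0 \<beta>c[OF k] by (simp add: cc_def)
    then have "plane_subst w (tf e k) = 0" by (simp add: tf_def plane_subst \<beta>c[OF k] plane_subst_CC)
    then show ?thesis by (rule vanish) (use True e(1) in \<open>auto simp: T_def\<close>)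
  next
    case False
    then show ?thesis using \<beta>(2)[OF e(1), of k] by (simp add: tf_def b_def val is_ring_homD[OF is_ring_hom_Const])
  qed
  have tg0: "tg e k = 0" if k: "k \<le> N" for k
  proof (cases "k \<le> nb e + ng e")
    case True
    have "coeff (pderiv Q) (e - 1) = of_nat e" using Qe e(2) by (simp add: coeff_pderiv)
    then have "c e k = coeff a' k * of_nat e" unfolding c_def at_0 \<gamma>c[OF k] by (simp add: cc_def of_nat_poly)
    moreover have "plane_subst w (tg e k) = of_nat e * (cc (coeff a' k) * pderiv Q) - cc (c e k) * pderiv Q"
      by (simp only: tg_def plane_subst \<gamma>c[OF k] plane_subst_CC pderiv_plane_subst[symmetric] Q_def)
    ultimately have "plane_subst w (tg e k) = 0" by (simp only: cc) (simp add: mult_ac)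
    then show ?thesis by (rule vanish) (use True e(1) in \<open>auto simp: T_def\<close>)
  next
    case False
    then show ?thesis using \<gamma>(2)[OF e(1), of k] by (simp add: tg_def c_def val is_ring_homD[OF is_ring_hom_Const])
  qed
  have inv: "[:Const (1 / of_nat e):] * of_nat e = (1 :: 'n mpoly poly)"
    using Const_inverse_of_nat[OF e(2), where 'n = 'n] by (simp add: of_nat_poly mult.commute one_pCons)
  have \<gamma>e: "\<gamma> e k = [:Const (c e k / of_nat e):] * pderiv (R e)" if "k \<le> N" for k
  proof -
    have "\<gamma> e k = [:Const (1 / of_nat e):] * of_nat e * \<gamma> e k" unfolding inv by simp
    also have "\<dots> = [:Const (1 / of_nat e):] * ([:Const (c e k):] * pderiv (R e))"
      using tg0[OF that] by (simp only: tg_def mult.assoc) simp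
    also have "\<dots> = ([:Const (1 / of_nat e):] * [:Const (c e k):]) * pderiv (R e)" by (simp only: mult.assoc)
    also have "[:Const (1 / of_nat e):] * [:Const (c e k):] = [:Const (c e k / of_nat e) :: 'n mpoly:]"
      by (simp add: is_ring_homD(4)[OF is_ring_hom_Const, symmetric])
    finally show ?thesis .
  qed
  have "f = (\<Sum>k\<le>N. R e ^ k * \<beta> e k)" by (rule \<beta>(3)[OF e(1)]) (simp add: N_def)
  also have "\<dots> = (\<Sum>k\<le>N. [:Const (b e k):] * R e ^ k)"
    using tf0 by (intro sum.cong) (auto simp: tf_def mult.commute)
  also have "\<dots> = poly (map_poly (\<lambda>c. [:Const c:]) (\<Sum>k\<le>N. monom (b e k) k)) (R e)"
    by (rule poly_map_sum_monom[OF hom_CC, symmetric])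
  finally have F: "f = poly (map_poly (\<lambda>c. [:Const c:]) (\<Sum>k\<le>N. monom (b e k) k)) (R e)" .
  have "g = (\<Sum>k\<le>N. R e ^ k * \<gamma> e k)" by (rule \<gamma>(3)[OF e(1)]) (simp add: N_def)
  also have "\<dots> = (\<Sum>k\<le>N. [:Const (c e k / of_nat e):] * R e ^ k) * pderiv (R e)"
    unfolding sum_distrib_right using \<gamma>e by (intro sum.cong) (auto simp: mult_ac)
  also have "(\<Sum>k\<le>N. [:Const (c e k / of_nat e):] * R e ^ k) = poly (map_poly (\<lambda>c. [:Const c:]) (\<Sum>k\<le>N. monom (c e k / of_nat e) k)) (R e)"
    by (rule poly_map_sum_monom[OF hom_CC, symmetric])
  finally show ?thesis using F Rm[OF e(1)] by blast
qed

section \<open>Reconstruction from lines and the normal form\<close>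

definition line_defect :: "('n::{finite,linorder} \<Rightarrow> complex) \<Rightarrow> 'n mpoly poly \<Rightarrow> 'n mpoly poly" where
  "line_defect v F = pderiv F - (\<Sum>i\<in>UNIV. [:Const (v i):] * map_poly (mpoly_partial i) F)"

lemma coeff_line_defect:
  "coeff (line_defect v F) k = of_nat (Suc k) * coeff F (Suc k) - (\<Sum>i\<in>UNIV. Const (v i) * mpoly_partial i (coeff F k))"
  by (simp add: line_defect_def coeff_pderiv coeff_sum coeff_map_poly del: of_nat_Suc)

lemma line_defect_derivation: "derivation (line_defect v)"
proof -
  note md = derivationD[OF map_poly_derivation[OF mpoly_partial_derivation]] and pd = derivationD[OF pderiv_derivation]
  show ?thesis
    unfolding derivation_def line_defect_def
    by (simp add: md(1,2) pd(1,2) sum.distrib sum_distrib_left sum_distrib_right algebra_simps)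
qed

lemmas line_defect = derivationD[OF line_defect_derivation]

lemma line_defect_line_subst: "line_defect v (line_subst v f) = 0"
  unfolding line_defect_def pderiv_line_subst partial_line_subst by (simp add: line_subst line_subst_simps)

lemma degree_line_defect_le: "degree (line_defect v F) \<le> degree F"
  by (intro degree_le) (simp add: coeff_line_defect coeff_eq_0 del: of_nat_Suc)

lemma line_defect_pderiv: "line_defect v (pderiv F) = pderiv (line_defect v F)"
proof (rule poly_eqI)
  fix k
  note D = derivationD[OF mpoly_partial_derivation]
  have "mpoly_partial i (of_nat (Suc k) * x) = of_nat (Suc k) * mpoly_partial i x" for i :: 'a and x
    by (simp only: D(2) D(7)) simp
  then have "(\<Sum>i\<in>UNIV. Const (v i) * mpoly_partial i (of_nat (Suc k) * coeff F (Suc k)))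
    = of_nat (Suc k) * (\<Sum>i\<in>UNIV. Const (v i) * mpoly_partial i (coeff F (Suc k)))"
    unfolding sum_distrib_left by (intro sum.cong refl) (simp only: mult.left_commute)
  then show "coeff (line_defect v (pderiv F)) k = coeff (pderiv (line_defect v F)) k"
    by (simp only: coeff_line_defect coeff_pderiv right_diff_distrib)
qed

text \<open>The condition expresses (k+1) times the coefficient of T^(k+1) through derivatives of
  that of T^k, so \<open>F\<close> is determined by its constant term and comes from a polynomial on
  the space.\<close>

lemma line_defect_eq_0:
  assumes "line_defect v F = 0"
  shows "F = line_subst v (poly F 0)"
proof -
  define H where "H = F - line_subst v (poly F 0)"
  have H: "line_defect v H = 0" by (simp add: H_def line_defect assms line_defect_line_subst)
  have H0: "coeff H 0 = 0" by (simp add: H_def line_subst_at_0 poly_0_coeff_0[symmetric])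
  have "coeff H k = 0" for k
  proof (induction k)
    case (Suc k)
    have "of_nat (Suc k) * coeff H (Suc k) = 0"
      using coeff_line_defect[of v H k] Suc H by (simp del: of_nat_Suc)
    moreover have "(of_nat (Suc k) :: 'a mpoly) \<noteq> 0"
    proof
      assume "(of_nat (Suc k) :: 'a mpoly) = 0"
      then show False using of_nat_mpoly_unit[of k, where 'n = 'a] by (simp del: of_nat_Suc)
    qed
    ultimately show ?case by (simp del: of_nat_Suc)
  qed (rule H0)
  then have "H = 0" by (intro poly_eqI) simp
  then show ?thesis by (simp add: H_def)
qed

text \<open>The uniqueness half of Hermite reduction: for nonzero \<open>q\<close> the left side has
  a term of degree \<open>degree p - 1 + degree q\<close>, out of reach for the right side.\<close>

lemma degree_pderiv_mult_less:
  fixes p q s :: "'n::{finite,linorder} mpoly poly"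
  assumes p: "lead_coeff p = 1" "degree p > 0"
    and eq: "pderiv p * q = pderiv q + s" and s: "s = 0 \<or> degree s + 1 < degree p"
  shows "q = 0"
proof (rule ccontr)
  assume q: "q \<noteq> 0"
  define D where "D = degree p"
  have c: "coeff (pderiv p) (D - 1) = of_nat D" using p by (simp add: coeff_pderiv D_def)
  have "(of_nat D :: 'n mpoly) \<noteq> 0"
    using Const_inverse_of_nat[of D, where 'n = 'n] p(2) by (auto simp: D_def)
  then have "coeff (pderiv p * q) ((D - 1) + degree q) \<noteq> 0"
    using coeff_mult_top[of "pderiv p" "D - 1" q "degree q"] degree_pderiv_le[of p] c q by (simp add: D_def)
  moreover have "coeff (pderiv q) ((D - 1) + degree q) = 0"
    by (simp add: coeff_pderiv coeff_eq_0)
  moreover have "coeff s ((D - 1) + degree q) = 0"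
    using s by (auto simp: D_def intro: coeff_eq_0)
  ultimately show False unfolding eq by simp
qed

text \<open>In a direction \<open>v\<close> in which \<open>h\<close> is monic, Hermite reduction along the lines parallel to \<open>v\<close> makes the
  \<open>v\<close>-component of \<open>\<omega>\<close> of low degree. On planes containing \<open>v\<close> it is then of the form
  \<open>a(P) dP\<close> with \<open>h = B(P)\<close>. Once the \<open>v\<close>-component vanishes, the equation forces the form to vanish.\<close>

theorem affine_normal_form:
  fixes \<omega> :: "'n::{finite,linorder} \<Rightarrow> 'n mpoly"
  assumes rel: "\<And>i j. mpoly_partial i (\<omega> j) - mpoly_partial j (\<omega> i) = mpoly_partial i h * \<omega> j - mpoly_partial j h * \<omega> i"
    and h: "h \<notin> range Const"
  shows "\<exists>P Q a b. \<forall>i. \<omega> i = mpoly_partial i Q + (poly (map_poly Const a) P + poly (map_poly Const b) P * Q) * mpoly_partial i P"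
proof -
  obtain v where v: "lead_coeff (line_subst v h) = 1" "degree (line_subst v h) > 0" using generic_direction[OF h] by blast
  define L where "L = line_subst v"
  define p where "p = L h"
  note L = line_subst[of v, folded L_def] and L_simps = line_subst_simps[of v, folded L_def]
  have p: "lead_coeff p = 1" "degree p > 0" using v by (simp_all add: p_def L_def)
  define V where "V \<eta> = (\<Sum>i\<in>UNIV. Const (v i) * \<eta> i)" for \<eta> :: "'n \<Rightarrow> 'n mpoly"
  have pL: "pderiv (L f) = L (V (\<lambda>i. mpoly_partial i f))" for f unfolding L_def V_def by (rule pderiv_line_subst)
  have V_simps: "V (\<lambda>i. \<eta> i + \<eta>' i) = V \<eta> + V \<eta>'" "V (\<lambda>i. \<eta> i - \<eta>' i) = V \<eta> - V \<eta>'" "V (\<lambda>i. f * \<eta> i) = f * V \<eta>" for \<eta> \<eta>' f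
    by (simp_all add: V_def sum.distrib sum_subtractf sum_distrib_left algebra_simps)
  obtain q r where qr: "L (V \<omega>) = pderiv q - pderiv p * q + r" "r = 0 \<or> degree r + 1 < degree p"
    using hermite_reduction[OF p] by blast
  have dL: "line_defect v (L f) = 0" for f unfolding L_def by (rule line_defect_line_subst)
  \<comment> \<open>The defect kills \<omega> and \<open>p\<close> and commutes with
    \<open>pderiv\<close>, so the defects of \<open>q\<close> and \<open>r\<close> satisfy the
    homogeneous reduction equation; by uniqueness \<open>q\<close> has none.\<close>
  have "line_defect v q = 0"
  proof (rule degree_pderiv_mult_less[OF p])
    have "line_defect v (pderiv p) = 0" by (simp add: line_defect_pderiv p_def dL)
    then have "0 = pderiv (line_defect v q) - pderiv p * line_defect v q + line_defect v r"
      using arg_cong[OF qr(1), of "line_defect v"] by (simp add: line_defect dL line_defect_pderiv)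
    then show "pderiv p * line_defect v q = pderiv (line_defect v q) + line_defect v r" by (simp add: algebra_simps)
    show "line_defect v r = 0 \<or> degree (line_defect v r) + 1 < degree p"
      using qr(2) degree_line_defect_le[of v r] by (auto simp: line_defect)
  qed
  then obtain Q where Q: "q = L Q" using line_defect_eq_0 unfolding L_def by blast
  \<comment> \<open>What is subtracted is dQ - Q dh, that is, exp (h) d(Q exp (- h)). It satisfies
    the same equation as \<omega>, and its removal leaves \<open>r\<close> as component along
    \<open>v\<close>.\<close>
  define \<omega>1 where "\<omega>1 i = \<omega> i - mpoly_partial i Q + Q * mpoly_partial i h" for i
  note md = derivationD[OF mpoly_partial_derivation]
  have rel1: "mpoly_partial i (\<omega>1 j) - mpoly_partial j (\<omega>1 i) = mpoly_partial i h * \<omega>1 j - mpoly_partial j h * \<omega>1 i" for i j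
    using rel[of i j] mpoly_partial_commute[of i j Q] mpoly_partial_commute[of i j h]
    by (simp add: \<omega>1_def md algebra_simps)
  have r1: "L (V \<omega>1) = r"
  proof -
    have V1: "V \<omega>1 = V \<omega> - V (\<lambda>i. mpoly_partial i Q) + Q * V (\<lambda>i. mpoly_partial i h)"
      unfolding \<omega>1_def V_simps ..
    show ?thesis unfolding V1 L(3,4,6) pL[symmetric] qr(1) Q p_def by simp
  qed
  have "\<exists>P B a. lead_coeff P = 1 \<and> degree P > 0 \<and> p = poly (map_poly (\<lambda>c. [:Const c:]) B) P \<and>
    r = poly (map_poly (\<lambda>c. [:Const c:]) a) P * pderiv P"
  proof (rule lift_integral[OF p])
    fix w :: "'n \<Rightarrow> complex"
    \<comment> \<open>Restriction to the plane of the points z w + t v. The component of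
      \<open>\<omega>1\<close> along \<open>v\<close> becomes the coefficient of dt and that along
      \<open>w\<close> the coefficient of dz.\<close>
    define \<Phi> where "\<Phi> f = plane_subst w (L f)" for f
    have \<Phi>: "is_ring_hom \<Phi>"
      using is_ring_hom_comp[OF plane_subst_hom line_subst_hom] unfolding \<Phi>_def L_def .
    note \<Phi>h = is_ring_homD[OF \<Phi>]
    have \<Phi>C: "\<Phi> (Const c) = cc c" for c by (simp add: \<Phi>_def L_simps plane_subst_CC)
    have \<Phi>V: "pderiv (\<Phi> (Var i)) = cc (v i)" "dz (\<Phi> (Var i)) = cc (w i)" for i
    proof -
      have *: "\<Phi> (Var i) = [:[:0, w i:], [:v i:]:]"
        by (simp add: \<Phi>_def L_simps plane_subst_def map_poly_pCons base_subst base_subst_simps)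
      show "pderiv (\<Phi> (Var i)) = cc (v i)" "dz (\<Phi> (Var i)) = cc (w i)"
        unfolding * by (simp_all add: cc_def dz_def pderiv_pCons map_poly_pCons)
    qed
    have cc0: "pderiv (cc c) = 0" "dz (cc c) = 0" for c by (simp_all add: cc_def dz_def pderiv_pCons map_poly_pCons)
    have ct: "pderiv (\<Phi> f) = (\<Sum>i\<in>UNIV. \<Phi> (mpoly_partial i f) * cc (v i))" for f
      using chain_rule[OF \<Phi> pderiv_derivation, of f] by (simp add: \<Phi>C \<Phi>V cc0)
    have cz: "dz (\<Phi> f) = (\<Sum>i\<in>UNIV. \<Phi> (mpoly_partial i f) * cc (w i))" for f
      using chain_rule[OF \<Phi> dz_derivation, of f] by (simp add: \<Phi>C \<Phi>V cc0)
    define R where "R = plane_subst w r"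
    define U where "U = (\<Sum>j\<in>UNIV. cc (w j) * \<Phi> (\<omega>1 j))"
    have R: "R = (\<Sum>i\<in>UNIV. cc (v i) * \<Phi> (\<omega>1 i))"
    proof -
      have "R = \<Phi> (V \<omega>1)" by (simp add: R_def \<Phi>_def r1)
      then show ?thesis by (simp add: V_def \<Phi>h \<Phi>C)
    qed
    have pw: "plane_subst w p = \<Phi> h" by (simp add: \<Phi>_def p_def)
    have "dz R - dz (\<Phi> h) * R = pderiv U - pderiv (\<Phi> h) * U"
    proof -
      note zD = derivationD[OF dz_derivation] and tD = derivationD[OF pderiv_derivation]
      define T where "T i j = cc (v i) * (cc (w j) * \<Phi> (mpoly_partial j (\<omega>1 i) - mpoly_partial j h * \<omega>1 i))" for i j
      define T' where "T' i j = cc (v i) * (cc (w j) * \<Phi> (mpoly_partial i (\<omega>1 j) - mpoly_partial i h * \<omega>1 j))" for i j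
      have "dz R - dz (\<Phi> h) * R = (\<Sum>i\<in>UNIV. \<Sum>j\<in>UNIV. T i j)"
      proof -
        have "dz R = (\<Sum>i\<in>UNIV. \<Sum>j\<in>UNIV. cc (v i) * (cc (w j) * \<Phi> (mpoly_partial j (\<omega>1 i))))"
          by (simp add: R zD(2,8) cc0 cz sum_distrib_left mult_ac)
        moreover have "dz (\<Phi> h) * R = (\<Sum>i\<in>UNIV. \<Sum>j\<in>UNIV. cc (v i) * (cc (w j) * (\<Phi> (mpoly_partial j h) * \<Phi> (\<omega>1 i))))"
          unfolding R cz sum_product by (subst sum.swap) (simp add: mult_ac)
        ultimately show ?thesis by (simp add: T_def \<Phi>h sum_subtractf[symmetric] right_diff_distrib)
      qed
      also have "\<dots> = (\<Sum>i\<in>UNIV. \<Sum>j\<in>UNIV. T' i j)"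
      proof -
        have "mpoly_partial j (\<omega>1 i) - mpoly_partial j h * \<omega>1 i = mpoly_partial i (\<omega>1 j) - mpoly_partial i h * \<omega>1 j" for i j
          using rel1[of i j] by (simp add: algebra_simps)
        then show ?thesis unfolding T_def T'_def by simp
      qed
      also have "\<dots> = pderiv U - pderiv (\<Phi> h) * U"
      proof -
        have "pderiv U = (\<Sum>j\<in>UNIV. \<Sum>i\<in>UNIV. cc (v i) * (cc (w j) * \<Phi> (mpoly_partial i (\<omega>1 j))))"
          by (simp add: U_def tD(2,8) cc0 ct sum_distrib_left mult_ac)
        also have "\<dots> = (\<Sum>i\<in>UNIV. \<Sum>j\<in>UNIV. cc (v i) * (cc (w j) * \<Phi> (mpoly_partial i (\<omega>1 j))))" by (rule sum.swap)
        finally have "pderiv U = (\<Sum>i\<in>UNIV. \<Sum>j\<in>UNIV. cc (v i) * (cc (w j) * \<Phi> (mpoly_partial i (\<omega>1 j))))" .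
        moreover have "pderiv (\<Phi> h) * U = (\<Sum>i\<in>UNIV. \<Sum>j\<in>UNIV. cc (v i) * (cc (w j) * (\<Phi> (mpoly_partial i h) * \<Phi> (\<omega>1 j))))"
          unfolding U_def ct sum_product by (simp add: mult_ac)
        ultimately show ?thesis by (simp add: T'_def \<Phi>h sum_subtractf[symmetric] right_diff_distrib)
      qed
      finally show ?thesis .
    qed
    moreover have "R = 0 \<or> degree R + 1 < degree (plane_subst w p)"
      using qr(2) degree_plane_subst_le[of w r] degree_plane_subst_monic(1)[OF p(1), of w]
      by (auto simp: R_def plane_subst)
    ultimately show "\<exists>P B a. lead_coeff P = 1 \<and> degree P > 0 \<and> plane_subst w p = poly (map_poly cc B) P \<and>
      plane_subst w r = poly (map_poly cc a) P * pderiv P"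
      using plane_integral[of "plane_subst w p" R U] degree_plane_subst_monic[OF p(1), of w] p(2)
      unfolding pw R_def by simp
  qed
  then obtain P0 B a where P0: "lead_coeff P0 = 1" "degree P0 > 0" "p = poly (map_poly (\<lambda>c. [:Const c:]) B) P0"
    "r = poly (map_poly (\<lambda>c. [:Const c:]) a) P0 * pderiv P0" by blast
  have der_compose: "\<delta> (poly (map_poly H q) x) = poly (map_poly H (pderiv q)) x * \<delta> x"
    if "derivation \<delta>" "is_ring_hom H" "\<And>c. \<delta> (H c) = 0" for \<delta> :: "'b::idom \<Rightarrow> 'b" and H :: "complex \<Rightarrow> 'b" and q x
  proof -
    have "map_poly \<delta> (map_poly H q) = 0" by (intro poly_eqI) (simp add: coeff_map_poly is_ring_homD[OF that(2)] derivationD[OF that(1)] that(3))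
    moreover have "pderiv (map_poly H q) = map_poly H (pderiv q)"
      by (intro poly_eqI) (simp add: coeff_pderiv coeff_map_poly is_ring_homD[OF that(2)] del: of_nat_Suc)
    ultimately show ?thesis using derivation_poly[OF that(1), of "map_poly H q" x] by simp
  qed
  \<comment> \<open>\<open>p\<close> has no defect and equals B(P0), so the chain rule gives B'(P0)
    times the defect of \<open>P0\<close> as zero; and B'(P0) is nonzero because \<open>p\<close> is
    not constant in T.\<close>
  have "line_defect v P0 = 0"
  proof -
    have "line_defect v [:Const c:] = 0" for c using dL[of "Const c"] by (simp add: L_simps)
    then have "poly (map_poly (\<lambda>c. [:Const c:]) (pderiv B)) P0 * line_defect v P0 = 0"
      using der_compose[OF line_defect_derivation hom_CC, of v B P0] dL[of h] P0(3) by (simp add: p_def)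
    moreover have "poly (map_poly (\<lambda>c. [:Const c:]) (pderiv B)) P0 \<noteq> 0"
    proof
      assume 0: "poly (map_poly (\<lambda>c. [:Const c:]) (pderiv B)) P0 = 0"
      have "pderiv p = poly (map_poly (\<lambda>c. [:Const c:]) (pderiv B)) P0 * pderiv P0"
        unfolding P0(3) by (rule der_compose[OF pderiv_derivation hom_CC]) (simp add: pderiv_pCons)
      then have "pderiv p = 0" using 0 by simp
      then show False using degree_pderiv_mult_less[OF p, of 1 0] by (simp add: pderiv_1)
    qed
    ultimately show ?thesis by simp
  qed
  then obtain P where P: "P0 = L P" using line_defect_eq_0 unfolding L_def by blast
  have L_compose: "L (poly (map_poly Const q) x) = poly (map_poly (\<lambda>c. [:Const c:]) q) (L x)" for q x
    by (induction q) (simp_all add: map_poly_pCons L L_simps is_ring_homD[OF is_ring_hom_Const])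
  have L_inj: "L f = L g \<Longrightarrow> f = g" for f g unfolding L_def by (metis line_subst_at_0)
  have hB: "h = poly (map_poly Const B) P" by (rule L_inj) (simp add: L_compose P0(3)[unfolded p_def P])
  have dC: "mpoly_partial i (poly (map_poly Const q) P) = poly (map_poly Const (pderiv q)) P * mpoly_partial i P" for i q
    by (rule der_compose[OF mpoly_partial_derivation is_ring_hom_Const mpoly_partial_Const])
  \<comment> \<open>Since h = B(P), the form a(P) dP satisfies the same equation; subtracting it
    removes the component along \<open>v\<close>.\<close>
  define \<omega>2 where "\<omega>2 i = \<omega>1 i - poly (map_poly Const a) P * mpoly_partial i P" for i
  have rel2: "mpoly_partial i (\<omega>2 j) - mpoly_partial j (\<omega>2 i) = mpoly_partial i h * \<omega>2 j - mpoly_partial j h * \<omega>2 i" for i j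
    using rel1[of i j] mpoly_partial_commute[of i j P]
    by (simp add: \<omega>2_def md dC hB algebra_simps)
  have V2: "V \<omega>2 = 0"
  proof (rule L_inj)
    have "V \<omega>2 = V \<omega>1 - poly (map_poly Const a) P * V (\<lambda>i. mpoly_partial i P)" unfolding \<omega>2_def V_simps ..
    then show "L (V \<omega>2) = L 0" by (simp add: L r1 L_compose pL[symmetric] P0(4) P)
  qed
  \<comment> \<open>Contraction of the equation with \<open>v\<close> leaves, for each coefficient,
    the logarithmic equation f' = f h' on lines parallel to \<open>v\<close>. Its nonzero solutions
    are multiples of exp (h), never polynomial, as \<open>h\<close> has positive degree
    there.\<close>
  have \<omega>2: "\<omega>2 j = 0" for j
  proof -
    have "mpoly_partial j (V \<omega>2) = V (\<lambda>i. mpoly_partial j (\<omega>2 i))"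
      by (simp add: V_def md mpoly_partial_Const)
    then have Vj: "V (\<lambda>i. mpoly_partial j (\<omega>2 i)) = 0" using V2 by (simp add: md)
    have "V (\<lambda>i. mpoly_partial i (\<omega>2 j)) = V (\<lambda>i. mpoly_partial i (\<omega>2 j) - mpoly_partial j (\<omega>2 i))"
      unfolding V_simps Vj by simp
    also have "\<dots> = V (\<lambda>i. \<omega>2 j * mpoly_partial i h - mpoly_partial j h * \<omega>2 i)"
      unfolding rel2 by (simp only: mult.commute)
    also have "\<dots> = \<omega>2 j * V (\<lambda>i. mpoly_partial i h)" unfolding V_simps V2 by simp
    finally have "pderiv (L (\<omega>2 j)) = L (\<omega>2 j) * pderiv p" by (simp add: pL p_def L)
    then have "pderiv p * L (\<omega>2 j) = pderiv (L (\<omega>2 j)) + 0" by (simp add: mult.commute)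
    then have "L (\<omega>2 j) = 0" by (rule degree_pderiv_mult_less[OF p]) simp
    then show ?thesis using L_inj[of "\<omega>2 j" 0] by (simp add: L)
  qed
  \<comment> \<open>Here \<omega> = dQ - Q dh + a(P) dP with dh = B'(P) dP, which accounts for the
    sign of the coefficient b = - B'.\<close>
  have "\<omega> i = mpoly_partial i Q + (poly (map_poly Const a) P + poly (map_poly Const (- pderiv B)) P * Q) * mpoly_partial i P" for i
  proof -
    have "poly (map_poly Const (- pderiv B)) P = - poly (map_poly Const (pderiv B)) P"
    proof -
      have "map_poly Const (- pderiv B) = - (map_poly Const (pderiv B) :: 'n mpoly poly)"
        by (intro poly_eqI) (simp add: coeff_map_poly is_ring_homD[OF is_ring_hom_Const])
      then show ?thesis by simp
    qed
    then show ?thesis using \<omega>2[of i] by (simp add: \<omega>2_def \<omega>1_def hB dC algebra_simps)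
  qed
  then show ?thesis by blast
qed

section \<open>The pull-back and the conclusion\<close>

lemma mpoly_subst_insertion: "mpoly_subst P f = insertion Const P f"
  by (simp add: mpoly_subst_def insertion_def)

lemma pullback_affine_form:
  fixes P :: "2 \<Rightarrow> 'n mpoly"
  shows "pullback P (affine_form a b) i =
    (poly (map_poly Const a) (P 1) + poly (map_poly Const b) (P 1) * P 2) * mpoly_partial i (P 1) + mpoly_partial i (P 2)"
proof -
  define S where "S = insertion Const P"
  have S: "is_ring_hom S" unfolding S_def by (rule insertion_ring_hom[OF is_ring_hom_Const])
  have SV: "S (Var j) = P j" "S (Const c) = Const c" for j c
    by (simp_all add: S_def insertion_Var insertion_Const is_ring_hom_Const)
  have Sp: "S (poly (map_poly Const q) x) = poly (map_poly Const q) (S x)" for q x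
    by (induction q) (simp_all add: map_poly_pCons is_ring_homD[OF S] SV is_ring_homD[OF is_ring_hom_Const])
  show ?thesis
    unfolding pullback_def UNIV_2 mpoly_subst_insertion S_def[symmetric]
    by (simp add: affine_form_def d0_def is_ring_homD[OF S] SV Sp)
qed

theorem corollary2:
  fixes \<omega> :: "'n::{finite,linorder} \<Rightarrow> 'n mpoly"
  assumes "liouvillian_integrable TYPE('k::field) \<omega>"
    and "\<not> (\<exists>f. invariant_hypersurface f \<omega>)"
  shows "\<exists>(P :: 2 \<Rightarrow> 'n mpoly) (a :: complex poly) (b :: complex poly).
           \<omega> = pullback P (affine_form a b)"
proof -
  have form: ?thesis if "\<And>i. \<omega> i = mpoly_partial i Q + (poly (map_poly Const a) P + poly (map_poly Const b) P * Q) * mpoly_partial i P" for P Q a b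
    by (rule exI[of _ "\<lambda>j. if j = 1 then P else Q"], rule exI[of _ a], rule exI[of _ b])
      (simp add: fun_eq_iff pullback_affine_form that)
  show ?thesis
  proof (cases "\<forall>i. \<omega> i = 0")
    case True
    then show ?thesis by (intro form[of 0 0 0 0]) simp
  next
    case False
    then obtain i0 where "\<omega> i0 \<noteq> 0" by blast
    obtain \<eta> where \<eta>: "\<And>i j. mpoly_partial i (\<eta> j) = mpoly_partial j (\<eta> i)"
      "\<And>i j. d1 mpoly_partial \<omega> i j = wedge11 \<eta> \<omega> i j"
      using polynomial_closed_multiplier[OF assms \<open>\<omega> i0 \<noteq> 0\<close>] by blast
    obtain h where h: "\<And>i. mpoly_partial i h = \<eta> i" using closed_form_exact[OF \<eta>(1)] by blast
    have rel: "mpoly_partial i (\<omega> j) - mpoly_partial j (\<omega> i) = mpoly_partial i h * \<omega> j - mpoly_partial j h * \<omega> i" for i j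
      using \<eta>(2)[of i j] by (simp add: d1_def wedge11_def h)
    show ?thesis
    proof (cases "h \<in> range Const")
      \<comment> \<open>A constant \<open>h\<close> has positive degree in no direction. In this
        case \<omega> itself is closed, hence exact, and a = b = 0.\<close>
      case True
      then have "mpoly_partial i (\<omega> j) = mpoly_partial j (\<omega> i)" for i j
        using rel[of i j] by (auto simp: mpoly_partial_Const)
      then obtain Q where "\<And>i. mpoly_partial i Q = \<omega> i" using closed_form_exact[of \<omega>] by blast
      then show ?thesis by (intro form[of Q 0 0 0]) simp
    next
      case False
      then show ?thesis using affine_normal_form[OF rel] form by blast
    qed
  qed
qed

end
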